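(* Let $(\Omega,\mathscr H,\widehat{\mathbb E})$ be a sub-linear expectation space satisfying condition (CC) with a family $\mathscr P$ of probability measures on $\sigma(\mathscr H)$, and let $\mathbb V$ be a sub-additive capacity satisfying the compatibility property (C). Let $\{X_n;n\ge1\}$ be a sequence of independent random variables in $(\Omega,\mathscr H,\widehat{\mathbb E})$ with $\widehat{\mathbb E}[X_n^2]<\infty$ for all $n$. Put $S_n=\sum_{i=1}^nX_i$, $s_n^2=\sum_{k=1}^n\widehat{\mathbb E}[X_k^2]$, $t_n=\sqrt{2\log\log s_n^2}$, $a_n=s_nt_n$, $\Gamma_n(p,\alpha)=\widehat{\mathbb E}[((|X_n|-\alpha s_n/t_n)^+)^p]$ and $\Lambda_n(p,\alpha)=\sum_{j=1}^n\widehat{\mathbb E}[((|X_j|-\alpha s_n/t_n)^+)^p]$. Suppose that (i) $\sum_{n=1}^\infty\mathbb V(|X_n|\ge\epsilon a_n)<\infty$ for all $\epsilon>0$; (ii) for every $\alpha>0$ there exist some $p\ge2$ and $d\ge0$ such that $\sum_{n=1}^\infty\frac{\Gamma_n(p,\alpha)}{a_n^p}\big(\frac{\Lambda_n(p,\alpha)}{a_n^p}\big)^d<\infty$; (iii) $\sum_{n=1}^\infty s_n^{-2}(\log s_n^2)^{\delta-1}\widehat{\mathbb E}[X_n^2]=\infty$ for all $\delta>0$; (iv) $\frac{1}{a_n}\sum_{j=1}^n\big(|\widehat{\mathbb E}[X_j]|+|\widehat{\mathcal E}[X_j]|\big)\to0$. Then for $V=\mathbb V^{\mathscr P}$, $V=\mathbb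 C^*$ or $V=\widehat{\mathbb V}^*$, $$V\Big(\limsup_{n\to\infty}\frac{|S_n|}{a_n}>1\Big)=0\qquad\text{and}\qquad V\Big(\liminf_{n\to\infty}\frac{S_n}{a_n}=-1\ \text{ and }\ \limsup_{n\to\infty}\frac{S_n}{a_n}=1\Big)=1.$$
   Context: Sub-linear expectation space: $(\Omega,\mathcal F)$ is a measurable space and $\mathscr H$ is a linear space of real measurable functions on it such that $\varphi(X_1,\dots,X_n)\in\mathscr H$ whenever $X_1,\dots,X_n\in\mathscr H$ and $\varphi\in C_{l,Lip}(\mathbb R^n)$, where $C_{l,Lip}(\mathbb R^n)$ is the set of $\varphi$ with $|\varphi(x)-\varphi(y)|\le C(1+|x|^m+|y|^m)|x-y|$ for some $C>0$, $m\in\mathbb N$ depending on $\varphi$. A sub-linear expectation is a map $\widehat{\mathbb E}:\mathscr H\to[-\infty,\infty]$ such that: $X\ge Y$ implies $\widehat{\mathbb E}[X]\ge\widehat{\mathbb E}[Y]$; $\widehat{\mathbb E}[c]=c$ for constants $c$; $\widehat{\mathbb E}[X+Y]\le\widehat{\mathbb E}[X]+\widehat{\mathbb E}[Y]$ whenever the right side is not of the form $\infty-\infty$; $\widehat{\mathbb E}[\lambda X]=\lambda\widehat{\mathbb E}[X]$ for $\lambda\ge0$ (with $0\cdot\infty=0$). The conjugate expectation is $\widehat{\mathcal E}[X]=-\widehat{\mathbb E}[-X]$. Elements of $\mathscr H$ are called random variables. Independence: a random vector $\bm Y\in\mathscr H^n$ is independent to $\bm X\in\mathscr H^m$ if $\widehat{\mathbb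 E}[\varphi(\bm X,\bm Y)]=\widehat{\mathbb E}\big[\widehat{\mathbb E}[\varphi(\bm x,\bm Y)]|_{\bm x=\bm X}\big]$ for each $\varphi\in C_{l,Lip}(\mathbb R^m\times\mathbb R^n)$ with $\overline\varphi(\bm x):=\widehat{\mathbb E}[|\varphi(\bm x,\bm Y)|]<\infty$ for all $\bm x$ and $\widehat{\mathbb E}[|\overline\varphi(\bm X)|]<\infty$. A sequence $\{X_n\}$ is independent if $X_{i+1}$ is independent to $(X_1,\dots,X_i)$ for each $i\ge1$. Condition (CC): with $\mathscr H_b=\{f\in\mathscr H: f\text{ bounded}\}$, one has $\widehat{\mathbb E}[X]=\sup_{P\in\mathscr P}P[X]$ for all $X\in\mathscr H_b$ (where $P[X]=\int X\,dP$), and $\mathscr P$ is a countable-dimensionally weakly compact family of probability measures on $(\Omega,\sigma(\mathscr H))$: for any $Y_1,Y_2,\dots\in\mathscr H_b$ and any sequence $\{P_n\}\subset\mathscr P$ there are a subsequence $\{n_k\}$ and $P\in\mathscr P$ with $\lim_{k\to\infty}P_{n_k}[\varphi(Y_1,\dots,Y_d)]=P[\varphi(Y_1,\dots,Y_d)]$ for all bounded Lipschitz $\varphi:\mathbb R^d\to\mathbb R$ and all $d\ge1$. Capacities: a capacity is a monotone set function $V:\mathcal F\to[0,1]$ with $V(\emptyset)=0$, $V(\Omega)=1$; it is sub-additive if $V(A\cup B)\le V(A)+V(B)$. Property (C) for $\mathbb V$: $\widehat{\mathbb E}[f]\le\mathbb V(A)\le\widehat{\mathbb E}[g]$ whenever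 $f\le I_A\le g$, $f,g\in\mathscr H$, $A\in\mathcal F$. Define $\mathbb V^{\mathscr P}(A)=\sup_{P\in\mathscr P}P(A)$ for $A\in\sigma(\mathscr H)$; $\widehat{\mathbb V}(A)=\inf\{\widehat{\mathbb E}[\xi]:I_A\le\xi,\ \xi\in\mathscr H\}$; $\widehat{\mathbb V}^*(A)=\inf\{\sum_{n=1}^\infty\widehat{\mathbb V}(A_n):A\subset\bigcup_{n=1}^\infty A_n\}$; $\mathbb C^*(A)=\inf\{\lim_{n\to\infty}\widehat{\mathbb E}[\sum_{i=1}^ng_i]:I_A\le\sum_{n=1}^\infty g_n,\ 0\le g_n\in\mathscr H\}$. Conventions: $\log x=\ln\max(e,x)$; $x^+=\max(x,0)$. *)

theory Defs
  imports "HOL-Probability.Probability"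
begin

section \<open>Test functions on Euclidean spaces of variable dimension\<close>

text \<open>
  A point of the n-dimensional Euclidean space is a function \<open>nat \<Rightarrow> real\<close> of which only the
  coordinates \<open>i < n\<close> count; \<open>L2_set x {..<n}\<close> is its Euclidean norm.  Both classes below consist of
  functions that depend on these coordinates only: points that agree on \<open>{..<n}\<close> have distance 0.
\<close>

definition C_lLip :: "nat \<Rightarrow> ((nat \<Rightarrow> real) \<Rightarrow> real) set" where
  "C_lLip n = {\<phi>. \<exists>C>0. \<exists>m::nat. \<forall>x y.
     \<bar>\<phi> x - \<phi> y\<bar> \<le> C * (1 + L2_set x {..<n} ^ m + L2_set y {..<n} ^ m) * L2_set (\<lambda>i. x i - y i) {..<n}}"

definition C_bLip :: "nat \<Rightarrow> ((nat \<Rightarrow> real) \<Rightarrow> real) set" where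
  "C_bLip n = {\<phi>. (\<exists>B. \<forall>x. \<bar>\<phi> x\<bar> \<le> B) \<and>
     (\<exists>L. \<forall>x y. \<bar>\<phi> x - \<phi> y\<bar> \<le> L * L2_set (\<lambda>i. x i - y i) {..<n})}"

definition vec_append :: "nat \<Rightarrow> (nat \<Rightarrow> real) \<Rightarrow> (nat \<Rightarrow> real) \<Rightarrow> nat \<Rightarrow> real" where
  "vec_append m x y = (\<lambda>i. if i < m then x i else y (i - m))"


section \<open>Sub-linear expectation spaces\<close>

text \<open>
  Only the measurable space underlying \<open>M\<close> is used.  The values of \<open>E\<close> off \<open>H\<close> are irrelevant.
\<close>

locale sublinear_expectation_space =
  fixes M :: "'a measure" and H :: "('a \<Rightarrow> real) set" and E :: "('a \<Rightarrow> real) \<Rightarrow> ereal"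
  assumes H_measurable: "H \<subseteq> borel_measurable M"
    and H_zero: "(\<lambda>\<omega>. 0) \<in> H"
    and H_add: "X \<in> H \<Longrightarrow> Y \<in> H \<Longrightarrow> (\<lambda>\<omega>. X \<omega> + Y \<omega>) \<in> H"
    and H_scale: "X \<in> H \<Longrightarrow> (\<lambda>\<omega>. c * X \<omega>) \<in> H"
    and H_C_lLip: "(\<And>i. i < n \<Longrightarrow> Z i \<in> H) \<Longrightarrow> \<phi> \<in> C_lLip n \<Longrightarrow> (\<lambda>\<omega>. \<phi> (\<lambda>i. Z i \<omega>)) \<in> H"
    and E_mono: "X \<in> H \<Longrightarrow> Y \<in> H \<Longrightarrow> (\<And>\<omega>. \<omega> \<in> space M \<Longrightarrow> Y \<omega> \<le> X \<omega>) \<Longrightarrow> E Y \<le> E X"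
    and E_const: "E (\<lambda>\<omega>. c) = ereal c"
    and E_subadd: "X \<in> H \<Longrightarrow> Y \<in> H \<Longrightarrow>
      \<not> (E X = \<infinity> \<and> E Y = - \<infinity>) \<Longrightarrow> \<not> (E X = - \<infinity> \<and> E Y = \<infinity>) \<Longrightarrow>
      E (\<lambda>\<omega>. X \<omega> + Y \<omega>) \<le> E X + E Y"
    and E_pos_homog: "X \<in> H \<Longrightarrow> 0 \<le> r \<Longrightarrow> E (\<lambda>\<omega>. r * X \<omega>) = ereal r * E X"

definition conj_expectation :: "(('a \<Rightarrow> real) \<Rightarrow> ereal) \<Rightarrow> ('a \<Rightarrow> real) \<Rightarrow> ereal" where
  "conj_expectation E X = - E (\<lambda>\<omega>. - X \<omega>)"

text \<open>
  \<open>independent_to H E n Y m X\<close>: the n-dimensional random vector \<open>Y\<close> is independent to the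
  m-dimensional random vector \<open>X\<close>.  As \<open>E\<close> is an expectation on \<open>H\<close> only, the two conditions
  \<open>\<dots> \<in> H\<close> on the partial expectations evaluated at \<open>X\<close> express that the expectations taken of them
  are meaningful; a test function for which they fail imposes no condition.  They do not follow
  from the finiteness of the partial expectations, but they hold for instance for all bounded
  Lipschitz test functions when \<open>E \<bar>Y\<^sub>i\<bar> < \<infinity>\<close>.  The uses of \<open>real_of_ereal\<close> are harmless because
  the finiteness premise makes the converted values finite.
\<close>

definition independent_to ::
  "('a \<Rightarrow> real) set \<Rightarrow> (('a \<Rightarrow> real) \<Rightarrow> ereal) \<Rightarrow>
   nat \<Rightarrow> (nat \<Rightarrow> 'a \<Rightarrow> real) \<Rightarrow> nat \<Rightarrow> (nat \<Rightarrow> 'a \<Rightarrow> real) \<Rightarrow> bool" where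
  "independent_to H E n Y m X \<longleftrightarrow>
     (\<forall>i<n. Y i \<in> H) \<and> (\<forall>i<m. X i \<in> H) \<and>
     (\<forall>\<phi> \<in> C_lLip (m + n).
        let \<phi>bar = (\<lambda>x. E (\<lambda>\<omega>. \<bar>\<phi> (vec_append m x (\<lambda>j. Y j \<omega>))\<bar>));
            \<phi>bar_X = (\<lambda>\<omega>. real_of_ereal (\<phi>bar (\<lambda>i. X i \<omega>)));
            \<phi>part_X = (\<lambda>\<omega>. real_of_ereal (E (\<lambda>\<omega>'. \<phi> (vec_append m (\<lambda>i. X i \<omega>) (\<lambda>j. Y j \<omega>')))))
        in (\<forall>x. \<phi>bar x < \<infinity>) \<longrightarrow> \<phi>bar_X \<in> H \<longrightarrow> E (\<lambda>\<omega>. \<bar>\<phi>bar_X \<omega>\<bar>) < \<infinity> \<longrightarrow> \<phi>part_X \<in> H \<longrightarrow>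
           E (\<lambda>\<omega>. \<phi> (vec_append m (\<lambda>i. X i \<omega>) (\<lambda>j. Y j \<omega>))) = E \<phi>part_X)"

text \<open>Sequences of random variables are indexed from 1 throughout; \<open>X 0\<close> is never used.\<close>

definition independent_seq ::
  "('a \<Rightarrow> real) set \<Rightarrow> (('a \<Rightarrow> real) \<Rightarrow> ereal) \<Rightarrow> (nat \<Rightarrow> 'a \<Rightarrow> real) \<Rightarrow> bool" where
  "independent_seq H E X \<longleftrightarrow>
     (\<forall>i\<ge>1. independent_to H E 1 (\<lambda>_. X (Suc i)) i (\<lambda>k. X (Suc k)))"


section \<open>Condition (CC)\<close>

definition sigma_H :: "'a measure \<Rightarrow> ('a \<Rightarrow> real) set \<Rightarrow> 'a measure" where
  "sigma_H M H = sigma (space M) {f -` B \<inter> space M | f B. f \<in> H \<and> B \<in> sets borel}"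

definition H_bdd :: "'a measure \<Rightarrow> ('a \<Rightarrow> real) set \<Rightarrow> ('a \<Rightarrow> real) set" where
  "H_bdd M H = {f \<in> H. bounded (f ` space M)}"

definition countable_dim_weakly_compact ::
  "'a measure \<Rightarrow> ('a \<Rightarrow> real) set \<Rightarrow> 'a measure set \<Rightarrow> bool" where
  "countable_dim_weakly_compact M H \<P> \<longleftrightarrow>
     (\<forall>Y :: nat \<Rightarrow> 'a \<Rightarrow> real. \<forall>Q :: nat \<Rightarrow> 'a measure.
        (\<forall>i. Y i \<in> H_bdd M H) \<longrightarrow> (\<forall>n. Q n \<in> \<P>) \<longrightarrow>
        (\<exists>r P. strict_mono r \<and> P \<in> \<P> \<and>
           (\<forall>d\<ge>1. \<forall>\<phi> \<in> C_bLip d.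
              (\<lambda>k. \<integral>\<omega>. \<phi> (\<lambda>i. Y i \<omega>) \<partial>Q (r k)) \<longlonglongrightarrow> (\<integral>\<omega>. \<phi> (\<lambda>i. Y i \<omega>) \<partial>P))))"

definition condition_CC ::
  "'a measure \<Rightarrow> ('a \<Rightarrow> real) set \<Rightarrow> (('a \<Rightarrow> real) \<Rightarrow> ereal) \<Rightarrow> 'a measure set \<Rightarrow> bool" where
  "condition_CC M H E \<P> \<longleftrightarrow>
     (\<forall>P\<in>\<P>. prob_space P \<and> sets P = sets (sigma_H M H)) \<and>
     (\<forall>X \<in> H_bdd M H. E X = (SUP P\<in>\<P>. ereal (\<integral>\<omega>. X \<omega> \<partial>P))) \<and>
     countable_dim_weakly_compact M H \<P>"


section \<open>Capacities\<close>

definition capacity :: "'a measure \<Rightarrow> ('a set \<Rightarrow> real) \<Rightarrow> bool" where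
  "capacity M V \<longleftrightarrow>
     (\<forall>A \<in> sets M. 0 \<le> V A \<and> V A \<le> 1) \<and> V {} = 0 \<and> V (space M) = 1 \<and>
     (\<forall>A \<in> sets M. \<forall>B \<in> sets M. A \<subseteq> B \<longrightarrow> V A \<le> V B)"

definition subadditive_capacity :: "'a measure \<Rightarrow> ('a set \<Rightarrow> real) \<Rightarrow> bool" where
  "subadditive_capacity M V \<longleftrightarrow>
     capacity M V \<and> (\<forall>A \<in> sets M. \<forall>B \<in> sets M. V (A \<union> B) \<le> V A + V B)"

definition property_C ::
  "'a measure \<Rightarrow> ('a \<Rightarrow> real) set \<Rightarrow> (('a \<Rightarrow> real) \<Rightarrow> ereal) \<Rightarrow> ('a set \<Rightarrow> real) \<Rightarrow> bool" where
  "property_C M H E V \<longleftrightarrow>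
     (\<forall>A \<in> sets M. \<forall>f \<in> H. \<forall>g \<in> H.
        (\<forall>\<omega>\<in>space M. f \<omega> \<le> indicator A \<omega> \<and> indicator A \<omega> \<le> g \<omega>) \<longrightarrow>
        E f \<le> ereal (V A) \<and> ereal (V A) \<le> E g)"

definition V_P :: "'a measure set \<Rightarrow> 'a set \<Rightarrow> ereal" where
  "V_P \<P> A = (SUP P\<in>\<P>. ereal (measure P A))"

definition V_hat :: "'a measure \<Rightarrow> ('a \<Rightarrow> real) set \<Rightarrow> (('a \<Rightarrow> real) \<Rightarrow> ereal) \<Rightarrow> 'a set \<Rightarrow> ereal" where
  "V_hat M H E A = Inf {E \<xi> | \<xi>. \<xi> \<in> H \<and> (\<forall>\<omega>\<in>space M. indicator A \<omega> \<le> \<xi> \<omega>)}"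

text \<open>
  The covering sets are taken measurable.  Allowing arbitrary ones would give the same value, since
  \<open>I\<^sub>A \<le> \<xi>\<close> implies that \<open>A\<close> is contained in the measurable set where \<open>\<xi> \<ge> 1\<close>.
\<close>

definition V_hat_star :: "'a measure \<Rightarrow> ('a \<Rightarrow> real) set \<Rightarrow> (('a \<Rightarrow> real) \<Rightarrow> ereal) \<Rightarrow> 'a set \<Rightarrow> ereal" where
  "V_hat_star M H E A =
     Inf {(\<Sum>n. V_hat M H E (B n)) | B. (\<forall>n. B n \<in> sets M) \<and> A \<subseteq> (\<Union>n. B n)}"

definition C_star :: "'a measure \<Rightarrow> ('a \<Rightarrow> real) set \<Rightarrow> (('a \<Rightarrow> real) \<Rightarrow> ereal) \<Rightarrow> 'a set \<Rightarrow> ereal" where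
  "C_star M H E A =
     Inf {L. \<exists>g :: nat \<Rightarrow> 'a \<Rightarrow> real.
       (\<forall>n. g n \<in> H \<and> (\<forall>\<omega>\<in>space M. 0 \<le> g n \<omega>)) \<and>
       (\<forall>\<omega>\<in>space M. indicator A \<omega> \<le> (\<Sum>n. ereal (g n \<omega>))) \<and>
       (\<lambda>n. E (\<lambda>\<omega>. \<Sum>i<n. g i \<omega>)) \<longlonglongrightarrow> L}"


section \<open>Normalizing sequences\<close>

definition log_e :: "real \<Rightarrow> real" where
  "log_e x = ln (max (exp 1) x)"

definition partial_sum :: "(nat \<Rightarrow> 'a \<Rightarrow> real) \<Rightarrow> nat \<Rightarrow> 'a \<Rightarrow> real" where
  "partial_sum X n \<omega> = (\<Sum>i=1..n. X i \<omega>)"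

text \<open>
  \<open>ss E X n\<close> is the square of the norming constant \<open>s\<^sub>n\<close>.  It is used only when all
  \<open>E (X\<^sub>k\<^sup>2)\<close> are finite.  If \<open>s\<^sub>n = 0\<close> for some initial indices, quotients by \<open>s\<^sub>n\<close> or \<open>a\<^sub>n\<close>
  formed in the reals are 0 there; the terms of a series that carry such a factor then vanish, which
  discards finitely many undefined terms once \<open>s\<^sub>n\<close> is eventually positive.
\<close>

definition ss :: "(('a \<Rightarrow> real) \<Rightarrow> ereal) \<Rightarrow> (nat \<Rightarrow> 'a \<Rightarrow> real) \<Rightarrow> nat \<Rightarrow> real" where
  "ss E X n = (\<Sum>k=1..n. real_of_ereal (E (\<lambda>\<omega>. (X k \<omega>)\<^sup>2)))"

definition s_norm :: "(('a \<Rightarrow> real) \<Rightarrow> ereal) \<Rightarrow> (nat \<Rightarrow> 'a \<Rightarrow> real) \<Rightarrow> nat \<Rightarrow> real" where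
  "s_norm E X n = sqrt (ss E X n)"

definition t_norm :: "(('a \<Rightarrow> real) \<Rightarrow> ereal) \<Rightarrow> (nat \<Rightarrow> 'a \<Rightarrow> real) \<Rightarrow> nat \<Rightarrow> real" where
  "t_norm E X n = sqrt (2 * log_e (log_e (ss E X n)))"

definition a_norm :: "(('a \<Rightarrow> real) \<Rightarrow> ereal) \<Rightarrow> (nat \<Rightarrow> 'a \<Rightarrow> real) \<Rightarrow> nat \<Rightarrow> real" where
  "a_norm E X n = s_norm E X n * t_norm E X n"

definition tail_moment ::
  "(('a \<Rightarrow> real) \<Rightarrow> ereal) \<Rightarrow> (nat \<Rightarrow> 'a \<Rightarrow> real) \<Rightarrow> nat \<Rightarrow> nat \<Rightarrow> real \<Rightarrow> real \<Rightarrow> ereal" where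
  "tail_moment E X n j p \<alpha> =
     E (\<lambda>\<omega>. max (\<bar>X j \<omega>\<bar> - \<alpha> * s_norm E X n / t_norm E X n) 0 powr p)"

definition Gam ::
  "(('a \<Rightarrow> real) \<Rightarrow> ereal) \<Rightarrow> (nat \<Rightarrow> 'a \<Rightarrow> real) \<Rightarrow> nat \<Rightarrow> real \<Rightarrow> real \<Rightarrow> ereal" where
  "Gam E X n p \<alpha> = tail_moment E X n n p \<alpha>"

definition Lam ::
  "(('a \<Rightarrow> real) \<Rightarrow> ereal) \<Rightarrow> (nat \<Rightarrow> 'a \<Rightarrow> real) \<Rightarrow> nat \<Rightarrow> real \<Rightarrow> real \<Rightarrow> ereal" where
  "Lam E X n p \<alpha> = (\<Sum>j=1..n. tail_moment E X n j p \<alpha>)"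

text \<open>
  Powers of extended nonnegative numbers with real exponent \<open>d \<ge> 0\<close>; here \<open>x\<^sup>0 = 1\<close> for all \<open>x\<close>,
  whereas \<open>0 powr 0 = 0\<close>.
\<close>

definition ereal_powr :: "ereal \<Rightarrow> real \<Rightarrow> ereal" where
  "ereal_powr x d =
     (if d = 0 then 1 else if x = \<infinity> then \<infinity> else ereal (real_of_ereal x powr d))"

end

theory Submission
  imports Defs
begin

text \<open>
  Proof idea.  Independence makes the sub-linear expectation of a bounded Lipschitz function of finitely
  many \<open>X j\<close> an iterated one-dimensional expectation, so exponential moments of sums of truncated
  variables factorise and a maximal inequality follows from a supermartingale argument.

  The indices are cut into blocks along which the variance \<open>v\<close> grows by a factor \<open>c\<close>.  At the end \<open>N\<close> of
  a block put \<open>h = \<alpha> * s N / t N\<close>.  By (ii), for all but a sparse set of blocks the moments of the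
  excesses \<open>\<bar>X j\<bar> - h\<close> are negligible; then truncation at \<open>2 * h\<close> gives Gaussian exponential moments in
  the range that matters.  On the sparse set a truncation at a small multiple of \<open>a N\<close> suffices, as only
  a power of \<open>t N\<close> is then to be gained.  With \<open>c\<close> near 1 the Borel-Cantelli lemma yields the upper half.

  For the lower half \<open>c\<close> is large and Chernoff's comparison of exponential moments bounds the
  expectation of a soft indicator of the event that a block sum exceeds \<open>(1 - 4 * \<eta>) * a N\<close> from below
  by a multiple of \<open>(k + 1) powr (\<eta> - 1)\<close>.  By (iii) these bounds have a divergent sum, so on
  arbitrarily late stretches of coordinates the event occurs with upper probability near 1; weak
  compactness of \<open>\<P>\<close> provides one probability measure under which this happens infinitely often.
\<close>

section \<open>Test functions of finitely many coordinates\<close>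

text \<open>Two gaps separate the argument from the classical one: \<open>E\<close> need not be
  countably sub-additive, and under a single measure in \<open>PP\<close> the variables need not be
  independent. Null sets are therefore handled by explicit covers (\<open>qs\<close>), and the
  divergence half of the Borel-Cantelli lemma is carried out under \<open>E\<close> itself, on
  finitely many coordinates, before any measure is chosen. Only constants and nonnegative factors
  leave a sub-linear expectation, so conditioning is cast into the form
  \<open>A + B * \<psi>\<close> with \<open>B \<ge> 0\<close> (\<open>Ex_block\<close>). Test
  functions are kept bounded and Lipschitz because this class is stable under integrating out one
  coordinate, which secures the membership conditions in \<open>independent_to\<close>; indicators
  are replaced by ramps. A block counts as good when its excess moments are small against a negative
  power of t. The threshold is a compromise: low enough for the Gaussian exponent at the level
  \<alpha> * s / t, and high enough that on bad blocks the only available gain, a power of t, is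
  bounded by the summable \<open>L k powr (d + 1)\<close>.\<close>

text \<open>Bounded functions of a sequence that are Lipschitz in, and depend only on, the coordinates in
  \<open>J\<close>.\<close>

definition cyl :: "nat set \<Rightarrow> ((nat \<Rightarrow> real) \<Rightarrow> real) \<Rightarrow> bool" where
  "cyl J \<phi> \<longleftrightarrow> finite J \<and> (\<exists>B. \<forall>x. \<bar>\<phi> x\<bar> \<le> B) \<and>
     (\<exists>L. \<forall>x y. \<bar>\<phi> x - \<phi> y\<bar> \<le> L * (\<Sum>j\<in>J. \<bar>x j - y j\<bar>))"

lemma cylI:
  assumes "finite J" "\<And>x. \<bar>\<phi> x\<bar> \<le> B" "\<And>x y. \<bar>\<phi> x - \<phi> y\<bar> \<le> L * (\<Sum>j\<in>J. \<bar>x j - y j\<bar>)"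
  shows "cyl J \<phi>"
  using assms unfolding cyl_def by blast

text \<open>Positive constants can be multiplied and compared without case distinctions on
  signs.\<close>

lemma cyl_bounds:
  assumes "cyl J \<phi>"
  shows "\<exists>B L. finite J \<and> B > 0 \<and> L > 0 \<and> (\<forall>x. \<bar>\<phi> x\<bar> \<le> B) \<and>
    (\<forall>x y. \<bar>\<phi> x - \<phi> y\<bar> \<le> L * (\<Sum>j\<in>J. \<bar>x j - y j\<bar>))"
proof -
  from assms obtain B L where J: "finite J" and B: "\<And>x. \<bar>\<phi> x\<bar> \<le> B"
    and L: "\<And>x y. \<bar>\<phi> x - \<phi> y\<bar> \<le> L * (\<Sum>j\<in>J. \<bar>x j - y j\<bar>)"
    unfolding cyl_def by blast
  have "\<bar>\<phi> x - \<phi> y\<bar> \<le> (\<bar>L\<bar> + 1) * (\<Sum>j\<in>J. \<bar>x j - y j\<bar>)" for x y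
    by (rule order_trans[OF L mult_right_mono]) (auto intro: sum_nonneg)
  moreover have "\<bar>\<phi> x\<bar> \<le> \<bar>B\<bar> + 1" for x
    using B[of x] by linarith
  ultimately show ?thesis
    using J by (intro exI[of _ "\<bar>B\<bar> + 1"] exI[of _ "\<bar>L\<bar> + 1"]) auto
qed

lemma cyl_finite: "cyl J \<phi> \<Longrightarrow> finite J"
  by (simp add: cyl_def)

text \<open>The Lipschitz bound vanishes for points that agree on \<open>J\<close>. Coordinates
  outside \<open>J\<close>, in particular coordinate 0, may thus be overwritten at will.\<close>

lemma cyl_dep:
  assumes "cyl J \<phi>" "\<And>j. j \<in> J \<Longrightarrow> x j = y j"
  shows "\<phi> x = \<phi> y"
proof -
  obtain B L where *: "finite J" "B > 0" "L > 0" "\<And>x. \<bar>\<phi> x\<bar> \<le> B"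
    "\<And>x y. \<bar>\<phi> x - \<phi> y\<bar> \<le> L * (\<Sum>j\<in>J. \<bar>x j - y j\<bar>)"
    using cyl_bounds[OF assms(1)] by blast
  have "(\<Sum>j\<in>J. \<bar>x j - y j\<bar>) = 0" using assms(2) by (simp add: sum.neutral)
  with *(5)[of x y] show ?thesis by simp
qed

lemma cyl_mono:
  assumes "cyl J \<phi>" "J \<subseteq> J'" "finite J'"
  shows "cyl J' \<phi>"
proof -
  obtain B L where *: "finite J" "B > 0" "L > 0" "\<And>x. \<bar>\<phi> x\<bar> \<le> B"
    "\<And>x y. \<bar>\<phi> x - \<phi> y\<bar> \<le> L * (\<Sum>j\<in>J. \<bar>x j - y j\<bar>)"
    using cyl_bounds[OF assms(1)] by blast
  have "\<bar>\<phi> x - \<phi> y\<bar> \<le> L * (\<Sum>j\<in>J'. \<bar>x j - y j\<bar>)" for x y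
    by (rule order_trans[OF *(5) mult_left_mono[OF sum_mono2]]) (use assms * in auto)
  with assms(3) *(4) show ?thesis by (rule cylI)
qed

lemma cyl_const: "finite J \<Longrightarrow> cyl J (\<lambda>x. c)"
  by (rule cylI[where B="\<bar>c\<bar>" and L=0]) auto

lemma cyl_add:
  assumes "cyl J f" "cyl J g"
  shows "cyl J (\<lambda>x. f x + g x)"
proof -
  obtain B L where f: "finite J" "B > 0" "L > 0" "\<And>x. \<bar>f x\<bar> \<le> B"
    "\<And>x y. \<bar>f x - f y\<bar> \<le> L * (\<Sum>j\<in>J. \<bar>x j - y j\<bar>)"
    using cyl_bounds[OF assms(1)] by blast
  obtain B' L' where g: "finite J" "B' > 0" "L' > 0" "\<And>x. \<bar>g x\<bar> \<le> B'"
    "\<And>x y. \<bar>g x - g y\<bar> \<le> L' * (\<Sum>j\<in>J. \<bar>x j - y j\<bar>)"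
    using cyl_bounds[OF assms(2)] by blast
  show ?thesis
  proof (rule cylI[where B="B + B'" and L="L + L'"])
    show "\<bar>f x + g x\<bar> \<le> B + B'" for x using f(4)[of x] g(4)[of x] by linarith
    show "\<bar>f x + g x - (f y + g y)\<bar> \<le> (L + L') * (\<Sum>j\<in>J. \<bar>x j - y j\<bar>)" for x y
      unfolding distrib_right using f(5)[of x y] g(5)[of x y] by linarith
  qed fact
qed

lemma cyl_mult:
  assumes "cyl J f" "cyl J g"
  shows "cyl J (\<lambda>x. f x * g x)"
proof -
  obtain B L where f: "finite J" "B > 0" "L > 0" "\<And>x. \<bar>f x\<bar> \<le> B"
    "\<And>x y. \<bar>f x - f y\<bar> \<le> L * (\<Sum>j\<in>J. \<bar>x j - y j\<bar>)"
    using cyl_bounds[OF assms(1)] by blast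
  obtain B' L' where g: "finite J" "B' > 0" "L' > 0" "\<And>x. \<bar>g x\<bar> \<le> B'"
    "\<And>x y. \<bar>g x - g y\<bar> \<le> L' * (\<Sum>j\<in>J. \<bar>x j - y j\<bar>)"
    using cyl_bounds[OF assms(2)] by blast
  show ?thesis
  proof (rule cylI[where B="B * B'" and L="B * L' + B' * L"])
    show "\<bar>f x * g x\<bar> \<le> B * B'" for x
      unfolding abs_mult using f(4)[of x] g(4)[of x] f(2) by (intro mult_mono) auto
    show "\<bar>f x * g x - f y * g y\<bar> \<le> (B * L' + B' * L) * (\<Sum>j\<in>J. \<bar>x j - y j\<bar>)" for x y
    proof -
      have "f x * g x - f y * g y = f x * (g x - g y) + g y * (f x - f y)" by algebra
      then have "\<bar>f x * g x - f y * g y\<bar> \<le> \<bar>f x\<bar> * \<bar>g x - g y\<bar> + \<bar>g y\<bar> * \<bar>f x - f y\<bar>"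
        by (metis abs_mult abs_triangle_ineq)
      also have "\<dots> \<le> B * (L' * (\<Sum>j\<in>J. \<bar>x j - y j\<bar>)) + B' * (L * (\<Sum>j\<in>J. \<bar>x j - y j\<bar>))"
        using f g by (intro add_mono mult_mono) auto
      finally show ?thesis by (simp add: algebra_simps)
    qed
  qed fact
qed

lemma cyl_cmult: "cyl J f \<Longrightarrow> cyl J (\<lambda>x. c * f x)"
  by (rule cyl_mult[OF cyl_const]) (auto dest: cyl_finite)

lemma cyl_uminus: "cyl J f \<Longrightarrow> cyl J (\<lambda>x. - f x)"
  using cyl_cmult[of J f "-1"] by simp

lemma cyl_diff: "cyl J f \<Longrightarrow> cyl J g \<Longrightarrow> cyl J (\<lambda>x. f x - g x)"
  using cyl_add[OF _ cyl_uminus, of J f g] by simp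

lemma cyl_sum:
  assumes "finite J" "\<And>i. i \<in> I \<Longrightarrow> cyl J (f i)"
  shows "cyl J (\<lambda>x. \<Sum>i\<in>I. f i x)"
  using assms(2)
proof (induction I rule: infinite_finite_induct)
  case (insert i I)
  then show ?case by (simp add: cyl_add)
qed (auto simp: cyl_const assms(1))

lemma cyl_prod:
  assumes "finite J" "\<And>i. i \<in> I \<Longrightarrow> cyl J (f i)"
  shows "cyl J (\<lambda>x. \<Prod>i\<in>I. f i x)"
  using assms(2)
proof (induction I rule: infinite_finite_induct)
  case (insert i I)
  then show ?case by (simp add: cyl_mult)
qed (auto simp: cyl_const assms(1))

text \<open>A locally Lipschitz \<open>g\<close> suffices because \<open>f\<close> stays in a
  bounded interval; this is what admits \<open>exp\<close>.\<close>

lemma cyl_comp: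
  assumes f: "cyl J f" and g: "\<And>B. \<exists>C. \<forall>u v. \<bar>u\<bar> \<le> B \<longrightarrow> \<bar>v\<bar> \<le> B \<longrightarrow> \<bar>g u - g v\<bar> \<le> C * \<bar>u - v\<bar>"
  shows "cyl J (\<lambda>x. g (f x) :: real)"
proof -
  obtain B L where f: "finite J" "B > 0" "L > 0" "\<And>x. \<bar>f x\<bar> \<le> B"
    "\<And>x y. \<bar>f x - f y\<bar> \<le> L * (\<Sum>j\<in>J. \<bar>x j - y j\<bar>)"
    using cyl_bounds[OF f] by blast
  obtain C where C: "\<And>u v. \<bar>u\<bar> \<le> B \<Longrightarrow> \<bar>v\<bar> \<le> B \<Longrightarrow> \<bar>g u - g v\<bar> \<le> C * \<bar>u - v\<bar>"
    using g[of B] by blast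
  have C': "\<bar>g u - g v\<bar> \<le> \<bar>C\<bar> * \<bar>u - v\<bar>" if "\<bar>u\<bar> \<le> B" "\<bar>v\<bar> \<le> B" for u v
    using C[OF that] by (rule order_trans) (simp add: mult_right_mono)
  show ?thesis
  proof (rule cylI[where B="\<bar>g 0\<bar> + \<bar>C\<bar> * B" and L="\<bar>C\<bar> * L"])
    show "\<bar>g (f x)\<bar> \<le> \<bar>g 0\<bar> + \<bar>C\<bar> * B" for x
    proof -
      have "\<bar>g (f x) - g 0\<bar> \<le> \<bar>C\<bar> * \<bar>f x - 0\<bar>" using C'[of "f x" 0] f by auto
      also have "\<dots> \<le> \<bar>C\<bar> * B" using f(4)[of x] by (simp add: mult_left_mono)
      finally show ?thesis by linarith
    qed
    show "\<bar>g (f x) - g (f y)\<bar> \<le> \<bar>C\<bar> * L * (\<Sum>j\<in>J. \<bar>x j - y j\<bar>)" for x y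
      using order_trans[OF C'[OF f(4) f(4)] mult_left_mono[OF f(5) abs_ge_zero]]
      by (simp add: mult.assoc)
  qed fact
qed

lemma cyl_lip:
  assumes "cyl J f" "\<And>u v. \<bar>g u - g v\<bar> \<le> C * \<bar>u - v\<bar>"
  shows "cyl J (\<lambda>x. g (f x) :: real)"
  by (rule cyl_comp[OF assms(1)]) (use assms(2) in auto)

lemma cyl_abs: "cyl J f \<Longrightarrow> cyl J (\<lambda>x. \<bar>f x\<bar>)"
  by (rule cyl_lip[where C=1]) auto

lemma cyl_exp:
  assumes "cyl J f"
  shows "cyl J (\<lambda>x. exp (f x))"
proof (rule cyl_comp[OF assms])
  fix B :: real
  have *: "exp u - exp v \<le> exp B * (u - v)" if "v \<le> u" "\<bar>u\<bar> \<le> B" for u v :: real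
  proof -
    \<comment> \<open>The tangent at \<open>u\<close> lies below the convex exponential.\<close>
    have "exp v \<ge> exp u * (1 + (v - u))"
      using mult_left_mono[OF exp_ge_add_one_self[of "v - u"], of "exp u"]
      by (simp add: mult_exp_exp)
    then have "exp u - exp v \<le> exp u * (u - v)" by (simp add: algebra_simps)
    also have "\<dots> \<le> exp B * (u - v)" using that by (intro mult_right_mono) auto
    finally show ?thesis .
  qed
  have "\<bar>exp u - exp v\<bar> \<le> exp B * \<bar>u - v\<bar>" if "\<bar>u\<bar> \<le> B" "\<bar>v\<bar> \<le> B" for u v :: real
    using *[of v u] *[of u v] that by (cases "v \<le> u") auto
  then show "\<exists>C. \<forall>u v::real. \<bar>u\<bar> \<le> B \<longrightarrow> \<bar>v\<bar> \<le> B \<longrightarrow> \<bar>exp u - exp v\<bar> \<le> C * \<bar>u - v\<bar>"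
    by blast
qed

lemma cyl_coord:
  assumes "finite J" "j \<in> J" "\<And>u. \<bar>g u\<bar> \<le> B" "\<And>u v. \<bar>g u - g v\<bar> \<le> C * \<bar>u - v\<bar>"
  shows "cyl J (\<lambda>x. g (x j) :: real)"
proof -
  have "cyl {j} (\<lambda>x. g (x j))"
    by (rule cylI[where B=B and L=C]) (use assms in auto)
  then show ?thesis by (rule cyl_mono) (use assms in auto)
qed


section \<open>Calculus of sub-linear expectations\<close>

context sublinear_expectation_space
begin

text \<open>Faithful on \<open>L1\<close> by \<open>E_L1\<close>; an infinite \<open>E F\<close> is
  read as 0.\<close>

definition rE :: "('a \<Rightarrow> real) \<Rightarrow> real" where
  "rE F = real_of_ereal (E F)"

definition L1 :: "('a \<Rightarrow> real) set" where
  "L1 = {F \<in> H. E (\<lambda>\<omega>. \<bar>F \<omega>\<bar>) < \<infinity>}"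

lemma H_const: "(\<lambda>\<omega>. c) \<in> H"
proof -
  have "(\<lambda>x. c) \<in> C_lLip 0"
    unfolding C_lLip_def by (auto intro!: exI[of _ "1::real"])
  then show ?thesis using H_C_lLip[of 0 "\<lambda>_ _. 0" "\<lambda>_. c"] by simp
qed

text \<open>The case of one coordinate of \<open>H_C_lLip\<close>. The constant is enlarged to
  \<open>\<bar>C\<bar> + 1\<close> since \<open>C_lLip\<close> asks for a positive one.\<close>

lemma H_poly_comp:
  assumes F: "F \<in> H" and C: "\<And>u v. \<bar>g u - g v\<bar> \<le> C * (1 + \<bar>u\<bar> ^ m + \<bar>v\<bar> ^ m) * \<bar>u - v :: real\<bar>"
  shows "(\<lambda>\<omega>. g (F \<omega>) :: real) \<in> H"
proof -
  have "\<bar>g u - g v\<bar> \<le> (\<bar>C\<bar> + 1) * (1 + \<bar>u\<bar> ^ m + \<bar>v\<bar> ^ m) * \<bar>u - v\<bar>" for u v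
    by (rule order_trans[OF C]) (intro mult_right_mono, auto)
  moreover have "L2_set x {..<1} = \<bar>x 0\<bar>" for x :: "nat \<Rightarrow> real"
    by (simp add: lessThan_Suc)
  ultimately have "(\<lambda>x. g (x 0)) \<in> C_lLip 1"
    unfolding C_lLip_def by (auto intro!: exI[of _ "\<bar>C\<bar> + 1"] exI[of _ m])
  from H_C_lLip[OF _ this, of "\<lambda>_. F"] F show ?thesis by simp
qed

lemma H_lip_comp:
  assumes F: "F \<in> H" and C: "\<And>u v. \<bar>g u - g v\<bar> \<le> C * \<bar>u - v :: real\<bar>"
  shows "(\<lambda>\<omega>. g (F \<omega>) :: real) \<in> H"
  \<comment> \<open>For m = 0 the growth factor is 1 + 1 + 1, hence the division by 3.\<close>
  using C by (intro H_poly_comp[OF F, where C="C/3" and m=0]) simp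

lemma H_abs: "F \<in> H \<Longrightarrow> (\<lambda>\<omega>. \<bar>F \<omega>\<bar>) \<in> H"
  by (rule H_lip_comp[where C=1]) auto

lemma H_uminus: "F \<in> H \<Longrightarrow> (\<lambda>\<omega>. - F \<omega>) \<in> H"
  by (rule H_lip_comp[where C=1]) auto

lemma H_sum: "(\<And>i. i \<in> I \<Longrightarrow> F i \<in> H) \<Longrightarrow> (\<lambda>\<omega>. \<Sum>i\<in>I. F i \<omega>) \<in> H"
  by (induction I rule: infinite_finite_induct) (simp_all add: H_zero H_add)

lemma H_square: "F \<in> H \<Longrightarrow> (\<lambda>\<omega>. (F \<omega>)\<^sup>2) \<in> H"
proof (erule H_poly_comp[where C=1 and m=1])
  fix u v :: real
  have "\<bar>u\<^sup>2 - v\<^sup>2\<bar> = \<bar>u + v\<bar> * \<bar>u - v\<bar>"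
    by (simp add: power2_eq_square square_diff_square_factored abs_mult)
  also have "\<dots> \<le> (1 + \<bar>u\<bar> ^ 1 + \<bar>v\<bar> ^ 1) * \<bar>u - v\<bar>"
    by (intro mult_right_mono) auto
  finally show "\<bar>u\<^sup>2 - v\<^sup>2\<bar> \<le> 1 * (1 + \<bar>u\<bar> ^ 1 + \<bar>v\<bar> ^ 1) * \<bar>u - v\<bar>" by simp
qed

lemma L1_H: "F \<in> L1 \<Longrightarrow> F \<in> H"
  by (simp add: L1_def)

lemma E_nonneg: "F \<in> H \<Longrightarrow> (\<And>\<omega>. \<omega> \<in> space M \<Longrightarrow> 0 \<le> F \<omega>) \<Longrightarrow> 0 \<le> E F"
  using E_mono[of F "\<lambda>_. 0"] H_zero E_const[of 0] by (simp add: zero_ereal_def)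

lemma L1_dom:
  assumes "F \<in> H" "G \<in> L1" "\<And>\<omega>. \<omega> \<in> space M \<Longrightarrow> \<bar>F \<omega>\<bar> \<le> G \<omega>"
  shows "F \<in> L1"
proof -
  have "E (\<lambda>\<omega>. \<bar>F \<omega>\<bar>) \<le> E (\<lambda>\<omega>. \<bar>G \<omega>\<bar>)"
    using assms by (intro E_mono H_abs) (auto simp: L1_def intro: order_trans[OF assms(3)])
  with assms show ?thesis by (auto simp: L1_def)
qed

text \<open>From above, \<open>F\<close> is dominated by its absolute value. From below, \<open>0 =
  E (\<bar>F\<bar> - \<bar>F\<bar>) \<le> E \<bar>F\<bar> + E (- \<bar>F\<bar>)\<close> keeps
  \<open>E (- \<bar>F\<bar>)\<close>, and hence \<open>E F\<close>, away from - \<infinity>.\<close>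

lemma E_L1:
  assumes "F \<in> L1"
  shows "E F = ereal (rE F)"
proof -
  have H: "F \<in> H" and a: "E (\<lambda>\<omega>. \<bar>F \<omega>\<bar>) < \<infinity>" using assms by (auto simp: L1_def)
  have "E F \<le> E (\<lambda>\<omega>. \<bar>F \<omega>\<bar>)" by (intro E_mono H_abs H) auto
  then have 1: "E F \<noteq> \<infinity>" using a by auto
  have pos: "0 \<le> E (\<lambda>\<omega>. \<bar>F \<omega>\<bar>)" by (intro E_nonneg H_abs H) auto
  have "0 = E (\<lambda>\<omega>. \<bar>F \<omega>\<bar> + - \<bar>F \<omega>\<bar>)" using E_const[of 0] by simp
  also have "\<dots> \<le> E (\<lambda>\<omega>. \<bar>F \<omega>\<bar>) + E (\<lambda>\<omega>. - \<bar>F \<omega>\<bar>)"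
    using a pos by (intro E_subadd H_abs H_uminus H) auto
  finally have "E (\<lambda>\<omega>. - \<bar>F \<omega>\<bar>) \<noteq> -\<infinity>" using a pos by (cases "E (\<lambda>\<omega>. \<bar>F \<omega>\<bar>)") auto
  moreover have "E (\<lambda>\<omega>. - \<bar>F \<omega>\<bar>) \<le> E F" by (intro E_mono H_abs H_uminus H) auto
  ultimately have "E F \<noteq> -\<infinity>" by auto
  with 1 show ?thesis unfolding rE_def by (cases "E F") auto
qed

lemma L1_const: "(\<lambda>\<omega>. c) \<in> L1"
  unfolding L1_def using H_const E_const[of "\<bar>c\<bar>"] by simp

lemma L1_bounded: "F \<in> H \<Longrightarrow> (\<And>\<omega>. \<omega> \<in> space M \<Longrightarrow> \<bar>F \<omega>\<bar> \<le> B) \<Longrightarrow> F \<in> L1"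
  by (rule L1_dom[OF _ L1_const])

lemma L1_add:
  assumes "F \<in> L1" "G \<in> L1"
  shows "(\<lambda>\<omega>. F \<omega> + G \<omega>) \<in> L1"
proof -
  have H: "F \<in> H" "G \<in> H" using assms by (auto simp: L1_def)
  have p: "0 \<le> E (\<lambda>\<omega>. \<bar>F \<omega>\<bar>)" "0 \<le> E (\<lambda>\<omega>. \<bar>G \<omega>\<bar>)" by (intro E_nonneg H_abs H; simp)+
  have "E (\<lambda>\<omega>. \<bar>F \<omega> + G \<omega>\<bar>) \<le> E (\<lambda>\<omega>. \<bar>F \<omega>\<bar> + \<bar>G \<omega>\<bar>)"
    by (intro E_mono H_abs H_add H) auto
  also have "\<dots> \<le> E (\<lambda>\<omega>. \<bar>F \<omega>\<bar>) + E (\<lambda>\<omega>. \<bar>G \<omega>\<bar>)"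
    using p by (intro E_subadd H_abs H) auto
  also have "\<dots> < \<infinity>" using assms by (auto simp: L1_def)
  finally show ?thesis using H by (simp add: L1_def H_add)
qed

lemma L1_cmult:
  assumes "F \<in> L1"
  shows "(\<lambda>\<omega>. c * F \<omega>) \<in> L1"
proof -
  have H: "F \<in> H" and a: "E (\<lambda>\<omega>. \<bar>F \<omega>\<bar>) < \<infinity>" using assms by (auto simp: L1_def)
  have pos: "0 \<le> E (\<lambda>\<omega>. \<bar>F \<omega>\<bar>)" by (intro E_nonneg H_abs H) auto
  have "E (\<lambda>\<omega>. \<bar>c\<bar> * \<bar>F \<omega>\<bar>) = ereal \<bar>c\<bar> * E (\<lambda>\<omega>. \<bar>F \<omega>\<bar>)"
    by (intro E_pos_homog H_abs H) auto
  also have "\<dots> < \<infinity>" using a pos by (cases "E (\<lambda>\<omega>. \<bar>F \<omega>\<bar>)") auto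
  finally show ?thesis using H by (simp add: L1_def H_scale abs_mult)
qed

lemma L1_uminus: "F \<in> L1 \<Longrightarrow> (\<lambda>\<omega>. - F \<omega>) \<in> L1"
  using L1_cmult[of F "-1"] by simp

lemma L1_diff: "F \<in> L1 \<Longrightarrow> G \<in> L1 \<Longrightarrow> (\<lambda>\<omega>. F \<omega> - G \<omega>) \<in> L1"
  using L1_add[OF _ L1_uminus, of F G] by simp

lemma L1_abs: "F \<in> L1 \<Longrightarrow> (\<lambda>\<omega>. \<bar>F \<omega>\<bar>) \<in> L1"
  by (auto simp: L1_def H_abs)

lemma rE_mono:
  assumes "F \<in> L1" "G \<in> L1" "\<And>\<omega>. \<omega> \<in> space M \<Longrightarrow> F \<omega> \<le> G \<omega>"
  shows "rE F \<le> rE G"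
  using E_mono[of G F] assms by (simp add: E_L1 L1_H)

lemma rE_const [simp]: "rE (\<lambda>\<omega>. c) = c"
  by (simp add: rE_def E_const)

lemma rE_le: "F \<in> L1 \<Longrightarrow> (\<And>\<omega>. \<omega> \<in> space M \<Longrightarrow> F \<omega> \<le> c) \<Longrightarrow> rE F \<le> c"
  using rE_mono[OF _ L1_const, of F c] by simp

lemma rE_ge: "F \<in> L1 \<Longrightarrow> (\<And>\<omega>. \<omega> \<in> space M \<Longrightarrow> c \<le> F \<omega>) \<Longrightarrow> c \<le> rE F"
  using rE_mono[OF L1_const, of F c] by simp

lemma rE_add:
  assumes "F \<in> L1" "G \<in> L1"
  shows "rE (\<lambda>\<omega>. F \<omega> + G \<omega>) \<le> rE F + rE G"
  using E_subadd[of F G] assms by (simp add: E_L1 L1_H L1_add)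

lemma rE_cmult: "F \<in> L1 \<Longrightarrow> 0 \<le> c \<Longrightarrow> rE (\<lambda>\<omega>. c * F \<omega>) = c * rE F"
  unfolding rE_def using E_pos_homog[of F c] by (simp add: L1_H)

text \<open>Sub-additivity for \<open>F = (F - G) + G\<close>. Lower bounds come from here, with the
  subtracted part entering through its upper expectation.\<close>

lemma rE_diff_ge:
  assumes "F \<in> L1" "G \<in> L1"
  shows "rE F - rE G \<le> rE (\<lambda>\<omega>. F \<omega> - G \<omega>)"
  using rE_add[OF L1_diff[OF assms] assms(2)] by simp

text \<open>Sub-additivity with \<open>c\<close> and then with \<open>- c\<close> closes to an
  equality, so constants leave the expectation exactly.\<close>

lemma rE_add_const: "F \<in> L1 \<Longrightarrow> rE (\<lambda>\<omega>. c + F \<omega>) = c + rE F"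
  using rE_add[OF L1_const, of F c] rE_add[OF L1_add[OF L1_const] L1_const, of F c "-c"]
  by simp

lemma rE_abs_diff:
  assumes "F \<in> L1" "G \<in> L1" "\<And>\<omega>. \<omega> \<in> space M \<Longrightarrow> \<bar>F \<omega> - G \<omega>\<bar> \<le> c"
  shows "\<bar>rE F - rE G\<bar> \<le> c"
proof -
  have "rE F - rE G \<le> rE (\<lambda>\<omega>. F \<omega> - G \<omega>)" "rE G - rE F \<le> rE (\<lambda>\<omega>. G \<omega> - F \<omega>)"
    using assms by (auto intro: rE_diff_ge)
  moreover have "rE (\<lambda>\<omega>. F \<omega> - G \<omega>) \<le> c" "rE (\<lambda>\<omega>. G \<omega> - F \<omega>) \<le> c"
    using assms(3) by (auto intro!: rE_le L1_diff assms(1,2) simp: abs_le_iff minus_diff_eq)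
  ultimately show ?thesis by linarith
qed

lemma V_hat_le:
  assumes "\<xi> \<in> L1" "\<And>\<omega>. \<omega> \<in> space M \<Longrightarrow> indicator A \<omega> \<le> \<xi> \<omega>"
  shows "V_hat M H E A \<le> ereal (rE \<xi>)"
proof -
  have "V_hat M H E A \<le> E \<xi>"
    unfolding V_hat_def by (rule Inf_lower) (use assms L1_H in blast)
  then show ?thesis by (simp add: E_L1 assms(1))
qed

end

section \<open>Independent sequences\<close>

text \<open>The random variables are numbered from 1 and the coordinates of \<open>C_lLip\<close>
  from 0, hence the shift k - 1. The Lipschitz bound is global, so the growth exponent is 0.\<close>

lemma cyl_C_lLip:
  assumes "cyl {1..n} \<phi>"
  shows "(\<lambda>y. \<phi> (\<lambda>k. y (k - 1))) \<in> C_lLip n"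
proof -
  obtain B L where *: "finite {1..n}" "B > 0" "L > 0" "\<And>x. \<bar>\<phi> x\<bar> \<le> B"
    "\<And>x y. \<bar>\<phi> x - \<phi> y\<bar> \<le> L * (\<Sum>j\<in>{1..n}. \<bar>x j - y j\<bar>)"
    using cyl_bounds[OF assms] by blast
  define C where "C = L * real n + 1"
  have C: "C > 0" "L * real n \<le> C" using *(3) by (auto simp: C_def intro: add_nonneg_pos)
  have "\<bar>\<phi> (\<lambda>k. x (k - 1)) - \<phi> (\<lambda>k. y (k - 1))\<bar>
      \<le> C * (1 + L2_set x {..<n} ^ 0 + L2_set y {..<n} ^ 0) * L2_set (\<lambda>i. x i - y i) {..<n}" for x y
  proof -
    let ?d = "L2_set (\<lambda>i. x i - y i) {..<n}"
    have le: "\<bar>x i - y i\<bar> \<le> ?d" if "i < n" for i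
      using member_le_L2_set[of "{..<n}" i "\<lambda>i. \<bar>x i - y i\<bar>"] that by (simp add: L2_set_def)
    have "\<bar>\<phi> (\<lambda>k. x (k - 1)) - \<phi> (\<lambda>k. y (k - 1))\<bar> \<le> L * (\<Sum>j\<in>{1..n}. \<bar>x (j - 1) - y (j - 1)\<bar>)"
      by (rule *(5))
    also have "(\<Sum>j\<in>{1..n}. \<bar>x (j - 1) - y (j - 1)\<bar>) = (\<Sum>i<n. \<bar>x i - y i\<bar>)"
      by (simp add: sum.atLeast1_atMost_eq)
    also have "\<dots> \<le> real n * ?d"
      using sum_bounded_above[of "{..<n}" "\<lambda>i. \<bar>x i - y i\<bar>" ?d] le by simp
    also have "L * (real n * ?d) \<le> C * ?d"
      using mult_right_mono[OF C(2), of ?d] by (simp add: mult.assoc)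
    also have "\<dots> \<le> C * (1 + 1 + 1) * ?d" using C by (intro mult_right_mono) auto
    finally show ?thesis using *(3) by simp
  qed
  then show ?thesis unfolding C_lLip_def using C(1) by blast
qed

locale indep_sequence = sublinear_expectation_space M H E
  for M :: "'a measure" and H E +
  fixes X :: "nat \<Rightarrow> 'a \<Rightarrow> real"
  assumes X_H: "n \<ge> 1 \<Longrightarrow> X n \<in> H" and indep: "independent_seq H E X"
begin

definition path :: "'a \<Rightarrow> nat \<Rightarrow> real" where
  "path \<omega> = (\<lambda>k. X k \<omega>)"

definition Ex :: "((nat \<Rightarrow> real) \<Rightarrow> real) \<Rightarrow> real" where
  "Ex \<phi> = rE (\<lambda>\<omega>. \<phi> (path \<omega>))"

text \<open>The inner expectation in the definition of independence, with the past frozen at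
  \<open>x\<close>.\<close>

definition integ :: "nat \<Rightarrow> ((nat \<Rightarrow> real) \<Rightarrow> real) \<Rightarrow> (nat \<Rightarrow> real) \<Rightarrow> real" where
  "integ n \<phi> x = rE (\<lambda>\<omega>. \<phi> (x(n := X n \<omega>)))"

text \<open>Index 0 is excluded because \<open>X 0\<close> is not assumed to lie in
  \<open>H\<close>.\<close>

lemma cyl_H:
  assumes "cyl J \<phi>" "0 \<notin> J"
  shows "(\<lambda>\<omega>. \<phi> (path \<omega>)) \<in> H"
proof -
  have fin: "finite J" using assms by (simp add: cyl_def)
  have "J \<subseteq> {1..Max (insert 1 J)}" using assms(2) fin by (auto simp: Suc_le_eq intro!: gr0I)
  then have c: "cyl {1..Max (insert 1 J)} \<phi>" by (rule cyl_mono[OF assms(1)]) simp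
  have "(\<lambda>\<omega>. (\<lambda>y. \<phi> (\<lambda>k. y (k - 1))) (\<lambda>i. X (Suc i) \<omega>)) \<in> H"
    by (rule H_C_lLip[OF _ cyl_C_lLip[OF c]]) (simp add: X_H)
  moreover have "\<phi> (\<lambda>k. X (Suc (k - 1)) \<omega>) = \<phi> (path \<omega>)" for \<omega>
    by (rule cyl_dep[OF c]) (simp add: path_def)
  ultimately show ?thesis by simp
qed

lemma cyl_L1:
  assumes "cyl J \<phi>" "0 \<notin> J"
  shows "(\<lambda>\<omega>. \<phi> (path \<omega>)) \<in> L1"
proof -
  obtain B where "\<And>x. \<bar>\<phi> x\<bar> \<le> B" using assms(1) by (auto simp: cyl_def)
  then show ?thesis by (intro L1_bounded[OF cyl_H[OF assms]])
qed

lemma section_L1: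
  assumes "cyl J \<phi>" "n \<ge> 1"
  shows "(\<lambda>\<omega>. \<phi> (x(n := X n \<omega>))) \<in> L1"
proof -
  obtain B L where *: "finite J" "B > 0" "L > 0" "\<And>x. \<bar>\<phi> x\<bar> \<le> B"
    "\<And>x y. \<bar>\<phi> x - \<phi> y\<bar> \<le> L * (\<Sum>j\<in>J. \<bar>x j - y j\<bar>)"
    using cyl_bounds[OF assms(1)] by blast
  have "(\<Sum>j\<in>J. \<bar>(x(n := u)) j - (x(n := v)) j\<bar>) \<le> \<bar>u - v\<bar>" for u v
  proof -
    have "(\<Sum>j\<in>J. \<bar>(x(n := u)) j - (x(n := v)) j\<bar>) = (\<Sum>j\<in>J. if j = n then \<bar>u - v\<bar> else 0)"
      by (intro sum.cong) auto
    then show ?thesis using *(1) by (simp add: sum.delta)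
  qed
  then have "\<bar>\<phi> (x(n := u)) - \<phi> (x(n := v))\<bar> \<le> L * \<bar>u - v\<bar>" for u v
    using order_trans[OF *(5) mult_left_mono] *(3) by (meson less_imp_le)
  then show ?thesis
    by (intro L1_bounded[OF _ *(4)] H_lip_comp[OF X_H[OF assms(2)], where g="\<lambda>u. \<phi> (x(n := u))"])
qed

text \<open>\<open>rE\<close> preserves bounds and contracts uniform distances, so the class is
  stable under partial expectation. Hence the functions that \<open>independent_to\<close> wants in
  \<open>H\<close> are there.\<close>

lemma integ_cyl:
  assumes "cyl J \<phi>" "n \<ge> 1"
  shows "cyl (J - {n}) (integ n \<phi>)"
proof -
  obtain B L where *: "finite J" "B > 0" "L > 0" "\<And>x. \<bar>\<phi> x\<bar> \<le> B"
    "\<And>x y. \<bar>\<phi> x - \<phi> y\<bar> \<le> L * (\<Sum>j\<in>J. \<bar>x j - y j\<bar>)"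
    using cyl_bounds[OF assms(1)] by blast
  show ?thesis
  proof (rule cylI)
    show "\<bar>integ n \<phi> x\<bar> \<le> B" for x
      unfolding integ_def abs_le_iff
    proof
      show "rE (\<lambda>\<omega>. \<phi> (x(n := X n \<omega>))) \<le> B"
        by (rule rE_le[OF section_L1[OF assms]]) (use *(4) abs_le_iff in blast)
      have "-B \<le> rE (\<lambda>\<omega>. \<phi> (x(n := X n \<omega>)))"
        by (rule rE_ge[OF section_L1[OF assms]]) (metis *(4) abs_le_iff minus_le_iff)
      then show "- rE (\<lambda>\<omega>. \<phi> (x(n := X n \<omega>))) \<le> B" by simp
    qed
    show "\<bar>integ n \<phi> x - integ n \<phi> y\<bar> \<le> L * (\<Sum>j\<in>J - {n}. \<bar>x j - y j\<bar>)" for x y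
      unfolding integ_def
    proof (rule rE_abs_diff[OF section_L1[OF assms] section_L1[OF assms]])
      fix \<omega>
      have "(\<Sum>j\<in>J. \<bar>(x(n := X n \<omega>)) j - (y(n := X n \<omega>)) j\<bar>) = (\<Sum>j\<in>J - {n}. \<bar>x j - y j\<bar>)"
        using *(1) by (intro sum.mono_neutral_cong_right) auto
      with *(5)[of "x(n := X n \<omega>)" "y(n := X n \<omega>)"]
      show "\<bar>\<phi> (x(n := X n \<omega>)) - \<phi> (y(n := X n \<omega>))\<bar> \<le> L * (\<Sum>j\<in>J - {n}. \<bar>x j - y j\<bar>)" by simp
    qed
  qed (use * in simp)
qed

text \<open>Fubini for the last coordinate. The premises of \<open>independent_to\<close> hold
  because both \<phi> and its absolute value remain cylinder functions after integration.\<close>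

lemma Ex_integ:
  assumes c: "cyl {1..n} \<phi>" and n: "n \<ge> 1"
  shows "Ex \<phi> = Ex (integ n \<phi>)"
proof (cases "n = 1")
  \<comment> \<open>There is no past: \<open>integ n \<phi>\<close> is constant, and independence is
    not called upon.\<close>
  case True
  have "\<phi> (x(n := X n \<omega>)) = \<phi> (path \<omega>)" for x \<omega>
    by (rule cyl_dep[OF c]) (auto simp: True path_def)
  then have "integ n \<phi> x = Ex \<phi>" for x by (simp add: integ_def Ex_def)
  then show ?thesis unfolding Ex_def[of "integ n \<phi>"] by simp
next
  case False
  then obtain i where i: "n = Suc i" "i \<ge> 1" using n by (cases n) auto
  have ind: "independent_to H E 1 (\<lambda>_. X (Suc i)) i (\<lambda>k. X (Suc k))"
    using indep i(2) unfolding independent_seq_def by blast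
  \<comment> \<open>\<open>vec_append\<close> counts from 0; reading coordinate k at k - 1 leaves an
    arbitrary value at k = 0, which \<open>f\<close> ignores.\<close>
  have va: "f (\<lambda>k. vec_append i x (\<lambda>j. X (Suc i) \<omega>) (k - 1)) = f ((\<lambda>k. x (k - 1))(n := X n \<omega>))"
    if "cyl {1..n} f" for f x \<omega>
    by (rule cyl_dep[OF that]) (auto simp: vec_append_def i)
  have path: "integ n f (\<lambda>k. X (Suc (k - 1)) \<omega>) = integ n f (path \<omega>)" if "cyl {1..n} f" for f \<omega>
    by (rule cyl_dep[OF integ_cyl[OF that n]]) (auto simp: path_def)
  have ca: "cyl {1..n} (\<lambda>x. \<bar>\<phi> x\<bar>)" by (rule cyl_abs[OF c])
  have E1: "E (\<lambda>\<omega>. f (x(n := X n \<omega>))) = ereal (integ n f x)" if "cyl {1..n} f" for f x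
    unfolding integ_def by (rule E_L1[OF section_L1[OF that n]])
  have H1: "(\<lambda>\<omega>. integ n f (path \<omega>)) \<in> L1" if "cyl {1..n} f" for f
    by (rule cyl_L1[OF integ_cyl[OF that n]]) simp
  let ?\<phi> = "\<lambda>y. \<phi> (\<lambda>k. y (k - 1))"
  have \<phi>: "?\<phi> \<in> C_lLip (i + 1)" using cyl_C_lLip[OF c] by (simp add: i)
  have
    "(\<forall>x. E (\<lambda>\<omega>. \<bar>?\<phi> (vec_append i x (\<lambda>j. X (Suc i) \<omega>))\<bar>) < \<infinity>) \<longrightarrow>
     (\<lambda>\<omega>. real_of_ereal (E (\<lambda>\<omega>'. \<bar>?\<phi> (vec_append i (\<lambda>k. X (Suc k) \<omega>) (\<lambda>j. X (Suc i) \<omega>'))\<bar>))) \<in> H \<longrightarrow>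
     E (\<lambda>\<omega>. \<bar>real_of_ereal (E (\<lambda>\<omega>'. \<bar>?\<phi> (vec_append i (\<lambda>k. X (Suc k) \<omega>) (\<lambda>j. X (Suc i) \<omega>'))\<bar>))\<bar>) < \<infinity> \<longrightarrow>
     (\<lambda>\<omega>. real_of_ereal (E (\<lambda>\<omega>'. ?\<phi> (vec_append i (\<lambda>k. X (Suc k) \<omega>) (\<lambda>j. X (Suc i) \<omega>'))))) \<in> H \<longrightarrow>
     E (\<lambda>\<omega>. ?\<phi> (vec_append i (\<lambda>k. X (Suc k) \<omega>) (\<lambda>j. X (Suc i) \<omega>)))
      = E (\<lambda>\<omega>. real_of_ereal (E (\<lambda>\<omega>'. ?\<phi> (vec_append i (\<lambda>k. X (Suc k) \<omega>) (\<lambda>j. X (Suc i) \<omega>')))))"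
    by (rule bspec[OF conjunct2[OF conjunct2[OF ind[unfolded independent_to_def Let_def]]] \<phi>])
  then have
    "E (\<lambda>\<omega>. ?\<phi> (vec_append i (\<lambda>k. X (Suc k) \<omega>) (\<lambda>j. X (Suc i) \<omega>)))
      = E (\<lambda>\<omega>. real_of_ereal (E (\<lambda>\<omega>'. ?\<phi> (vec_append i (\<lambda>k. X (Suc k) \<omega>) (\<lambda>j. X (Suc i) \<omega>')))))"
    unfolding va[OF c] va[OF ca] E1[OF c] E1[OF ca] path[OF c] path[OF ca]
    using L1_H[OF H1[OF c]] L1_H[OF H1[OF ca]] H1[OF ca] by (simp add: L1_def)
  then have "E (\<lambda>\<omega>. \<phi> ((\<lambda>k. X (Suc (k - 1)) \<omega>)(n := X n \<omega>))) = E (\<lambda>\<omega>. integ n \<phi> (path \<omega>))"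
    unfolding va[OF c] E1[OF c] path[OF c] by simp
  moreover have "\<phi> ((\<lambda>k. X (Suc (k - 1)) \<omega>)(n := X n \<omega>)) = \<phi> (path \<omega>)" for \<omega>
    by (rule cyl_dep[OF c]) (auto simp: path_def)
  ultimately show ?thesis by (simp add: Ex_def rE_def)
qed

lemma Ex_mono:
  assumes "cyl J f" "cyl J' g" "0 \<notin> J" "0 \<notin> J'" "\<And>x. f x \<le> g x"
  shows "Ex f \<le> Ex g"
  unfolding Ex_def by (intro rE_mono cyl_L1[OF assms(1)] cyl_L1[OF assms(2)] assms)

lemma Ex_const [simp]: "Ex (\<lambda>x. c) = c"
  by (simp add: Ex_def)

lemma Ex_coord: "Ex (\<lambda>x. g (x j)) = rE (\<lambda>\<omega>. g (X j \<omega>))"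
  by (simp add: Ex_def path_def)

text \<open>For a fixed past, the map from \<psi> to \<open>A + B * \<psi>\<close> commutes with
  \<open>rE\<close>, since constants and nonnegative factors leave it. Coordinates are integrated
  out from the last one down to m + 1. As \<open>E\<close> is not linear, the summand
  \<open>A\<close> has to be carried along; \<open>maximal_inequality\<close> and
  \<open>rich_blocks\<close> rely on it.\<close>

lemma Ex_block:
  assumes A: "cyl {1..m} A" and B: "cyl {1..m} B" "\<And>x. 0 \<le> B x"
    and "m \<le> n" "cyl {m<..n} \<psi>"
  shows "Ex (\<lambda>x. A x + B x * \<psi> x) = Ex (\<lambda>x. A x + B x * Ex \<psi>)"
  using assms(4,5)
proof (induction n arbitrary: \<psi> rule: dec_induct)
  \<comment> \<open>With no coordinate left, \<psi> is a constant.\<close>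
  case base
  then have c: "cyl {} \<psi>" by simp
  have "\<psi> x = \<psi> undefined" for x by (rule cyl_dep[OF c]) simp
  then have "\<psi> = (\<lambda>x. \<psi> undefined)" by blast
  then show ?case by (metis Ex_const)
next
  case (step n)
  have sub: "{1..m} \<subseteq> {1..Suc n}" "{m<..Suc n} \<subseteq> {1..Suc n}" using step.hyps by auto
  have c: "cyl {1..Suc n} A" "cyl {1..Suc n} B" "cyl {1..Suc n} \<psi>"
    using cyl_mono[OF A sub(1)] cyl_mono[OF B(1) sub(1)] cyl_mono[OF step.prems sub(2)] by auto
  have *: "integ (Suc n) (\<lambda>x. A x + B x * \<psi> x) x = A x + B x * integ (Suc n) \<psi> x" for x
  proof -
    have "A (x(Suc n := u)) = A x" "B (x(Suc n := u)) = B x" for u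
      using step.hyps by (auto intro!: cyl_dep[OF A] cyl_dep[OF B(1)])
    moreover have s: "(\<lambda>\<omega>. \<psi> (x(Suc n := X (Suc n) \<omega>))) \<in> L1"
      by (rule section_L1[OF step.prems]) simp
    ultimately show ?thesis unfolding integ_def
      by (simp only: rE_add_const[OF L1_cmult[OF s]] rE_cmult[OF s B(2)])
  qed
  have "Ex (\<lambda>x. A x + B x * \<psi> x) = Ex (\<lambda>x. A x + B x * integ (Suc n) \<psi> x)"
    using Ex_integ[of "Suc n" "\<lambda>x. A x + B x * \<psi> x"] c unfolding * by (simp add: cyl_add cyl_mult)
  also have "{m<..Suc n} - {Suc n} = {m<..n}" by auto
  then have "cyl {m<..n} (integ (Suc n) \<psi>)"
    using integ_cyl[OF step.prems, of "Suc n"] by simp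
  then have "Ex (\<lambda>x. A x + B x * integ (Suc n) \<psi> x) = Ex (\<lambda>x. A x + B x * Ex (integ (Suc n) \<psi>))"
    by (rule step.IH)
  also have "Ex (integ (Suc n) \<psi>) = Ex \<psi>" using Ex_integ[OF c(3)] by simp
  finally show ?case .
qed

lemma Ex_prod_blocks:
  assumes f: "cyl {1..m} f" "\<And>x. 0 \<le> f x" and "m \<le> n" and g: "cyl {m<..n} g" "\<And>x. 0 \<le> g x"
  shows "Ex (\<lambda>x. f x * g x) = Ex f * Ex g"
proof -
  have "0 \<le> Ex g" unfolding Ex_def by (rule rE_ge[OF cyl_L1[OF g(1)]]) (use g in auto)
  then have "Ex (\<lambda>x. f x * Ex g) = Ex f * Ex g"
    using rE_cmult[OF cyl_L1[OF f(1)], of "Ex g"] by (simp add: Ex_def mult.commute)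
  then show ?thesis
    using Ex_block[OF cyl_const f assms(3) g(1), of 0] by simp
qed

lemma Ex_prod:
  assumes "m \<le> n" "\<And>j. j \<in> {m<..n} \<Longrightarrow> cyl {j} (\<lambda>x. f j (x j))" "\<And>j u. 0 \<le> f j u"
  shows "Ex (\<lambda>x. \<Prod>j\<in>{m<..n}. f j (x j)) = (\<Prod>j\<in>{m<..n}. rE (\<lambda>\<omega>. f j (X j \<omega>)))"
  using assms(1,2)
proof (induction n rule: dec_induct)
  case base
  show ?case by simp
next
  case (step n)
  have s: "{m<..Suc n} = insert (Suc n) {m<..n}" using step.hyps by auto
  have a: "Ex (\<lambda>x. (\<Prod>j\<in>{m<..n}. f j (x j)) * f (Suc n) (x (Suc n)))
      = Ex (\<lambda>x. \<Prod>j\<in>{m<..n}. f j (x j)) * Ex (\<lambda>x. f (Suc n) (x (Suc n)))"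
  proof (rule Ex_prod_blocks[of n _ "Suc n"])
    show "cyl {1..n} (\<lambda>x. \<Prod>j\<in>{m<..n}. f j (x j))"
    proof (rule cyl_prod)
      fix j assume "j \<in> {m<..n}"
      then show "cyl {1..n} (\<lambda>x. f j (x j))" using step.hyps by (intro cyl_mono[OF step.prems]) auto
    qed simp
    show "cyl {n<..Suc n} (\<lambda>x. f (Suc n) (x (Suc n)))"
      by (rule cyl_mono[OF step.prems]) (use step.hyps in auto)
    show "0 \<le> (\<Prod>j\<in>{m<..n}. f j (x j))" for x by (rule prod_nonneg) (simp add: assms(3))
  qed (simp_all add: assms(3))
  have b: "Ex (\<lambda>x. \<Prod>j\<in>{m<..n}. f j (x j)) = (\<Prod>j\<in>{m<..n}. rE (\<lambda>\<omega>. f j (X j \<omega>)))"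
    by (rule step.IH, rule step.prems) auto
  have "(\<Prod>j\<in>insert (Suc n) {m<..n}. g j) = (\<Prod>j\<in>{m<..n}. g j) * g (Suc n)" for g :: "nat \<Rightarrow> real"
    by (simp add: mult.commute)
  then show ?case unfolding s using a b Ex_coord[of "f (Suc n)" "Suc n"] by presburger
qed

end

section \<open>Quasi-sure events\<close>

context sublinear_expectation_space
begin

text \<open>The exceptional set is null for \<open>V_hat_star\<close>, the largest of the three
  capacities; this is spelled out through covers because covers are what gets combined
  below.\<close>

definition qs :: "('a \<Rightarrow> bool) \<Rightarrow> bool" where
  "qs P \<longleftrightarrow> (\<forall>e>0. \<exists>B. (\<forall>n. B n \<in> sets M) \<and> {\<omega> \<in> space M. \<not> P \<omega>} \<subseteq> (\<Union>n. B n) \<and>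
     (\<Sum>n. V_hat M H E (B n)) \<le> ereal e)"

lemma V_hat_nonneg: "0 \<le> V_hat M H E A"
  unfolding V_hat_def
proof (rule Inf_greatest)
  fix x assume "x \<in> {E \<xi> |\<xi>. \<xi> \<in> H \<and> (\<forall>\<omega>\<in>space M. indicat_real A \<omega> \<le> \<xi> \<omega>)}"
  then obtain \<xi> where "x = E \<xi>" "\<xi> \<in> H" "\<forall>\<omega>\<in>space M. indicat_real A \<omega> \<le> \<xi> \<omega>" by auto
  moreover have "0 \<le> \<xi> \<omega>" if "\<omega> \<in> space M" for \<omega>
    using calculation(3) that by (metis indicator_pos_le order_trans)
  ultimately show "0 \<le> x" using E_nonneg[of \<xi>] by simp
qed

lemma V_hat_mono: "A \<subseteq> B \<Longrightarrow> V_hat M H E A \<le> V_hat M H E B"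
  unfolding V_hat_def
proof (rule Inf_superset_mono, clarify)
  fix \<xi> assume *: "A \<subseteq> B" "\<xi> \<in> H" "\<forall>\<omega>\<in>space M. indicat_real B \<omega> \<le> \<xi> \<omega>"
  have "indicat_real A \<omega> \<le> \<xi> \<omega>" if "\<omega> \<in> space M" for \<omega>
    using *(3) that *(1) by (intro order_trans[OF indicator_leI[of \<omega> A \<omega> B]]) auto
  with * show "\<exists>\<xi>'. E \<xi> = E \<xi>' \<and> \<xi>' \<in> H \<and> (\<forall>\<omega>\<in>space M. indicat_real A \<omega> \<le> \<xi>' \<omega>)"
    by (intro exI[of _ \<xi>]) simp
qed

lemma V_hat_star_qs:
  assumes "qs P"
  shows "V_hat_star M H E {\<omega> \<in> space M. \<not> P \<omega>} \<le> 0"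
proof (rule ereal_le_epsilon2)
  fix e :: real assume "0 < e"
  with assms obtain B where "\<forall>n. B n \<in> sets M" "{\<omega> \<in> space M. \<not> P \<omega>} \<subseteq> (\<Union>n. B n)"
    "(\<Sum>n. V_hat M H E (B n)) \<le> ereal e"
    unfolding qs_def by auto
  then have "V_hat_star M H E {\<omega> \<in> space M. \<not> P \<omega>} \<le> ereal e"
    unfolding V_hat_star_def by (intro order_trans[OF Inf_lower]) auto
  then show "V_hat_star M H E {\<omega> \<in> space M. \<not> P \<omega>} \<le> 0 + ereal e" by simp
qed

lemma qs_mono:
  assumes "qs P" "\<And>\<omega>. \<omega> \<in> space M \<Longrightarrow> P \<omega> \<Longrightarrow> Q \<omega>"
  shows "qs Q"
proof -
  have "{\<omega> \<in> space M. \<not> Q \<omega>} \<subseteq> {\<omega> \<in> space M. \<not> P \<omega>}" using assms(2) by auto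
  note sub = this
  show ?thesis
    unfolding qs_def
  proof (intro allI impI)
    fix e :: real assume "e > 0"
    with assms(1) obtain B where B: "\<forall>n. B n \<in> sets M" "{\<omega> \<in> space M. \<not> P \<omega>} \<subseteq> (\<Union>n. B n)"
      "(\<Sum>n. V_hat M H E (B n)) \<le> ereal e"
      unfolding qs_def by auto
    show "\<exists>B. (\<forall>n. B n \<in> sets M) \<and> {\<omega> \<in> space M. \<not> Q \<omega>} \<subseteq> (\<Union>n. B n) \<and>
      (\<Sum>n. V_hat M H E (B n)) \<le> ereal e"
      by (intro exI[of _ B] conjI B subset_trans[OF sub])
  qed
qed

text \<open>Countable sub-additivity is built into the covers: those of size e / 2^(i + 1) for the
  single statements are merged along the pairing \<open>prod_decode\<close>.\<close>

lemma qs_all: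
  assumes "\<And>i::nat. qs (P i)"
  shows "qs (\<lambda>\<omega>. \<forall>i. P i \<omega>)"
  unfolding qs_def
proof (intro allI impI)
  fix e :: real assume e: "0 < e"
  have "\<exists>B. (\<forall>n. B n \<in> sets M) \<and> {\<omega> \<in> space M. \<not> P i \<omega>} \<subseteq> (\<Union>n. B n) \<and>
     (\<Sum>n. V_hat M H E (B n)) \<le> ereal (e * (1/2) ^ Suc i)" for i
  proof -
    have "e * (1/2) ^ Suc i > 0" using e by simp
    with assms[of i] show ?thesis unfolding qs_def by simp
  qed
  then have "\<exists>B. \<forall>i. (\<forall>n. B i n \<in> sets M) \<and> {\<omega> \<in> space M. \<not> P i \<omega>} \<subseteq> (\<Union>n. B i n) \<and>
     (\<Sum>n. V_hat M H E (B i n)) \<le> ereal (e * (1/2) ^ Suc i)"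
    by (intro choice allI)
  then obtain B where B: "\<And>i n. B i n \<in> sets M" "\<And>i. {\<omega> \<in> space M. \<not> P i \<omega>} \<subseteq> (\<Union>n. B i n)"
    "\<And>i. (\<Sum>n. V_hat M H E (B i n)) \<le> ereal (e * (1/2) ^ Suc i)" by auto
  define C where "C k = B (fst (prod_decode k)) (snd (prod_decode k))" for k
  show "\<exists>B. (\<forall>n. B n \<in> sets M) \<and> {\<omega> \<in> space M. \<not> (\<forall>i. P i \<omega>)} \<subseteq> (\<Union>n. B n) \<and>
     (\<Sum>n. V_hat M H E (B n)) \<le> ereal e"
  proof (intro exI[of _ C] conjI allI)
    show "C n \<in> sets M" for n using B(1) by (simp add: C_def)
    show "{\<omega> \<in> space M. \<not> (\<forall>i. P i \<omega>)} \<subseteq> (\<Union>n. C n)"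
    proof
      fix \<omega> assume "\<omega> \<in> {\<omega> \<in> space M. \<not> (\<forall>i. P i \<omega>)}"
      then obtain i where "\<omega> \<in> {\<omega> \<in> space M. \<not> P i \<omega>}" by auto
      then obtain n where "\<omega> \<in> B i n" using subsetD[OF B(2)] by auto
      then have "\<omega> \<in> C (prod_encode (i, n))" by (simp add: C_def)
      then show "\<omega> \<in> (\<Union>n. C n)" by blast
    qed
    show "(\<Sum>n. V_hat M H E (C n)) \<le> ereal e"
    proof (rule suminf_bound, intro allI)
      fix K
      let ?v = "\<lambda>p. V_hat M H E (B (fst p) (snd p))"
      \<comment> \<open>A finite set of pairs fits into a square, so partial sums along the pairing
        are bounded by iterated sums.\<close>
      define m where "m = Suc (Max (fst ` prod_decode ` {..<K} \<union> snd ` prod_decode ` {..<K} \<union> {0}))"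
      have sub: "prod_decode ` {..<K} \<subseteq> {..<m} \<times> {..<m}"
      proof
        fix p assume p: "p \<in> prod_decode ` {..<K}"
        then have "fst p < m" "snd p < m"
          unfolding m_def less_Suc_eq_le by (auto intro!: Max_ge)
        then show "p \<in> {..<m} \<times> {..<m}" by (simp add: mem_Times_iff)
      qed
      have "(\<Sum>n<K. V_hat M H E (C n)) = sum ?v (prod_decode ` {..<K})"
        unfolding C_def by (subst sum.reindex) (auto intro: inj_on_subset[OF inj_prod_decode])
      also have "\<dots> \<le> sum ?v ({..<m} \<times> {..<m})"
        by (rule sum_mono2[OF _ sub]) (auto intro: V_hat_nonneg)
      also have "\<dots> = (\<Sum>i<m. \<Sum>n<m. V_hat M H E (B i n))"
        by (simp add: sum.cartesian_product case_prod_beta)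
      also have "\<dots> \<le> (\<Sum>i<m. ereal (e * (1/2) ^ Suc i))"
        by (intro sum_mono order_trans[OF suminf_upper B(3)] V_hat_nonneg)
      also have "\<dots> \<le> (\<Sum>i. ereal (e * (1/2) ^ Suc i))"
        by (rule suminf_upper) (use e in auto)
      also have "\<dots> = ereal e"
        using sums_mult[OF power_half_series, of e] by (intro sums_unique[symmetric]) (simp only: sums_ereal mult_1_right)
      finally show "(\<Sum>n<K. V_hat M H E (C n)) \<le> ereal e" .
    qed (rule V_hat_nonneg)
  qed
qed

lemma qs_conj: "qs P \<Longrightarrow> qs Q \<Longrightarrow> qs (\<lambda>\<omega>. P \<omega> \<and> Q \<omega>)"
  by (rule qs_mono[OF qs_all[of "\<lambda>i. if i = 0 then P else Q"]]) (simp_all, metis zero_neq_one)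

text \<open>Every tail of the sequence covers the event that infinitely many \<open>B n\<close>
  occur, and its total capacity is a tail of a convergent series.\<close>

lemma qs_Borel_Cantelli:
  assumes B: "\<And>n. B n \<in> sets M" and r: "\<And>n. V_hat M H E (B n) \<le> ereal (r n)" and "summable r"
  shows "qs (\<lambda>\<omega>. \<forall>\<^sub>F n in sequentially. \<omega> \<notin> B n)"
  unfolding qs_def
proof (intro allI impI)
  fix e :: real assume "0 < e"
  have r0: "0 \<le> r n" for n using order_trans[OF V_hat_nonneg r[of n]] by simp
  obtain N where N: "norm (\<Sum>n. r (n + N)) < e"
    using suminf_exist_split[OF \<open>0 < e\<close> assms(3)] by blast
  show "\<exists>C. (\<forall>n. C n \<in> sets M) \<and> {\<omega> \<in> space M. \<not> (\<forall>\<^sub>F n in sequentially. \<omega> \<notin> B n)} \<subseteq> (\<Union>n. C n) \<and>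
     (\<Sum>n. V_hat M H E (C n)) \<le> ereal e"
  proof (intro exI[of _ "\<lambda>n. B (n + N)"] conjI allI B)
    show "{\<omega> \<in> space M. \<not> (\<forall>\<^sub>F n in sequentially. \<omega> \<notin> B n)} \<subseteq> (\<Union>n. B (n + N))"
    proof
      fix \<omega> assume "\<omega> \<in> {\<omega> \<in> space M. \<not> (\<forall>\<^sub>F n in sequentially. \<omega> \<notin> B n)}"
      then obtain n where "n \<ge> N" "\<omega> \<in> B n" by (auto simp: eventually_sequentially)
      then show "\<omega> \<in> (\<Union>n. B (n + N))" by (auto intro!: exI[of _ "n - N"])
    qed
    have "(\<Sum>n. V_hat M H E (B (n + N))) \<le> (\<Sum>n. ereal (r (n + N)))"
      by (intro suminf_le_pos r V_hat_nonneg)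
    also have "\<dots> = ereal (\<Sum>n. r (n + N))"
      using assms(3) by (intro suminf_ereal') (simp add: summable_iff_shift)
    also have "\<dots> \<le> ereal e" using N by simp
    finally show "(\<Sum>n. V_hat M H E (B (n + N))) \<le> ereal e" .
  qed
qed

text \<open>Functions above the indicators of the covering sets, optimal up to e / 2^(n + 1), form
  an admissible sequence for \<open>C_star\<close>; finite sub-additivity bounds their partial
  sums.\<close>

lemma C_star_le_V_hat_star: "C_star M H E A \<le> V_hat_star M H E A"
  unfolding V_hat_star_def
proof (rule Inf_greatest, clarify)
  fix B :: "nat \<Rightarrow> 'a set" assume B: "\<forall>n. B n \<in> sets M" "A \<subseteq> (\<Union>n. B n)"
  show "C_star M H E A \<le> (\<Sum>n. V_hat M H E (B n))"
  proof (rule ereal_le_epsilon2)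
    fix e :: real assume e: "0 < e"
    show "C_star M H E A \<le> (\<Sum>n. V_hat M H E (B n)) + ereal e"
    proof (cases "(\<Sum>n. V_hat M H E (B n)) = \<infinity>")
      case False
      have "\<exists>\<xi>. \<xi> \<in> H \<and> (\<forall>\<omega>\<in>space M. indicator (B n) \<omega> \<le> \<xi> \<omega>) \<and>
        E \<xi> \<le> V_hat M H E (B n) + ereal (e * (1/2) ^ Suc n)" for n
      proof (rule ccontr)
        assume *: "\<not> ?thesis"
        have "V_hat M H E (B n) + ereal (e * (1/2) ^ Suc n) \<le> V_hat M H E (B n)"
        proof (subst (2) V_hat_def, rule Inf_greatest, clarify)
          fix \<xi> assume "\<xi> \<in> H" "\<forall>\<omega>\<in>space M. indicat_real (B n) \<omega> \<le> \<xi> \<omega>"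
          with * have "\<not> E \<xi> \<le> V_hat M H E (B n) + ereal (e * (1/2) ^ Suc n)" by blast
          then show "V_hat M H E (B n) + ereal (e * (1/2) ^ Suc n) \<le> E \<xi>"
            by (simp only: not_le less_imp_le)
        qed
        moreover have "V_hat M H E (B n) \<le> (\<Sum>n. V_hat M H E (B n))"
          using sum_le_suminf[OF summable_ereal_pos, of "\<lambda>n. V_hat M H E (B n)" "{n}"] V_hat_nonneg by simp
        then have "V_hat M H E (B n) \<noteq> \<infinity>" using False by auto
        moreover have "e * (1/2) ^ Suc n > 0" using e by simp
        ultimately show False using V_hat_nonneg[of "B n"]
          by (cases "V_hat M H E (B n)") auto
      qed
      then have "\<exists>\<xi>. \<forall>n. \<xi> n \<in> H \<and> (\<forall>\<omega>\<in>space M. indicator (B n) \<omega> \<le> \<xi> n \<omega>) \<and>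
        E (\<xi> n) \<le> V_hat M H E (B n) + ereal (e * (1/2) ^ Suc n)"
        by (intro choice allI)
      then obtain \<xi> where \<xi>: "\<And>n. \<xi> n \<in> H" "\<And>n \<omega>. \<omega> \<in> space M \<Longrightarrow> indicator (B n) \<omega> \<le> \<xi> n \<omega>"
        "\<And>n. E (\<xi> n) \<le> V_hat M H E (B n) + ereal (e * (1/2) ^ Suc n)" by auto
      have pos: "0 \<le> \<xi> n \<omega>" if "\<omega> \<in> space M" for n \<omega>
        using \<xi>(2)[OF that, of n] by (rule order_trans[rotated]) simp
      define L where "L = (SUP n. E (\<lambda>\<omega>. \<Sum>i<n. \<xi> i \<omega>))"
      have Hs: "(\<lambda>\<omega>. \<Sum>i<n. \<xi> i \<omega>) \<in> H" for n by (rule H_sum) (rule \<xi>)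
      have "incseq (\<lambda>n. E (\<lambda>\<omega>. \<Sum>i<n. \<xi> i \<omega>))"
        by (rule incseq_SucI, rule E_mono[OF Hs Hs]) (simp add: pos)
      then have lim: "(\<lambda>n. E (\<lambda>\<omega>. \<Sum>i<n. \<xi> i \<omega>)) \<longlonglongrightarrow> L" unfolding L_def by (rule LIMSEQ_SUP)
      have cover: "(indicator A \<omega> :: ereal) \<le> (\<Sum>n. ereal (\<xi> n \<omega>))" if \<omega>: "\<omega> \<in> space M" for \<omega>
      proof (cases "\<omega> \<in> A")
        case True
        then obtain n where n: "\<omega> \<in> B n" using B(2) by auto
        have "(indicator A \<omega> :: ereal) \<le> ereal (\<xi> n \<omega>)" using \<xi>(2)[OF \<omega>, of n] n True by simp
        also have "\<dots> \<le> (\<Sum>n. ereal (\<xi> n \<omega>))"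
          using sum_le_suminf[OF summable_ereal_pos, of "\<lambda>n. ereal (\<xi> n \<omega>)" "{n}"] pos[OF \<omega>] by simp
        finally show ?thesis .
      next
        case False
        then show ?thesis by (simp add: suminf_nonneg summable_ereal_pos pos \<omega>)
      qed
      have "C_star M H E A \<le> L"
        unfolding C_star_def
      proof (rule Inf_lower, rule CollectI, rule exI[of _ \<xi>], intro conjI)
        show "\<forall>n. \<xi> n \<in> H \<and> (\<forall>\<omega>\<in>space M. 0 \<le> \<xi> n \<omega>)" using \<xi>(1) pos by simp
        show "\<forall>\<omega>\<in>space M. (indicator A \<omega> :: ereal) \<le> (\<Sum>n. ereal (\<xi> n \<omega>))" using cover by simp
      qed (rule lim)
      also have "L \<le> (\<Sum>n. V_hat M H E (B n)) + ereal e"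
        unfolding L_def
      proof (rule SUP_least)
        fix n
        have "E (\<lambda>\<omega>. \<Sum>i<n. \<xi> i \<omega>) \<le> (\<Sum>i<n. E (\<xi> i))"
        proof (induction n)
          case 0 show ?case using E_const[of 0] by simp
        next
          case (Suc n)
          have p: "0 \<le> E (\<lambda>\<omega>. \<Sum>i<n. \<xi> i \<omega>)" by (rule E_nonneg[OF Hs]) (simp add: sum_nonneg pos)
          have p': "0 \<le> E (\<xi> n)" by (rule E_nonneg[OF \<xi>(1) pos])
          have "E (\<lambda>\<omega>. (\<Sum>i<n. \<xi> i \<omega>) + \<xi> n \<omega>) \<le> E (\<lambda>\<omega>. \<Sum>i<n. \<xi> i \<omega>) + E (\<xi> n)"
            using p p' by (intro E_subadd[OF Hs \<xi>(1)]) auto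
          also have "\<dots> \<le> (\<Sum>i<n. E (\<xi> i)) + E (\<xi> n)" using Suc by (intro add_mono) auto
          finally show ?case by simp
        qed
        also have "\<dots> \<le> (\<Sum>i<n. V_hat M H E (B i) + ereal (e * (1/2) ^ Suc i))"
          by (intro sum_mono \<xi>)
        also have "\<dots> = (\<Sum>i<n. V_hat M H E (B i)) + (\<Sum>i<n. ereal (e * (1/2) ^ Suc i))"
          by (rule sum.distrib)
        also have "\<dots> \<le> (\<Sum>i. V_hat M H E (B i)) + (\<Sum>i. ereal (e * (1/2) ^ Suc i))"
          using e by (intro add_mono suminf_upper V_hat_nonneg) auto
        also have "(\<Sum>i. ereal (e * (1/2) ^ Suc i)) = ereal e"
          using sums_mult[OF power_half_series, of e]
          by (intro sums_unique[symmetric]) (simp only: sums_ereal mult_1_right)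
        finally show "E (\<lambda>\<omega>. \<Sum>i<n. \<xi> i \<omega>) \<le> (\<Sum>n. V_hat M H E (B n)) + ereal e" .
      qed
      finally show ?thesis .
    next
      case True
      then show ?thesis by simp
    qed
  qed
qed

lemma C_star_nonneg: "0 \<le> C_star M H E A"
  unfolding C_star_def
proof (rule Inf_greatest, clarify)
  fix L g
  assume g: "\<forall>n. g n \<in> H \<and> (\<forall>\<omega>\<in>space M. 0 \<le> g n \<omega>)" and L: "(\<lambda>n. E (\<lambda>\<omega>. \<Sum>i<n. g i \<omega>)) \<longlonglongrightarrow> L"
  have "0 \<le> E (\<lambda>\<omega>. \<Sum>i<n. g i \<omega>)" for n
    using g by (intro E_nonneg H_sum sum_nonneg) auto
  then show "0 \<le> L" by (intro tendsto_lowerbound[OF L]) auto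
qed

lemma V_hat_star_le_1: "V_hat_star M H E A \<le> 1" if "A \<subseteq> space M"
proof -
  let ?B = "\<lambda>n::nat. if n = 0 then space M else {}"
  have v: "V_hat M H E (?B n) \<le> ereal (if n = 0 then 1 else 0)" for n
    using V_hat_le[OF L1_const[of "if n = 0 then 1 else 0"], of "?B n"] by (auto split: if_splits)
  have "V_hat_star M H E A \<le> (\<Sum>n. V_hat M H E (?B n))"
    unfolding V_hat_star_def by (rule Inf_lower) (use that in \<open>auto intro!: exI[of _ ?B]\<close>)
  also have "\<dots> \<le> (\<Sum>n. ereal (if n = 0 then 1 else 0))"
    by (intro suminf_le_pos V_hat_nonneg v)
  also have "\<dots> = ereal 1"
    by (rule sums_unique[symmetric]) (simp only: sums_ereal, rule sums_single)
  finally show ?thesis by (simp add: one_ereal_def)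
qed

end

section \<open>Exponential bounds for truncated sums\<close>

text \<open>Taylor's formula of second order. On good blocks the argument is at most 4 * \<alpha> in
  absolute value, so the exponential correction is close to 1.\<close>

lemma exp_quadratic_upper: "exp u \<le> 1 + u + u\<^sup>2 / 2 * exp \<bar>u\<bar>" for u :: real
proof -
  obtain t where t: "\<bar>t\<bar> \<le> \<bar>u\<bar>" "exp u = (\<Sum>m<2. u ^ m / fact m) + exp t / fact 2 * u ^ 2"
    using Maclaurin_exp_le[of u 2] by blast
  have "exp t * u\<^sup>2 \<le> exp \<bar>u\<bar> * u\<^sup>2" using t(1) by (intro mult_right_mono) auto
  with t(2) show ?thesis by (simp add: eval_nat_numeral field_simps)
qed

lemma exp_quadratic_lower: "1 + u + u\<^sup>2 / 2 * exp (- \<bar>u\<bar>) \<le> exp u" for u :: real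
proof -
  obtain t where t: "\<bar>t\<bar> \<le> \<bar>u\<bar>" "exp u = (\<Sum>m<2. u ^ m / fact m) + exp t / fact 2 * u ^ 2"
    using Maclaurin_exp_le[of u 2] by blast
  have "exp (- \<bar>u\<bar>) * u\<^sup>2 \<le> exp t * u\<^sup>2" using t(1) by (intro mult_right_mono) auto
  with t(2) show ?thesis by (simp add: eval_nat_numeral field_simps)
qed

section \<open>Truncation and powers of excesses\<close>

definition clip :: "real \<Rightarrow> real \<Rightarrow> real" where
  "clip y u = max (- y) (min y u)"

lemma clip_lip: "\<bar>clip y u - clip y v\<bar> \<le> \<bar>u - v\<bar>"
  unfolding clip_def by (simp add: max_def min_def abs_if split: if_splits)

lemma clip_bound: "0 \<le> y \<Longrightarrow> \<bar>clip y u\<bar> \<le> y"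
  unfolding clip_def by (simp add: max_def min_def abs_if split: if_splits)

lemma clip_abs_le: "0 \<le> y \<Longrightarrow> \<bar>clip y u\<bar> \<le> \<bar>u\<bar>"
  unfolding clip_def by (simp add: max_def min_def abs_if split: if_splits)

lemma clip_excess: "0 \<le> y \<Longrightarrow> \<bar>u - clip y u\<bar> = max (\<bar>u\<bar> - y) 0"
  unfolding clip_def by (simp add: max_def min_def abs_if split: if_splits)

lemma clip_square_le: "0 \<le> y \<Longrightarrow> (clip y u)\<^sup>2 \<le> u\<^sup>2"
  using clip_abs_le[of y u] by (simp add: abs_le_square_iff)

lemma powr_diff_le:
  fixes x y r :: real
  assumes "0 \<le> x" "x \<le> y" "1 \<le> r"
  shows "y powr r - x powr r \<le> r * y powr (r - 1) * (y - x)"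
proof (cases "x = y")
  case False
  then have lt: "x < y" using assms by simp
  have "\<exists>l z. x < z \<and> z < y \<and> DERIV (\<lambda>x. x powr r) z :> l \<and> y powr r - x powr r = (y - x) * l"
  proof (rule MVT[OF lt])
    show "continuous_on {x..y} (\<lambda>x. x powr r)"
      using assms by (intro continuous_on_powr' continuous_on_id continuous_on_const) auto
    show "(\<lambda>x. x powr r) differentiable at z" if "x < z" "z < y" for z
      using has_real_derivative_powr[of z r] that assms(1) real_differentiable_def by fastforce
  qed
  then obtain l z where z: "x < z" "z < y" "DERIV (\<lambda>x. x powr r) z :> l"
    "y powr r - x powr r = (y - x) * l" by blast
  have "l = r * z powr (r - 1)"
    by (rule DERIV_unique[OF z(3)]) (use z(1) assms(1) in \<open>auto intro: has_real_derivative_powr\<close>)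
  also have "\<dots> \<le> r * y powr (r - 1)"
    using z assms by (intro mult_left_mono powr_mono2) auto
  finally show ?thesis using z(4) lt by (simp add: mult.commute mult_left_mono)
qed simp

text \<open>\<open>C_lLip\<close> only knows natural exponents; rounding p up gives polynomial
  growth, by the mean value bound \<open>powr_diff_le\<close>. This puts the integrands of condition
  (ii) into \<open>H\<close>.\<close>

lemma powr_growth:
  fixes a b p :: real
  assumes "0 \<le> a" "0 \<le> b" "1 \<le> p"
  shows "\<bar>a powr p - b powr p\<bar> \<le> p * (1 + a ^ nat \<lceil>p\<rceil> + b ^ nat \<lceil>p\<rceil>) * \<bar>a - b\<bar>"
  using assms(1,2)
proof (induction a b rule: linorder_wlog)
  case (le a b)
  have "b powr (p - 1) \<le> 1 + b ^ nat \<lceil>p\<rceil>"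
  proof (cases "b \<le> 1")
    case True
    then have "b powr (p - 1) \<le> 1" using le assms by (intro powr_le1) auto
    then show ?thesis using le by (simp add: add_increasing2)
  next
    case False
    have "b powr (p - 1) \<le> b powr (real (nat \<lceil>p\<rceil>))"
      using False assms by (intro powr_mono) linarith+
    also have "\<dots> = b ^ nat \<lceil>p\<rceil>" using False by (intro powr_realpow) simp
    finally show ?thesis by simp
  qed
  then have "b powr (p - 1) \<le> 1 + a ^ nat \<lceil>p\<rceil> + b ^ nat \<lceil>p\<rceil>"
    using zero_le_power[OF le(2), of "nat \<lceil>p\<rceil>"] by linarith
  then have "p * b powr (p - 1) * (b - a) \<le> p * (1 + a ^ nat \<lceil>p\<rceil> + b ^ nat \<lceil>p\<rceil>) * (b - a)"
    using le assms by (intro mult_right_mono mult_left_mono) auto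
  moreover have "b powr p - a powr p \<le> p * b powr (p - 1) * (b - a)"
    by (rule powr_diff_le) (use le assms in auto)
  moreover have "a powr p \<le> b powr p" using le assms by (intro powr_mono2) auto
  then have "\<bar>a powr p - b powr p\<bar> = b powr p - a powr p" "\<bar>a - b\<bar> = b - a" using le by auto
  ultimately show ?case by simp
next
  case (sym a b)
  then show ?case by (simp add: abs_minus_commute add.commute add.left_commute)
qed

context sublinear_expectation_space
begin

lemma L1_lip_comp:
  assumes "F \<in> L1" "\<And>u v. \<bar>g u - g v\<bar> \<le> C * \<bar>u - v :: real\<bar>"
  shows "(\<lambda>\<omega>. g (F \<omega>)) \<in> L1"
proof (rule L1_dom)
  show "(\<lambda>\<omega>. g (F \<omega>)) \<in> H" by (rule H_lip_comp[OF L1_H[OF assms(1)] assms(2)])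
  show "(\<lambda>\<omega>. \<bar>g 0\<bar> + C * \<bar>F \<omega>\<bar>) \<in> L1"
    by (rule L1_add[OF L1_const L1_cmult[OF L1_abs[OF assms(1)]]])
  show "\<bar>g (F \<omega>)\<bar> \<le> \<bar>g 0\<bar> + C * \<bar>F \<omega>\<bar>" for \<omega>
    using assms(2)[of "F \<omega>" 0] by simp
qed

lemma H_excess_powr:
  assumes "F \<in> H" "0 \<le> h" "1 \<le> p"
  shows "(\<lambda>\<omega>. max (\<bar>F \<omega>\<bar> - h) 0 powr p) \<in> H"
proof (rule H_poly_comp[OF assms(1)])
  fix u v :: real
  let ?m = "nat \<lceil>p\<rceil>"
  let ?a = "max (\<bar>u\<bar> - h) 0" and ?b = "max (\<bar>v\<bar> - h) 0"
  have "\<bar>?a powr p - ?b powr p\<bar> \<le> p * (1 + ?a ^ ?m + ?b ^ ?m) * \<bar>?a - ?b\<bar>"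
    by (rule powr_growth) (use assms in auto)
  also have "\<dots> \<le> p * (1 + \<bar>u\<bar> ^ ?m + \<bar>v\<bar> ^ ?m) * \<bar>u - v\<bar>"
    using assms by (intro mult_mono mult_left_mono add_mono power_mono) auto
  finally show "\<bar>?a powr p - ?b powr p\<bar> \<le> p * (1 + \<bar>u\<bar> ^ ?m + \<bar>v\<bar> ^ ?m) * \<bar>u - v\<bar>" .
qed

end

context indep_sequence
begin

text \<open>The crossing of the level \<open>y\<close> is detected by the continuous weights \<open>h (S k)\<close>; stopping the
  supermartingale \<open>exp S\<close> with them costs a factor of at most \<open>e\<close>.\<close>

lemma maximal_inequality:
  assumes z: "\<And>j. j \<in> {1..N} \<Longrightarrow> cyl {j} (\<lambda>x. z j (x j))"
    and b: "\<And>j. j \<in> {1..N} \<Longrightarrow> 0 \<le> b j"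
    and zb: "\<And>j. j \<in> {1..N} \<Longrightarrow> rE (\<lambda>\<omega>. exp (z j (X j \<omega>))) \<le> exp (b j)"
  shows "V_hat M H E {\<omega> \<in> space M. \<exists>m\<in>{1..N}. y \<le> (\<Sum>j=1..m. z j (X j \<omega>))}
    \<le> ereal (exp (1 - y + (\<Sum>j=1..N. b j)))"
proof -
  define S where "S m x = (\<Sum>j=1..m. z j (x j))" for m and x :: "nat \<Rightarrow> real"
  \<comment> \<open>A ramp from 0 at y - 1 to 1 at y. Where it is positive,
    \<open>exp (S - (y - 1))\<close> is at least 1; the unit gap is the factor e in the
    bound.\<close>
  define h where "h u = max 0 (min 1 (u - (y - 1)))" for u :: real
  define D where "D m x = (\<Prod>k=1..m. 1 - h (S k x))" for m and x :: "nat \<Rightarrow> real"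
  define C where "C m = exp (\<Sum>j\<in>{m<..N}. b j)" for m
  \<comment> \<open>Weight stopped so far, plus the running exponential on the weight not yet
    stopped, compensated by \<open>C m\<close> for the steps to come. The expectation decreases from
    the claimed bound at m = 0, and at m = N it dominates that of \<open>1 - D N\<close>.\<close>
  define Z where "Z m x = (1 - D m x) + (D m x * exp (S m x - (y - 1))) * C m" for m x
  have h01: "0 \<le> h u" "h u \<le> 1" for u by (auto simp: h_def)
  have D01: "0 \<le> D m x" "D m x \<le> 1" for m x
    unfolding D_def using h01 by (auto intro!: prod_nonneg prod_le_1)
  have cS: "cyl {1..m} (S m)" if "m \<le> N" for m
    unfolding S_def
  proof (rule cyl_sum)
    fix j assume "j \<in> {1..m}"
    then show "cyl {1..m} (\<lambda>x. z j (x j))" using that by (intro cyl_mono[OF z]) auto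
  qed simp
  have cD: "cyl {1..m} (D m)" if "m \<le> N" for m
    unfolding D_def
  proof (rule cyl_prod)
    fix k assume k: "k \<in> {1..m}"
    have "cyl {1..m} (S k)" using k that by (intro cyl_mono[OF cS]) auto
    then have "cyl {1..m} (\<lambda>x. h (S k x))"
      by (rule cyl_lip[where C=1]) (simp add: h_def max_def min_def abs_if)
    then show "cyl {1..m} (\<lambda>x. 1 - h (S k x))" by (intro cyl_diff cyl_const) auto
  qed simp
  have cB: "cyl {1..m} (\<lambda>x. (D m x * exp (S m x - (y - 1))) * c)" if "m \<le> N" for m c
    by (intro cyl_mult cyl_const cyl_exp cyl_diff cD cS that) auto
  have cA: "cyl {1..m} (\<lambda>x. 1 - D m x)" if "m \<le> N" for m
    by (intro cyl_diff cyl_const cD that) auto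
  have cZ: "cyl {1..m} (Z m)" if "m \<le> N" for m
    unfolding Z_def by (intro cyl_add cA cB that)
  have step: "Ex (Z (Suc m)) \<le> Ex (Z m)" if m: "Suc m \<le> N" for m
  proof -
    let ?j = "Suc m"
    have mN: "m \<le> N" and jN: "?j \<in> {1..N}" using m by auto
    have cpsi: "cyl {m<..?j} (\<lambda>x. exp (z ?j (x ?j)))"
      by (intro cyl_exp cyl_mono[OF z[OF jN]]) auto
    have C1: "1 \<le> C ?j" unfolding C_def using m b by (auto intro!: sum_nonneg)
    have "{m<..N} = insert ?j {?j<..N}" using m by auto
    then have CC: "C m = exp (b ?j) * C ?j" unfolding C_def by (simp add: exp_add)
    have le: "Z ?j x \<le> (1 - D m x) + (D m x * exp (S m x - (y - 1))) * C ?j * exp (z ?j (x ?j))" for x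
    proof -
      let ?e = "exp (S ?j x - (y - 1))" and ?h = "h (S ?j x)"
      have D: "D ?j x = D m x * (1 - ?h)" by (simp add: D_def)
      have e: "?e = exp (S m x - (y - 1)) * exp (z ?j (x ?j))"
        by (simp add: S_def exp_add[symmetric])
      \<comment> \<open>Replacing the weight stopped now by its share of the exponential only
        increases \<open>Z\<close>.\<close>
      have "?h \<le> ?h * (?e * C ?j)"
      proof (cases "S ?j x \<le> y - 1")
        case True
        then have "?h = 0" by (simp add: h_def)
        then show ?thesis by simp
      next
        case False
        then have "1 \<le> ?e * C ?j" using mult_mono[of 1 ?e 1 "C ?j"] C1 by simp
        then show ?thesis using mult_left_mono[OF _ h01(1), of 1 "?e * C ?j"] by simp
      qed
      then have hD: "D m x * ?h \<le> D m x * (?h * (?e * C ?j))" using D01(1) by (intro mult_left_mono)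
      have gen: "(1 - d * (1 - k)) + (d * (1 - k) * w) * c \<le> (1 - d) + d * (w * c)"
        if "d * k \<le> d * (k * (w * c))" for d k w c :: real
        using that by (simp add: algebra_simps)
      have "(D m x * exp (S m x - (y - 1))) * C ?j * exp (z ?j (x ?j)) = D m x * (?e * C ?j)"
        unfolding e by (simp only: mult_ac)
      then show ?thesis unfolding Z_def D by (simp only: gen[OF hD])
    qed
    have "Ex (Z ?j) \<le> Ex (\<lambda>x. (1 - D m x) + (D m x * exp (S m x - (y - 1))) * C ?j * exp (z ?j (x ?j)))"
    proof (rule Ex_mono[OF cZ[OF m] _ _ _ le])
      show "cyl {1..?j} (\<lambda>x. (1 - D m x) + (D m x * exp (S m x - (y - 1))) * C ?j * exp (z ?j (x ?j)))"
        by (intro cyl_add cyl_mult[of _ _ "\<lambda>x. exp (z ?j (x ?j))"] cyl_mono[OF cA[OF mN]]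
            cyl_mono[OF cB[OF mN]] cyl_mono[OF cpsi]) auto
    qed auto
    also have "\<dots> = Ex (\<lambda>x. (1 - D m x) + (D m x * exp (S m x - (y - 1))) * C ?j * Ex (\<lambda>x. exp (z ?j (x ?j))))"
      by (rule Ex_block[OF cA[OF mN] cB[OF mN] _ _ cpsi]) (use D01 C1 in auto)
    also have "\<dots> \<le> Ex (Z m)"
    proof (rule Ex_mono)
      show "cyl {1..m} (\<lambda>x. (1 - D m x) + (D m x * exp (S m x - (y - 1))) * C ?j * Ex (\<lambda>x. exp (z ?j (x ?j))))"
        by (intro cyl_add cyl_mult[of _ _ "\<lambda>x. Ex (\<lambda>x. exp (z ?j (x ?j)))"] cA cB mN cyl_const) auto
      show "cyl {1..m} (Z m)" by (rule cZ[OF mN])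
      fix x
      have "Ex (\<lambda>x. exp (z ?j (x ?j))) \<le> exp (b ?j)"
        using zb[OF jN] by (simp add: Ex_def path_def)
      then have "(D m x * exp (S m x - (y - 1))) * C ?j * Ex (\<lambda>x. exp (z ?j (x ?j)))
          \<le> (D m x * exp (S m x - (y - 1))) * C ?j * exp (b ?j)"
        using D01 C1 by (intro mult_left_mono mult_nonneg_nonneg) auto
      then show "(1 - D m x) + (D m x * exp (S m x - (y - 1))) * C ?j * Ex (\<lambda>x. exp (z ?j (x ?j))) \<le> Z m x"
        unfolding Z_def CC by (simp add: mult_ac)
    qed auto
    finally show ?thesis .
  qed
  have "Ex (Z m) \<le> Ex (Z 0)" if "m \<le> N" for m
    using that
  proof (induction m)
    case (Suc m)
    then show ?case using step[of m] by simp
  qed simp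
  moreover have "Z 0 x = exp (1 - y + (\<Sum>j=1..N. b j))" for x
  proof -
    have "{0<..N} = {1..N}" by auto
    then show ?thesis by (simp add: Z_def D_def S_def C_def exp_add[symmetric] add.commute)
  qed
  then have "Z 0 = (\<lambda>x. exp (1 - y + (\<Sum>j=1..N. b j)))" by (rule ext)
  then have "Ex (Z 0) = exp (1 - y + (\<Sum>j=1..N. b j))" by (simp only: Ex_const)
  ultimately have ZN: "Ex (Z N) \<le> exp (1 - y + (\<Sum>j=1..N. b j))" using order_refl[of N] by simp
  have "Ex (\<lambda>x. 1 - D N x) \<le> Ex (Z N)"
    by (rule Ex_mono[OF cA cZ]) (auto simp: Z_def C_def D01)
  with ZN have "rE (\<lambda>\<omega>. 1 - D N (path \<omega>)) \<le> exp (1 - y + (\<Sum>j=1..N. b j))"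
    by (simp add: Ex_def)
  moreover have "V_hat M H E {\<omega> \<in> space M. \<exists>m\<in>{1..N}. y \<le> (\<Sum>j=1..m. z j (X j \<omega>))}
    \<le> ereal (rE (\<lambda>\<omega>. 1 - D N (path \<omega>)))"
  proof (rule V_hat_le)
    show "(\<lambda>\<omega>. 1 - D N (path \<omega>)) \<in> L1" by (rule cyl_L1[OF cA]) auto
    fix \<omega>
    show "indicator {\<omega> \<in> space M. \<exists>m\<in>{1..N}. y \<le> (\<Sum>j=1..m. z j (X j \<omega>))} \<omega> \<le> 1 - D N (path \<omega>)"
    proof (cases "\<exists>m\<in>{1..N}. y \<le> S m (path \<omega>)")
      case True
      then obtain m where m: "m \<in> {1..N}" "h (S m (path \<omega>)) = 1" by (auto simp: h_def)
      then have "\<exists>m\<in>{1..N}. 1 - h (S m (path \<omega>)) = 0" by (intro bexI[of _ m]) auto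
      then have "D N (path \<omega>) = 0" unfolding D_def by simp
      then show ?thesis by (simp add: indicator_def)
    next
      case False
      then show ?thesis using D01(2)[of N "path \<omega>"] by (simp add: indicator_def S_def path_def)
    qed
  qed
  ultimately show ?thesis using order_trans ereal_less_eq(3) by blast
qed

text \<open>Steps up to n0 are replaced by 0: condition (ii) can be void at early indices with
  \<open>a n = 0\<close>, where the excess moments may be infinite.\<close>

lemma maximal_inequality_from:
  assumes z: "\<And>j. j \<in> {n0<..N} \<Longrightarrow> cyl {j} (\<lambda>x. z j (x j))"
    and b: "\<And>j. j \<in> {n0<..N} \<Longrightarrow> 0 \<le> b j"
    and zb: "\<And>j. j \<in> {n0<..N} \<Longrightarrow> rE (\<lambda>\<omega>. exp (z j (X j \<omega>))) \<le> exp (b j)"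
  shows "V_hat M H E {\<omega> \<in> space M. \<exists>m\<in>{1..N}. y \<le> (\<Sum>j\<in>{n0<..m}. z j (X j \<omega>))}
    \<le> ereal (exp (1 - y + (\<Sum>j\<in>{n0<..N}. b j)))"
proof -
  define z' where "z' j = (if j \<le> n0 then (\<lambda>u. 0) else z j)" for j
  define b' where "b' j = (if j \<le> n0 then 0 else b j)" for j
  have "V_hat M H E {\<omega> \<in> space M. \<exists>m\<in>{1..N}. y \<le> (\<Sum>j=1..m. z' j (X j \<omega>))}
    \<le> ereal (exp (1 - y + (\<Sum>j=1..N. b' j)))"
  proof (rule maximal_inequality)
    fix j assume j: "j \<in> {1..N}"
    show "cyl {j} (\<lambda>x. z' j (x j))"
      using z[of j] j by (cases "j \<le> n0") (simp_all add: z'_def cyl_const)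
    show "0 \<le> b' j" using b[of j] j by (simp add: b'_def)
    show "rE (\<lambda>\<omega>. exp (z' j (X j \<omega>))) \<le> exp (b' j)"
      using zb[of j] j by (cases "j \<le> n0") (simp_all add: z'_def b'_def)
  qed
  moreover have "(\<Sum>j=1..m. z' j (X j \<omega>)) = (\<Sum>j\<in>{n0<..m}. z j (X j \<omega>))" for m \<omega>
    unfolding z'_def by (rule sum.mono_neutral_cong_right) auto
  moreover have "(\<Sum>j=1..N. b' j) = (\<Sum>j\<in>{n0<..N}. b j)"
    unfolding b'_def by (rule sum.mono_neutral_cong_right) auto
  ultimately show ?thesis by (simp only:)
qed

end

section \<open>Exponential moments of truncated variables\<close>

locale L2_sequence = indep_sequence M H E X
  for M :: "'a measure" and H E X +
  assumes square_finite: "n \<ge> 1 \<Longrightarrow> E (\<lambda>\<omega>. (X n \<omega>)\<^sup>2) < \<infinity>"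
begin

definition q :: "nat \<Rightarrow> real" where
  "q j = rE (\<lambda>\<omega>. (X j \<omega>)\<^sup>2)"

text \<open>The summand of condition (iv); it bounds \<open>rE (\<sigma> * X j)\<close> for both
  signs \<sigma>.\<close>

definition mb :: "nat \<Rightarrow> real" where
  "mb j = \<bar>rE (X j)\<bar> + \<bar>rE (\<lambda>\<omega>. - X j \<omega>)\<bar>"

definition exc :: "real \<Rightarrow> nat \<Rightarrow> real" where
  "exc y j = rE (\<lambda>\<omega>. max (\<bar>X j \<omega>\<bar> - y) 0)"

definition trunc_moment :: "real \<Rightarrow> real \<Rightarrow> nat \<Rightarrow> real" where
  "trunc_moment p h j = rE (\<lambda>\<omega>. max (\<bar>X j \<omega>\<bar> - h) 0 powr p)"

lemma X_square_L1: "n \<ge> 1 \<Longrightarrow> (\<lambda>\<omega>. (X n \<omega>)\<^sup>2) \<in> L1"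
  unfolding L1_def using square_finite[of n] H_square[OF X_H[of n]] by simp

lemma X_L1: "n \<ge> 1 \<Longrightarrow> X n \<in> L1"
proof (rule L1_dom[OF X_H L1_add[OF L1_const[of 1] X_square_L1]])
  fix \<omega>
  have "0 \<le> (\<bar>X n \<omega>\<bar> - 1)\<^sup>2" by simp
  then show "\<bar>X n \<omega>\<bar> \<le> 1 + (X n \<omega>)\<^sup>2" by (simp add: power2_eq_square algebra_simps)
qed

lemma sX_L1: "n \<ge> 1 \<Longrightarrow> (\<lambda>\<omega>. \<sigma> * X n \<omega>) \<in> L1"
  by (rule L1_cmult[OF X_L1])

lemma X_lip_L1:
  assumes "j \<ge> 1" "\<And>u v. \<bar>g u - g v\<bar> \<le> C * \<bar>u - v :: real\<bar>"
  shows "(\<lambda>\<omega>. g (X j \<omega>)) \<in> L1"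
  by (rule L1_lip_comp[OF X_L1[OF assms(1)] assms(2)])

lemma q_nonneg: "j \<ge> 1 \<Longrightarrow> 0 \<le> q j"
  unfolding q_def by (rule rE_ge[OF X_square_L1]) auto

lemma mb_nonneg: "0 \<le> mb j"
  by (simp add: mb_def)

lemma excess_L1: "j \<ge> 1 \<Longrightarrow> (\<lambda>\<omega>. max (\<bar>X j \<omega>\<bar> - y) 0) \<in> L1"
  by (rule X_lip_L1[where C=1]) (auto simp: max_def)

lemma exc_nonneg: "j \<ge> 1 \<Longrightarrow> 0 \<le> exc y j"
  unfolding exc_def by (rule rE_ge[OF excess_L1]) auto

text \<open>Chebyshev: u^2 / y exceeds the absolute value of u beyond y. Used on the bad blocks,
  where the moments of order p give no control.\<close>

lemma exc_le:
  assumes "j \<ge> 1" "0 < y"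
  shows "exc y j \<le> q j / y"
proof -
  have "rE (\<lambda>\<omega>. max (\<bar>X j \<omega>\<bar> - y) 0) \<le> rE (\<lambda>\<omega>. (1 / y) * (X j \<omega>)\<^sup>2)"
  proof (rule rE_mono[OF excess_L1 L1_cmult[OF X_square_L1]])
    fix \<omega>
    have "max (\<bar>u\<bar> - y) 0 \<le> (1 / y) * u\<^sup>2" for u
    proof (cases "\<bar>u\<bar> \<le> y")
      case False
      then have "\<bar>u\<bar> * y \<le> \<bar>u\<bar> * \<bar>u\<bar>" by (intro mult_left_mono) auto
      then have "\<bar>u\<bar> \<le> (1 / y) * u\<^sup>2" using assms(2) by (simp add: field_simps power2_eq_square)
      then show ?thesis using assms(2) False by simp
    qed (use assms in simp)
    then show "max (\<bar>X j \<omega>\<bar> - y) 0 \<le> (1 / y) * (X j \<omega>)\<^sup>2" .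
  qed (use assms in auto)
  also have "\<dots> = (1 / y) * rE (\<lambda>\<omega>. (X j \<omega>)\<^sup>2)" by (rule rE_cmult[OF X_square_L1]) (use assms in auto)
  finally show ?thesis by (simp add: exc_def q_def)
qed

lemma rE_sX_le: "j \<ge> 1 \<Longrightarrow> \<sigma> = 1 \<or> \<sigma> = -1 \<Longrightarrow> rE (\<lambda>\<omega>. \<sigma> * X j \<omega>) \<le> mb j"
  by (auto simp: mb_def)

lemma cyl_clip:
  assumes "0 \<le> y" "\<sigma> = 1 \<or> \<sigma> = -1"
  shows "cyl {j} (\<lambda>x. clip y (\<sigma> * x j))"
proof (rule cyl_coord[where B=y and C=1])
  fix u v :: real
  show "\<bar>clip y (\<sigma> * u) - clip y (\<sigma> * v)\<bar> \<le> 1 * \<bar>u - v\<bar>"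
    using assms(2) clip_lip[of y "\<sigma> * u" "\<sigma> * v"] by auto
qed (use clip_bound assms in auto)

lemma exp_clip_L1:
  assumes "j \<ge> 1" "0 \<le> y" "\<sigma> = 1 \<or> \<sigma> = -1"
  shows "(\<lambda>\<omega>. exp (l * clip y (\<sigma> * X j \<omega>))) \<in> L1"
  using cyl_L1[OF cyl_exp[OF cyl_cmult[OF cyl_clip[OF assms(2,3)]]], of j l] assms(1)
  by (simp add: path_def)

text \<open>Second-order expansion, then 1 + x \<le> exp x. Means need not vanish and truncation
  shifts them: \<open>clip\<close> deviates from its argument by the excess only, so the linear term
  costs \<open>l * (mb j + exc y j)\<close>.\<close>

lemma mgf_upper:
  assumes j: "j \<ge> 1" and y: "0 \<le> y" and l: "0 \<le> l" and \<sigma>: "\<sigma> = 1 \<or> \<sigma> = -1"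
  shows "rE (\<lambda>\<omega>. exp (l * clip y (\<sigma> * X j \<omega>)))
    \<le> exp (l * (mb j + exc y j) + l\<^sup>2 / 2 * exp (l * y) * q j)"
proof -
  let ?K = "l\<^sup>2 / 2 * exp (l * y)"
  have le: "exp (l * clip y (\<sigma> * u)) \<le> 1 + (l * (\<sigma> * u + max (\<bar>u\<bar> - y) 0) + ?K * u\<^sup>2)" for u
  proof -
    have "(\<sigma> * u)\<^sup>2 = u\<^sup>2" using \<sigma> by auto
    then have a: "\<bar>clip y (\<sigma> * u)\<bar> \<le> y" "(clip y (\<sigma> * u))\<^sup>2 \<le> u\<^sup>2"
      using clip_bound[OF y, of "\<sigma> * u"] clip_square_le[OF y, of "\<sigma> * u"] by auto
    have a3: "clip y (\<sigma> * u) \<le> \<sigma> * u + max (\<bar>u\<bar> - y) 0"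
      using clip_excess[OF y, of "\<sigma> * u"] \<sigma> by (auto simp: abs_if split: if_splits)
    have "exp (l * clip y (\<sigma> * u))
        \<le> 1 + l * clip y (\<sigma> * u) + (l * clip y (\<sigma> * u))\<^sup>2 / 2 * exp \<bar>l * clip y (\<sigma> * u)\<bar>"
      by (rule exp_quadratic_upper)
    moreover have "l * clip y (\<sigma> * u) \<le> l * (\<sigma> * u + max (\<bar>u\<bar> - y) 0)"
      using a3 l by (intro mult_left_mono)
    moreover have "(l * clip y (\<sigma> * u))\<^sup>2 / 2 * exp \<bar>l * clip y (\<sigma> * u)\<bar> \<le> (l\<^sup>2 * u\<^sup>2) / 2 * exp (l * y)"
      unfolding power_mult_distrib using a l
      by (intro mult_mono divide_right_mono mult_left_mono) (auto simp: abs_mult mult_left_mono)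
    ultimately show ?thesis by (simp add: mult_ac)
  qed
  have L: "(\<lambda>\<omega>. \<sigma> * X j \<omega> + max (\<bar>X j \<omega>\<bar> - y) 0) \<in> L1" "(\<lambda>\<omega>. ?K * (X j \<omega>)\<^sup>2) \<in> L1"
    by (intro L1_add sX_L1 excess_L1 L1_cmult X_square_L1 j)+
  have "rE (\<lambda>\<omega>. exp (l * clip y (\<sigma> * X j \<omega>)))
      \<le> rE (\<lambda>\<omega>. 1 + (l * (\<sigma> * X j \<omega> + max (\<bar>X j \<omega>\<bar> - y) 0) + ?K * (X j \<omega>)\<^sup>2))"
    by (rule rE_mono[OF exp_clip_L1[OF j y \<sigma>] L1_add[OF L1_const L1_add[OF L1_cmult[OF L(1)] L(2)]] le])
  also have "\<dots> = 1 + rE (\<lambda>\<omega>. l * (\<sigma> * X j \<omega> + max (\<bar>X j \<omega>\<bar> - y) 0) + ?K * (X j \<omega>)\<^sup>2)"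
    by (rule rE_add_const[OF L1_add[OF L1_cmult[OF L(1)] L(2)]])
  also have "rE (\<lambda>\<omega>. l * (\<sigma> * X j \<omega> + max (\<bar>X j \<omega>\<bar> - y) 0) + ?K * (X j \<omega>)\<^sup>2)
      \<le> rE (\<lambda>\<omega>. l * (\<sigma> * X j \<omega> + max (\<bar>X j \<omega>\<bar> - y) 0)) + rE (\<lambda>\<omega>. ?K * (X j \<omega>)\<^sup>2)"
    by (rule rE_add[OF L1_cmult[OF L(1)] L(2)])
  also have "rE (\<lambda>\<omega>. l * (\<sigma> * X j \<omega> + max (\<bar>X j \<omega>\<bar> - y) 0)) = l * rE (\<lambda>\<omega>. \<sigma> * X j \<omega> + max (\<bar>X j \<omega>\<bar> - y) 0)"
    by (rule rE_cmult[OF L(1) l])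
  also have "rE (\<lambda>\<omega>. ?K * (X j \<omega>)\<^sup>2) = ?K * q j"
    unfolding q_def by (rule rE_cmult[OF X_square_L1[OF j]]) auto
  also have "rE (\<lambda>\<omega>. \<sigma> * X j \<omega> + max (\<bar>X j \<omega>\<bar> - y) 0) \<le> mb j + exc y j"
    using rE_add[OF sX_L1[OF j, of \<sigma>] excess_L1[OF j, of y]] rE_sX_le[OF j \<sigma>] by (simp add: exc_def)
  finally have "rE (\<lambda>\<omega>. exp (l * clip y (\<sigma> * X j \<omega>))) \<le> 1 + (l * (mb j + exc y j) + ?K * q j)"
    using l by (simp add: mult_left_mono)
  also have "\<dots> \<le> exp (l * (mb j + exc y j) + ?K * q j)" by (rule exp_ge_add_one_self)
  finally show ?thesis .
qed

text \<open>The quadratic term is kept, and the linear term is subtracted through the upper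
  expectation of its negative, which \<open>mb\<close> controls as well; \<open>rE_diff_ge\<close>
  then applies.\<close>

lemma mgf_lower:
  assumes j: "j \<ge> 1" and y: "0 \<le> y" and l: "0 \<le> l" and \<sigma>: "\<sigma> = 1 \<or> \<sigma> = -1"
  shows "1 + (l\<^sup>2 / 2 * exp (- (l * y)) * rE (\<lambda>\<omega>. (clip y (\<sigma> * X j \<omega>))\<^sup>2) - l * (mb j + exc y j))
    \<le> rE (\<lambda>\<omega>. exp (l * clip y (\<sigma> * X j \<omega>)))"
proof -
  let ?K = "l\<^sup>2 / 2 * exp (- (l * y))"
  have le: "1 + (?K * (clip y (\<sigma> * u))\<^sup>2 - l * (- \<sigma> * u + max (\<bar>u\<bar> - y) 0)) \<le> exp (l * clip y (\<sigma> * u))" for u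
  proof -
    have a: "\<bar>clip y (\<sigma> * u)\<bar> \<le> y" "- clip y (\<sigma> * u) \<le> - \<sigma> * u + max (\<bar>u\<bar> - y) 0"
      using clip_bound[OF y, of "\<sigma> * u"] clip_excess[OF y, of "\<sigma> * u"] \<sigma>
      by (auto simp: abs_if split: if_splits)
    have "1 + l * clip y (\<sigma> * u) + (l * clip y (\<sigma> * u))\<^sup>2 / 2 * exp (- \<bar>l * clip y (\<sigma> * u)\<bar>)
        \<le> exp (l * clip y (\<sigma> * u))"
      by (rule exp_quadratic_lower)
    moreover have "l * (- clip y (\<sigma> * u)) \<le> l * (- \<sigma> * u + max (\<bar>u\<bar> - y) 0)"
      using a l by (intro mult_left_mono)
    moreover have "(l * clip y (\<sigma> * u))\<^sup>2 / 2 * exp (- (l * y)) \<le> (l * clip y (\<sigma> * u))\<^sup>2 / 2 * exp (- \<bar>l * clip y (\<sigma> * u)\<bar>)"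
      using a l by (intro mult_left_mono) (auto simp: abs_mult mult_left_mono)
    ultimately show ?thesis by (simp add: power_mult_distrib mult_ac)
  qed
  have cL: "(\<lambda>\<omega>. (clip y (\<sigma> * X j \<omega>))\<^sup>2) \<in> L1"
    using cyl_L1[OF cyl_mult[OF cyl_clip[OF y \<sigma>] cyl_clip[OF y \<sigma>]], of j] j
    by (simp add: path_def power2_eq_square)
  have L: "(\<lambda>\<omega>. - \<sigma> * X j \<omega> + max (\<bar>X j \<omega>\<bar> - y) 0) \<in> L1" "(\<lambda>\<omega>. ?K * (clip y (\<sigma> * X j \<omega>))\<^sup>2) \<in> L1"
    by (intro L1_add sX_L1 excess_L1 L1_cmult cL j)+
  have "rE (\<lambda>\<omega>. ?K * (clip y (\<sigma> * X j \<omega>))\<^sup>2) - rE (\<lambda>\<omega>. l * (- \<sigma> * X j \<omega> + max (\<bar>X j \<omega>\<bar> - y) 0))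
      \<le> rE (\<lambda>\<omega>. ?K * (clip y (\<sigma> * X j \<omega>))\<^sup>2 - l * (- \<sigma> * X j \<omega> + max (\<bar>X j \<omega>\<bar> - y) 0))"
    by (rule rE_diff_ge[OF L(2) L1_cmult[OF L(1)]])
  moreover have "1 + rE (\<lambda>\<omega>. ?K * (clip y (\<sigma> * X j \<omega>))\<^sup>2 - l * (- \<sigma> * X j \<omega> + max (\<bar>X j \<omega>\<bar> - y) 0))
      \<le> rE (\<lambda>\<omega>. exp (l * clip y (\<sigma> * X j \<omega>)))"
    unfolding rE_add_const[OF L1_diff[OF L(2) L1_cmult[OF L(1)]], symmetric]
    by (rule rE_mono[OF L1_add[OF L1_const L1_diff[OF L(2) L1_cmult[OF L(1)]]] exp_clip_L1[OF j y \<sigma>] le])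
  moreover have "rE (\<lambda>\<omega>. ?K * (clip y (\<sigma> * X j \<omega>))\<^sup>2) = ?K * rE (\<lambda>\<omega>. (clip y (\<sigma> * X j \<omega>))\<^sup>2)"
    by (rule rE_cmult[OF cL]) auto
  moreover have "rE (\<lambda>\<omega>. l * (- \<sigma> * X j \<omega> + max (\<bar>X j \<omega>\<bar> - y) 0)) \<le> l * (mb j + exc y j)"
  proof -
    have "rE (\<lambda>\<omega>. - \<sigma> * X j \<omega> + max (\<bar>X j \<omega>\<bar> - y) 0) \<le> mb j + exc y j"
      using rE_add[OF sX_L1[OF j, of "- \<sigma>"] excess_L1[OF j, of y]] rE_sX_le[OF j, of "- \<sigma>"] \<sigma>
      by (auto simp: exc_def)
    then show ?thesis unfolding rE_cmult[OF L(1) l] using l by (rule mult_left_mono)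
  qed
  ultimately show ?thesis by linarith
qed

lemma clip_sum_bound:
  assumes y: "0 \<le> y" and l: "0 \<le> l" and \<sigma>: "\<sigma> = 1 \<or> \<sigma> = -1"
  shows "V_hat M H E {\<omega> \<in> space M. \<exists>m\<in>{1..N}. x \<le> (\<Sum>j\<in>{n0<..m}. clip y (\<sigma> * X j \<omega>))}
    \<le> ereal (exp (1 - l * x + (\<Sum>j\<in>{n0<..N}. l * (mb j + exc y j) + l\<^sup>2 / 2 * exp (l * y) * q j)))"
proof -
  have "V_hat M H E {\<omega> \<in> space M. \<exists>m\<in>{1..N}. l * x \<le> (\<Sum>j\<in>{n0<..m}. l * clip y (\<sigma> * X j \<omega>))}
    \<le> ereal (exp (1 - l * x + (\<Sum>j\<in>{n0<..N}. l * (mb j + exc y j) + l\<^sup>2 / 2 * exp (l * y) * q j)))"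
  proof (rule maximal_inequality_from)
    fix j assume "j \<in> {n0<..N}"
    then have j: "j \<ge> 1" by auto
    show "cyl {j} (\<lambda>x. l * clip y (\<sigma> * x j))" by (rule cyl_cmult[OF cyl_clip[OF y \<sigma>]])
    show "0 \<le> l * (mb j + exc y j) + l\<^sup>2 / 2 * exp (l * y) * q j"
      using l mb_nonneg exc_nonneg[OF j] q_nonneg[OF j] by simp
    show "rE (\<lambda>\<omega>. exp (l * clip y (\<sigma> * X j \<omega>))) \<le> exp (l * (mb j + exc y j) + l\<^sup>2 / 2 * exp (l * y) * q j)"
      by (rule mgf_upper[OF j y l \<sigma>])
  qed
  moreover have "{\<omega> \<in> space M. \<exists>m\<in>{1..N}. x \<le> (\<Sum>j\<in>{n0<..m}. clip y (\<sigma> * X j \<omega>))}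
    \<subseteq> {\<omega> \<in> space M. \<exists>m\<in>{1..N}. l * x \<le> (\<Sum>j\<in>{n0<..m}. l * clip y (\<sigma> * X j \<omega>))}"
    unfolding sum_distrib_left[symmetric] using mult_left_mono[OF _ l] by blast
  ultimately show ?thesis using order_trans[OF V_hat_mono] by blast
qed

lemma trunc_moment_H: "j \<ge> 1 \<Longrightarrow> 0 \<le> h \<Longrightarrow> 1 \<le> p \<Longrightarrow> (\<lambda>\<omega>. max (\<bar>X j \<omega>\<bar> - h) 0 powr p) \<in> H"
  by (rule H_excess_powr[OF X_H])

text \<open>Applied with r = 0, 1, 2 to w = \<bar>u\<bar> - h on the set \<bar>u\<bar> > 2 *
  h.\<close>

lemma powr_ge_cmult:
  fixes h w p r :: real
  assumes "0 < h" "h \<le> w" "r \<le> p"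
  shows "w powr r \<le> h powr (r - p) * w powr p"
proof -
  have "w powr (r - p) \<le> h powr (r - p)" using assms by (intro powr_mono2') auto
  then have "w powr (r - p) * w powr p \<le> h powr (r - p) * w powr p" by (intro mult_right_mono) auto
  then show ?thesis using assms by (simp add: powr_add[symmetric])
qed

text \<open>Where \<bar>u\<bar> exceeds 2 * h, its excess over h is at least h, so the first power
  is dominated by the p-th. Hence the two levels: moments are taken at h, truncation at 2 *
  h.\<close>

lemma exc_le_trunc_moment:
  assumes j: "j \<ge> 1" and h: "0 < h" and p: "1 \<le> p"
    and R: "(\<lambda>\<omega>. max (\<bar>X j \<omega>\<bar> - h) 0 powr p) \<in> L1"
  shows "exc (2 * h) j \<le> h powr (1 - p) * trunc_moment p h j"
proof -
  have "max (\<bar>u\<bar> - 2 * h) 0 \<le> h powr (1 - p) * max (\<bar>u\<bar> - h) 0 powr p" for u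
  proof (cases "\<bar>u\<bar> \<le> 2 * h")
    case False
    then show ?thesis using powr_ge_cmult[of h "\<bar>u\<bar> - h" 1 p] h p by simp
  qed (use h in simp)
  then have "rE (\<lambda>\<omega>. max (\<bar>X j \<omega>\<bar> - 2 * h) 0) \<le> rE (\<lambda>\<omega>. h powr (1 - p) * max (\<bar>X j \<omega>\<bar> - h) 0 powr p)"
    by (intro rE_mono excess_L1 L1_cmult R j)
  then show ?thesis using rE_cmult[OF R, of "h powr (1 - p)"] by (simp add: exc_def trunc_moment_def)
qed

text \<open>Beyond 2 * h one has \<bar>u\<bar> \<le> 2 * (\<bar>u\<bar> - h), so the second moment
  lost by truncation is dominated by the p-th excess moment; this is where p \<ge> 2 enters.\<close>

lemma clip_square_ge:
  assumes j: "j \<ge> 1" and h: "0 < h" and p: "2 \<le> p" and \<sigma>: "\<sigma> = 1 \<or> \<sigma> = -1"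
    and R: "(\<lambda>\<omega>. max (\<bar>X j \<omega>\<bar> - h) 0 powr p) \<in> L1"
  shows "q j - 4 * h powr (2 - p) * trunc_moment p h j \<le> rE (\<lambda>\<omega>. (clip (2 * h) (\<sigma> * X j \<omega>))\<^sup>2)"
proof -
  have le: "u\<^sup>2 \<le> (clip (2 * h) (\<sigma> * u))\<^sup>2 + 4 * h powr (2 - p) * max (\<bar>u\<bar> - h) 0 powr p" for u
  proof (cases "\<bar>u\<bar> \<le> 2 * h")
    case True
    then have "clip (2 * h) (\<sigma> * u) = \<sigma> * u"
      using \<sigma> by (auto simp: clip_def abs_le_iff max_def min_def)
    then show ?thesis using \<sigma> by auto
  next
    case False
    have "\<bar>u\<bar>\<^sup>2 \<le> (2 * (\<bar>u\<bar> - h))\<^sup>2" using False h by (intro power_mono) auto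
    also have "\<dots> = 4 * (\<bar>u\<bar> - h) powr 2" using False h by (subst power_mult_distrib) (simp add: powr_numeral)
    also have "\<dots> \<le> 4 * (h powr (2 - p) * (\<bar>u\<bar> - h) powr p)"
      using powr_ge_cmult[of h "\<bar>u\<bar> - h" 2 p] False h p by simp
    finally show ?thesis using False h by (simp add: max_def add_increasing)
  qed
  have cL: "(\<lambda>\<omega>. (clip (2 * h) (\<sigma> * X j \<omega>))\<^sup>2) \<in> L1"
    using cyl_L1[OF cyl_mult[OF cyl_clip[of "2 * h", OF _ \<sigma>] cyl_clip[of "2 * h", OF _ \<sigma>]], of j] j h
    by (simp add: path_def power2_eq_square)
  have "q j \<le> rE (\<lambda>\<omega>. (clip (2 * h) (\<sigma> * X j \<omega>))\<^sup>2 + 4 * h powr (2 - p) * max (\<bar>X j \<omega>\<bar> - h) 0 powr p)"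
    unfolding q_def by (rule rE_mono[OF X_square_L1[OF j] L1_add[OF cL L1_cmult[OF R]] le])
  also have "\<dots> \<le> rE (\<lambda>\<omega>. (clip (2 * h) (\<sigma> * X j \<omega>))\<^sup>2) + rE (\<lambda>\<omega>. 4 * h powr (2 - p) * max (\<bar>X j \<omega>\<bar> - h) 0 powr p)"
    by (rule rE_add[OF cL L1_cmult[OF R]])
  also have "rE (\<lambda>\<omega>. 4 * h powr (2 - p) * max (\<bar>X j \<omega>\<bar> - h) 0 powr p) = 4 * h powr (2 - p) * trunc_moment p h j"
    unfolding trunc_moment_def by (rule rE_cmult[OF R]) simp
  finally show ?thesis by simp
qed

text \<open>A bound of Fuk-Nagaev type. \<open>exp (l * g u)\<close> differs from 1 only beyond 2 *
  h, where \<open>h powr - p * (\<bar>u\<bar> - h) powr p\<close> is at least 1; the p-th moments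
  thus control it, at the price \<open>exp (l * B)\<close> for the cap.\<close>

lemma excess_sum_bound:
  assumes h: "0 < h" and p: "1 \<le> p" and B: "0 \<le> B" and l: "0 \<le> l" and N: "N \<ge> 1"
    and R: "\<And>j. j \<in> {n0<..N} \<Longrightarrow> (\<lambda>\<omega>. max (\<bar>X j \<omega>\<bar> - h) 0 powr p) \<in> L1"
  shows "V_hat M H E {\<omega> \<in> space M. x \<le> (\<Sum>j\<in>{n0<..N}. min (max (\<bar>X j \<omega>\<bar> - 2 * h) 0) B)}
    \<le> ereal (exp (1 - l * x + exp (l * B) * h powr - p * (\<Sum>j\<in>{n0<..N}. trunc_moment p h j)))"
proof -
  define g where "g u = min (max (\<bar>u\<bar> - 2 * h) 0) B" for u :: real
  have g: "\<bar>g u\<bar> \<le> B" "\<bar>g u - g v\<bar> \<le> 1 * \<bar>u - v\<bar>" for u v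
    using B by (auto simp: g_def max_def min_def)
  have gc: "cyl {j} (\<lambda>x. g (x j))" for j by (rule cyl_coord[OF _ _ g]) auto
  let ?K = "exp (l * B) * h powr - p"
  have le: "exp (l * g u) \<le> 1 + ?K * max (\<bar>u\<bar> - h) 0 powr p" for u
  proof (cases "\<bar>u\<bar> \<le> 2 * h")
    case True
    then show ?thesis using B by (simp add: g_def)
  next
    case False
    have "g u \<le> B" by (simp add: g_def)
    then have "exp (l * g u) \<le> exp (l * B) * 1" using l by (simp add: mult_left_mono)
    also have "1 \<le> h powr - p * (\<bar>u\<bar> - h) powr p"
      using powr_ge_cmult[of h "\<bar>u\<bar> - h" 0 p] False h p by simp
    finally show ?thesis using False h by (simp add: max_def mult.assoc)
  qed
  have "V_hat M H E {\<omega> \<in> space M. \<exists>m\<in>{1..N}. l * x \<le> (\<Sum>j\<in>{n0<..m}. l * g (X j \<omega>))}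
    \<le> ereal (exp (1 - l * x + (\<Sum>j\<in>{n0<..N}. ?K * trunc_moment p h j)))"
  proof (rule maximal_inequality_from)
    fix j assume jN: "j \<in> {n0<..N}"
    then have j: "j \<ge> 1" by auto
    show "cyl {j} (\<lambda>x. l * g (x j))" by (rule cyl_cmult[OF gc])
    have "0 \<le> trunc_moment p h j" unfolding trunc_moment_def by (rule rE_ge[OF R[OF jN]]) simp
    then show "0 \<le> ?K * trunc_moment p h j" by simp
    have eL: "(\<lambda>\<omega>. exp (l * g (X j \<omega>))) \<in> L1"
      using cyl_L1[OF cyl_exp[OF cyl_cmult[OF gc]], of j l] j by (simp add: path_def)
    have "rE (\<lambda>\<omega>. exp (l * g (X j \<omega>))) \<le> rE (\<lambda>\<omega>. 1 + ?K * max (\<bar>X j \<omega>\<bar> - h) 0 powr p)"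
      by (rule rE_mono[OF eL L1_add[OF L1_const L1_cmult[OF R[OF jN]]] le])
    also have "\<dots> = 1 + rE (\<lambda>\<omega>. ?K * max (\<bar>X j \<omega>\<bar> - h) 0 powr p)"
      by (rule rE_add_const[OF L1_cmult[OF R[OF jN]]])
    also have "rE (\<lambda>\<omega>. ?K * max (\<bar>X j \<omega>\<bar> - h) 0 powr p) = ?K * trunc_moment p h j"
      unfolding trunc_moment_def by (rule rE_cmult[OF R[OF jN]]) simp
    also have "1 + ?K * trunc_moment p h j \<le> exp (?K * trunc_moment p h j)" by (rule exp_ge_add_one_self)
    finally show "rE (\<lambda>\<omega>. exp (l * g (X j \<omega>))) \<le> exp (?K * trunc_moment p h j)" .
  qed
  moreover have "{\<omega> \<in> space M. x \<le> (\<Sum>j\<in>{n0<..N}. min (max (\<bar>X j \<omega>\<bar> - 2 * h) 0) B)}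
    \<subseteq> {\<omega> \<in> space M. \<exists>m\<in>{1..N}. l * x \<le> (\<Sum>j\<in>{n0<..m}. l * g (X j \<omega>))}"
    unfolding sum_distrib_left[symmetric] g_def using mult_left_mono[OF _ l] N by fastforce
  ultimately show ?thesis using order_trans[OF V_hat_mono] by (simp add: sum_distrib_left)
qed

end

section \<open>Representing probability measures\<close>

lemma sum_abs_le_L2: "(\<Sum>i<n. \<bar>x i\<bar>) \<le> real n * L2_set x {..<n}"
proof -
  have "\<bar>x i\<bar> \<le> L2_set x {..<n}" if "i < n" for i
    using member_le_L2_set[of "{..<n}" i "\<lambda>i. \<bar>x i\<bar>"] that by (simp add: L2_set_def)
  then show ?thesis using sum_bounded_above[of "{..<n}" "\<lambda>i. \<bar>x i\<bar>" "L2_set x {..<n}"] by simp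
qed

lemma cyl_C_bLip:
  assumes "cyl {..<n} \<phi>"
  shows "\<phi> \<in> C_bLip n"
proof -
  obtain B L where *: "finite {..<n}" "B > 0" "L > 0" "\<And>x. \<bar>\<phi> x\<bar> \<le> B"
    "\<And>x y. \<bar>\<phi> x - \<phi> y\<bar> \<le> L * (\<Sum>j\<in>{..<n}. \<bar>x j - y j\<bar>)"
    using cyl_bounds[OF assms] by blast
  have "\<bar>\<phi> x - \<phi> y\<bar> \<le> (L * real n) * L2_set (\<lambda>i. x i - y i) {..<n}" for x y
    unfolding mult.assoc
    by (rule order_trans[OF *(5) mult_left_mono[OF sum_abs_le_L2]]) (use * in simp)
  with *(4) show ?thesis unfolding C_bLip_def by auto
qed

locale CC_sequence = indep_sequence M H E X
  for M :: "'a measure" and H E X +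
  fixes PP :: "'a measure set"
  assumes CC: "condition_CC M H E PP"
begin

lemma PP_prob: "P \<in> PP \<Longrightarrow> prob_space P"
  and PP_sets: "P \<in> PP \<Longrightarrow> sets P = sets (sigma_H M H)"
  and E_bdd: "F \<in> H_bdd M H \<Longrightarrow> E F = (SUP P\<in>PP. ereal (\<integral>\<omega>. F \<omega> \<partial>P))"
  and PP_compact: "countable_dim_weakly_compact M H PP"
  using CC unfolding condition_CC_def by auto

lemma gen_subset: "{f -` B \<inter> space M | f B. f \<in> H \<and> B \<in> sets borel} \<subseteq> Pow (space M)"
  by auto

lemma space_PP: "P \<in> PP \<Longrightarrow> space P = space M"
  using sets_eq_imp_space_eq[OF PP_sets] space_measure_of[OF gen_subset] unfolding sigma_H_def by simp

lemma H_measurable_PP: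
  assumes "P \<in> PP" "f \<in> H"
  shows "f \<in> borel_measurable P"
proof (rule measurableI)
  fix B :: "real set" assume "B \<in> sets borel"
  then have "f -` B \<inter> space M \<in> {f -` B \<inter> space M | f B. f \<in> H \<and> B \<in> sets borel}"
    using assms(2) by blast
  then have "f -` B \<inter> space M \<in> sets (sigma_H M H)"
    unfolding sigma_H_def by (rule in_measure_of[OF gen_subset])
  then show "f -` B \<inter> space P \<in> sets P" by (simp add: space_PP PP_sets assms(1))
qed simp

text \<open>A supremum over the empty family would be - \<infinity>, but the expectation of 0 is
  0.\<close>

lemma PP_nonempty: "PP \<noteq> {}"
proof
  assume "PP = {}"
  moreover have "(\<lambda>\<omega>. 0) \<in> H_bdd M H" by (auto simp: H_bdd_def H_zero bounded_iff)
  ultimately have "E (\<lambda>\<omega>. 0) = -\<infinity>" using E_bdd[of "\<lambda>\<omega>. 0"] by (simp add: bot_ereal_def)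
  then show False using E_const[of 0] by simp
qed

lemma H_bddI: "F \<in> H \<Longrightarrow> (\<And>\<omega>. \<omega> \<in> space M \<Longrightarrow> \<bar>F \<omega>\<bar> \<le> B) \<Longrightarrow> F \<in> H_bdd M H"
  unfolding H_bdd_def bounded_iff by auto

lemma integral_le_E:
  assumes "P \<in> PP" "F \<in> H" "\<And>\<omega>. \<omega> \<in> space M \<Longrightarrow> \<bar>F \<omega>\<bar> \<le> B"
  shows "ereal (\<integral>\<omega>. F \<omega> \<partial>P) \<le> E F"
  using E_bdd[OF H_bddI[OF assms(2,3)]] SUP_upper[OF assms(1), of "\<lambda>P. ereal (\<integral>\<omega>. F \<omega> \<partial>P)"] by simp

lemma ex_integral_ge:
  assumes "F \<in> H" "\<And>\<omega>. \<omega> \<in> space M \<Longrightarrow> \<bar>F \<omega>\<bar> \<le> B" "0 < e"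
  shows "\<exists>P\<in>PP. rE F - e \<le> (\<integral>\<omega>. F \<omega> \<partial>P)"
proof -
  have "ereal (rE F - e) < ereal (rE F)" using assms(3) by simp
  also have "\<dots> = (SUP P\<in>PP. ereal (\<integral>\<omega>. F \<omega> \<partial>P))"
    using E_bdd[OF H_bddI[OF assms(1,2)]] E_L1[OF L1_bounded[OF assms(1,2)]] by simp
  finally obtain P where "P \<in> PP" "ereal (rE F - e) < ereal (\<integral>\<omega>. F \<omega> \<partial>P)"
    unfolding less_SUP_iff by blast
  then show ?thesis by (intro bexI[of _ P]) auto
qed

lemma H_bounded_integrable:
  assumes "P \<in> PP" "F \<in> H" "\<And>\<omega>. \<omega> \<in> space M \<Longrightarrow> \<bar>F \<omega>\<bar> \<le> B"
  shows "integrable P F"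
proof -
  interpret prob_space P by (rule PP_prob[OF assms(1)])
  show ?thesis
    by (rule integrable_const_bound[where B=B])
      (use assms space_PP H_measurable_PP in \<open>auto intro!: AE_I2\<close>)
qed

text \<open>The representation by \<open>PP\<close> covers bounded functions only, so partial sums
  are truncated at 1. Under the single measure \<open>P\<close> they converge boundedly to a
  function above the indicator of \<open>A\<close>.\<close>

lemma measure_le_C_star:
  assumes P: "P \<in> PP" and A: "A \<in> sets P"
  shows "ereal (measure P A) \<le> C_star M H E A"
  unfolding C_star_def
proof (rule Inf_greatest, clarify)
  fix L g
  assume g: "\<forall>n. g n \<in> H \<and> (\<forall>\<omega>\<in>space M. 0 \<le> g n \<omega>)"
    and cover: "\<forall>\<omega>\<in>space M. (indicator A \<omega> :: ereal) \<le> (\<Sum>n. ereal (g n \<omega>))"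
    and L: "(\<lambda>n. E (\<lambda>\<omega>. \<Sum>i<n. g i \<omega>)) \<longlonglongrightarrow> L"
  interpret prob_space P by (rule PP_prob[OF P])
  define f where "f n \<omega> = min 1 (max 0 (\<Sum>i<n. g i \<omega>))" for n \<omega>
  have f01: "0 \<le> f n \<omega>" "f n \<omega> \<le> 1" for n \<omega> by (auto simp: f_def)
  have gH: "(\<lambda>\<omega>. \<Sum>i<n. g i \<omega>) \<in> H" for n using g by (intro H_sum) auto
  have fH: "f n \<in> H" for n
    unfolding f_def[abs_def] by (rule H_lip_comp[OF gH, where C=1]) (auto simp: min_def max_def)
  have fle: "ereal (\<integral>\<omega>. f n \<omega> \<partial>P) \<le> E (\<lambda>\<omega>. \<Sum>i<n. g i \<omega>)" for n
  proof (rule order_trans[OF integral_le_E[OF P fH, where B=1] E_mono[OF gH fH]])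
    show "\<bar>f n \<omega>\<bar> \<le> 1" for \<omega> using f01[of n \<omega>] by auto
    show "f n \<omega> \<le> (\<Sum>i<n. g i \<omega>)" if "\<omega> \<in> space M" for \<omega>
    proof -
      have "0 \<le> (\<Sum>i<n. g i \<omega>)" using g that by (intro sum_nonneg) auto
      then show ?thesis by (simp add: f_def)
    qed
  qed
  define F where "F \<omega> = (SUP n. f n \<omega>)" for \<omega>
  have bdd: "bdd_above (range (\<lambda>n. f n \<omega>))" for \<omega>
    using f01(2)[of _ \<omega>] by (intro bdd_aboveI[of _ 1]) auto
  have lim: "(\<lambda>n. f n \<omega>) \<longlonglongrightarrow> F \<omega>" if "\<omega> \<in> space M" for \<omega>
    unfolding F_def
  proof (rule LIMSEQ_incseq_SUP[OF bdd])
    show "incseq (\<lambda>n. f n \<omega>)"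
    proof (rule incseq_SucI)
      fix n
      have "0 \<le> g n \<omega>" using g that by auto
      then show "f n \<omega> \<le> f (Suc n) \<omega>" by (simp add: f_def max_def min_def)
    qed
  qed
  have F01: "0 \<le> F \<omega>" "F \<omega> \<le> 1" if "\<omega> \<in> space M" for \<omega>
    using LIMSEQ_le_const[OF lim[OF that], of 0] LIMSEQ_le_const2[OF lim[OF that], of 1] f01 by auto
  have AF: "indicat_real A \<omega> \<le> F \<omega>" if "\<omega> \<in> space M" for \<omega>
  proof (cases "\<omega> \<in> A")
    case True
    show ?thesis
    proof (rule ccontr)
      assume "\<not> ?thesis"
      then have lt: "F \<omega> < 1" using True by simp
      \<comment> \<open>As \<open>F \<omega> < 1\<close>, the truncation at 1 is never active; all
        partial sums stay below \<open>F \<omega>\<close>, which contradicts the covering of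
        \<omega>.\<close>
      have "(\<Sum>i<n. g i \<omega>) \<le> F \<omega>" for n
      proof -
        have "f n \<omega> \<le> F \<omega>" unfolding F_def by (rule cSUP_upper[OF _ bdd]) simp
        then show ?thesis using lt by (auto simp: f_def min_def max_def split: if_splits)
      qed
      then have "(\<Sum>n. ereal (g n \<omega>)) \<le> ereal (F \<omega>)"
        using g that by (intro suminf_bound allI) auto
      also have "\<dots> < 1" using lt by (simp add: one_ereal_def)
      finally have "(\<Sum>n. ereal (g n \<omega>)) < 1" .
      moreover have "1 \<le> (\<Sum>n. ereal (g n \<omega>))" using cover that True by (auto dest!: bspec)
      ultimately show False by simp
    qed
  qed (simp add: F01 that)
  have meas: "f n \<in> borel_measurable P" for n by (rule H_measurable_PP[OF P fH])
  have measF: "F \<in> borel_measurable P"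
    by (rule borel_measurable_LIMSEQ_real[of P f]) (auto simp: space_PP[OF P] meas lim)
  have "(\<lambda>n. \<integral>\<omega>. f n \<omega> \<partial>P) \<longlonglongrightarrow> (\<integral>\<omega>. F \<omega> \<partial>P)"
  proof (rule integral_dominated_convergence[where w="\<lambda>_. 1"])
    show "AE \<omega> in P. (\<lambda>n. f n \<omega>) \<longlonglongrightarrow> F \<omega>"
      by (rule AE_I2) (simp add: lim space_PP[OF P])
    show "AE \<omega> in P. norm (f n \<omega>) \<le> 1" for n
      by (rule AE_I2) (use f01 in simp)
  qed (auto simp: meas measF)
  then have lim': "(\<lambda>n. ereal (\<integral>\<omega>. f n \<omega> \<partial>P)) \<longlonglongrightarrow> ereal (\<integral>\<omega>. F \<omega> \<partial>P)" by simp
  have "measure P A = (\<integral>\<omega>. indicat_real A \<omega> \<partial>P)" using A by simp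
  also have "\<dots> \<le> (\<integral>\<omega>. F \<omega> \<partial>P)"
  proof (rule integral_mono)
    show "integrable P (indicat_real A)" using A by (simp add: integrable_indicator_iff emeasure_eq_measure)
    show "integrable P F"
      by (rule integrable_const_bound[where B=1]) (auto simp: measF space_PP[OF P] F01 intro!: AE_I2)
  qed (simp add: AF space_PP[OF P])
  finally have "ereal (measure P A) \<le> ereal (\<integral>\<omega>. F \<omega> \<partial>P)" by simp
  also have "\<dots> \<le> L"
    by (rule LIMSEQ_le[OF lim' L]) (use fle in auto)
  finally show "ereal (measure P A) \<le> L" .
qed

lemma V_P_le_C_star: "V_P PP A \<le> C_star M H E A"
  unfolding V_P_def
proof (rule SUP_least)
  fix P assume P: "P \<in> PP"
  show "ereal (measure P A) \<le> C_star M H E A"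
  proof (cases "A \<in> sets P")
    \<comment> \<open>\<open>measure\<close> is 0 off the \<sigma>-algebra.\<close>
    case False
    then show ?thesis using C_star_nonneg[of A] by (simp add: measure_notin_sets flip: zero_ereal_def)
  qed (rule measure_le_C_star[OF P])
qed

lemma V_P_nonneg: "0 \<le> V_P PP A"
proof -
  obtain P where "P \<in> PP" using PP_nonempty by auto
  then have "ereal (measure P A) \<le> V_P PP A" unfolding V_P_def by (rule SUP_upper)
  then show ?thesis by (rule order_trans[rotated]) simp
qed

lemma qs_measure:
  assumes "qs Q" "P \<in> PP"
  shows "measure P {\<omega> \<in> space M. \<not> Q \<omega>} = 0"
proof -
  have "ereal (measure P {\<omega> \<in> space M. \<not> Q \<omega>}) \<le> V_P PP {\<omega> \<in> space M. \<not> Q \<omega>}"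
    unfolding V_P_def using assms(2) by (rule SUP_upper)
  also have "\<dots> \<le> 0"
    by (rule order_trans[OF V_P_le_C_star order_trans[OF C_star_le_V_hat_star V_hat_star_qs[OF assms(1)]]])
  finally show ?thesis by (simp add: measure_le_0_iff)
qed

text \<open>A sequence of events that can each be realised, with upper probability close to one, on
  arbitrarily late finite blocks of coordinates.\<close>

definition rich :: "(nat \<Rightarrow> (nat \<Rightarrow> real) \<Rightarrow> bool) \<Rightarrow> bool" where
  "rich F \<longleftrightarrow> (\<forall>N. \<forall>e>0. \<exists>N' g. N < N' \<and> cyl {N<..N'} g \<and> (\<forall>x. 0 \<le> g x \<and> g x \<le> 1) \<and>
     1 - e \<le> Ex g \<and> (\<forall>x. 0 < g x \<longrightarrow> F N x))"

text \<open>Windows of coordinates are chosen one after the other, each serving one of the families.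
  By independence the product of the first k soft events has expectation at least 1 - e / 2, so some
  measure \<open>Q k\<close> nearly attains it. Weak compactness for the countably many bounded
  functions \<open>g l\<close> gives one limit measure that works for all k.\<close>

lemma rich_realised:
  assumes F: "\<And>i::nat. rich (F i)" and e: "0 < e"
  shows "\<exists>P\<in>PP. \<exists>G\<in>sets P. 1 - e \<le> measure P G \<and> (\<forall>\<omega>\<in>G. \<forall>i N. \<exists>N'\<ge>N. F i N' (path \<omega>))"
proof -
  \<comment> \<open>The first component of \<open>prod_decode\<close> takes every value infinitely
    often, so every family is served arbitrarily late.\<close>
  define \<kappa> where "\<kappa> l = fst (prod_decode l)" for l
  \<comment> \<open>The losses of all windows sum to e / 2; the other half is spent on choosing the
    measures \<open>Q k\<close>.\<close>
  define d where "d l = e / 2 * (1/2) ^ Suc l" for l :: nat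
  have d: "0 < d l" for l using e by (simp add: d_def)
  have "\<exists>p. N < fst p \<and> cyl {N<..fst p} (snd p) \<and> (\<forall>x. 0 \<le> snd p x \<and> snd p x \<le> 1) \<and>
     1 - d l \<le> Ex (snd p) \<and> (\<forall>x. 0 < snd p x \<longrightarrow> F (\<kappa> l) N x)" for l N
    using F[of "\<kappa> l"] d[of l] unfolding rich_def split_paired_Ex fst_conv snd_conv by simp
  then have "\<exists>p. \<forall>lN. snd lN < fst (p lN) \<and> cyl {snd lN<..fst (p lN)} (snd (p lN)) \<and>
     (\<forall>x. 0 \<le> snd (p lN) x \<and> snd (p lN) x \<le> 1) \<and>
     1 - d (fst lN) \<le> Ex (snd (p lN)) \<and> (\<forall>x. 0 < snd (p lN) x \<longrightarrow> F (\<kappa> (fst lN)) (snd lN) x)"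
    by (intro choice allI)
  then obtain p where p: "\<forall>lN. snd lN < fst (p lN) \<and> cyl {snd lN<..fst (p lN)} (snd (p lN)) \<and>
     (\<forall>x. 0 \<le> snd (p lN) x \<and> snd (p lN) x \<le> 1) \<and>
     1 - d (fst lN) \<le> Ex (snd (p lN)) \<and> (\<forall>x. 0 < snd (p lN) x \<longrightarrow> F (\<kappa> (fst lN)) (snd lN) x)" ..
  define Nx where "Nx = rec_nat (0::nat) (\<lambda>l N. fst (p (l, N)))"
  define g where "g l = snd (p (l, Nx l))" for l
  have Nx0: "Nx 0 = 0" and NxS: "Nx (Suc l) = fst (p (l, Nx l))" for l by (simp_all add: Nx_def)
  have pl: "Nx l < Nx (Suc l)" "cyl {Nx l<..Nx (Suc l)} (g l)" "0 \<le> g l x" "g l x \<le> 1"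
    "1 - d l \<le> Ex (g l)" "0 < g l x \<Longrightarrow> F (\<kappa> l) (Nx l) x" for l x
    using p[rule_format, of "(l, Nx l)"] by (simp_all add: NxS g_def)
  have Nxl: "l \<le> Nx l" for l
  proof (induction l)
    case (Suc l)
    then show ?case using pl(1)[of l] by linarith
  qed simp
  have Nxm: "Nx l \<le> Nx k" if "l \<le> k" for l k
    using that by (rule lift_Suc_mono_le[rotated]) (use pl(1) less_imp_le in auto)
  define G where "G k x = (\<Prod>l<k. g l x)" for k x
  have G01: "0 \<le> G k x" "G k x \<le> 1" for k x
    unfolding G_def by (auto intro!: prod_nonneg prod_le_1 pl)
  have Gm: "G k x \<le> G l x" if "l \<le> k" for l k x
    using that
  proof (rule lift_Suc_antimono_le[rotated])
    show "G (Suc n) x \<le> G n x" for n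
      using mult_left_mono[OF pl(4)[of n x] G01(1)[of n x]] by (simp add: G_def)
  qed
  have gc: "cyl {1..Nx k} (g l)" if "l < k" for l k
    by (rule cyl_mono[OF pl(2)]) (use Nxm[of "Suc l" k] that in auto)
  have Gc: "cyl {1..Nx k} (G k)" for k
    unfolding G_def by (rule cyl_prod[OF _ gc]) auto
  have GL1: "(\<lambda>\<omega>. G k (path \<omega>)) \<in> L1" for k by (rule cyl_L1[OF Gc]) auto
  have gL1: "(\<lambda>\<omega>. g k (path \<omega>)) \<in> L1" for k by (rule cyl_L1[OF pl(2)]) auto
  have ExG: "1 - (\<Sum>l<k. d l) \<le> Ex (G k)" for k
  proof (induction k)
    case 0
    show ?case by (simp add: G_def)
  next
    case (Suc k)
    have "Ex (\<lambda>x. G k x * g k x) = Ex (G k) * Ex (g k)"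
      by (rule Ex_prod_blocks[OF Gc G01(1) _ pl(2,3)]) (rule less_imp_le[OF pl(1)])
    \<comment> \<open>Expanded, this says that the losses of the two factors at most add up.\<close>
    moreover have "0 \<le> (1 - Ex (G k)) * (1 - Ex (g k))"
      unfolding Ex_def using rE_le[OF GL1, of k 1] rE_le[OF gL1, of k 1] G01 pl(4)
      by (intro mult_nonneg_nonneg) auto
    moreover have "(\<lambda>x. G k x * g k x) = G (Suc k)" by (simp add: G_def mult.commute fun_eq_iff)
    ultimately have "Ex (G k) + Ex (g k) - 1 \<le> Ex (G (Suc k))"
      by (simp add: algebra_simps)
    then show ?case using Suc pl(5)[of k] by simp
  qed
  have "(\<Sum>l<k. d l) \<le> e / 2" for k
    using sum_le_suminf[of "\<lambda>l. d l" "{..<k}"] sums_mult[OF power_half_series, of "e / 2"] d less_imp_le[OF d]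
    by (simp add: d_def sums_iff)
  with ExG have ExG': "1 - e / 2 \<le> Ex (G k)" for k by (meson diff_left_mono order_trans)
  have "\<exists>P. P \<in> PP \<and> 1 - e \<le> (\<integral>\<omega>. G k (path \<omega>) \<partial>P)" for k
  proof -
    have "\<exists>P\<in>PP. rE (\<lambda>\<omega>. G k (path \<omega>)) - e / 2 \<le> (\<integral>\<omega>. G k (path \<omega>) \<partial>P)"
      by (rule ex_integral_ge[OF L1_H[OF GL1], where B=1]) (use G01 e in auto)
    then show ?thesis using ExG'[of k] unfolding Ex_def by fastforce
  qed
  then have "\<exists>Q. \<forall>k. Q k \<in> PP \<and> 1 - e \<le> (\<integral>\<omega>. G k (path \<omega>) \<partial>(Q k))" by (intro choice allI)
  then obtain Q where Q: "\<forall>k. Q k \<in> PP \<and> 1 - e \<le> (\<integral>\<omega>. G k (path \<omega>) \<partial>(Q k))" ..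
  have "\<forall>l. (\<lambda>\<omega>. g l (path \<omega>)) \<in> H_bdd M H"
    by (intro allI H_bddI[OF L1_H[OF gL1], where B=1]) (use pl(3,4) in auto)
  moreover have "\<forall>k. Q k \<in> PP" using Q by simp
  ultimately obtain r P where r: "strict_mono r" and P: "P \<in> PP"
    and lim: "\<forall>k\<ge>1. \<forall>\<phi>\<in>C_bLip k.
      (\<lambda>n. \<integral>\<omega>. \<phi> (\<lambda>l. g l (path \<omega>)) \<partial>Q (r n)) \<longlonglongrightarrow> (\<integral>\<omega>. \<phi> (\<lambda>l. g l (path \<omega>)) \<partial>P)"
    using PP_compact[unfolded countable_dim_weakly_compact_def, rule_format, of "\<lambda>l \<omega>. g l (path \<omega>)" Q]
    by auto
  interpret prob_space P by (rule PP_prob[OF P])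
  have int: "1 - e \<le> (\<integral>\<omega>. G k (path \<omega>) \<partial>P)" if k: "k \<ge> 1" for k
  proof -
    \<comment> \<open>A product of coordinates is in general neither bounded nor Lipschitz on the
      whole space; clamping each to [0, 1] does not change the value at the
      \<open>g l\<close>.\<close>
    define \<phi> where "\<phi> y = (\<Prod>l<k. max 0 (min 1 (y l)))" for y :: "nat \<Rightarrow> real"
    have "\<phi> \<in> C_bLip k"
      unfolding \<phi>_def
    proof (rule cyl_C_bLip[OF cyl_prod])
      show "cyl {..<k} (\<lambda>x. max 0 (min 1 (x l)))" if "l \<in> {..<k}" for l
        by (rule cyl_coord[where B=1 and C=1]) (use that in \<open>auto simp: max_def min_def\<close>)
    qed simp
    then have l: "(\<lambda>n. \<integral>\<omega>. \<phi> (\<lambda>l. g l (path \<omega>)) \<partial>Q (r n)) \<longlonglongrightarrow> (\<integral>\<omega>. \<phi> (\<lambda>l. g l (path \<omega>)) \<partial>P)"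
      using lim k by simp
    have \<phi>: "\<phi> (\<lambda>l. g l x) = G k x" for x
      unfolding \<phi>_def G_def using pl(3,4) by (simp add: min_absorb2 max_absorb2)
    \<comment> \<open>\<open>Q (r n)\<close> was chosen for the longer product
      \<open>G (r n)\<close>, which lies below \<open>G k\<close> once r n \<ge> k.\<close>
    have "1 - e \<le> (\<integral>\<omega>. G k (path \<omega>) \<partial>Q (r n))" if "n \<ge> k" for n
    proof -
      have "k \<le> r n" using seq_suble[OF r, of n] that by simp
      have QP: "Q (r n) \<in> PP" using Q by simp
      have "(\<integral>\<omega>. G (r n) (path \<omega>) \<partial>Q (r n)) \<le> (\<integral>\<omega>. G k (path \<omega>) \<partial>Q (r n))"
        by (rule integral_mono)
          (use G01 Gm[OF \<open>k \<le> r n\<close>] in \<open>auto intro!: H_bounded_integrable[OF QP L1_H[OF GL1], where B=1]\<close>)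
      then show ?thesis using Q order_trans by blast
    qed
    then show ?thesis
      by (intro LIMSEQ_le_const[OF l[unfolded \<phi>]]) auto
  qed
  \<comment> \<open>A positive product has positive factors, and each positive factor forces the
    event of its window. As \<open>G k \<le> 1\<close>, its integral bounds the measure of this set
    from below.\<close>
  define A where "A k = {\<omega> \<in> space P. 0 < G k (path \<omega>)}" for k
  have Gmeas: "(\<lambda>\<omega>. G k (path \<omega>)) \<in> borel_measurable P" for k
    by (rule H_measurable_PP[OF P L1_H[OF GL1]])
  have A: "A k \<in> sets P" for k
    unfolding A_def using Gmeas by measurable
  have mA: "1 - e \<le> measure P (A (Suc k))" for k
  proof -
    have "(\<integral>\<omega>. G (Suc k) (path \<omega>) \<partial>P) \<le> (\<integral>\<omega>. indicat_real (A (Suc k)) \<omega> \<partial>P)"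
    proof (rule integral_mono)
      show "integrable P (\<lambda>\<omega>. G (Suc k) (path \<omega>))"
        by (rule H_bounded_integrable[OF P L1_H[OF GL1], where B=1]) (use G01 in auto)
      show "integrable P (indicat_real (A (Suc k)))"
        using A by (simp add: integrable_indicator_iff emeasure_eq_measure)
      show "G (Suc k) (path \<omega>) \<le> indicat_real (A (Suc k)) \<omega>" if "\<omega> \<in> space P" for \<omega>
        using that G01[of "Suc k" "path \<omega>"] by (simp add: A_def indicator_def)
    qed
    also have "\<dots> = measure P (A (Suc k))" using A by simp
    finally show ?thesis using int[of "Suc k"] by simp
  qed
  have dec: "decseq (\<lambda>k. A (Suc k))"
  proof (rule decseq_SucI)
    show "A (Suc (Suc n)) \<subseteq> A (Suc n)" for n
      unfolding A_def using Gm[of "Suc n" "Suc (Suc n)"] by (auto intro: less_le_trans)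
  qed
  have "(\<lambda>k. measure P (A (Suc k))) \<longlonglongrightarrow> measure P (\<Inter>k. A (Suc k))"
    by (rule finite_Lim_measure_decseq[OF _ dec]) (use A in auto)
  then have "1 - e \<le> measure P (\<Inter>k. A (Suc k))"
    by (rule LIMSEQ_le_const) (use mA in auto)
  moreover have "(\<Inter>k. A (Suc k)) \<in> sets P" using A by auto
  moreover have "\<exists>N'\<ge>N. F i N' (path \<omega>)" if "\<omega> \<in> (\<Inter>k. A (Suc k))" for \<omega> i N
  proof -
    \<comment> \<open>This window serves family i, and it starts late enough since
      \<open>N \<le> ?l \<le> Nx ?l\<close>.\<close>
    let ?l = "prod_encode (i, N)"
    have "0 < G (Suc ?l) (path \<omega>)" using that by (auto simp: A_def)
    then have "0 < g ?l (path \<omega>)" using pl(3)[of ?l "path \<omega>"] by (cases "g ?l (path \<omega>) = 0") (auto simp: G_def)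
    then have "F (\<kappa> ?l) (Nx ?l) (path \<omega>)" by (rule pl(6))
    moreover have "N \<le> Nx ?l" using le_prod_encode_2[of N i] Nxl[of ?l] by linarith
    ultimately show ?thesis by (auto simp: \<kappa>_def)
  qed
  ultimately show ?thesis using P by blast
qed

end

section \<open>Iterated logarithms and geometric blocks\<close>

definition LL :: "real \<Rightarrow> real" where
  "LL v = log_e (log_e v)"

lemma log_e_ge_1: "1 \<le> log_e x"
proof -
  have "ln (exp 1) \<le> ln (max (exp 1) x)" by (subst ln_le_cancel_iff) (auto simp: less_max_iff_disj)
  then show ?thesis by (simp add: log_e_def)
qed

lemma log_e_mono: "x \<le> y \<Longrightarrow> log_e x \<le> log_e y"
  unfolding log_e_def by (subst ln_le_cancel_iff) (auto simp: less_max_iff_disj)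

lemma LL_ge_1: "1 \<le> LL v"
  by (simp add: LL_def log_e_ge_1)

lemma LL_mono: "x \<le> y \<Longrightarrow> LL x \<le> LL y"
  unfolding LL_def by (intro log_e_mono)

lemma ln_le_log_e: "0 < x \<Longrightarrow> ln x \<le> log_e x"
  unfolding log_e_def by (subst ln_le_cancel_iff) (auto simp: less_max_iff_disj)

lemma log_e_mult_le:
  assumes "1 \<le> c"
  shows "log_e (c * v) \<le> ln c + log_e v"
proof -
  have p: "0 < max (exp 1) v" by (simp add: less_max_iff_disj)
  have "max (exp 1) (c * v) \<le> c * max (exp 1) v"
  proof (rule max.boundedI)
    have "exp 1 \<le> c * exp (1::real)" using assms by simp
    also have "\<dots> \<le> c * max (exp 1) v" using assms by (intro mult_left_mono) auto
    finally show "exp 1 \<le> c * max (exp 1) v" .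
  qed (use assms in \<open>intro mult_left_mono, auto\<close>)
  then have "log_e (c * v) \<le> ln (c * max (exp 1) v)"
    unfolding log_e_def using assms p by (subst ln_le_cancel_iff) (auto simp: less_max_iff_disj)
  also have "\<dots> = ln c + log_e v" unfolding log_e_def using assms p by (intro ln_mult_pos) auto
  finally show ?thesis .
qed

text \<open>Crude, but 1 + ln c tends to 1 as c decreases to 1, which suffices for comparing norming
  constants within a block.\<close>

lemma LL_mult_le:
  assumes "1 \<le> c"
  shows "LL (c * v) \<le> (1 + ln c) * LL v"
proof -
  have lc: "0 \<le> ln c" using assms by simp
  have "log_e (c * v) \<le> (1 + ln c) * log_e v"
    using log_e_mult_le[OF assms, of v] mult_left_mono[OF log_e_ge_1[of v] lc] by (simp add: algebra_simps)
  then have "LL (c * v) \<le> log_e ((1 + ln c) * log_e v)" unfolding LL_def by (rule log_e_mono)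
  also have "\<dots> \<le> ln (1 + ln c) + LL v" unfolding LL_def by (rule log_e_mult_le) (use lc in simp)
  also have "\<dots> \<le> ln c + LL v" using ln_add_one_self_le_self[OF lc] by simp
  also have "\<dots> \<le> (1 + ln c) * LL v"
    using mult_left_mono[OF LL_ge_1[of v] lc] by (simp add: algebra_simps)
  finally show ?thesis .
qed

text \<open>Monotonicity of \<open>LL x / x\<close> without division. It makes s / t, and with it
  the truncation levels \<open>h \<alpha> n\<close>, nondecreasing.\<close>

lemma LL_ratio_mono:
  assumes "0 \<le> x" "x \<le> y"
  shows "x * LL y \<le> y * LL x"
proof -
  define z where "z = exp (exp (1::real))"
  have LLz: "LL u = 1" if "u \<le> z" for u
  proof -
    have "log_e u \<le> exp 1"
    proof -
      have "exp 1 \<le> exp (exp (1::real))" by simp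
      then have "max (exp 1) u \<le> exp (exp 1)" using that by (simp add: z_def)
      then have "ln (max (exp 1) u) \<le> ln (exp (exp 1))"
        by (subst ln_le_cancel_iff) (auto simp: less_max_iff_disj)
      then show ?thesis by (simp add: log_e_def)
    qed
    then show ?thesis unfolding LL_def by (simp add: log_e_def[of "log_e u"] max_def)
  qed
  have LLln: "LL u = ln (ln u)" "exp 1 \<le> ln u" if "z \<le> u" for u
  proof -
    have u: "0 < u" using that unfolding z_def by (rule less_le_trans[OF exp_gt_zero])
    show 1: "exp 1 \<le> ln u" using that u unfolding z_def by (simp add: ln_ge_iff)
    have "exp 1 \<le> z" unfolding z_def by (simp add: exp_le_cancel_iff)
    then have "log_e u = ln u" using that by (simp add: log_e_def max_def)
    then show "LL u = ln (ln u)" using 1 by (simp add: LL_def log_e_def max_def)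
  qed
  show ?thesis
  proof (cases "y \<le> z")
    case True
    then show ?thesis using assms by (simp add: LLz)
  next
    case False
    \<comment> \<open>Up to z = exp (exp 1) the function \<open>LL\<close> equals 1, so x may be
      raised to z; beyond z it is ln (ln x), and \<open>ln_diff_le\<close> is applied twice.\<close>
    define x' where "x' = max x z"
    have x': "z \<le> x'" "x' \<le> y" "x \<le> x'" using assms False by (auto simp: x'_def)
    have pos: "0 < x'" using x'(1) unfolding z_def by (rule less_le_trans[OF exp_gt_zero])
    have LLx: "LL x' = LL x" using LLz[of x] LLz[of z] by (auto simp: x'_def max_def)
    have l1: "1 \<le> ln x'" using LLln(2)[OF x'(1)] by (rule order_trans[rotated]) simp
    have ly: "ln x' \<le> ln y" using x' pos by simp
    have "ln (ln y) - ln (ln x') \<le> (ln y - ln x') / ln x'"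
      using l1 ly by (intro ln_diff_le) linarith+
    also have "\<dots> \<le> (ln y - ln x') / 1" using l1 ly by (intro divide_left_mono) auto
    also have "\<dots> \<le> ln y - ln x'" by simp
    also have "\<dots> \<le> (y - x') / x'" using x' pos by (intro ln_diff_le) auto
    finally have "x' * (LL y - LL x') \<le> y - x'"
      using pos x' False by (simp add: LLln field_simps)
    moreover have "(y - x') * 1 \<le> (y - x') * LL x'" using x' LL_ge_1 by (intro mult_left_mono) auto
    ultimately have "x' * LL y \<le> y * LL x'" by (simp add: algebra_simps)
    moreover have "x * LL y \<le> x' * LL y" using x' LL_ge_1[of y] by (intro mult_right_mono) auto
    ultimately show ?thesis by (simp add: LLx)
  qed
qed

lemma exp_LL: "exp (- r * LL v) \<le> log_e v powr - r" if "0 \<le> r"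
proof -
  have "ln (log_e v) \<le> LL v" unfolding LL_def using log_e_ge_1[of v] by (intro ln_le_log_e) simp
  then have "- r * LL v \<le> - r * ln (log_e v)" using that by (simp add: mult_left_mono)
  then show ?thesis using log_e_ge_1[of v] by (simp add: powr_def)
qed

lemma LL_le_powr:
  assumes "0 < b"
  shows "LL v \<le> (1 + 1 / b) * log_e v powr b"
proof -
  let ?y = "log_e v"
  have y: "1 \<le> ?y" by (rule log_e_ge_1)
  have "LL v \<le> 1 + ln ?y"
    unfolding LL_def log_e_def[of "log_e v"] using y by (auto simp: max_def)
  also have "ln ?y \<le> ?y powr b / b" by (rule ln_powr_bound[OF y assms])
  also have "1 \<le> ?y powr b" using y assms by (intro ge_one_powr_ge_zero) auto
  finally show ?thesis by (simp add: algebra_simps)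
qed

text \<open>Makes powers of t negligible against the divergence in condition (iii); used to discard
  the bad blocks in \<open>good_not_summable\<close>.\<close>

lemma t_powr_le:
  assumes "0 < e" "0 < Q"
  shows "\<exists>C>0. \<forall>v. sqrt (2 * LL v) powr Q \<le> C * log_e v powr e"
proof -
  \<comment> \<open>Chosen so that the power Q / 2 of \<open>log_e v powr b\<close> has exponent
    e.\<close>
  define b where "b = 2 * e / Q"
  have b: "0 < b" using assms by (simp add: b_def)
  define C where "C = (2 * (1 + 1 / b)) powr (Q / 2)"
  have "sqrt (2 * LL v) powr Q \<le> C * log_e v powr e" for v
  proof -
    have "sqrt (2 * LL v) powr Q = (2 * LL v) powr (Q / 2)"
      using LL_ge_1[of v] by (simp add: powr_half_sqrt[symmetric] powr_powr)
    also have "\<dots> \<le> (2 * ((1 + 1 / b) * log_e v powr b)) powr (Q / 2)"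
      using LL_le_powr[OF b, of v] LL_ge_1[of v] assms by (intro powr_mono2) auto
    also have "\<dots> = C * (log_e v powr b) powr (Q / 2)"
      unfolding C_def using b by (subst powr_mult[symmetric]) (auto simp: mult.assoc[symmetric])
    also have "(log_e v powr b) powr (Q / 2) = log_e v powr e"
      using assms by (simp add: powr_powr b_def)
    finally show ?thesis .
  qed
  moreover have "0 < 2 * (1 + 1 / b)" using b by (simp add: add_pos_pos)
  then have "0 < C" unfolding C_def by simp
  ultimately show ?thesis by blast
qed

text \<open>Serves to interchange summations: an index of variance x contributes to every block k
  with x < c^(k + 1). From the first such k on the weights are dominated by c, 1, 1 / c, and so on,
  of sum c^2 / (c - 1).\<close>

lemma geometric_tail_sum:
  fixes c x :: real
  assumes c: "1 < c" and x: "0 \<le> x"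
  shows "(\<Sum>k<m. if x < c ^ Suc k then x / c ^ k else 0) \<le> c\<^sup>2 / (c - 1)"
proof (cases "\<exists>k. x < c ^ Suc k")
  case False
  then have "(\<Sum>k<m. if x < c ^ Suc k then x / c ^ k else 0) = 0" by simp
  then show ?thesis using c by simp
next
  case True
  define k0 where "k0 = (LEAST k. x < c ^ Suc k)"
  have k0: "x < c ^ Suc k0" unfolding k0_def using True by (rule LeastI_ex)
  have le: "(if x < c ^ Suc k then x / c ^ k else 0) \<le> (if k0 \<le> k then c * (1 / c) ^ (k - k0) else 0)" for k
  proof (cases "x < c ^ Suc k")
    case True
    then have kk: "k0 \<le> k" unfolding k0_def by (rule Least_le)
    have "x / c ^ k \<le> c ^ Suc k0 / c ^ k" using k0 c by (intro divide_right_mono) auto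
    also have "\<dots> = c * (1 / c) ^ (k - k0)"
      using kk c by (simp add: power_diff power_one_over divide_simps)
    finally show ?thesis using True kk by simp
  qed (use c in simp)
  have "(\<Sum>k<m. if x < c ^ Suc k then x / c ^ k else 0) \<le> (\<Sum>k<m. if k0 \<le> k then c * (1 / c) ^ (k - k0) else 0)"
    by (intro sum_mono le)
  also have "\<dots> \<le> (\<Sum>j<m. c * (1 / c) ^ j)"
  proof -
    have "(\<Sum>k<m. if k0 \<le> k then c * (1 / c) ^ (k - k0) else 0) = (\<Sum>k\<in>{k0..<m}. c * (1 / c) ^ (k - k0))"
      by (rule sum.mono_neutral_cong_right) auto
    also have "\<dots> = (\<Sum>j<m - k0. c * (1 / c) ^ j)"
      by (rule sum.reindex_bij_witness[of _ "\<lambda>j. k0 + j" "\<lambda>k. k - k0"]) auto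
    also have "\<dots> \<le> (\<Sum>j<m. c * (1 / c) ^ j)" using c by (intro sum_mono2) auto
    finally show ?thesis .
  qed
  also have "\<dots> \<le> (\<Sum>j. c * (1 / c) ^ j)"
    using c by (intro sum_le_suminf summable_mult summable_geometric) auto
  also have "\<dots> = c * (1 / (1 - 1 / c))"
    using c by (subst suminf_mult) (auto simp: suminf_geometric summable_geometric)
  also have "\<dots> = c\<^sup>2 / (c - 1)" using c by (simp add: field_simps power2_eq_square)
  finally show ?thesis .
qed

text \<open>\<open>last r\<close> is the last index at which the variance is below \<open>r\<close>.\<close>

locale variance_clock =
  fixes v :: "nat \<Rightarrow> real"
  assumes v0: "v 0 = 0" and v_mono: "m \<le> n \<Longrightarrow> v m \<le> v n" and v_unbounded: "\<exists>n. r \<le> v n"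
begin

definition last :: "real \<Rightarrow> nat" where
  "last r = (LEAST n. r \<le> v (Suc n))"

definition t :: "nat \<Rightarrow> real" where "t n = sqrt (2 * LL (v n))"
definition s :: "nat \<Rightarrow> real" where "s n = sqrt (v n)"
definition a :: "nat \<Rightarrow> real" where "a n = s n * t n"

text \<open>The working form of the definition. With r > 0 the index 0, where the variance is 0,
  lies below the level.\<close>

lemma le_last_iff:
  assumes "0 < r"
  shows "n \<le> last r \<longleftrightarrow> v n < r"
proof -
  obtain m where m: "r \<le> v m" using v_unbounded by blast
  then have "m \<noteq> 0" using assms v0 by (cases m) auto
  with m have "r \<le> v (Suc (m - 1))" by simp
  then have L: "r \<le> v (Suc (last r))" unfolding last_def by (rule LeastI)
  show ?thesis
  proof
    assume n: "n \<le> last r"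
    show "v n < r"
    proof (cases n)
      case 0 then show ?thesis using assms v0 by simp
    next
      case (Suc k)
      then have "k < last r" using n by simp
      then show ?thesis using not_less_Least[of k "\<lambda>n. r \<le> v (Suc n)"] Suc by (simp add: last_def)
    qed
  next
    assume "v n < r"
    then show "n \<le> last r" using L v_mono[of "Suc (last r)" n] by (cases "n \<le> last r") auto
  qed
qed

lemma v_last: "0 < r \<Longrightarrow> v (last r) < r"
  using le_last_iff[of r "last r"] by simp

lemma last_mono: "0 < r \<Longrightarrow> r \<le> r' \<Longrightarrow> last r \<le> last r'"
  using le_last_iff[of r' "last r"] v_last[of r] by simp

lemma v_nonneg: "0 \<le> v n"
  using v_mono[of 0 n] v0 by simp

lemma t_ge_1: "1 \<le> t n"
  using LL_ge_1[of "v n"] by (simp add: t_def)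

lemma t_square: "(t n)\<^sup>2 = 2 * LL (v n)"
  using LL_ge_1[of "v n"] by (simp add: t_def)

lemma s_square: "(s n)\<^sup>2 = v n"
  by (simp add: s_def v_nonneg)

lemma s_nonneg: "0 \<le> s n"
  by (simp add: s_def v_nonneg)

lemma a_nonneg: "0 \<le> a n"
  using t_ge_1[of n] by (simp add: a_def s_nonneg)

lemma s_pos: "0 < v n \<Longrightarrow> 0 < s n"
  by (simp add: s_def)

lemma a_pos: "0 < v n \<Longrightarrow> 0 < a n"
  using t_ge_1[of n] s_pos[of n] by (simp add: a_def)

lemma a_square: "(a n)\<^sup>2 = 2 * v n * LL (v n)"
  by (simp add: a_def power_mult_distrib s_square t_square)

lemma a_mono: "m \<le> n \<Longrightarrow> a m \<le> a n"
  unfolding a_def s_def t_def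
  using v_mono LL_mono[OF v_mono] v_nonneg LL_ge_1
  by (intro mult_mono) (auto simp: real_sqrt_le_iff intro: order_trans[of 0 1])

lemma s_div_t_mono:
  assumes "m \<le> n"
  shows "s m / t m \<le> s n / t n"
proof -
  have "v m * (2 * LL (v n)) \<le> v n * (2 * LL (v m))"
    using LL_ratio_mono[OF v_nonneg v_mono[OF assms]] by simp
  then have "sqrt (v m * (2 * LL (v n))) \<le> sqrt (v n * (2 * LL (v m)))" by (rule real_sqrt_le_mono)
  then have "s m * t n \<le> s n * t m" by (simp only: s_def t_def real_sqrt_mult)
  then show ?thesis using t_ge_1[of m] t_ge_1[of n] by (simp add: field_simps)
qed

text \<open>The quotient is at most 1, so the exponent may be lowered to 2; then
  \<open>a_square\<close> and the monotonicity of \<open>LL\<close> leave the quotient of variances,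
  which decays geometrically over blocks.\<close>

lemma a_ratio:
  assumes "0 < v i" "i \<le> N" "2 \<le> Q"
  shows "(a i / a N) powr Q \<le> v i / v N"
proof -
  have pos: "0 < v N" "0 < a i" "0 < a N" using assms v_mono[OF assms(2)] a_pos by auto
  have le1: "a i / a N \<le> 1" using a_mono[OF assms(2)] pos by simp
  have "(a i / a N) powr Q \<le> (a i / a N) powr 2"
    using le1 pos assms by (intro powr_mono') auto
  also have "\<dots> = (v i * LL (v i)) / (v N * LL (v N))"
    using pos by (simp add: powr_numeral power_divide a_square)
  also have "\<dots> \<le> v i / v N"
    using pos assms(1) LL_mono[OF v_mono[OF assms(2)]] LL_ge_1[of "v i"]
    by (simp add: field_simps mult_left_mono)
  finally show ?thesis .
qed

text \<open>The block \<open>k\<close> consists of the indices with \<open>c ^ k \<le> v n < c ^ Suc k\<close>; \<open>hit c k\<close> says that it is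
  not empty.\<close>

definition block_end :: "real \<Rightarrow> nat \<Rightarrow> nat" where
  "block_end c k = last (c ^ Suc k)"

definition hit :: "real \<Rightarrow> nat \<Rightarrow> bool" where
  "hit c k \<longleftrightarrow> c ^ k \<le> v (block_end c k)"

lemma v_block_end: "1 < c \<Longrightarrow> v (block_end c k) < c ^ Suc k"
  unfolding block_end_def by (rule v_last) simp

lemma le_block_end_iff: "1 < c \<Longrightarrow> n \<le> block_end c k \<longleftrightarrow> v n < c ^ Suc k"
  unfolding block_end_def by (rule le_last_iff) simp

lemma block_end_mono: "1 < c \<Longrightarrow> j \<le> k \<Longrightarrow> block_end c j \<le> block_end c k"
  unfolding block_end_def by (rule last_mono) (auto intro: power_increasing)

lemma log_e_block_end_ge: "1 < c \<Longrightarrow> hit c k \<Longrightarrow> real k * ln c \<le> log_e (v (block_end c k))"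
proof -
  assume c: "1 < c" and k: "hit c k"
  have "real k * ln c = ln (c ^ k)" using c by (simp add: ln_realpow)
  also have "\<dots> \<le> log_e (c ^ k)" using c by (intro ln_le_log_e) simp
  also have "\<dots> \<le> log_e (v (block_end c k))" using k unfolding hit_def by (rule log_e_mono)
  finally show ?thesis .
qed

lemma log_e_le_block: "1 < c \<Longrightarrow> v n < c ^ Suc k \<Longrightarrow> log_e (v n) \<le> (1 + ln c) * real (Suc k)"
proof -
  assume c: "1 < c" and n: "v n < c ^ Suc k"
  have lc: "0 \<le> ln c" using c by simp
  have "log_e (v n) \<le> log_e (c ^ Suc k * 1)" using n by (intro log_e_mono) simp
  also have "\<dots> \<le> ln (c ^ Suc k) + log_e 1"
    using c by (intro log_e_mult_le one_le_power) simp
  also have "\<dots> = real (Suc k) * ln c + 1"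
    using c by (simp only: ln_realpow) (simp add: log_e_def max_def)
  also have "\<dots> \<le> (1 + ln c) * real (Suc k)" using lc by (simp add: algebra_simps)
  finally show ?thesis .
qed

text \<open>Telescoping turns the series of condition (ii) into a bound for the moments at the block ends:
  \<open>l n powr (d + 1)\<close> grows by at most \<open>(d + 1) * l n powr d * g n\<close>, and the norming at the block ends
  grows geometrically.\<close>

lemma block_moment_summable:
  fixes g l :: "nat \<Rightarrow> real" and p d c :: real
  assumes c: "1 < c" and p: "2 \<le> p" and d: "0 \<le> d" and n0: "0 < v n0"
    and g: "\<And>n. 0 \<le> g n" and l: "\<And>n. 0 \<le> l n" and l0: "l n0 = 0"
    and step: "\<And>n. n0 \<le> n \<Longrightarrow> l (Suc n) \<le> l n + g (Suc n)"
    and sum: "summable (\<lambda>n. if n0 < n then g n / a n powr p * (l n / a n powr p) powr d else 0)"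
  shows "summable (\<lambda>k. if hit c k \<and> n0 < block_end c k
    then (l (block_end c k) / a (block_end c k) powr p) powr (d + 1) else 0)"
proof -
  \<comment> \<open>The exponent of the norming in the (d + 1)-st power of
    \<open>l / a powr p\<close>.\<close>
  define Q where "Q = p * (d + 1)"
  have "2 * 1 \<le> p * (d + 1)" using p d by (intro mult_mono) auto
  then have Q: "2 \<le> Q" by (simp add: Q_def)
  \<comment> \<open>The factor d + 1 comes from the derivative of x^(d + 1):
    \<open>b n * a n powr Q\<close> bounds the increment of \<open>l powr (d + 1)\<close>.\<close>
  define b where "b n = (if n0 < n then (d + 1) * (g n / a n powr p * (l n / a n powr p) powr d) else 0)" for n
  have b0: "0 \<le> b n" for n using g d by (simp add: b_def)
  have bsum: "summable b"
  proof -
    have "b = (\<lambda>n. (d + 1) * (if n0 < n then g n / a n powr p * (l n / a n powr p) powr d else 0))"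
      by (simp add: b_def fun_eq_iff)
    then show ?thesis using summable_mult[OF sum, of "d + 1"] by simp
  qed
  have vpos: "0 < v n" if "n0 < n" for n using n0 v_mono[of n0 n] that by simp
  have apos: "0 < a n" if "n0 < n" for n using a_pos[OF vpos[OF that]] .
  have bQ: "b n * a n powr Q = (d + 1) * l n powr d * g n" if n: "n0 < n" for n
  proof -
    have "(l n / a n powr p) powr d = l n powr d / a n powr (p * d)"
      using l apos[OF n] by (simp add: powr_divide powr_powr)
    moreover have "a n powr Q = a n powr p * a n powr (p * d)"
      by (simp add: Q_def powr_add[symmetric] algebra_simps)
    ultimately show ?thesis using n apos[OF n] by (simp add: b_def field_simps)
  qed
  have tele: "l n powr (d + 1) \<le> (\<Sum>i\<in>{n0<..n}. b i * a i powr Q)" if "n0 \<le> n" for n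
    using that
  proof (induction n rule: dec_induct)
    case base
    show ?case by (simp add: l0)
  next
    case (step n)
    \<comment> \<open>Increments of \<open>l\<close> are bounded from above only; where
      \<open>l\<close> decreases, so does its power.\<close>
    have "l (Suc n) powr (d + 1) \<le> l n powr (d + 1) + b (Suc n) * a (Suc n) powr Q"
    proof (cases "l n \<le> l (Suc n)")
      case True
      have "l (Suc n) powr (d + 1) - l n powr (d + 1) \<le> (d + 1) * l (Suc n) powr (d + 1 - 1) * (l (Suc n) - l n)"
        by (rule powr_diff_le) (use l True d in auto)
      also have "\<dots> \<le> (d + 1) * l (Suc n) powr (d + 1 - 1) * g (Suc n)"
        using assms(8)[OF step.hyps(1)] d by (intro mult_left_mono) auto
      finally show ?thesis using bQ[of "Suc n"] step.hyps by simp
    next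
      case False
      then have "l (Suc n) powr (d + 1) \<le> l n powr (d + 1)" using l d by (intro powr_mono2) auto
      then show ?thesis using b0[of "Suc n"] by (simp add: add_increasing2)
    qed
    moreover have "{n0<..Suc n} = insert (Suc n) {n0<..n}" using step.hyps by auto
    ultimately show ?case using step.IH by simp
  qed
  define f where "f k = (if hit c k \<and> n0 < block_end c k
    then (l (block_end c k) / a (block_end c k) powr p) powr (d + 1) else 0)" for k
  have f0: "0 \<le> f k" for k by (simp add: f_def)
  define C where "C = c\<^sup>2 / (c - 1)"
  \<comment> \<open>The restriction v i < c^(k + 1) encodes i \<le> \<open>block_end c k\<close> and
    makes the range of summation the same for all k \<le> m, ready for the interchange.\<close>
  have fk: "f k \<le> (\<Sum>i\<in>{n0<..block_end c m}. b i * (if v i < c ^ Suc k then v i / c ^ k else 0))"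
    if km: "k \<le> m" for k m
  proof (cases "hit c k \<and> n0 < block_end c k")
    case True
    let ?N = "block_end c k"
    have N: "n0 < ?N" and h: "c ^ k \<le> v ?N" using True by (auto simp: hit_def)
    have "f k = l ?N powr (d + 1) / a ?N powr Q"
      using True l apos[OF N] by (simp add: f_def powr_divide powr_powr Q_def)
    also have "\<dots> \<le> (\<Sum>i\<in>{n0<..?N}. b i * a i powr Q) / a ?N powr Q"
      using tele[of ?N] N by (intro divide_right_mono) auto
    also have "\<dots> = (\<Sum>i\<in>{n0<..?N}. b i * (a i / a ?N) powr Q)"
      unfolding sum_divide_distrib
      using apos apos[OF N] by (intro sum.cong refl) (simp add: powr_divide less_imp_le)
    also have "\<dots> \<le> (\<Sum>i\<in>{n0<..?N}. b i * (if v i < c ^ Suc k then v i / c ^ k else 0))"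
    proof (rule sum_mono)
      fix i assume i: "i \<in> {n0<..?N}"
      have "(a i / a ?N) powr Q \<le> v i / v ?N" by (rule a_ratio) (use i vpos Q in auto)
      also have "\<dots> \<le> v i / c ^ k"
        using h c v_nonneg vpos[OF N] by (intro divide_left_mono mult_pos_pos) auto
      finally have "(a i / a ?N) powr Q \<le> (if v i < c ^ Suc k then v i / c ^ k else 0)"
        using le_block_end_iff[OF c, of i k] i by simp
      then show "b i * (a i / a ?N) powr Q \<le> b i * (if v i < c ^ Suc k then v i / c ^ k else 0)"
        by (rule mult_left_mono[OF _ b0])
    qed
    also have "\<dots> \<le> (\<Sum>i\<in>{n0<..block_end c m}. b i * (if v i < c ^ Suc k then v i / c ^ k else 0))"
      using block_end_mono[OF c km] c b0 v_nonneg by (intro sum_mono2) auto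
    finally show ?thesis .
  next
    case False
    then have "f k = 0" unfolding f_def by (rule if_not_P)
    then show ?thesis using b0 v_nonneg c by (auto intro!: sum_nonneg mult_nonneg_nonneg)
  qed
  have "summable f"
  proof (rule summableI_nonneg_bounded[OF f0])
    fix m
    have "(\<Sum>k<m. f k) \<le> (\<Sum>k<m. \<Sum>i\<in>{n0<..block_end c m}. b i * (if v i < c ^ Suc k then v i / c ^ k else 0))"
      by (intro sum_mono fk) auto
    also have "\<dots> = (\<Sum>i\<in>{n0<..block_end c m}. b i * (\<Sum>k<m. if v i < c ^ Suc k then v i / c ^ k else 0))"
      by (subst sum.swap) (simp only: sum_distrib_left)
    also have "\<dots> \<le> (\<Sum>i\<in>{n0<..block_end c m}. b i * C)"
      unfolding C_def by (intro sum_mono mult_left_mono geometric_tail_sum c v_nonneg b0)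
    also have "\<dots> = (\<Sum>i\<in>{n0<..block_end c m}. b i) * C" by (simp add: sum_distrib_right)
    also have "\<dots> \<le> suminf b * C"
      using c by (intro mult_right_mono sum_le_suminf bsum) (auto simp: C_def b0)
    finally show "(\<Sum>k<m. f k) \<le> suminf b * C" .
  qed
  then show ?thesis unfolding f_def[abs_def] .
qed

text \<open>In block k a summand is at most a constant times (k + 1)^(\<delta> - 1) * (v n - v (n -
  1)) / c^k, and the increments of the block telescope to less than c^(k + 1). Read backwards,
  condition (iii) makes the sum over nonempty blocks diverge.\<close>

lemma hit_sum_bound:
  assumes c: "1 < c" and \<delta>: "0 < \<delta>" "\<delta> < 1"
    and sum: "summable (\<lambda>k. if hit c k then real (Suc k) powr (\<delta> - 1) else 0)"
  shows "\<exists>B. \<forall>m. (\<Sum>n=1..m. 1 / v n * log_e (v n) powr (\<delta> - 1) * (v n - v (n - 1))) \<le> B"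
proof -
  define u where "u n = 1 / v n * log_e (v n) powr (\<delta> - 1) * (v n - v (n - 1))" for n
  have u0: "0 \<le> u n" for n
    unfolding u_def using v_nonneg[of n] v_mono[of "n - 1" n] by simp
  define g where "g k = (if hit c k then real (Suc k) powr (\<delta> - 1) else 0)" for k
  \<comment> \<open>Gives a lower bound w * (k + 1) for \<open>log_e (v n)\<close> that also covers
    k = 0, where k * ln c vanishes and \<open>log_e_ge_1\<close> takes over.\<close>
  define w where "w = min 1 (ln c) / 2"
  have w: "0 < w" using c by (simp add: w_def)
  define C where "C = c * w powr (\<delta> - 1)"
  have block: "(\<Sum>n\<in>{last (c ^ k)<..block_end c k}. u n) \<le> C * g k" for k
  proof (cases "hit c k")
    case False
    then have "block_end c k \<le> last (c ^ k)" using le_last_iff[of "c ^ k" "block_end c k"] c by (simp add: hit_def)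
    then show ?thesis using False by (simp add: g_def)
  next
    case True
    let ?N = "block_end c k" and ?M = "last (c ^ k)"
    have MN: "?M \<le> ?N" unfolding block_end_def using c by (intro last_mono) auto
    have "u n \<le> (w * real (Suc k)) powr (\<delta> - 1) / c ^ k * (v n - v (n - 1))" if n: "n \<in> {?M<..?N}" for n
    proof -
      have vn: "c ^ k \<le> v n" using n le_last_iff[of "c ^ k" n] c by simp
      have "real k * ln c = ln (c ^ k)" using c by (simp add: ln_realpow)
      also have "\<dots> \<le> log_e (c ^ k)" using c by (intro ln_le_log_e) simp
      also have "\<dots> \<le> log_e (v n)" using vn by (rule log_e_mono)
      finally have "real k * ln c \<le> log_e (v n)" .
      moreover have "w * real (Suc k) \<le> max 1 (real k * ln c)"
      proof -
        have "w * real k \<le> (ln c / 2) * real k" by (intro mult_right_mono) (auto simp: w_def)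
        moreover have "w \<le> 1 / 2" by (simp add: w_def)
        ultimately have "w * real (Suc k) \<le> (real k * ln c) / 2 + 1 / 2" by (simp add: algebra_simps)
        then show ?thesis by linarith
      qed
      ultimately have "w * real (Suc k) \<le> log_e (v n)" using log_e_ge_1[of "v n"] by simp
      then have "log_e (v n) powr (\<delta> - 1) \<le> (w * real (Suc k)) powr (\<delta> - 1)"
        using w \<delta> by (intro powr_mono2') auto
      moreover have "0 < c ^ k" using c by simp
      then have "1 / v n \<le> 1 / c ^ k" using vn by (intro divide_left_mono mult_pos_pos) auto
      ultimately have "1 / v n * log_e (v n) powr (\<delta> - 1) \<le> 1 / c ^ k * (w * real (Suc k)) powr (\<delta> - 1)"
        using c by (intro mult_mono) auto
      then show ?thesis unfolding u_def using v_mono[of "n - 1" n]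
        by (intro mult_right_mono) (auto simp: mult.commute)
    qed
    then have "(\<Sum>n\<in>{?M<..?N}. u n) \<le> (\<Sum>n\<in>{?M<..?N}. (w * real (Suc k)) powr (\<delta> - 1) / c ^ k * (v n - v (n - 1)))"
      by (rule sum_mono)
    also have "\<dots> = (w * real (Suc k)) powr (\<delta> - 1) / c ^ k * (\<Sum>n\<in>{?M<..?N}. v n - v (n - 1))"
      by (simp add: sum_distrib_left)
    also have "(\<Sum>n\<in>{?M<..?N}. v n - v (n - 1)) = v ?N - v ?M"
    proof -
      have "(\<Sum>n\<in>{m<..N}. v n - v (n - 1)) = v N - v m" if "m \<le> N" for m N
        using that
      proof (induction N rule: dec_induct)
        case (step N)
        have "{m<..Suc N} = insert (Suc N) {m<..N}" using step.hyps by auto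
        then show ?case using step.IH by simp
      qed simp
      then show ?thesis using MN .
    qed
    also have "(w * real (Suc k)) powr (\<delta> - 1) / c ^ k * (v ?N - v ?M) \<le> (w * real (Suc k)) powr (\<delta> - 1) / c ^ k * c ^ Suc k"
      using v_block_end[OF c, of k] v_nonneg[of ?M] c by (intro mult_left_mono) auto
    also have "\<dots> = C * g k" using True w c by (simp add: C_def g_def powr_mult)
    finally show ?thesis .
  qed
  have part: "(\<Sum>n=1..last (c ^ k). u n) \<le> (\<Sum>n=1..last 1. u n) + C * (\<Sum>j<k. g j)" for k
  proof (induction k)
    case (Suc k)
    have le: "last (c ^ k) \<le> block_end c k" unfolding block_end_def using c by (intro last_mono) auto
    have "{1..last (c ^ Suc k)} = {1..last (c ^ k)} \<union> {last (c ^ k)<..block_end c k}"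
      using le by (auto simp: block_end_def)
    moreover have "(\<Sum>n\<in>{1..last (c ^ k)} \<union> {last (c ^ k)<..block_end c k}. u n)
        = (\<Sum>n=1..last (c ^ k). u n) + (\<Sum>n\<in>{last (c ^ k)<..block_end c k}. u n)"
      by (rule sum.union_disjoint) auto
    ultimately show ?case using Suc block[of k] by (simp add: algebra_simps)
  qed simp
  have C0: "0 \<le> C" using c by (simp add: C_def)
  have gs: "(\<Sum>j<k. g j) \<le> suminf g" for k
    by (rule sum_le_suminf) (use sum in \<open>auto simp: g_def[abs_def]\<close>)
  have "(\<Sum>n=1..m. u n) \<le> (\<Sum>n=1..last 1. u n) + C * suminf g" for m
  proof -
    obtain k where k: "v m < c ^ k" using real_arch_pow[OF c] by blast
    then have "m \<le> last (c ^ k)" using le_last_iff[of "c ^ k" m] c by simp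
    then have "(\<Sum>n=1..m. u n) \<le> (\<Sum>n=1..last (c ^ k). u n)" by (intro sum_mono2) (auto simp: u0)
    also have "\<dots> \<le> (\<Sum>n=1..last 1. u n) + C * suminf g"
      using part[of k] mult_left_mono[OF gs[of k] C0] by linarith
    finally show ?thesis .
  qed
  then show ?thesis unfolding u_def by blast
qed

lemma block_of:
  assumes c: "1 < c" and n: "1 \<le> v n"
  shows "\<exists>k. hit c k \<and> c ^ k \<le> v n \<and> n \<le> block_end c k"
proof -
  define k where "k = (LEAST k. v n < c ^ Suc k)"
  obtain j where "v n < c ^ j" using real_arch_pow[OF c] by blast
  moreover have "c ^ j \<le> c ^ Suc j" using c by (intro power_increasing) auto
  ultimately have "v n < c ^ Suc j" by linarith
  then have k: "v n < c ^ Suc k" unfolding k_def by (rule LeastI)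
  have lo: "c ^ k \<le> v n"
  proof (cases k)
    case (Suc i)
    then have "\<not> v n < c ^ Suc i" using not_less_Least[of i "\<lambda>k. v n < c ^ Suc k"] by (simp add: k_def)
    then show ?thesis using Suc by simp
  qed (use n in simp)
  have le: "n \<le> block_end c k" using k le_block_end_iff[OF c] by simp
  then have "hit c k" using lo v_mono[OF le] by (simp add: hit_def)
  with lo le show ?thesis by blast
qed

end

section \<open>Consequences of the hypotheses\<close>

text \<open>Passes from the extended series of condition (ii) to a real one. An infinite
  \<open>L\<close> and the exponent d = 0 are where the conventions for products and powers
  differ.\<close>

lemma ereal_powr_term_le:
  assumes "0 \<le> G" "0 < w" "0 \<le> x" "ereal x \<le> L" "0 \<le> d"
  shows "ereal (G * w * (x * w) powr d) \<le> ereal G * ereal w * ereal_powr (L * ereal w) d"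
proof (cases L)
  case (real l)
  show ?thesis
  proof (cases "d = 0")
    case True
    \<comment> \<open>For d = 0 the real power is 0 at base 0 while \<open>ereal_powr\<close> is 1,
      so this is an inequality and not an equation.\<close>
    then show ?thesis using assms by (simp add: ereal_powr_def)
  next
    case False
    have "(x * w) powr d \<le> (l * w) powr d" using assms real by (intro powr_mono2 mult_right_mono) auto
    then have "G * w * (x * w) powr d \<le> G * w * (l * w) powr d" using assms by (intro mult_left_mono) auto
    then show ?thesis using False real by (simp add: ereal_powr_def)
  qed
next
  case PInf
  have le1: "(x * w) powr d \<le> 1" if "d = 0" using that by simp
  show ?thesis
  proof (cases "d = 0")
    case True
    have "G * w * (x * w) powr d \<le> G * w * 1" using le1[OF True] assms by (intro mult_left_mono) auto
    then show ?thesis using True by (simp add: ereal_powr_def)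
  next
    case False
    then have "ereal_powr (L * ereal w) d = \<infinity>" using PInf assms by (simp add: ereal_powr_def)
    then show ?thesis using assms by (cases "G = 0") (auto simp: ereal_mult_infty)
  qed
qed (use assms in auto)

locale lil_sequence = L2_sequence M H E X + CC_sequence M H E X PP
  for M :: "'a measure" and H E X PP +
  fixes V :: "'a set \<Rightarrow> real"
  assumes V_cap: "subadditive_capacity M V" and V_C: "property_C M H E V"
    and i: "\<And>\<epsilon>::real. \<epsilon> > 0 \<Longrightarrow>
      (\<Sum>n. ereal (V {\<omega> \<in> space M. \<bar>X (Suc n) \<omega>\<bar> \<ge> \<epsilon> * a_norm E X (Suc n)})) < \<infinity>"
    and ii: "\<And>\<alpha>::real. \<alpha> > 0 \<Longrightarrow> \<exists>p::real. \<exists>d::real. p \<ge> 2 \<and> d \<ge> 0 \<and>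
      (\<Sum>n. Gam E X (Suc n) p \<alpha> * ereal (1 / a_norm E X (Suc n) powr p)
            * ereal_powr (Lam E X (Suc n) p \<alpha> * ereal (1 / a_norm E X (Suc n) powr p)) d) < \<infinity>"
    and iii: "\<And>\<delta>::real. \<delta> > 0 \<Longrightarrow>
      (\<Sum>n. ereal (1 / ss E X (Suc n) * log_e (ss E X (Suc n)) powr (\<delta> - 1))
            * E (\<lambda>\<omega>. (X (Suc n) \<omega>)\<^sup>2)) = \<infinity>"
    and iv: "(\<lambda>n. (\<Sum>j=1..n. \<bar>E (X j)\<bar> + \<bar>conj_expectation E (X j)\<bar>) / ereal (a_norm E X n)) \<longlonglongrightarrow> 0"
begin

lemma E_square: "n \<ge> 1 \<Longrightarrow> E (\<lambda>\<omega>. (X n \<omega>)\<^sup>2) = ereal (q n)"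
  unfolding q_def by (rule E_L1[OF X_square_L1])

lemma ss_eq: "ss E X n = (\<Sum>k=1..n. q k)"
  by (simp add: ss_def q_def rE_def)

lemma iii_partial:
  assumes "\<delta> > 0"
  shows "\<exists>m. B < (\<Sum>n=1..m. 1 / ss E X n * log_e (ss E X n) powr (\<delta> - 1) * q n)"
proof (rule ccontr)
  define u where "u n = 1 / ss E X n * log_e (ss E X n) powr (\<delta> - 1) * q n" for n
  assume "\<not> ?thesis"
  then have B: "(\<Sum>n=1..m. u n) \<le> B" for m unfolding u_def by (simp add: not_less)
  have u0: "0 \<le> u (Suc n)" for n
  proof -
    have "0 \<le> ss E X (Suc n)" unfolding ss_eq by (intro sum_nonneg q_nonneg) auto
    then show ?thesis unfolding u_def using q_nonneg[of "Suc n"] by simp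
  qed
  have "(\<Sum>n. ereal (u (Suc n))) \<le> ereal B"
  proof (rule suminf_bound, intro allI)
    fix m
    have "(\<Sum>n<m. u (Suc n)) = (\<Sum>n=1..m. u n)" by (simp add: sum.atLeast1_atMost_eq)
    then show "(\<Sum>n<m. ereal (u (Suc n))) \<le> ereal B" using B[of m] by simp
  qed (use u0 in simp)
  then show False using iii[OF assms] by (simp add: E_square u_def)
qed

text \<open>Condition (iii) with \<delta> = 1: were the variances bounded, the summands would be at
  most q n / w with w the first positive variance, and the series would converge.\<close>

lemma ss_unbounded: "\<exists>n. r \<le> ss E X n"
proof (rule ccontr)
  assume "\<not> ?thesis"
  then have r: "ss E X n < r" for n by (simp add: not_le)
  have mono: "ss E X m \<le> ss E X n" if "m \<le> n" for m n
    unfolding ss_eq using that by (intro sum_mono2) (auto intro: q_nonneg)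
  have q_le: "q n \<le> ss E X n" if "n \<ge> 1" for n
    unfolding ss_eq using that by (intro member_le_sum) (auto intro: q_nonneg)
  obtain n1 w where w: "0 < w" "\<And>n. n \<ge> 1 \<Longrightarrow> 1 / ss E X n * q n \<le> q n / w"
  proof (cases "\<exists>n. 0 < ss E X n")
    case True
    define n1 where "n1 = (LEAST n. 0 < ss E X n)"
    have n1: "0 < ss E X n1" unfolding n1_def using True by (rule LeastI_ex)
    have "1 / ss E X n * q n \<le> q n / ss E X n1" if "n \<ge> 1" for n
    proof (cases "0 < ss E X n")
      case True
      then have "n1 \<le> n" unfolding n1_def by (rule Least_le)
      then have "q n / ss E X n \<le> q n / ss E X n1"
        using mono n1 True q_nonneg[OF that] by (intro divide_left_mono) auto
      then show ?thesis by simp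
    next
      case False
      then have "q n = 0" using q_le[OF that] q_nonneg[OF that] by linarith
      then show ?thesis by simp
    qed
    then show thesis using that n1 by blast
  next
    case False
    have "q n = 0" if "n \<ge> 1" for n
      using False q_le[OF that] q_nonneg[OF that] by (meson not_le order_antisym order_trans)
    then show thesis using that[of 1] by simp
  qed
  have "(\<Sum>n=1..m. 1 / ss E X n * log_e (ss E X n) powr (1 - 1) * q n) \<le> r / w" for m
  proof -
    have "(\<Sum>n=1..m. 1 / ss E X n * log_e (ss E X n) powr (1 - 1) * q n) \<le> (\<Sum>n=1..m. q n / w)"
    proof (rule sum_mono)
      fix n assume "n \<in> {1..m}"
      moreover have "log_e (ss E X n) powr (1 - 1) = 1"
        using log_e_ge_1[of "ss E X n"] by simp
      ultimately show "1 / ss E X n * log_e (ss E X n) powr (1 - 1) * q n \<le> q n / w" using w(2)[of n] by simp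
    qed
    also have "\<dots> = ss E X m / w" by (simp add: ss_eq sum_divide_distrib)
    also have "\<dots> \<le> r / w" using r[of m] w(1) by (intro divide_right_mono) auto
    finally show ?thesis .
  qed
  then show False using iii_partial[of 1 "r / w"] by (auto simp: not_less[symmetric])
qed

sublocale variance_clock "ss E X"
proof
  show "ss E X m \<le> ss E X n" if "m \<le> n" for m n
    unfolding ss_eq using that by (intro sum_mono2) (auto intro: q_nonneg)
  show "ss E X 0 = 0" by (simp add: ss_def)
  show "\<exists>n. r \<le> ss E X n" for r by (rule ss_unbounded)
qed

lemma s_norm_eq: "s_norm E X = s" and t_norm_eq: "t_norm E X = t" and a_norm_eq: "a_norm E X = a"
  by (simp_all add: fun_eq_iff s_norm_def s_def t_norm_def t_def a_norm_def a_def LL_def)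

abbreviation v :: "nat \<Rightarrow> real" where
  "v \<equiv> ss E X"

lemma sum_q: "(\<Sum>k\<in>{m<..n}. q k) = v n - v m" if "m \<le> n"
proof -
  have "{1..n} = {1..m} \<union> {m<..n}" using that by auto
  then have "(\<Sum>k=1..n. q k) = (\<Sum>k=1..m. q k) + (\<Sum>k\<in>{m<..n}. q k)"
    by (simp only:) (rule sum.union_disjoint, auto)
  then show ?thesis by (simp add: ss_eq)
qed

lemma a_tends: "\<exists>n1. \<forall>n\<ge>n1. r < a n"
proof -
  obtain n1 where n1: "(\<bar>r\<bar> + 1)\<^sup>2 \<le> v n1" using v_unbounded by blast
  have "r < a n" if "n \<ge> n1" for n
  proof -
    have "(\<bar>r\<bar> + 1)\<^sup>2 \<le> (s n)\<^sup>2" using n1 v_mono[OF that] by (simp add: s_square)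
    then have "\<bar>r\<bar> + 1 \<le> s n" using s_nonneg by (rule power2_le_imp_le)
    moreover have "s n * 1 \<le> s n * t n" using t_ge_1 s_nonneg by (intro mult_left_mono)
    ultimately show ?thesis by (simp add: a_def)
  qed
  then show ?thesis by blast
qed

lemma block_end_tends: "1 < c \<Longrightarrow> \<forall>\<^sub>F k in sequentially. n \<le> block_end c k"
proof -
  assume c: "1 < c"
  obtain k0 where k0: "v n < c ^ k0" using real_arch_pow[OF c] by blast
  show ?thesis
    unfolding eventually_sequentially
  proof (intro exI allI impI)
    fix k assume "k0 \<le> k"
    then have "c ^ k0 \<le> c ^ Suc k" using c by (intro power_increasing) auto
    then show "n \<le> block_end c k" using k0 le_block_end_iff[OF c] by simp
  qed
qed

lemma mb_sum_small:
  assumes "0 < \<epsilon>"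
  shows "\<exists>n1. \<forall>n\<ge>n1. (\<Sum>j=1..n. mb j) \<le> \<epsilon> * a n"
proof -
  have eq: "\<bar>E (X j)\<bar> + \<bar>conj_expectation E (X j)\<bar> = ereal (mb j)" if "j \<ge> 1" for j
    using X_L1[OF that] by (simp add: mb_def conj_expectation_def E_L1 L1_uminus)
  have "(\<Sum>j=1..n. \<bar>E (X j)\<bar> + \<bar>conj_expectation E (X j)\<bar>) = ereal (\<Sum>j=1..n. mb j)" for n
    by (simp add: eq)
  then have "(\<lambda>n. ereal (\<Sum>j=1..n. mb j) / ereal (a n)) \<longlonglongrightarrow> 0" using iv by (simp add: a_norm_eq)
  then have "\<forall>\<^sub>F n in sequentially. ereal (\<Sum>j=1..n. mb j) / ereal (a n) < ereal \<epsilon>"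
    by (rule order_tendstoD) (use assms in simp)
  then obtain m1 where m1: "\<And>n. n \<ge> m1 \<Longrightarrow> ereal (\<Sum>j=1..n. mb j) / ereal (a n) < ereal \<epsilon>"
    unfolding eventually_sequentially by blast
  obtain m2 where m2: "\<And>n. n \<ge> m2 \<Longrightarrow> 0 < a n" using a_tends[of 0] by blast
  have "(\<Sum>j=1..n. mb j) \<le> \<epsilon> * a n" if "n \<ge> max m1 m2" for n
    using m1[of n] m2[of n] that by (simp add: divide_less_eq)
  then show ?thesis by blast
qed

text \<open>Condition (i) speaks of \<open>V\<close>, the covers of \<open>V_hat\<close>. A ramp
  between b and 2 * b separates the two, so that property (C) applies; the factor 2 is harmless as
  (i) holds for all \<epsilon>.\<close>

lemma V_hat_tail_le:
  assumes "n \<ge> 1" "0 < b"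
  shows "V_hat M H E {\<omega> \<in> space M. 2 * b \<le> \<bar>X n \<omega>\<bar>} \<le> ereal (V {\<omega> \<in> space M. b \<le> \<bar>X n \<omega>\<bar>})"
proof -
  define g where "g u = max 0 (min 1 ((\<bar>u\<bar> - b) / b))" for u :: real
  have lip: "\<bar>g u - g u'\<bar> \<le> (1 / b) * \<bar>u - u'\<bar>" for u u'
  proof -
    have "\<bar>max 0 (min 1 y) - max 0 (min 1 y')\<bar> \<le> \<bar>y - y'\<bar>" for y y' :: real
      by (auto simp: max_def min_def)
    then have "\<bar>g u - g u'\<bar> \<le> \<bar>(\<bar>u\<bar> - b) / b - (\<bar>u'\<bar> - b) / b\<bar>" unfolding g_def .
    also have "\<dots> = \<bar>\<bar>u\<bar> - \<bar>u'\<bar>\<bar> / b" using assms(2) by (simp add: diff_divide_distrib[symmetric])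
    also have "\<dots> \<le> \<bar>u - u'\<bar> / b" using assms(2) by (intro divide_right_mono) auto
    finally show ?thesis by simp
  qed
  have gL: "(\<lambda>\<omega>. g (X n \<omega>)) \<in> L1" by (rule X_lip_L1[OF assms(1) lip])
  let ?A = "{\<omega> \<in> space M. b \<le> \<bar>X n \<omega>\<bar>}"
  have Xm: "X n \<in> borel_measurable M" using X_H[OF assms(1)] H_measurable by blast
  have A: "?A \<in> sets M" using Xm by measurable
  have "V_hat M H E {\<omega> \<in> space M. 2 * b \<le> \<bar>X n \<omega>\<bar>} \<le> ereal (rE (\<lambda>\<omega>. g (X n \<omega>)))"
    by (rule V_hat_le[OF gL]) (use assms in \<open>auto simp: indicator_def g_def field_simps\<close>)
  also have "\<dots> = E (\<lambda>\<omega>. g (X n \<omega>))" using E_L1[OF gL] by simp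
  also have "\<dots> \<le> ereal (V ?A)"
  proof -
    have "\<forall>\<omega>\<in>space M. g (X n \<omega>) \<le> indicator ?A \<omega> \<and> indicator ?A \<omega> \<le> (1::real)"
      using assms(2) by (auto simp: indicator_def g_def divide_simps)
    then show ?thesis
      using V_C[unfolded property_C_def, rule_format, OF A L1_H[OF gL] H_const[of 1]] by blast
  qed
  finally show ?thesis .
qed

lemma V_hat_le_1: "V_hat M H E A \<le> 1"
  using V_hat_le[OF L1_const[of 1], of A] by (simp add: indicator_def one_ereal_def)

lemma X_measurable: "n \<ge> 1 \<Longrightarrow> X n \<in> borel_measurable M"
  using X_H H_measurable by blast

lemma qs_X_small:
  assumes "0 < \<epsilon>"
  shows "qs (\<lambda>\<omega>. \<forall>\<^sub>F n in sequentially. \<bar>X (Suc n) \<omega>\<bar> < \<epsilon> * a (Suc n))"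
proof -
  \<comment> \<open>The ramp needs a positive level; at the finitely many indices with
    \<open>a (Suc n) = 0\<close> the trivial bound 1 is taken.\<close>
  define r where "r n = (if 0 < a (Suc n) then V {\<omega> \<in> space M. \<epsilon> / 2 * a (Suc n) \<le> \<bar>X (Suc n) \<omega>\<bar>} else 1)" for n
  define B where "B n = {\<omega> \<in> space M. \<epsilon> * a (Suc n) \<le> \<bar>X (Suc n) \<omega>\<bar>}" for n
  have meas: "{\<omega> \<in> space M. b \<le> \<bar>X (Suc n) \<omega>\<bar>} \<in> sets M" for n b
    using X_measurable[of "Suc n"] by measurable
  have sV: "summable (\<lambda>n. V {\<omega> \<in> space M. \<epsilon> / 2 * a (Suc n) \<le> \<bar>X (Suc n) \<omega>\<bar>})"
  proof (rule summable_ereal)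
    show "0 \<le> V {\<omega> \<in> space M. \<epsilon> / 2 * a (Suc n) \<le> \<bar>X (Suc n) \<omega>\<bar>}" for n
      using V_cap meas unfolding subadditive_capacity_def capacity_def by blast
    show "(\<Sum>n. ereal (V {\<omega> \<in> space M. \<epsilon> / 2 * a (Suc n) \<le> \<bar>X (Suc n) \<omega>\<bar>})) \<noteq> \<infinity>"
      using i[of "\<epsilon> / 2"] assms by (simp add: a_norm_eq)
  qed
  have ev: "\<forall>\<^sub>F n in sequentially. r n = V {\<omega> \<in> space M. \<epsilon> / 2 * a (Suc n) \<le> \<bar>X (Suc n) \<omega>\<bar>}"
  proof -
    obtain n1 where n1: "\<forall>n\<ge>n1. 0 < a n" using a_tends[of 0] by blast
    have "r n = V {\<omega> \<in> space M. \<epsilon> / 2 * a (Suc n) \<le> \<bar>X (Suc n) \<omega>\<bar>}" if "n \<ge> n1" for n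
      using n1 that by (simp add: r_def)
    then show ?thesis unfolding eventually_sequentially by blast
  qed
  have "summable r" using sV unfolding summable_cong[OF ev] .
  moreover have "V_hat M H E (B n) \<le> ereal (r n)" for n
  proof (cases "0 < a (Suc n)")
    case True
    have "V_hat M H E (B n) \<le> ereal (V {\<omega> \<in> space M. \<epsilon> / 2 * a (Suc n) \<le> \<bar>X (Suc n) \<omega>\<bar>})"
      using V_hat_tail_le[of "Suc n" "\<epsilon> / 2 * a (Suc n)"] True assms by (simp add: B_def)
    then show ?thesis using True by (simp add: r_def)
  qed (use V_hat_le_1 in \<open>simp add: r_def one_ereal_def\<close>)
  moreover have "B n \<in> sets M" for n unfolding B_def by (rule meas)
  ultimately have "qs (\<lambda>\<omega>. \<forall>\<^sub>F n in sequentially. \<omega> \<notin> B n)" by (intro qs_Borel_Cantelli)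
  then show ?thesis
    by (rule qs_mono) (auto simp: B_def not_le elim: eventually_mono)
qed

text \<open>The norming increases, so the bound for \<open>X j\<close> at its own index persists;
  the finitely many early variables are absorbed because \<open>a n\<close> is unbounded.\<close>

lemma qs_X_uniformly_small:
  assumes "0 < \<epsilon>"
  shows "qs (\<lambda>\<omega>. \<exists>n1. \<forall>n\<ge>n1. \<forall>j\<in>{1..n}. \<bar>X j \<omega>\<bar> < \<epsilon> * a n)"
proof (rule qs_mono[OF qs_X_small[OF assms]])
  fix \<omega> assume "\<forall>\<^sub>F n in sequentially. \<bar>X (Suc n) \<omega>\<bar> < \<epsilon> * a (Suc n)"
  then obtain n2 where n2: "\<And>n. n \<ge> n2 \<Longrightarrow> \<bar>X (Suc n) \<omega>\<bar> < \<epsilon> * a (Suc n)"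
    unfolding eventually_sequentially by blast
  define W where "W = (\<Sum>j=1..n2. \<bar>X j \<omega>\<bar>)"
  obtain n3 where n3: "\<forall>n\<ge>n3. W / \<epsilon> < a n" using a_tends by blast
  show "\<exists>n1. \<forall>n\<ge>n1. \<forall>j\<in>{1..n}. \<bar>X j \<omega>\<bar> < \<epsilon> * a n"
  proof (intro exI allI impI ballI)
    fix n j assume n: "n3 \<le> n" and j: "j \<in> {1..n}"
    show "\<bar>X j \<omega>\<bar> < \<epsilon> * a n"
    proof (cases "j \<le> n2")
      case True
      then have "\<bar>X j \<omega>\<bar> \<le> W" unfolding W_def using j by (intro member_le_sum) auto
      also have "\<dots> < \<epsilon> * a n" using n3 n assms by (simp add: divide_less_eq mult.commute)
      finally show ?thesis .
    next
      case False
      then have "\<bar>X j \<omega>\<bar> < \<epsilon> * a j" using n2[of "j - 1"] j by simp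
      also have "\<dots> \<le> \<epsilon> * a n" using j assms by (intro mult_left_mono a_mono) auto
      finally show ?thesis .
    qed
  qed
qed

lemma hit_not_summable:
  assumes "1 < c" "0 < \<delta>" "\<delta> < 1"
  shows "\<not> summable (\<lambda>k. if hit c k then real (Suc k) powr (\<delta> - 1) else 0)"
proof
  assume "summable (\<lambda>k. if hit c k then real (Suc k) powr (\<delta> - 1) else 0)"
  from hit_sum_bound[OF assms this] obtain B
    where B: "\<And>m. (\<Sum>n=1..m. 1 / v n * log_e (v n) powr (\<delta> - 1) * (v n - v (n - 1))) \<le> B" by blast
  have "v n - v (n - 1) = q n" if "n \<ge> 1" for n
  proof -
    have "{n - 1<..n} = {n}" using that by auto
    then show ?thesis using sum_q[of "n - 1" n] by simp
  qed
  then have "(\<Sum>n=1..m. 1 / v n * log_e (v n) powr (\<delta> - 1) * (v n - v (n - 1)))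
      = (\<Sum>n=1..m. 1 / v n * log_e (v n) powr (\<delta> - 1) * q n)" for m
    by (intro sum.cong refl) simp
  then have "(\<Sum>n=1..m. 1 / v n * log_e (v n) powr (\<delta> - 1) * q n) \<le> B" for m
    using B[of m] by simp
  then show False using iii_partial[OF assms(2), of B] by (auto simp: not_less[symmetric])
qed

section \<open>Condition (ii) as a real series\<close>

definition h :: "real \<Rightarrow> nat \<Rightarrow> real" where
  "h \<alpha> n = \<alpha> * s n / t n"

lemma h_mono: "0 \<le> \<alpha> \<Longrightarrow> m \<le> n \<Longrightarrow> h \<alpha> m \<le> h \<alpha> n"
  unfolding h_def using mult_left_mono[OF s_div_t_mono] by simp

lemma h_nonneg: "0 \<le> \<alpha> \<Longrightarrow> 0 \<le> h \<alpha> n"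
  unfolding h_def using s_nonneg[of n] t_ge_1[of n] by simp

lemma trunc_L1_mono:
  assumes "j \<ge> 1" "0 \<le> h1" "h1 \<le> h2" "1 \<le> p" "(\<lambda>\<omega>. max (\<bar>X j \<omega>\<bar> - h1) 0 powr p) \<in> L1"
  shows "(\<lambda>\<omega>. max (\<bar>X j \<omega>\<bar> - h2) 0 powr p) \<in> L1" "trunc_moment p h2 j \<le> trunc_moment p h1 j"
proof -
  have le: "max (\<bar>X j \<omega>\<bar> - h2) 0 powr p \<le> max (\<bar>X j \<omega>\<bar> - h1) 0 powr p" for \<omega>
    using assms by (intro powr_mono2) auto
  show 1: "(\<lambda>\<omega>. max (\<bar>X j \<omega>\<bar> - h2) 0 powr p) \<in> L1"
    by (rule L1_dom[OF trunc_moment_H assms(5)]) (use assms le in auto)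
  show "trunc_moment p h2 j \<le> trunc_moment p h1 j"
    unfolding trunc_moment_def by (rule rE_mono[OF 1 assms(5) le])
qed

text \<open>Beyond n0 the norming is positive. There the finiteness of the series forces finite p-th
  excess moments, the integrability on which the later moment estimates rest.\<close>

lemma moment_series:
  assumes \<alpha>: "0 < \<alpha>"
  shows "\<exists>p d n0. 2 \<le> p \<and> 0 \<le> d \<and> 0 < v n0 \<and>
    (\<forall>n>n0. (\<lambda>\<omega>. max (\<bar>X n \<omega>\<bar> - h \<alpha> n) 0 powr p) \<in> L1) \<and>
    summable (\<lambda>n. if n0 < n then trunc_moment p (h \<alpha> n) n / a n powr p
      * ((\<Sum>j\<in>{n0<..n}. trunc_moment p (h \<alpha> n) j) / a n powr p) powr d else 0)"
proof -
  obtain p d where p: "2 \<le> p" and d: "0 \<le> d" and fin: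
    "(\<Sum>n. Gam E X (Suc n) p \<alpha> * ereal (1 / a (Suc n) powr p)
            * ereal_powr (Lam E X (Suc n) p \<alpha> * ereal (1 / a (Suc n) powr p)) d) < \<infinity>"
    using ii[OF \<alpha>] unfolding a_norm_eq by blast
  obtain n0 where "1 \<le> v n0" using v_unbounded by blast
  then have n0: "0 < v n0" by simp
  define T where "T n = Gam E X n p \<alpha> * ereal (1 / a n powr p)
            * ereal_powr (Lam E X n p \<alpha> * ereal (1 / a n powr p)) d" for n
  have tm: "tail_moment E X n j p \<alpha> = E (\<lambda>\<omega>. max (\<bar>X j \<omega>\<bar> - h \<alpha> n) 0 powr p)" for n j
    by (simp add: tail_moment_def h_def s_norm_eq t_norm_eq)
  have RH: "(\<lambda>\<omega>. max (\<bar>X j \<omega>\<bar> - h \<alpha> n) 0 powr p) \<in> H" if "j \<ge> 1" for n j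
    by (rule trunc_moment_H) (use that h_nonneg \<alpha> p in auto)
  have tm0: "0 \<le> tail_moment E X n j p \<alpha>" if "j \<ge> 1" for n j
    unfolding tm by (rule E_nonneg[OF RH[OF that]]) simp
  have Gam0: "0 \<le> Gam E X n p \<alpha>" if "n \<ge> 1" for n unfolding Gam_def by (rule tm0[OF that])
  have Lam0: "0 \<le> Lam E X n p \<alpha>" for n unfolding Lam_def by (rule sum_nonneg) (auto intro: tm0)
  have ep0: "0 \<le> ereal_powr x d" for x unfolding ereal_powr_def by auto
  have T0: "0 \<le> T (Suc n)" for n
    unfolding T_def by (intro ereal_0_le_mult Gam0 ep0) auto
  have Tfin: "T n \<noteq> \<infinity>" if n: "n \<ge> 1" for n
  proof -
    have k: "n = Suc (n - 1)" using n by simp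
    obtain k where k: "n = Suc k" using k ..
    have "T (Suc k) \<le> (\<Sum>n. T (Suc n))"
      using sum_le_suminf[OF summable_ereal_pos, of "\<lambda>n. T (Suc n)" "{k}"] T0 by simp
    also have "\<dots> < \<infinity>" using fin by (simp add: T_def)
    finally show ?thesis by (simp add: k)
  qed
  have vn: "0 < v n" if "n > n0" for n using n0 v_mono[of n0 n] that by simp
  have w: "0 < 1 / a n powr p" if "n > n0" for n using a_pos[OF vn[OF that]] by simp
  have L1n: "(\<lambda>\<omega>. max (\<bar>X n \<omega>\<bar> - h \<alpha> n) 0 powr p) \<in> L1" if n: "n > n0" for n
  proof -
    have n1: "n \<ge> 1" using n by simp
    have "Gam E X n p \<alpha> \<noteq> \<infinity>"
    proof
      \<comment> \<open>An infinite \<Gamma> makes \<Lambda> infinite too; its power is then 1 or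
        \<infinity>, never 0, and the whole term is infinite.\<close>
      assume G: "Gam E X n p \<alpha> = \<infinity>"
      have "tail_moment E X n n p \<alpha> \<le> Lam E X n p \<alpha>"
        unfolding Lam_def using n1 sum_mono2[of "{1..n}" "{n}" "\<lambda>j. tail_moment E X n j p \<alpha>"] tm0 by simp
      then have L: "Lam E X n p \<alpha> = \<infinity>" using G by (simp add: Gam_def)
      have "ereal_powr (Lam E X n p \<alpha> * ereal (1 / a n powr p)) d \<in> {1, \<infinity>}"
        using w[OF n] unfolding L by (simp add: ereal_powr_def)
      then have "T n = \<infinity>" unfolding T_def G using w[OF n] by auto
      then show False using Tfin[OF n1] by simp
    qed
    then show ?thesis
      using RH[OF n1, of n] unfolding L1_def Gam_def tm by (simp add: less_top[symmetric] top_ereal_def)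
  qed
  have L1nj: "(\<lambda>\<omega>. max (\<bar>X j \<omega>\<bar> - h \<alpha> n) 0 powr p) \<in> L1" if "j \<in> {n0<..n}" for n j
    by (rule trunc_L1_mono(1)[OF _ _ _ _ L1n[of j]])
      (use that p h_mono[of \<alpha> j n] h_nonneg[of \<alpha> j] \<alpha> in auto)
  have tr0: "0 \<le> trunc_moment p (h \<alpha> n) j" if "j \<in> {n0<..n}" for n j
    unfolding trunc_moment_def by (rule rE_ge[OF L1nj[OF that]]) simp
  have le: "ereal (trunc_moment p (h \<alpha> n) n / a n powr p
      * ((\<Sum>j\<in>{n0<..n}. trunc_moment p (h \<alpha> n) j) / a n powr p) powr d) \<le> T n" if n: "n > n0" for n
  proof -
    have "ereal (\<Sum>j\<in>{n0<..n}. trunc_moment p (h \<alpha> n) j) = (\<Sum>j\<in>{n0<..n}. tail_moment E X n j p \<alpha>)"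
      unfolding tm trunc_moment_def using E_L1[OF L1nj] by simp
    also have "\<dots> \<le> Lam E X n p \<alpha>"
      unfolding Lam_def by (rule sum_mono2) (auto intro: tm0)
    finally have le: "ereal (\<Sum>j\<in>{n0<..n}. trunc_moment p (h \<alpha> n) j) \<le> Lam E X n p \<alpha>" .
    have "ereal (trunc_moment p (h \<alpha> n) n * (1 / a n powr p)
      * ((\<Sum>j\<in>{n0<..n}. trunc_moment p (h \<alpha> n) j) * (1 / a n powr p)) powr d)
      \<le> ereal (trunc_moment p (h \<alpha> n) n) * ereal (1 / a n powr p) * ereal_powr (Lam E X n p \<alpha> * ereal (1 / a n powr p)) d"
      using tr0 n by (intro ereal_powr_term_le w le d sum_nonneg) auto
    moreover have "Gam E X n p \<alpha> = ereal (trunc_moment p (h \<alpha> n) n)"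
      unfolding Gam_def tm trunc_moment_def by (rule E_L1[OF L1n[OF n]])
    ultimately show ?thesis by (simp add: T_def)
  qed
  define u where "u n = (if n0 < n then trunc_moment p (h \<alpha> n) n / a n powr p
      * ((\<Sum>j\<in>{n0<..n}. trunc_moment p (h \<alpha> n) j) / a n powr p) powr d else 0)" for n
  have u0: "0 \<le> u n" for n unfolding u_def using tr0[of n n] by simp
  have "summable (\<lambda>n. u (Suc n))"
  proof (rule summable_ereal)
    have "(\<Sum>n. ereal (u (Suc n))) \<le> (\<Sum>n. T (Suc n))"
    proof (rule suminf_le_pos)
      show "ereal (u (Suc n)) \<le> T (Suc n)" for n using le[of "Suc n"] T0[of n] by (simp add: u_def flip: zero_ereal_def)
    qed (use u0 in simp)
    also have "\<dots> < \<infinity>" using fin by (simp add: T_def)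
    finally show "(\<Sum>n. ereal (u (Suc n))) \<noteq> \<infinity>" by simp
  qed (rule u0)
  then have "summable u" by (simp only: summable_Suc_iff)
  then show ?thesis using p d n0 L1n unfolding u_def by blast
qed

end

section \<open>Blocks with controlled truncated moments\<close>

lemma (in sublinear_expectation_space) V_hat_empty: "V_hat M H E {} \<le> 0"
  using V_hat_le[OF L1_const[of 0], of "{}"] by (simp add: zero_ereal_def)

text \<open>Keeps the variance term of \<open>bad_clip_small\<close> bounded.\<close>

lemma ln_square_le: "(ln x)\<^sup>2 \<le> 4 * x" if "1 \<le> x" for x :: real
proof -
  have "ln (sqrt x) \<le> sqrt x - 1" using that by (intro ln_le_minus_one) simp
  then have "ln x \<le> 2 * sqrt x" using that by (simp add: ln_sqrt)
  moreover have "0 \<le> ln x" using that by simp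
  ultimately have "(ln x)\<^sup>2 \<le> (2 * sqrt x)\<^sup>2" by (intro power_mono)
  then show ?thesis using that by (simp add: power_mult_distrib)
qed

text \<open>\<open>L k\<close> bounds the excess moments up to the end of block k relative to
  \<open>a powr p\<close>. It is positive so that \<open>ln (L k)\<close> can be used to tune the
  exponential bounds.\<close>

locale block_scheme = lil_sequence M H E X PP V
  for M :: "'a measure" and H E X PP V +
  fixes c \<alpha> p d :: real and n0 :: nat and L :: "nat \<Rightarrow> real"
  assumes c: "1 < c" and \<alpha>: "0 < \<alpha>" and p: "2 \<le> p" and d: "0 \<le> d" and n0: "0 < v n0"
    and trunc_L1: "n0 < j \<Longrightarrow> j \<le> n \<Longrightarrow> (\<lambda>\<omega>. max (\<bar>X j \<omega>\<bar> - h \<alpha> n) 0 powr p) \<in> L1"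
    and L_pos: "0 < L k"
    and L_bound: "hit c k \<Longrightarrow> n0 < block_end c k \<Longrightarrow>
      (\<Sum>j\<in>{n0<..block_end c k}. trunc_moment p (h \<alpha> (block_end c k)) j) \<le> L k * a (block_end c k) powr p"
    and L_sum: "summable (\<lambda>k. if hit c k \<and> n0 < block_end c k then L k powr (d + 1) else 0)"

lemma (in lil_sequence) block_scheme_exists:
  assumes \<alpha>: "0 < \<alpha>" and c: "1 < c"
  shows "\<exists>p d n0 L. block_scheme M H E X PP V c \<alpha> p d n0 L"
proof -
  obtain p d n0 where p: "2 \<le> p" and d: "0 \<le> d" and n0: "0 < v n0"
    and R: "\<And>n. n > n0 \<Longrightarrow> (\<lambda>\<omega>. max (\<bar>X n \<omega>\<bar> - h \<alpha> n) 0 powr p) \<in> L1"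
    and sum: "summable (\<lambda>n. if n0 < n then trunc_moment p (h \<alpha> n) n / a n powr p
      * ((\<Sum>j\<in>{n0<..n}. trunc_moment p (h \<alpha> n) j) / a n powr p) powr d else 0)"
    using moment_series[OF \<alpha>] by auto
  have Rj: "(\<lambda>\<omega>. max (\<bar>X j \<omega>\<bar> - h \<alpha> n) 0 powr p) \<in> L1" if "n0 < j" "j \<le> n" for n j
    by (rule trunc_L1_mono(1)[OF _ _ _ _ R[of j]])
      (use that p h_mono[of \<alpha> j n] h_nonneg[of \<alpha> j] \<alpha> in auto)
  have tr0: "0 \<le> trunc_moment p (h \<alpha> n) j" if "n0 < j" "j \<le> n" for n j
    unfolding trunc_moment_def by (rule rE_ge[OF Rj[OF that]]) simp
  define l where "l n = (\<Sum>j\<in>{n0<..n}. trunc_moment p (h \<alpha> n) j)" for n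
  define g where "g n = (if n0 < n then trunc_moment p (h \<alpha> n) n else 0)" for n
  have l0: "0 \<le> l n" for n unfolding l_def by (intro sum_nonneg tr0) auto
  have g0: "0 \<le> g n" for n unfolding g_def using tr0[of n n] by simp
  have step: "l (Suc n) \<le> l n + g (Suc n)" if "n0 \<le> n" for n
  proof -
    have "{n0<..Suc n} = insert (Suc n) {n0<..n}" using that by auto
    then have "l (Suc n) = (\<Sum>j\<in>{n0<..n}. trunc_moment p (h \<alpha> (Suc n)) j) + g (Suc n)"
      using that by (simp add: l_def g_def)
    moreover have "(\<Sum>j\<in>{n0<..n}. trunc_moment p (h \<alpha> (Suc n)) j) \<le> l n"
      unfolding l_def
    proof (rule sum_mono)
      fix j assume "j \<in> {n0<..n}"
      then show "trunc_moment p (h \<alpha> (Suc n)) j \<le> trunc_moment p (h \<alpha> n) j"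
        by (intro trunc_L1_mono(2)[OF _ _ _ _ Rj]) (use p h_mono[of \<alpha> n "Suc n"] h_nonneg[of \<alpha> n] \<alpha> in auto)
    qed
    ultimately show ?thesis by simp
  qed
  have "summable (\<lambda>n. if n0 < n then g n / a n powr p * (l n / a n powr p) powr d else 0)"
    using sum by (rule back_subst[of summable]) (auto simp: g_def l_def fun_eq_iff)
  then have S: "summable (\<lambda>k. if hit c k \<and> n0 < block_end c k
    then (l (block_end c k) / a (block_end c k) powr p) powr (d + 1) else 0)"
    using step by (intro block_moment_summable[where g=g, OF c p d n0 g0 l0]) (simp_all add: l_def)
  \<comment> \<open>The maximum keeps \<open>L k\<close> positive; since d + 1 \<ge> 1, the added
    part is dominated by the summable 1 / (k + 1)^2.\<close>
  define L where "L k = max (l (block_end c k) / a (block_end c k) powr p) (1 / real (Suc k) ^ 2)" for k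
  have "block_scheme M H E X PP V c \<alpha> p d n0 L"
  proof
    show "0 < L k" for k unfolding L_def by (rule less_max_iff_disj[THEN iffD2]) simp
    show "(\<Sum>j\<in>{n0<..block_end c k}. trunc_moment p (h \<alpha> (block_end c k)) j) \<le> L k * a (block_end c k) powr p"
      if "hit c k" "n0 < block_end c k" for k
    proof -
      have "0 < v (block_end c k)" using n0 v_mono[of n0 "block_end c k"] that by simp
      then have "0 < a (block_end c k) powr p" using a_pos[of "block_end c k"] by simp
      moreover have "l (block_end c k) / a (block_end c k) powr p \<le> L k" by (simp add: L_def)
      ultimately show ?thesis by (simp add: l_def divide_le_eq)
    qed
    show "summable (\<lambda>k. if hit c k \<and> n0 < block_end c k then L k powr (d + 1) else 0)"
    proof (rule summable_comparison_test_ev[OF always_eventually summable_add[OF S]], intro allI)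
      have "summable (\<lambda>k. 1 / real k ^ 2)" by (rule inverse_power_summable[of 2, unfolded inverse_eq_divide]) simp
      then show "summable (\<lambda>k. 1 / real (Suc k) ^ 2)" by (subst summable_Suc_iff)
      fix k
      have "L k powr (d + 1) \<le> (l (block_end c k) / a (block_end c k) powr p) powr (d + 1) + 1 / real (Suc k) ^ 2"
      proof -
        have le1: "1 / real (Suc k) ^ 2 \<le> 1" by simp
        have "(1 / real (Suc k) ^ 2) powr (d + 1) \<le> (1 / real (Suc k) ^ 2) powr 1"
          using d le1 by (intro powr_mono') auto
        then have "(1 / real (Suc k) ^ 2) powr (d + 1) \<le> 1 / real (Suc k) ^ 2" by simp
        moreover have "0 \<le> (l (block_end c k) / a (block_end c k) powr p) powr (d + 1)" by (rule powr_ge_zero)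
        moreover have "0 \<le> 1 / real (Suc k) ^ 2" by simp
        ultimately show ?thesis
          unfolding L_def by (cases "l (block_end c k) / a (block_end c k) powr p \<le> 1 / real (Suc k) ^ 2")
            (simp_all only: max_absorb2 max_absorb1 not_le less_imp_le add_increasing add_increasing2 order_refl)
      qed
      then show "norm (if hit c k \<and> n0 < block_end c k then L k powr (d + 1) else 0)
        \<le> (if hit c k \<and> n0 < block_end c k
    then (l (block_end c k) / a (block_end c k) powr p) powr (d + 1) else 0) + 1 / real (Suc k) ^ 2"
        by simp
    qed
  qed (use assms p d n0 Rj in auto)
  then show ?thesis by blast
qed

section \<open>Upper bounds along the blocks\<close>

context block_scheme
begin

abbreviation N :: "nat \<Rightarrow> nat" where
  "N k \<equiv> block_end c k"

definition active :: "nat \<Rightarrow> bool" where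
  "active k \<longleftrightarrow> hit c k \<and> n0 < N k"

text \<open>Blocks that are not good satisfy \<open>t (N k) powr - (4 * p * (d + 1)) \<le> L k powr (d + 1)\<close>, which is
  summable: they are sparse.\<close>

definition good :: "nat \<Rightarrow> bool" where
  "good k \<longleftrightarrow> L k * t (N k) powr (4 * p) \<le> 1"

lemma active_pos: "active k \<Longrightarrow> 0 < v (N k)"
  using n0 v_mono[of n0 "N k"] by (simp add: active_def)

lemma h_pos: "0 < v n \<Longrightarrow> 0 < h \<alpha> n"
  unfolding h_def using \<alpha> s_pos[of n] t_ge_1[of n] by simp

text \<open>Since a / h = t^2 / \<alpha>, passing from the norming a to the truncation level h costs
  t^(2 * p) / \<alpha>^p. Good blocks absorb this.\<close>

lemma trunc_sum_le:
  assumes "active k"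
  shows "h \<alpha> (N k) powr - p * (\<Sum>j\<in>{n0<..N k}. trunc_moment p (h \<alpha> (N k)) j)
    \<le> \<alpha> powr - p * (L k * t (N k) powr (2 * p))"
proof -
  have vp: "0 < v (N k)" by (rule active_pos[OF assms])
  have hp: "0 < h \<alpha> (N k)" by (rule h_pos[OF vp])
  have t0: "0 < t (N k)" using t_ge_1[of "N k"] by simp
  have "a (N k) = h \<alpha> (N k) * ((t (N k))\<^sup>2 / \<alpha>)"
    using \<alpha> t0 by (simp add: a_def h_def field_simps power2_eq_square)
  then have "a (N k) powr p = h \<alpha> (N k) powr p * ((t (N k))\<^sup>2 / \<alpha>) powr p"
    using hp t0 \<alpha> by (simp only: powr_mult)
  also have "((t (N k))\<^sup>2 / \<alpha>) powr p = \<alpha> powr - p * t (N k) powr (2 * p)"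
    using \<alpha> t0 by (simp add: powr_divide powr_minus_divide powr_powr flip: powr_numeral)
  finally have eq: "h \<alpha> (N k) powr - p * a (N k) powr p = \<alpha> powr - p * t (N k) powr (2 * p)"
    using hp by (simp add: powr_minus field_simps)
  have "h \<alpha> (N k) powr - p * (\<Sum>j\<in>{n0<..N k}. trunc_moment p (h \<alpha> (N k)) j)
    \<le> h \<alpha> (N k) powr - p * (L k * a (N k) powr p)"
    using L_bound assms unfolding active_def by (intro mult_left_mono) auto
  also have "\<dots> = L k * (h \<alpha> (N k) powr - p * a (N k) powr p)" by simp
  finally show ?thesis unfolding eq by (simp add: mult_ac)
qed

text \<open>The exponent 4 * p in \<open>good\<close> is twice the 2 * p of
  \<open>trunc_sum_le\<close>, so a factor \<open>L k powr (1/2)\<close> stays free for the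
  exponential bound in \<open>excess_small\<close>.\<close>

lemma good_le:
  assumes "good k"
  shows "L k powr (1/2) * t (N k) powr (2 * p) \<le> 1" "L k * t (N k) powr (2 * p) \<le> 1" "L k \<le> 1"
proof -
  have t1: "1 \<le> t (N k)" by (rule t_ge_1)
  have g: "L k * t (N k) powr (4 * p) \<le> 1" using assms by (simp add: good_def)
  have "(L k * t (N k) powr (4 * p)) powr (1/2) \<le> 1 powr (1/2)"
    using g L_pos[of k] by (intro powr_mono2) auto
  then show "L k powr (1/2) * t (N k) powr (2 * p) \<le> 1"
    using L_pos[of k] by (simp add: powr_mult powr_powr)
  have "L k * t (N k) powr (2 * p) \<le> L k * t (N k) powr (4 * p)"
    using L_pos[of k] t1 p by (intro mult_left_mono powr_mono) auto
  then show "L k * t (N k) powr (2 * p) \<le> 1" using g by simp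
  have "L k * 1 \<le> L k * t (N k) powr (4 * p)"
    using L_pos[of k] t1 p by (intro mult_left_mono ge_one_powr_ge_zero) auto
  then show "L k \<le> 1" using g by simp
qed

lemma trunc_nonneg: "n0 < j \<Longrightarrow> j \<le> n \<Longrightarrow> 0 \<le> trunc_moment p (h \<alpha> n) j"
  unfolding trunc_moment_def by (rule rE_ge[OF trunc_L1]) auto

text \<open>The excesses capped at e * a fall under \<open>excess_sum_bound\<close>, and the cap is
  eventually inactive by \<open>qs_X_uniformly_small\<close>. The tilt is tuned so that the bound
  becomes a multiple of the summable \<open>L k powr (d + 1)\<close>.\<close>

lemma excess_small:
  assumes \<epsilon>: "0 < \<epsilon>"
  shows "qs (\<lambda>\<omega>. \<forall>\<^sub>F k in sequentially. active k \<and> good k \<longrightarrow>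
    (\<Sum>j\<in>{n0<..N k}. max (\<bar>X j \<omega>\<bar> - 2 * h \<alpha> (N k)) 0) < \<epsilon> * a (N k))"
proof -
  \<comment> \<open>With this cap the exponent l * \<epsilon> * a becomes - (d + 1) * ln (L
    k).\<close>
  define e where "e = \<epsilon> / (2 * (d + 1))"
  have e: "0 < e" using \<epsilon> d by (simp add: e_def)
  define B where "B k = {\<omega> \<in> space M. (active k \<and> good k) \<and>
    \<epsilon> * a (N k) \<le> (\<Sum>j\<in>{n0<..N k}. min (max (\<bar>X j \<omega>\<bar> - 2 * h \<alpha> (N k)) 0) (e * a (N k)))}" for k
  define r where "r k = exp (1 + \<alpha> powr - p) * (if active k then L k powr (d + 1) else 0)" for k
  have meas: "B k \<in> sets M" for k
  proof -
    have "\<And>j. j \<in> {n0<..N k} \<Longrightarrow> X j \<in> borel_measurable M" using X_measurable by auto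
    then show ?thesis unfolding B_def by measurable
  qed
  have bound: "V_hat M H E (B k) \<le> ereal (r k)" for k
  proof (cases "active k \<and> good k")
    case False
    then have "B k = {}" by (auto simp: B_def)
    moreover have "0 \<le> r k" by (simp add: r_def)
    ultimately show ?thesis using V_hat_empty by (simp add: order_trans)
  next
    case True
    have vp: "0 < v (N k)" using active_pos True by simp
    have ap: "0 < a (N k)" by (rule a_pos[OF vp])
    \<comment> \<open>Makes the price of the cap \<open>L k powr - (1/2)\<close>, which
      \<open>good_le\<close> pays.\<close>
    define l where "l = - ln (L k) / (2 * (e * a (N k)))"
    have L1: "L k \<le> 1" using good_le(3) True by simp
    have "0 \<le> - ln (L k)" using L1 L_pos[of k] by simp
    then have l0: "0 \<le> l" unfolding l_def using e ap by (intro divide_nonneg_pos) auto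
    have N1: "N k \<ge> 1" using True by (auto simp: active_def)
    have "V_hat M H E {\<omega> \<in> space M. \<epsilon> * a (N k) \<le> (\<Sum>j\<in>{n0<..N k}. min (max (\<bar>X j \<omega>\<bar> - 2 * h \<alpha> (N k)) 0) (e * a (N k)))}
      \<le> ereal (exp (1 - l * (\<epsilon> * a (N k)) + exp (l * (e * a (N k))) * h \<alpha> (N k) powr - p * (\<Sum>j\<in>{n0<..N k}. trunc_moment p (h \<alpha> (N k)) j)))"
      by (rule excess_sum_bound) (use h_pos[OF vp] p e ap l0 N1 trunc_L1 in auto)
    also have "\<dots> \<le> ereal (r k)"
    proof -
      have le: "l * (e * a (N k)) = - ln (L k) / 2" unfolding l_def using e ap by simp
      have "l * (\<epsilon> * a (N k)) = - ln (L k) * (\<epsilon> / (2 * e))" unfolding l_def using ap e by (simp add: field_simps)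
      also have "\<epsilon> / (2 * e) = d + 1" unfolding e_def using \<epsilon> d by (simp add: field_simps)
      finally have lx: "l * (\<epsilon> * a (N k)) = - ln (L k) * (d + 1)" .
      have el: "exp (l * (e * a (N k))) = L k powr - (1/2)" unfolding le using L_pos[of k] by (simp add: powr_def)
      have "exp (l * (e * a (N k))) * (h \<alpha> (N k) powr - p * (\<Sum>j\<in>{n0<..N k}. trunc_moment p (h \<alpha> (N k)) j))
        \<le> L k powr - (1/2) * (\<alpha> powr - p * (L k * t (N k) powr (2 * p)))"
        unfolding el using trunc_sum_le True by (intro mult_left_mono) auto
      also have "\<dots> = \<alpha> powr - p * ((L k powr - (1/2) * L k powr 1) * t (N k) powr (2 * p))"
        using L_pos[of k] by (simp add: mult_ac)
      also have "L k powr - (1/2) * L k powr 1 = L k powr (1/2)" by (simp only: powr_add[symmetric]) simp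
      also have "\<alpha> powr - p * (L k powr (1/2) * t (N k) powr (2 * p)) \<le> \<alpha> powr - p * 1"
        using good_le(1) True by (intro mult_left_mono) auto
      finally have "exp (1 - l * (\<epsilon> * a (N k)) + exp (l * (e * a (N k))) * h \<alpha> (N k) powr - p * (\<Sum>j\<in>{n0<..N k}. trunc_moment p (h \<alpha> (N k)) j))
        \<le> exp (1 + \<alpha> powr - p + ln (L k) * (d + 1))"
        unfolding lx by (simp add: mult.assoc)
      also have "\<dots> = r k" using True L_pos[of k] by (simp add: r_def exp_add powr_def mult.commute)
      finally show ?thesis by simp
    qed
    finally show ?thesis using True by (simp add: B_def)
  qed
  have "summable r" unfolding r_def by (rule summable_mult) (use L_sum in \<open>simp add: active_def\<close>)
  from qs_Borel_Cantelli[OF meas bound this] qs_X_uniformly_small[OF e]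
  have "qs (\<lambda>\<omega>. (\<forall>\<^sub>F k in sequentially. \<omega> \<notin> B k) \<and> (\<exists>n1. \<forall>n\<ge>n1. \<forall>j\<in>{1..n}. \<bar>X j \<omega>\<bar> < e * a n))"
    by (rule qs_conj)
  then show ?thesis
  proof (rule qs_mono)
    fix \<omega> assume \<omega>: "\<omega> \<in> space M"
      and *: "(\<forall>\<^sub>F k in sequentially. \<omega> \<notin> B k) \<and> (\<exists>n1. \<forall>n\<ge>n1. \<forall>j\<in>{1..n}. \<bar>X j \<omega>\<bar> < e * a n)"
    then obtain n1 where n1: "\<And>n j. n \<ge> n1 \<Longrightarrow> j \<in> {1..n} \<Longrightarrow> \<bar>X j \<omega>\<bar> < e * a n" by blast
    from * have "\<forall>\<^sub>F k in sequentially. \<omega> \<notin> B k" by simp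
    with block_end_tends[OF c, of n1] show "\<forall>\<^sub>F k in sequentially. active k \<and> good k \<longrightarrow>
      (\<Sum>j\<in>{n0<..N k}. max (\<bar>X j \<omega>\<bar> - 2 * h \<alpha> (N k)) 0) < \<epsilon> * a (N k)"
    proof eventually_elim
      case (elim k)
      show ?case
      proof
        assume ak: "active k \<and> good k"
        have "max (\<bar>X j \<omega>\<bar> - 2 * h \<alpha> (N k)) 0 = min (max (\<bar>X j \<omega>\<bar> - 2 * h \<alpha> (N k)) 0) (e * a (N k))"
          if "j \<in> {n0<..N k}" for j
          using n1[OF elim(1), of j] that h_nonneg[of \<alpha> "N k"] \<alpha> by (auto simp: max_def min_def)
        then have "(\<Sum>j\<in>{n0<..N k}. max (\<bar>X j \<omega>\<bar> - 2 * h \<alpha> (N k)) 0)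
          = (\<Sum>j\<in>{n0<..N k}. min (max (\<bar>X j \<omega>\<bar> - 2 * h \<alpha> (N k)) 0) (e * a (N k)))"
          by (rule sum.cong[OF refl])
        then show "(\<Sum>j\<in>{n0<..N k}. max (\<bar>X j \<omega>\<bar> - 2 * h \<alpha> (N k)) 0) < \<epsilon> * a (N k)"
          using elim(2) \<omega> ak by (simp add: B_def)
      qed
    qed
  qed
qed

text \<open>Under the tilt t / s the truncation shifts the total mean by a bounded amount,
  negligible against exponents of order t^2.\<close>

lemma exc_sum_le:
  assumes k: "active k" "good k" and J: "J \<subseteq> {n0<..N k}"
  shows "t (N k) / s (N k) * (\<Sum>j\<in>J. exc (2 * h \<alpha> (N k)) j) \<le> \<alpha> * \<alpha> powr - p"
proof -
  have vp: "0 < v (N k)" by (rule active_pos[OF k(1)])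
  have hp: "0 < h \<alpha> (N k)" by (rule h_pos[OF vp])
  have th: "t (N k) / s (N k) * h \<alpha> (N k) = \<alpha>"
    unfolding h_def using s_pos[OF vp] t_ge_1[of "N k"] by simp
  have "(\<Sum>j\<in>J. exc (2 * h \<alpha> (N k)) j) \<le> (\<Sum>j\<in>{n0<..N k}. exc (2 * h \<alpha> (N k)) j)"
    using J by (intro sum_mono2) (auto intro: exc_nonneg)
  also have "\<dots> \<le> (\<Sum>j\<in>{n0<..N k}. h \<alpha> (N k) powr (1 - p) * trunc_moment p (h \<alpha> (N k)) j)"
    by (intro sum_mono exc_le_trunc_moment hp trunc_L1) (use p in auto)
  also have "\<dots> = h \<alpha> (N k) * (h \<alpha> (N k) powr - p * (\<Sum>j\<in>{n0<..N k}. trunc_moment p (h \<alpha> (N k)) j))"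
    using hp by (simp add: sum_distrib_left powr_diff powr_minus_divide)
  also have "\<dots> \<le> h \<alpha> (N k) * (\<alpha> powr - p * (L k * t (N k) powr (2 * p)))"
    using trunc_sum_le[OF k(1)] hp by (intro mult_left_mono) auto
  also have "\<dots> \<le> h \<alpha> (N k) * (\<alpha> powr - p * 1)"
    using good_le(2)[OF k(2)] hp by (intro mult_left_mono) auto
  finally have "t (N k) / s (N k) * (\<Sum>j\<in>J. exc (2 * h \<alpha> (N k)) j) \<le> t (N k) / s (N k) * (h \<alpha> (N k) * \<alpha> powr - p)"
    using s_nonneg[of "N k"] t_ge_1[of "N k"] by (intro mult_left_mono) auto
  also have "\<dots> = \<alpha> * \<alpha> powr - p" using th by (simp add: mult.assoc[symmetric])
  finally show ?thesis .
qed

lemma sum_q_le: "(\<Sum>j\<in>{n0<..N k}. q j) \<le> v (N k)"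
proof -
  have "(\<Sum>j\<in>{n0<..N k}. q j) \<le> (\<Sum>j=1..N k. q j)" by (rule sum_mono2) (auto intro: q_nonneg)
  then show ?thesis by (simp add: ss_eq)
qed

lemma sum_mb_le: "(\<Sum>j\<in>{n0<..n}. mb j) \<le> (\<Sum>j=1..n. mb j)"
  by (rule sum_mono2) (auto intro: mb_nonneg)

lemma clip_measurable: "n \<ge> 1 \<Longrightarrow> (\<lambda>\<omega>. clip y (\<sigma> * X n \<omega>)) \<in> borel_measurable M"
  unfolding clip_def using X_measurable by measurable

lemma log_e_powr_le:
  assumes "hit c k" "k \<ge> 1" "0 \<le> r"
  shows "exp (- r * LL (v (N k))) \<le> ln c powr - r * real k powr - r"
proof -
  have "0 < real k * ln c" using assms c by simp
  then have "log_e (v (N k)) powr - r \<le> (real k * ln c) powr - r"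
    using log_e_block_end_ge[OF c assms(1)] assms(3) by (intro powr_mono2') auto
  then show ?thesis using exp_LL[OF assms(3), of "v (N k)"] c by (simp add: powr_mult mult.commute)
qed

text \<open>With the tilt l = t / s one has l * a = t^2, l^2 * v = t^2 and l * (2 * h) = 2 *
  \<alpha>. Up to a constant the exponent is at most - (1 + 3 * \<epsilon>) * t^2 / 2, and t^2 / 2 =
  LL v turns it into a summable power of k.\<close>

lemma good_clip_small:
  assumes \<epsilon>: "0 < \<epsilon>" and \<alpha>\<epsilon>: "exp (2 * \<alpha>) \<le> 1 + \<epsilon>" and \<sigma>: "\<sigma> = 1 \<or> \<sigma> = -1"
  shows "qs (\<lambda>\<omega>. \<forall>\<^sub>F k in sequentially. active k \<and> good k \<longrightarrow>
    (\<forall>m\<in>{1..N k}. (\<Sum>j\<in>{n0<..m}. clip (2 * h \<alpha> (N k)) (\<sigma> * X j \<omega>)) < (1 + 3 * \<epsilon>) * a (N k)))"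
proof -
  obtain n1 where n1: "\<And>n. n \<ge> n1 \<Longrightarrow> (\<Sum>j=1..n. mb j) \<le> \<epsilon> * a n" using mb_sum_small[OF \<epsilon>] by blast
  obtain k0 where k0: "\<And>k. k \<ge> k0 \<Longrightarrow> n1 \<le> N k"
    using block_end_tends[OF c, of n1] unfolding eventually_sequentially by blast
  define K where "K k \<longleftrightarrow> active k \<and> good k \<and> k0 \<le> k \<and> 1 \<le> k" for k
  define B where "B k = {\<omega> \<in> space M. K k \<and>
    (\<exists>m\<in>{1..N k}. (1 + 3 * \<epsilon>) * a (N k) \<le> (\<Sum>j\<in>{n0<..m}. clip (2 * h \<alpha> (N k)) (\<sigma> * X j \<omega>)))}" for k
  define C where "C = exp (1 + \<alpha> * \<alpha> powr - p) * ln c powr - (1 + 3 * \<epsilon>)"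
  define r where "r k = C * real k powr - (1 + 3 * \<epsilon>)" for k
  have meas: "B k \<in> sets M" for k
  proof -
    have "(\<lambda>\<omega>. \<Sum>j\<in>{n0<..m}. clip (2 * h \<alpha> (N k)) (\<sigma> * X j \<omega>)) \<in> borel_measurable M" for m
      by (rule borel_measurable_sum) (auto intro: clip_measurable)
    then show ?thesis unfolding B_def by measurable
  qed
  have bound: "V_hat M H E (B k) \<le> ereal (r k)" for k
  proof (cases "K k")
    case False
    then have "B k = {}" by (auto simp: B_def)
    moreover have "0 \<le> r k" by (simp add: r_def C_def)
    ultimately show ?thesis using V_hat_empty by (simp add: order_trans)
  next
    case True
    then have k: "active k" "good k" "k0 \<le> k" "1 \<le> k" by (auto simp: K_def)
    have vp: "0 < v (N k)" by (rule active_pos[OF k(1)])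
    define T S where "T = t (N k)" and "S = s (N k)"
    have T: "1 \<le> T" and S: "0 < S" using t_ge_1 s_pos[OF vp] by (auto simp: T_def S_def)
    have aTS: "a (N k) = S * T" by (simp add: a_def T_def S_def)
    define l where "l = T / S"
    have l: "0 \<le> l" using T S by (simp add: l_def)
    let ?y = "2 * h \<alpha> (N k)"
    have ly: "l * ?y = 2 * \<alpha>" unfolding l_def h_def using T S by (simp add: T_def[symmetric] S_def[symmetric])
    have lv: "l\<^sup>2 * v (N k) = T\<^sup>2"
      unfolding l_def s_square[symmetric] S_def[symmetric] using S by (simp add: power_divide)
    have "V_hat M H E {\<omega> \<in> space M. \<exists>m\<in>{1..N k}. (1 + 3 * \<epsilon>) * a (N k) \<le> (\<Sum>j\<in>{n0<..m}. clip ?y (\<sigma> * X j \<omega>))}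
      \<le> ereal (exp (1 - l * ((1 + 3 * \<epsilon>) * a (N k)) + (\<Sum>j\<in>{n0<..N k}. l * (mb j + exc ?y j) + l\<^sup>2 / 2 * exp (l * ?y) * q j)))"
      by (rule clip_sum_bound[OF _ l \<sigma>]) (use h_pos[OF vp] in simp)
    also have "\<dots> \<le> ereal (r k)"
    proof -
      have lx: "l * ((1 + 3 * \<epsilon>) * a (N k)) = (1 + 3 * \<epsilon>) * T\<^sup>2"
        using S by (simp add: l_def aTS power2_eq_square)
      have "(\<Sum>j\<in>{n0<..N k}. l * (mb j + exc ?y j) + l\<^sup>2 / 2 * exp (l * ?y) * q j)
        = l * (\<Sum>j\<in>{n0<..N k}. mb j) + l * (\<Sum>j\<in>{n0<..N k}. exc ?y j) + l\<^sup>2 / 2 * exp (2 * \<alpha>) * (\<Sum>j\<in>{n0<..N k}. q j)"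
        unfolding ly by (simp add: sum.distrib sum_distrib_left distrib_left)
      moreover have "l * (\<Sum>j\<in>{n0<..N k}. mb j) \<le> \<epsilon> * T\<^sup>2"
      proof -
        have "l * (\<Sum>j\<in>{n0<..N k}. mb j) \<le> l * (\<epsilon> * a (N k))"
          using order_trans[OF sum_mb_le n1[OF k0[OF k(3)]]] l by (rule mult_left_mono)
        also have "\<dots> = \<epsilon> * T\<^sup>2" using S by (simp add: l_def aTS power2_eq_square)
        finally show ?thesis .
      qed
      moreover have "l * (\<Sum>j\<in>{n0<..N k}. exc ?y j) \<le> \<alpha> * \<alpha> powr - p"
        using exc_sum_le[OF k(1,2) order_refl] by (simp add: l_def T_def S_def)
      moreover have "l\<^sup>2 / 2 * exp (2 * \<alpha>) * (\<Sum>j\<in>{n0<..N k}. q j) \<le> (1 + \<epsilon>) * T\<^sup>2 / 2"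
      proof -
        have "l\<^sup>2 / 2 * exp (2 * \<alpha>) * (\<Sum>j\<in>{n0<..N k}. q j) \<le> l\<^sup>2 / 2 * (1 + \<epsilon>) * v (N k)"
          using \<alpha>\<epsilon> sum_q_le by (intro mult_mono mult_left_mono sum_nonneg) (auto intro: q_nonneg simp: \<epsilon> less_imp_le)
        also have "\<dots> = (1 + \<epsilon>) * T\<^sup>2 / 2" using lv by (simp add: field_simps)
        finally show ?thesis .
      qed
      ultimately have "1 - l * ((1 + 3 * \<epsilon>) * a (N k)) + (\<Sum>j\<in>{n0<..N k}. l * (mb j + exc ?y j) + l\<^sup>2 / 2 * exp (l * ?y) * q j)
        \<le> 1 + \<alpha> * \<alpha> powr - p + (\<epsilon> * T\<^sup>2 + (1 + \<epsilon>) * T\<^sup>2 / 2 - (1 + 3 * \<epsilon>) * T\<^sup>2)"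
        unfolding lx by linarith
      also have "\<epsilon> * T\<^sup>2 + (1 + \<epsilon>) * T\<^sup>2 / 2 - (1 + 3 * \<epsilon>) * T\<^sup>2 = - (1 + 3 * \<epsilon>) * LL (v (N k))"
        unfolding T_def t_square by (simp add: field_simps)
      finally have "exp (1 - l * ((1 + 3 * \<epsilon>) * a (N k)) + (\<Sum>j\<in>{n0<..N k}. l * (mb j + exc ?y j) + l\<^sup>2 / 2 * exp (l * ?y) * q j))
        \<le> exp (1 + \<alpha> * \<alpha> powr - p) * exp (- (1 + 3 * \<epsilon>) * LL (v (N k)))"
        by (simp add: exp_add[symmetric])
      also have "\<dots> \<le> exp (1 + \<alpha> * \<alpha> powr - p) * (ln c powr - (1 + 3 * \<epsilon>) * real k powr - (1 + 3 * \<epsilon>))"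
        using k \<epsilon> unfolding active_def by (intro mult_left_mono log_e_powr_le) auto
      also have "\<dots> = r k" by (simp add: r_def C_def)
      finally show ?thesis by simp
    qed
    finally show ?thesis using True by (simp add: B_def)
  qed
  have "summable r"
    unfolding r_def by (rule summable_mult) (subst summable_real_powr_iff, use \<epsilon> in simp)
  from qs_Borel_Cantelli[OF meas bound this] show ?thesis
  proof (rule qs_mono)
    fix \<omega> assume \<omega>: "\<omega> \<in> space M" and "\<forall>\<^sub>F k in sequentially. \<omega> \<notin> B k"
    with eventually_ge_at_top[of "max k0 1"] show "\<forall>\<^sub>F k in sequentially. active k \<and> good k \<longrightarrow>
      (\<forall>m\<in>{1..N k}. (\<Sum>j\<in>{n0<..m}. clip (2 * h \<alpha> (N k)) (\<sigma> * X j \<omega>)) < (1 + 3 * \<epsilon>) * a (N k))"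
    proof eventually_elim
      case (elim k)
      then show ?case using \<omega> by (auto simp: B_def K_def not_le[symmetric])
    qed
  qed
qed

text \<open>Truncation at y = e * a with l = ln T / y gives exp (l * y) = T, and the variance term
  is bounded because (ln T)^2 / T is. What remains is T to the power - 1 / (2 * e), and e is so
  small that this is at most T to the power - 4 * p * (d + 1), hence at most
  \<open>L k powr (d + 1)\<close> on a bad block.\<close>

lemma bad_clip_small:
  assumes e: "0 < e" "e \<le> 1 / (8 * p * (d + 1))" and \<sigma>: "\<sigma> = 1 \<or> \<sigma> = -1"
  shows "qs (\<lambda>\<omega>. \<forall>\<^sub>F k in sequentially. active k \<and> \<not> good k \<longrightarrow>
    (\<forall>m\<in>{1..N k}. (\<Sum>j\<in>{n0<..m}. clip (e * a (N k)) (\<sigma> * X j \<omega>)) < a (N k)))"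
proof -
  obtain n1 where n1: "\<And>n. n \<ge> n1 \<Longrightarrow> (\<Sum>j=1..n. mb j) \<le> 1/2 * a n" using mb_sum_small[of "1/2"] by auto
  obtain k0 where k0: "\<And>k. k \<ge> k0 \<Longrightarrow> n1 \<le> N k"
    using block_end_tends[OF c, of n1] unfolding eventually_sequentially by blast
  define K where "K k \<longleftrightarrow> active k \<and> \<not> good k \<and> k0 \<le> k" for k
  define B where "B k = {\<omega> \<in> space M. K k \<and>
    (\<exists>m\<in>{1..N k}. a (N k) \<le> (\<Sum>j\<in>{n0<..m}. clip (e * a (N k)) (\<sigma> * X j \<omega>)))}" for k
  define r where "r k = exp (1 + 3 / e\<^sup>2) * (if active k then L k powr (d + 1) else 0)" for k
  have meas: "B k \<in> sets M" for k
  proof -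
    have "(\<lambda>\<omega>. \<Sum>j\<in>{n0<..m}. clip (e * a (N k)) (\<sigma> * X j \<omega>)) \<in> borel_measurable M" for m
      by (rule borel_measurable_sum) (auto intro: clip_measurable)
    then show ?thesis unfolding B_def by measurable
  qed
  have bound: "V_hat M H E (B k) \<le> ereal (r k)" for k
  proof (cases "K k")
    case False
    then have "B k = {}" by (auto simp: B_def)
    moreover have "0 \<le> r k" by (simp add: r_def)
    ultimately show ?thesis using V_hat_empty by (simp add: order_trans)
  next
    case True
    then have k: "active k" "\<not> good k" "k0 \<le> k" by (auto simp: K_def)
    have vp: "0 < v (N k)" by (rule active_pos[OF k(1)])
    define T where "T = t (N k)"
    have T: "1 \<le> T" using t_ge_1 by (simp add: T_def)
    have ap: "0 < a (N k)" by (rule a_pos[OF vp])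
    have a2: "(a (N k))\<^sup>2 = v (N k) * T\<^sup>2" by (simp add: a_def T_def s_square power_mult_distrib)
    define y where "y = e * a (N k)"
    have y: "0 < y" using e ap by (simp add: y_def)
    have y2: "y\<^sup>2 = e\<^sup>2 * v (N k) * T\<^sup>2" by (simp add: y_def power_mult_distrib a2)
    define l where "l = ln T / y"
    have lnT: "0 \<le> ln T" "ln T \<le> T" using T ln_le_minus_one[of T] by auto
    have l: "0 \<le> l" using lnT y by (simp add: l_def)
    have ly: "exp (l * y) = T" using y T by (simp add: l_def)
    have la: "l * a (N k) = ln T / e" using ap e by (simp add: l_def y_def)
    have "V_hat M H E {\<omega> \<in> space M. \<exists>m\<in>{1..N k}. a (N k) \<le> (\<Sum>j\<in>{n0<..m}. clip y (\<sigma> * X j \<omega>))}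
      \<le> ereal (exp (1 - l * a (N k) + (\<Sum>j\<in>{n0<..N k}. l * (mb j + exc y j) + l\<^sup>2 / 2 * exp (l * y) * q j)))"
      by (rule clip_sum_bound[OF _ l \<sigma>]) (use y in simp)
    also have "\<dots> \<le> ereal (r k)"
    proof -
      have "(\<Sum>j\<in>{n0<..N k}. l * (mb j + exc y j) + l\<^sup>2 / 2 * exp (l * y) * q j)
        = l * (\<Sum>j\<in>{n0<..N k}. mb j) + l * (\<Sum>j\<in>{n0<..N k}. exc y j) + l\<^sup>2 / 2 * T * (\<Sum>j\<in>{n0<..N k}. q j)"
        unfolding ly by (simp add: sum.distrib sum_distrib_left distrib_left)
      \<comment> \<open>Half of the gain ln T / e is given up to the means.\<close>
      moreover have "l * (\<Sum>j\<in>{n0<..N k}. mb j) \<le> ln T / e / 2"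
      proof -
        have "l * (\<Sum>j\<in>{n0<..N k}. mb j) \<le> l * (1/2 * a (N k))"
          using order_trans[OF sum_mb_le n1[OF k0[OF k(3)]]] l by (rule mult_left_mono)
        then show ?thesis using la by simp
      qed
      moreover have "l * (\<Sum>j\<in>{n0<..N k}. exc y j) \<le> 1 / e\<^sup>2"
      proof -
        have "(\<Sum>j\<in>{n0<..N k}. exc y j) \<le> (\<Sum>j\<in>{n0<..N k}. q j / y)"
          by (intro sum_mono exc_le y) auto
        also have "\<dots> \<le> v (N k) / y" using sum_q_le y by (simp add: sum_divide_distrib[symmetric] divide_right_mono)
        finally have "l * (\<Sum>j\<in>{n0<..N k}. exc y j) \<le> l * (v (N k) / y)" using l by (rule mult_left_mono)
        also have "\<dots> = ln T * v (N k) / y\<^sup>2" by (simp add: l_def power2_eq_square)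
        also have "\<dots> = (ln T / T\<^sup>2) / e\<^sup>2" unfolding y2 using vp by (simp add: field_simps)
        also have "\<dots> \<le> 1 / e\<^sup>2"
        proof (rule divide_right_mono)
          have "ln T * 1 \<le> T * T" using lnT T by (intro mult_mono) auto
          then show "ln T / T\<^sup>2 \<le> 1" using T by (simp add: power2_eq_square)
        qed simp
        finally show ?thesis .
      qed
      moreover have "l\<^sup>2 / 2 * T * (\<Sum>j\<in>{n0<..N k}. q j) \<le> 2 / e\<^sup>2"
      proof -
        have "l\<^sup>2 / 2 * T * (\<Sum>j\<in>{n0<..N k}. q j) \<le> l\<^sup>2 / 2 * T * v (N k)"
          using T sum_q_le by (intro mult_left_mono) auto
        also have "\<dots> = ((ln T)\<^sup>2 / T) / (2 * e\<^sup>2)"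
          unfolding l_def power_divide y2 using vp T e by (simp add: field_simps power2_eq_square)
        also have "\<dots> \<le> 4 / (2 * e\<^sup>2)"
          using ln_square_le[OF T] T by (intro divide_right_mono) (auto simp: divide_le_eq)
        finally show ?thesis by simp
      qed
      moreover have "1 - x + A \<le> 1 + c' + d' - x / 2" if "A = B + C + D" "B \<le> x / 2" "C \<le> c'" "D \<le> d'"
        for A B C D x c' d' :: real
        using that by linarith
      ultimately have "1 - l * a (N k) + (\<Sum>j\<in>{n0<..N k}. l * (mb j + exc y j) + l\<^sup>2 / 2 * exp (l * y) * q j)
        \<le> 1 + 1 / e\<^sup>2 + 2 / e\<^sup>2 - ln T / e / 2"
        unfolding la by blast
      also have "1 + 1 / e\<^sup>2 + 2 / e\<^sup>2 = 1 + 3 / e\<^sup>2" by (simp add: add_divide_distrib[symmetric])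
      also have "1 + 3 / e\<^sup>2 - ln T / e / 2 \<le> 1 + 3 / e\<^sup>2 - 4 * p * (d + 1) * ln T"
      proof -
        have "8 * p * (d + 1) * e \<le> 1" using e p d by (simp add: le_divide_eq mult_ac)
        then have "ln T * (8 * p * (d + 1) * e) \<le> ln T * 1" using lnT(1) by (rule mult_left_mono)
        then have "4 * p * (d + 1) * ln T \<le> ln T / e / 2" using e by (simp add: field_simps)
        then show ?thesis by simp
      qed
      finally have "exp (1 - l * a (N k) + (\<Sum>j\<in>{n0<..N k}. l * (mb j + exc y j) + l\<^sup>2 / 2 * exp (l * y) * q j))
        \<le> exp (1 + 3 / e\<^sup>2) * exp (- (4 * p * (d + 1) * ln T))"
        by (simp add: exp_add[symmetric])
      also have "exp (- (4 * p * (d + 1) * ln T)) = (T powr - (4 * p)) powr (d + 1)"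
        using T by (simp add: powr_powr) (simp add: powr_def)
      also have "(T powr - (4 * p)) powr (d + 1) \<le> L k powr (d + 1)"
      proof (rule powr_mono2)
        have "1 < L k * T powr (4 * p)" using k(2) by (simp add: good_def T_def)
        then show "T powr - (4 * p) \<le> L k" using T by (simp add: powr_minus field_simps)
      qed (use d in auto)
      finally show ?thesis using k(1) by (simp add: r_def)
    qed
    finally show ?thesis using True by (simp add: B_def y_def)
  qed
  have "summable r" unfolding r_def by (rule summable_mult) (use L_sum in \<open>simp add: active_def\<close>)
  from qs_Borel_Cantelli[OF meas bound this] show ?thesis
  proof (rule qs_mono)
    fix \<omega> assume \<omega>: "\<omega> \<in> space M" and "\<forall>\<^sub>F k in sequentially. \<omega> \<notin> B k"
    with eventually_ge_at_top[of k0] show "\<forall>\<^sub>F k in sequentially. active k \<and> \<not> good k \<longrightarrow>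
      (\<forall>m\<in>{1..N k}. (\<Sum>j\<in>{n0<..m}. clip (e * a (N k)) (\<sigma> * X j \<omega>)) < a (N k))"
    proof eventually_elim
      case (elim k)
      then show ?case using \<omega> by (auto simp: B_def K_def not_le[symmetric])
    qed
  qed
qed

text \<open>On a good block the sum is at most the clipped sum plus the excesses; on a bad block
  clipping at e * a is eventually inactive. The first n0 variables contribute at most the fixed
  amount W, eventually below \<epsilon> * a.\<close>

lemma block_upper:
  assumes \<epsilon>: "0 < \<epsilon>" and \<alpha>\<epsilon>: "exp (2 * \<alpha>) \<le> 1 + \<epsilon>" and \<sigma>: "\<sigma> = 1 \<or> \<sigma> = -1"
  shows "qs (\<lambda>\<omega>. \<forall>\<^sub>F k in sequentially. active k \<longrightarrow>
    (\<forall>m\<in>{1..N k}. \<sigma> * (\<Sum>j=1..m. X j \<omega>) \<le> (1 + 5 * \<epsilon>) * a (N k)))"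
proof -
  define e where "e = 1 / (8 * p * (d + 1))"
  have e: "0 < e" "e \<le> 1 / (8 * p * (d + 1))" using p d by (simp_all add: e_def)
  from qs_conj[OF excess_small[OF \<epsilon>] qs_conj[OF good_clip_small[OF \<epsilon> \<alpha>\<epsilon> \<sigma>]
      qs_conj[OF bad_clip_small[OF e \<sigma>] qs_X_uniformly_small[OF e(1)]]]]
  show ?thesis
  proof (rule qs_mono, elim conjE exE)
    fix \<omega> n1
    assume 1: "\<forall>\<^sub>F k in sequentially. active k \<and> good k \<longrightarrow>
        (\<Sum>j\<in>{n0<..N k}. max (\<bar>X j \<omega>\<bar> - 2 * h \<alpha> (N k)) 0) < \<epsilon> * a (N k)"
      and 2: "\<forall>\<^sub>F k in sequentially. active k \<and> good k \<longrightarrow>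
        (\<forall>m\<in>{1..N k}. (\<Sum>j\<in>{n0<..m}. clip (2 * h \<alpha> (N k)) (\<sigma> * X j \<omega>)) < (1 + 3 * \<epsilon>) * a (N k))"
      and 3: "\<forall>\<^sub>F k in sequentially. active k \<and> \<not> good k \<longrightarrow>
        (\<forall>m\<in>{1..N k}. (\<Sum>j\<in>{n0<..m}. clip (e * a (N k)) (\<sigma> * X j \<omega>)) < a (N k))"
      and 4: "\<forall>n\<ge>n1. \<forall>j\<in>{1..n}. \<bar>X j \<omega>\<bar> < e * a n"
    define W where "W = (\<Sum>j=1..n0. \<bar>X j \<omega>\<bar>)"
    obtain n2 where n2: "\<forall>n\<ge>n2. W / \<epsilon> < a n" using a_tends by blast
    from 1 2 3 block_end_tends[OF c, of "max n1 n2"]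
    show "\<forall>\<^sub>F k in sequentially. active k \<longrightarrow>
      (\<forall>m\<in>{1..N k}. \<sigma> * (\<Sum>j=1..m. X j \<omega>) \<le> (1 + 5 * \<epsilon>) * a (N k))"
    proof eventually_elim
      case (elim k)
      show ?case
      proof (intro impI ballI)
        fix m assume k: "active k" and m: "m \<in> {1..N k}"
        have W: "W \<le> \<epsilon> * a (N k)" using n2 elim(4) \<epsilon> by (simp add: divide_less_eq mult.commute less_imp_le)
        have ap: "0 < a (N k)" by (rule a_pos[OF active_pos[OF k]])
        have hp: "0 < h \<alpha> (N k)" by (rule h_pos[OF active_pos[OF k]])
        have "\<sigma> * (\<Sum>j=1..m. X j \<omega>) = (\<Sum>j=1..m. \<sigma> * X j \<omega>)" by (rule sum_distrib_left)
        also have "\<dots> = (\<Sum>j\<in>{1..m} \<inter> {..n0}. \<sigma> * X j \<omega>) + (\<Sum>j\<in>{n0<..m}. \<sigma> * X j \<omega>)"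
        proof -
          have "{1..m} = ({1..m} \<inter> {..n0}) \<union> {n0<..m}" by auto
          then show ?thesis by (subst (1) \<open>{1..m} = _\<close>) (rule sum.union_disjoint, auto)
        qed
        also have "(\<Sum>j\<in>{1..m} \<inter> {..n0}. \<sigma> * X j \<omega>) \<le> (\<Sum>j\<in>{1..m} \<inter> {..n0}. \<bar>X j \<omega>\<bar>)"
          using \<sigma> by (intro sum_mono) auto
        also have "\<dots> \<le> W" unfolding W_def by (rule sum_mono2) auto
        finally have S: "\<sigma> * (\<Sum>j=1..m. X j \<omega>) \<le> W + (\<Sum>j\<in>{n0<..m}. \<sigma> * X j \<omega>)" by simp
        have "(\<Sum>j\<in>{n0<..m}. \<sigma> * X j \<omega>) \<le> (1 + 4 * \<epsilon>) * a (N k)"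
        proof (cases "good k")
          case True
          have "(\<Sum>j\<in>{n0<..m}. \<sigma> * X j \<omega>)
            \<le> (\<Sum>j\<in>{n0<..m}. clip (2 * h \<alpha> (N k)) (\<sigma> * X j \<omega>) + max (\<bar>X j \<omega>\<bar> - 2 * h \<alpha> (N k)) 0)"
          proof (rule sum_mono)
            fix j
            show "\<sigma> * X j \<omega> \<le> clip (2 * h \<alpha> (N k)) (\<sigma> * X j \<omega>) + max (\<bar>X j \<omega>\<bar> - 2 * h \<alpha> (N k)) 0"
              using clip_excess[of "2 * h \<alpha> (N k)" "\<sigma> * X j \<omega>"] hp \<sigma> by (auto simp: abs_le_iff)
          qed
          also have "\<dots> = (\<Sum>j\<in>{n0<..m}. clip (2 * h \<alpha> (N k)) (\<sigma> * X j \<omega>)) + (\<Sum>j\<in>{n0<..m}. max (\<bar>X j \<omega>\<bar> - 2 * h \<alpha> (N k)) 0)"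
            by (rule sum.distrib)
          also have "(\<Sum>j\<in>{n0<..m}. max (\<bar>X j \<omega>\<bar> - 2 * h \<alpha> (N k)) 0) \<le> (\<Sum>j\<in>{n0<..N k}. max (\<bar>X j \<omega>\<bar> - 2 * h \<alpha> (N k)) 0)"
            using m by (intro sum_mono2) auto
          also have "\<dots> \<le> \<epsilon> * a (N k)" using elim(1) k True by simp
          also have "(\<Sum>j\<in>{n0<..m}. clip (2 * h \<alpha> (N k)) (\<sigma> * X j \<omega>)) \<le> (1 + 3 * \<epsilon>) * a (N k)"
            using elim(2) k True m by (auto intro: less_imp_le)
          finally show ?thesis by (simp add: algebra_simps)
        next
          case False
          have "\<sigma> * X j \<omega> = clip (e * a (N k)) (\<sigma> * X j \<omega>)" if "j \<in> {n0<..m}" for j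
          proof -
            have "\<bar>X j \<omega>\<bar> < e * a (N k)" using 4 elim(4) that m by auto
            then show ?thesis using \<sigma> by (auto simp: clip_def abs_less_iff max_def min_def)
          qed
          then have "(\<Sum>j\<in>{n0<..m}. \<sigma> * X j \<omega>) = (\<Sum>j\<in>{n0<..m}. clip (e * a (N k)) (\<sigma> * X j \<omega>))"
            by (rule sum.cong[OF refl])
          also have "\<dots> \<le> a (N k)" using elim(3) k False m by (auto intro: less_imp_le)
          also have "\<dots> \<le> (1 + 4 * \<epsilon>) * a (N k)" using ap \<epsilon> by simp
          finally show ?thesis .
        qed
        then show "\<sigma> * (\<Sum>j=1..m. X j \<omega>) \<le> (1 + 5 * \<epsilon>) * a (N k)"
          using S W by (simp add: algebra_simps)
      qed
    qed
  qed
qed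

end

section \<open>From block ends to all indices\<close>

context lil_sequence
begin

text \<open>For n in block k the variance at the end of the block is at most c * v n. With c near 1
  the norming there is at most (1 + \<epsilon>) * a n, so the maximal bound of the block serves for
  n.\<close>

lemma upper_half:
  assumes \<eta>: "0 < \<eta>" and \<sigma>: "\<sigma> = 1 \<or> \<sigma> = -1"
  shows "qs (\<lambda>\<omega>. \<forall>\<^sub>F n in sequentially. \<sigma> * (\<Sum>j=1..n. X j \<omega>) \<le> (1 + \<eta>) * a n)"
proof -
  \<comment> \<open>For \<epsilon> \<le> 1 the product (1 + 5 * \<epsilon>) * (1 + \<epsilon>) is at
    most 1 + 11 * \<epsilon>.\<close>
  define \<epsilon> where "\<epsilon> = min 1 (\<eta> / 12)"
  have \<epsilon>: "0 < \<epsilon>" "\<epsilon> \<le> 1" "12 * \<epsilon> \<le> \<eta>" using \<eta> by (auto simp: \<epsilon>_def)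
  define c where "c = 1 + \<epsilon> / 2"
  have c: "1 < c" using \<epsilon> by (simp add: c_def)
  have cc: "c * (1 + ln c) \<le> (1 + \<epsilon>)\<^sup>2"
  proof -
    have "ln c \<le> \<epsilon> / 2" using ln_add_one_self_le_self[of "\<epsilon> / 2"] \<epsilon> by (simp add: c_def)
    then have "c * (1 + ln c) \<le> (1 + \<epsilon>) * (1 + \<epsilon>)" using c \<epsilon> by (intro mult_mono) (auto simp: c_def)
    then show ?thesis by (simp add: power2_eq_square)
  qed
  define \<alpha> where "\<alpha> = ln (1 + \<epsilon>) / 2"
  have \<alpha>0: "0 < \<alpha>" and \<alpha>\<epsilon>: "exp (2 * \<alpha>) \<le> 1 + \<epsilon>" using \<epsilon> by (simp_all add: \<alpha>_def)
  obtain p d n0 L where "block_scheme M H E X PP V c \<alpha> p d n0 L"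
    using block_scheme_exists[OF \<alpha>0 c] by blast
  then interpret block_scheme M H E X PP V c \<alpha> p d n0 L .
  obtain n1 where n1: "max 1 (v n0 + 1) \<le> v n1" using v_unbounded by blast
  show ?thesis
  proof (rule qs_mono[OF block_upper[OF \<epsilon>(1) \<alpha>\<epsilon> \<sigma>]])
    fix \<omega> assume "\<forall>\<^sub>F k in sequentially. active k \<longrightarrow>
      (\<forall>m\<in>{1..N k}. \<sigma> * (\<Sum>j=1..m. X j \<omega>) \<le> (1 + 5 * \<epsilon>) * a (N k))"
    then obtain k0 where k0: "\<And>k m. k \<ge> k0 \<Longrightarrow> active k \<Longrightarrow> m \<in> {1..N k} \<Longrightarrow>
      \<sigma> * (\<Sum>j=1..m. X j \<omega>) \<le> (1 + 5 * \<epsilon>) * a (N k)" unfolding eventually_sequentially by blast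
    show "\<forall>\<^sub>F n in sequentially. \<sigma> * (\<Sum>j=1..n. X j \<omega>) \<le> (1 + \<eta>) * a n"
      unfolding eventually_sequentially
    proof (intro exI allI impI)
      fix n assume n: "Suc (max n1 (N k0)) \<le> n"
      have "v n1 \<le> v n" using n by (intro v_mono) simp
      then have vn: "1 \<le> v n" "v n0 < v n" using n1 by auto
      obtain k where k: "hit c k" "c ^ k \<le> v n" "n \<le> N k" using block_of[OF c vn(1)] by blast
      have "n0 < n" using vn(2) v_mono[of n n0] by (cases "n0 < n") auto
      then have act: "active k" using k by (simp add: active_def)
      have kk: "k0 \<le> k"
      proof (rule ccontr)
        assume "\<not> k0 \<le> k"
        then have "N k \<le> N k0" by (intro block_end_mono c) simp
        then show False using k(3) n by simp
      qed
      have "c * c ^ k \<le> c * v n" using k(2) c by (intro mult_left_mono) auto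
      then have "v (N k) \<le> c * v n" using v_block_end[OF c, of k] by simp
      then have "v (N k) * LL (v (N k)) \<le> (c * v n) * ((1 + ln c) * LL (v n))"
        using LL_mono[of "v (N k)" "c * v n"] LL_mult_le[of c "v n"] c v_nonneg LL_ge_1[of "v (N k)"]
        by (intro mult_mono) auto
      also have "\<dots> = (c * (1 + ln c)) * (v n * LL (v n))" by (simp add: mult_ac)
      also have "\<dots> \<le> (1 + \<epsilon>)\<^sup>2 * (v n * LL (v n))"
        using cc v_nonneg LL_ge_1[of "v n"] by (intro mult_right_mono) auto
      finally have "(a (N k))\<^sup>2 \<le> ((1 + \<epsilon>) * a n)\<^sup>2"
        unfolding power_mult_distrib a_square by (simp add: mult_ac)
      then have aN: "a (N k) \<le> (1 + \<epsilon>) * a n"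
        by (rule power2_le_imp_le) (use a_nonneg \<epsilon> in auto)
      have "\<sigma> * (\<Sum>j=1..n. X j \<omega>) \<le> (1 + 5 * \<epsilon>) * a (N k)"
        by (rule k0[OF kk act]) (use k n in auto)
      also have "\<dots> \<le> (1 + 5 * \<epsilon>) * ((1 + \<epsilon>) * a n)" using aN \<epsilon> by (intro mult_left_mono) auto
      also have "\<dots> = ((1 + 5 * \<epsilon>) * (1 + \<epsilon>)) * a n" by simp
      also have "\<dots> \<le> (1 + \<eta>) * a n"
      proof (rule mult_right_mono[OF _ a_nonneg])
        have "\<epsilon> * \<epsilon> \<le> \<epsilon> * 1" using \<epsilon> by (intro mult_left_mono) auto
        moreover have "(1 + 5 * \<epsilon>) * (1 + \<epsilon>) = 1 + 6 * \<epsilon> + 5 * (\<epsilon> * \<epsilon>)" by (simp add: algebra_simps)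
        ultimately show "(1 + 5 * \<epsilon>) * (1 + \<epsilon>) \<le> 1 + \<eta>" using \<epsilon> by linarith
      qed
      finally show "\<sigma> * (\<Sum>j=1..n. X j \<omega>) \<le> (1 + \<eta>) * a n" .
    qed
  qed
qed

end

text \<open>Turns a lower bound 1 + A - B into an exponential one that survives products. For B
  \<le> 1/4 this is ln (1 + u) \<ge> u - 2 * u^2. For larger B the linear bound may be useless, but
  then A - 3 * B \<le> 1/8 - 3/4 lies below - 4 * \<alpha> and the second bound on r takes
  over.\<close>

lemma exp_le_one_plus_diff:
  fixes A B \<alpha> r :: real
  assumes \<alpha>: "0 \<le> \<alpha>" "\<alpha> \<le> 1/8" and A: "0 \<le> A" "A \<le> 8 * \<alpha>\<^sup>2" and B: "0 \<le> B"
    and r: "1 + (A - B) \<le> r" "exp (- (4 * \<alpha>)) \<le> r"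
  shows "exp (A * (1 - 16 * \<alpha>\<^sup>2) - 3 * B) \<le> r"
proof -
  have \<alpha>2: "\<alpha>\<^sup>2 \<le> 1/64" using power_mono[OF \<alpha>(2,1), of 2] by (simp add: power2_eq_square)
  show ?thesis
  proof (cases "B \<le> 1/4")
    case True
    define u where "u = A - B"
    have u: "\<bar>u\<bar> \<le> 1/2" unfolding u_def abs_le_iff using A B True \<alpha>2 by linarith
    have u2: "u\<^sup>2 \<le> A\<^sup>2 + B\<^sup>2" unfolding u_def using A B by (simp add: power2_diff)
    have "A\<^sup>2 \<le> 8 * (\<alpha>\<^sup>2 * A)" using mult_left_mono[OF A(2,1)] by (simp add: power2_eq_square[of A] mult_ac)
    moreover have "B * B \<le> B * (1/4)" using B True by (intro mult_left_mono)
    then have "B\<^sup>2 \<le> B / 4" by (simp add: power2_eq_square)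
    ultimately have "2 * u\<^sup>2 \<le> 16 * (\<alpha>\<^sup>2 * A) + B / 2" using u2 by linarith
    moreover have "u - ln (1 + u) \<le> 2 * u\<^sup>2" using abs_ln_one_plus_x_minus_x_bound[OF u] by linarith
    moreover have "A * (1 - 16 * \<alpha>\<^sup>2) = A - 16 * (\<alpha>\<^sup>2 * A)" by (simp add: algebra_simps)
    ultimately have "A * (1 - 16 * \<alpha>\<^sup>2) - 3 * B \<le> ln (1 + u)" using B unfolding u_def by linarith
    then have "exp (A * (1 - 16 * \<alpha>\<^sup>2) - 3 * B) \<le> exp (ln (1 + u))" by simp
    also have "\<dots> = 1 + u" using u by (intro exp_ln) (simp add: abs_le_iff)
    finally show ?thesis using r(1) by (simp add: u_def)
  next
    case False
    have "A * (1 - 16 * \<alpha>\<^sup>2) \<le> A * 1" using A by (intro mult_left_mono) auto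
    then have "A * (1 - 16 * \<alpha>\<^sup>2) - 3 * B \<le> - (4 * \<alpha>)" using A \<alpha> \<alpha>2 False by linarith
    then have "exp (A * (1 - 16 * \<alpha>\<^sup>2) - 3 * B) \<le> exp (- (4 * \<alpha>))" by simp
    then show ?thesis by (rule order_trans[OF _ r(2)])
  qed
qed

section \<open>Exponential moments and soft events for the lower half\<close>

context block_scheme
begin

text \<open>The sums for the lower half run over \<open>{block_start k<..N k}\<close>, which reaches back to variance
  \<open>c ^ k / c\<close>, so that it carries most of the variance even if the block \<open>k\<close> itself is short; these
  ranges are disjoint for indices of equal parity.\<close>

definition block_start :: "nat \<Rightarrow> nat" where
  "block_start k = last (c ^ k / c)"

lemma v_block_start: "v (block_start k) < c ^ k / c"
  unfolding block_start_def by (rule v_last) (use c in simp)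

lemma block_start_le: "block_start k \<le> N k"
proof -
  have "c ^ k * 1 \<le> c ^ k * (c * c)" using c by (intro mult_left_mono) (auto intro: order_trans[OF _ mult_mono[of 1 c 1 c]])
  then have "c ^ k / c \<le> c ^ Suc k" using c by (simp add: divide_le_eq mult_ac)
  then show ?thesis unfolding block_start_def block_end_def using c by (intro last_mono) auto
qed

lemma block_end_le_start: "j + 2 \<le> k \<Longrightarrow> N j \<le> block_start k"
proof -
  assume jk: "j + 2 \<le> k"
  have "c ^ Suc j * c \<le> c ^ k"
    using jk c power_increasing[of "Suc (Suc j)" k c] by (simp add: mult_ac)
  then have "c ^ Suc j \<le> c ^ k / c" using c by (simp add: le_divide_eq)
  then show ?thesis unfolding block_start_def block_end_def using c by (intro last_mono) auto
qed

lemma block_start_tends: "\<exists>k0. \<forall>k\<ge>k0. n \<le> block_start k"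
proof -
  obtain k0 where k0: "\<And>k. k \<ge> k0 \<Longrightarrow> n \<le> N k"
    using block_end_tends[OF c, of n] unfolding eventually_sequentially by blast
  have "n \<le> block_start k" if "k \<ge> k0 + 2" for k
  proof -
    have "k0 \<le> k - 2" "k - 2 + 2 \<le> k" using that by linarith+
    then show ?thesis using k0 block_end_le_start order_trans by blast
  qed
  then show ?thesis by blast
qed

lemma t_block_tends: "\<exists>k0. \<forall>k\<ge>k0. hit c k \<longrightarrow> r \<le> t (N k)"
proof -
  define r' where "r' = exp (exp (r\<^sup>2))"
  obtain n1 where n1: "r' \<le> v n1" using v_unbounded by blast
  obtain k0 where k0: "\<And>k. k \<ge> k0 \<Longrightarrow> n1 \<le> N k"
    using block_end_tends[OF c, of n1] unfolding eventually_sequentially by blast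
  have "r \<le> t (N k)" if "k \<ge> k0" for k
  proof -
    have "r' \<le> v (N k)" using n1 v_mono[OF k0[OF that]] by simp
    then have "LL r' \<le> LL (v (N k))" by (rule LL_mono)
    moreover have "r\<^sup>2 \<le> LL r'"
    proof -
      have "exp (r\<^sup>2) \<le> log_e r'" using ln_le_log_e[of r'] by (simp add: r'_def)
      moreover have "r\<^sup>2 \<le> log_e (exp (r\<^sup>2))" using ln_le_log_e[of "exp (r\<^sup>2)"] by simp
      ultimately show ?thesis unfolding LL_def using log_e_mono order_trans by blast
    qed
    moreover have "0 \<le> r\<^sup>2" by simp
    ultimately have "r\<^sup>2 \<le> (t (N k))\<^sup>2" unfolding t_square by linarith
    then show ?thesis by (rule power2_le_imp_le) (use t_ge_1[of "N k"] in simp)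
  qed
  then show ?thesis by blast
qed

definition block_sum :: "real \<Rightarrow> nat \<Rightarrow> (nat \<Rightarrow> real) \<Rightarrow> real" where
  "block_sum \<sigma> k x = (\<Sum>j\<in>{block_start k<..N k}. clip (2 * h \<alpha> (N k)) (\<sigma> * x j))"

text \<open>Normalised so that the exponent is \<theta> * t^2 times the block sum in units of a;
  under this tilt the sum concentrates near \<theta> * a.\<close>

definition block_mgf :: "real \<Rightarrow> nat \<Rightarrow> real \<Rightarrow> real" where
  "block_mgf \<sigma> k \<theta> = Ex (\<lambda>x. exp (\<theta> * (t (N k) / s (N k)) * block_sum \<sigma> k x))"

lemma cyl_block_sum:
  assumes "\<sigma> = 1 \<or> \<sigma> = -1"
  shows "cyl {block_start k<..N k} (block_sum \<sigma> k)"
  unfolding block_sum_def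
proof (rule cyl_sum)
  fix j assume "j \<in> {block_start k<..N k}"
  then show "cyl {block_start k<..N k} (\<lambda>x. clip (2 * h \<alpha> (N k)) (\<sigma> * x j))"
    using h_nonneg[of \<alpha> "N k"] \<alpha> by (intro cyl_mono[OF cyl_clip[OF _ assms]]) auto
qed simp

lemma block_mgf_prod:
  assumes \<sigma>: "\<sigma> = 1 \<or> \<sigma> = -1"
  shows "block_mgf \<sigma> k \<theta> = (\<Prod>j\<in>{block_start k<..N k}.
    rE (\<lambda>\<omega>. exp (\<theta> * (t (N k) / s (N k)) * clip (2 * h \<alpha> (N k)) (\<sigma> * X j \<omega>))))"
proof -
  have "block_mgf \<sigma> k \<theta> = Ex (\<lambda>x. \<Prod>j\<in>{block_start k<..N k}.
      exp (\<theta> * (t (N k) / s (N k)) * clip (2 * h \<alpha> (N k)) (\<sigma> * x j)))"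
    unfolding block_mgf_def block_sum_def by (simp add: sum_distrib_left exp_sum)
  also have "\<dots> = (\<Prod>j\<in>{block_start k<..N k}.
    rE (\<lambda>\<omega>. exp (\<theta> * (t (N k) / s (N k)) * clip (2 * h \<alpha> (N k)) (\<sigma> * X j \<omega>))))"
  proof (rule Ex_prod[OF block_start_le, where f="\<lambda>j u. exp (\<theta> * (t (N k) / s (N k)) * clip (2 * h \<alpha> (N k)) (\<sigma> * u))"])
    show "cyl {j} (\<lambda>x. exp (\<theta> * (t (N k) / s (N k)) * clip (2 * h \<alpha> (N k)) (\<sigma> * x j)))" for j
      using h_nonneg[of \<alpha> "N k"] \<alpha> by (intro cyl_exp cyl_cmult cyl_clip \<sigma>) simp
  qed simp
  finally show ?thesis .
qed

text \<open>The bound \<theta> \<le> 2 keeps the tilted truncation level below 4 * \<alpha>;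
  starting beyond n0 makes the excess moments of the window available.\<close>

lemma block_mgf_upper:
  assumes k: "active k" "good k" and big: "n0 \<le> block_start k" and \<theta>: "0 \<le> \<theta>" "\<theta> \<le> 2"
    and \<sigma>: "\<sigma> = 1 \<or> \<sigma> = -1" and e1: "(\<Sum>j=1..N k. mb j) \<le> e1 * a (N k)"
  shows "block_mgf \<sigma> k \<theta> \<le> exp (\<theta>\<^sup>2 / 2 * exp (4 * \<alpha>) * (t (N k))\<^sup>2 + 2 * e1 * (t (N k))\<^sup>2 + 2 * (\<alpha> * \<alpha> powr - p))"
proof -
  have vp: "0 < v (N k)" by (rule active_pos[OF k(1)])
  define T S where "T = t (N k)" and "S = s (N k)"
  have T: "1 \<le> T" and S: "0 < S" using t_ge_1 s_pos[OF vp] by (auto simp: T_def S_def)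
  define l where "l = T / S"
  have l: "0 \<le> l" using T S by (simp add: l_def)
  let ?y = "2 * h \<alpha> (N k)" and ?J = "{block_start k<..N k}"
  have J: "?J \<subseteq> {n0<..N k}" using big by auto
  have y0: "0 \<le> ?y" using h_pos[OF vp] by simp
  have lh: "l * h \<alpha> (N k) = \<alpha>" unfolding l_def h_def using T S by (simp add: T_def[symmetric] S_def[symmetric])
  have ly: "\<theta> * l * ?y \<le> 4 * \<alpha>"
  proof -
    have "\<theta> * l * ?y = \<theta> * (2 * \<alpha>)" using lh by (simp add: mult_ac)
    also have "\<dots> \<le> 2 * (2 * \<alpha>)" using \<theta> \<alpha> by (intro mult_right_mono) auto
    finally show ?thesis by simp
  qed
  have "block_mgf \<sigma> k \<theta> \<le> (\<Prod>j\<in>?J. exp (\<theta> * l * (mb j + exc ?y j) + (\<theta> * l)\<^sup>2 / 2 * exp (\<theta> * l * ?y) * q j))"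
    unfolding block_mgf_prod[OF \<sigma>] l_def T_def S_def
  proof (rule prod_mono, rule conjI)
    fix j assume "j \<in> ?J"
    then have j: "j \<ge> 1" by auto
    show "0 \<le> rE (\<lambda>\<omega>. exp (\<theta> * (t (N k) / s (N k)) * clip ?y (\<sigma> * X j \<omega>)))"
      by (rule rE_ge[OF exp_clip_L1[OF j y0 \<sigma>]]) simp
    show "rE (\<lambda>\<omega>. exp (\<theta> * (t (N k) / s (N k)) * clip ?y (\<sigma> * X j \<omega>)))
      \<le> exp (\<theta> * (t (N k) / s (N k)) * (mb j + exc ?y j) + (\<theta> * (t (N k) / s (N k)))\<^sup>2 / 2 * exp (\<theta> * (t (N k) / s (N k)) * ?y) * q j)"
      by (rule mgf_upper[OF j y0 mult_nonneg_nonneg[OF \<theta>(1) l, unfolded l_def T_def S_def] \<sigma>])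
  qed
  also have "\<dots> = exp (\<Sum>j\<in>?J. \<theta> * l * (mb j + exc ?y j) + (\<theta> * l)\<^sup>2 / 2 * exp (\<theta> * l * ?y) * q j)"
    by (rule exp_sum[symmetric]) simp
  also have "(\<Sum>j\<in>?J. \<theta> * l * (mb j + exc ?y j) + (\<theta> * l)\<^sup>2 / 2 * exp (\<theta> * l * ?y) * q j)
    = \<theta> * (l * (\<Sum>j\<in>?J. mb j) + l * (\<Sum>j\<in>?J. exc ?y j)) + (\<theta> * l)\<^sup>2 / 2 * exp (\<theta> * l * ?y) * (\<Sum>j\<in>?J. q j)"
    by (simp add: sum.distrib sum_distrib_left distrib_left mult.assoc)
  also have "\<dots> \<le> 2 * (e1 * T\<^sup>2 + \<alpha> * \<alpha> powr - p) + \<theta>\<^sup>2 / 2 * exp (4 * \<alpha>) * T\<^sup>2"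
  proof (rule add_mono)
    have "(\<Sum>j\<in>?J. mb j) \<le> (\<Sum>j=1..N k. mb j)" by (rule sum_mono2) (auto intro: mb_nonneg)
    then have "l * (\<Sum>j\<in>?J. mb j) \<le> l * (e1 * a (N k))" using e1 l by (intro mult_left_mono) auto
    also have "\<dots> = e1 * T\<^sup>2" using S by (simp add: l_def a_def T_def[symmetric] S_def[symmetric] power2_eq_square)
    finally have 1: "l * (\<Sum>j\<in>?J. mb j) \<le> e1 * T\<^sup>2" .
    have 2: "l * (\<Sum>j\<in>?J. exc ?y j) \<le> \<alpha> * \<alpha> powr - p"
      unfolding l_def T_def S_def by (rule exc_sum_le[OF k J])
    have "0 \<le> l * (\<Sum>j\<in>?J. mb j) + l * (\<Sum>j\<in>?J. exc ?y j)"
      using l by (intro add_nonneg_nonneg mult_nonneg_nonneg sum_nonneg mb_nonneg exc_nonneg) auto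
    then have "\<theta> * (l * (\<Sum>j\<in>?J. mb j) + l * (\<Sum>j\<in>?J. exc ?y j)) \<le> 2 * (l * (\<Sum>j\<in>?J. mb j) + l * (\<Sum>j\<in>?J. exc ?y j))"
      using \<theta> by (intro mult_right_mono) auto
    also have "\<dots> \<le> 2 * (e1 * T\<^sup>2 + \<alpha> * \<alpha> powr - p)"
      by (rule mult_left_mono[OF add_mono[OF 1 2]]) simp
    finally show "\<theta> * (l * (\<Sum>j\<in>?J. mb j) + l * (\<Sum>j\<in>?J. exc ?y j)) \<le> 2 * (e1 * T\<^sup>2 + \<alpha> * \<alpha> powr - p)" .
    have "(\<Sum>j\<in>?J. q j) \<le> (\<Sum>j\<in>{n0<..N k}. q j)" using J by (intro sum_mono2) (auto intro: q_nonneg)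
    then have qs: "(\<Sum>j\<in>?J. q j) \<le> v (N k)" using sum_q_le[of k] by simp
    have "(\<theta> * l)\<^sup>2 / 2 * exp (\<theta> * l * ?y) * (\<Sum>j\<in>?J. q j) \<le> (\<theta> * l)\<^sup>2 / 2 * exp (4 * \<alpha>) * v (N k)"
      using qs ly by (intro mult_mono mult_left_mono sum_nonneg) (auto intro: q_nonneg)
    also have "\<dots> = \<theta>\<^sup>2 / 2 * exp (4 * \<alpha>) * (l\<^sup>2 * v (N k))" by (simp add: power_mult_distrib)
    also have "l\<^sup>2 * v (N k) = T\<^sup>2"
      unfolding l_def s_square[symmetric] S_def[symmetric] using S by (simp add: power_divide)
    finally show "(\<theta> * l)\<^sup>2 / 2 * exp (\<theta> * l * ?y) * (\<Sum>j\<in>?J. q j) \<le> \<theta>\<^sup>2 / 2 * exp (4 * \<alpha>) * T\<^sup>2" .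
  qed
  finally show ?thesis by (simp add: T_def algebra_simps)
qed

text \<open>Each factor is bounded by \<open>mgf_lower\<close> and
  \<open>exp_le_one_plus_diff\<close>. The clipped second moments lose at most a multiple of the
  p-th excess moments, and the window carries at least the share 1 - 1 / c of the variance.\<close>

lemma block_mgf_lower:
  assumes k: "active k" "good k" and big: "n0 \<le> block_start k" and \<theta>: "0 \<le> \<theta>" "\<theta> \<le> 2"
    and \<alpha>8: "\<alpha> \<le> 1/8" and \<sigma>: "\<sigma> = 1 \<or> \<sigma> = -1" and e1: "(\<Sum>j=1..N k. mb j) \<le> e1 * a (N k)"
  shows "exp ((1 - 16 * \<alpha>\<^sup>2) * exp (- (4 * \<alpha>)) * (1 - 1 / c) * (\<theta>\<^sup>2 / 2 * (t (N k))\<^sup>2)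
      - 6 * e1 * (t (N k))\<^sup>2 - (8 * \<alpha>\<^sup>2 * \<alpha> powr - p + 6 * (\<alpha> * \<alpha> powr - p))) \<le> block_mgf \<sigma> k \<theta>"
proof -
  have vp: "0 < v (N k)" by (rule active_pos[OF k(1)])
  define T S where "T = t (N k)" and "S = s (N k)"
  have T: "1 \<le> T" and S: "0 < S" using t_ge_1 s_pos[OF vp] by (auto simp: T_def S_def)
  define l where "l = T / S"
  have l: "0 \<le> l" using T S by (simp add: l_def)
  have hp: "0 < h \<alpha> (N k)" by (rule h_pos[OF vp])
  define y J where "y = 2 * h \<alpha> (N k)" and "J = {block_start k<..N k}"
  have J: "J \<subseteq> {n0<..N k}" and Jf: "finite J" using big by (auto simp: J_def)
  have y0: "0 \<le> y" using hp by (simp add: y_def)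
  have lh: "l * h \<alpha> (N k) = \<alpha>" unfolding l_def h_def using T S by (simp add: T_def[symmetric] S_def[symmetric])
  have ly0: "\<theta> * l * y = \<theta> * (2 * \<alpha>)" using lh by (simp add: y_def mult_ac)
  have ly: "\<theta> * l * y \<le> 4 * \<alpha>"
  proof -
    have "\<theta> * (2 * \<alpha>) \<le> 2 * (2 * \<alpha>)" using \<theta> \<alpha> by (intro mult_right_mono) auto
    then show ?thesis unfolding ly0 by linarith
  qed
  have tl: "0 \<le> \<theta> * l" using \<theta> l by simp
  have \<alpha>2: "\<alpha>\<^sup>2 \<le> 1/64" using power_mono[OF \<alpha>8, of 2] \<alpha> by (simp add: power2_eq_square)
  define w where "w j = rE (\<lambda>\<omega>. (clip y (\<sigma> * X j \<omega>))\<^sup>2)" for j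
  define A where "A j = (\<theta> * l)\<^sup>2 / 2 * exp (- (4 * \<alpha>)) * w j" for j
  define B where "B j = \<theta> * l * (mb j + exc y j)" for j
  have cL: "(\<lambda>\<omega>. (clip y (\<sigma> * X j \<omega>))\<^sup>2) \<in> L1" if "j \<ge> 1" for j
    using cyl_L1[OF cyl_mult[OF cyl_clip[OF y0 \<sigma>] cyl_clip[OF y0 \<sigma>]], of j] that
    by (simp add: path_def power2_eq_square)
  have w0: "0 \<le> w j" if "j \<ge> 1" for j
    unfolding w_def by (rule rE_ge[OF cL[OF that]]) simp
  have wy: "w j \<le> y\<^sup>2" if "j \<ge> 1" for j
    unfolding w_def
  proof (rule rE_le[OF cL[OF that]])
    show "(clip y (\<sigma> * X j \<omega>))\<^sup>2 \<le> y\<^sup>2" for \<omega>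
      using clip_bound[OF y0, of "\<sigma> * X j \<omega>"] y0 abs_le_square_iff[of "clip y (\<sigma> * X j \<omega>)" y] by simp
  qed
  have A0: "0 \<le> A j" if "j \<ge> 1" for j unfolding A_def using w0[OF that] by simp
  have A8: "A j \<le> 8 * \<alpha>\<^sup>2" if "j \<ge> 1" for j
  proof -
    have "A j \<le> (\<theta> * l)\<^sup>2 / 2 * 1 * y\<^sup>2"
      unfolding A_def using wy[OF that] w0[OF that] \<alpha> by (intro mult_mono) auto
    also have "\<dots> = (\<theta> * l * y)\<^sup>2 / 2" by (simp add: power_mult_distrib)
    also have "\<dots> \<le> (4 * \<alpha>)\<^sup>2 / 2"
      using ly tl y0 by (intro divide_right_mono power_mono) auto
    finally show ?thesis by (simp add: power_mult_distrib)
  qed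
  have B0: "0 \<le> B j" if "j \<ge> 1" for j
    unfolding B_def using tl mb_nonneg[of j] exc_nonneg[OF that, of y] by simp
  have each: "exp (A j * (1 - 16 * \<alpha>\<^sup>2) - 3 * B j) \<le> rE (\<lambda>\<omega>. exp (\<theta> * l * clip y (\<sigma> * X j \<omega>)))"
    if j: "j \<ge> 1" for j
  proof (rule exp_le_one_plus_diff[OF _ \<alpha>8 A0[OF j] A8[OF j] B0[OF j]])
    have "1 + (A j - B j) \<le> 1 + ((\<theta> * l)\<^sup>2 / 2 * exp (- (\<theta> * l * y)) * w j - B j)"
      unfolding A_def using ly w0[OF j] by (simp add: mult_right_mono mult_left_mono)
    also have "\<dots> \<le> rE (\<lambda>\<omega>. exp (\<theta> * l * clip y (\<sigma> * X j \<omega>)))"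
      unfolding w_def B_def by (rule mgf_lower[OF j y0 tl \<sigma>])
    finally show "1 + (A j - B j) \<le> rE (\<lambda>\<omega>. exp (\<theta> * l * clip y (\<sigma> * X j \<omega>)))" .
    \<comment> \<open>Trivial bound from \<open>clip\<close> \<ge> - y, for factors with large
      \<open>B j\<close>.\<close>
    show "exp (- (4 * \<alpha>)) \<le> rE (\<lambda>\<omega>. exp (\<theta> * l * clip y (\<sigma> * X j \<omega>)))"
    proof (rule rE_ge[OF exp_clip_L1[OF j y0 \<sigma>]])
      fix \<omega>
      have "- y \<le> clip y (\<sigma> * X j \<omega>)" using clip_bound[OF y0, of "\<sigma> * X j \<omega>"] by simp
      then have "\<theta> * l * (- y) \<le> \<theta> * l * clip y (\<sigma> * X j \<omega>)" using tl by (rule mult_left_mono)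
      then show "exp (- (4 * \<alpha>)) \<le> exp (\<theta> * l * clip y (\<sigma> * X j \<omega>))" using ly by simp
    qed
  qed (use \<alpha> in simp)
  have SA: "exp (- (4 * \<alpha>)) * (1 - 1 / c) * (\<theta>\<^sup>2 / 2 * T\<^sup>2) - 8 * \<alpha>\<^sup>2 * \<alpha> powr - p \<le> (\<Sum>j\<in>J. A j)"
  proof -
    have sq: "v (N k) * (1 - 1 / c) \<le> (\<Sum>j\<in>J. q j)"
    proof -
      \<comment> \<open>The block is not empty, so c^k \<le> v (N k).\<close>
      have "v (block_start k) \<le> v (N k) / c"
        using v_block_start[of k] k(1) c unfolding active_def hit_def
        by (meson divide_right_mono less_imp_le order_trans zero_le_one less_trans)
      then show ?thesis unfolding J_def sum_q[OF block_start_le] by (simp add: algebra_simps)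
    qed
    have "(\<Sum>j\<in>J. q j) - 4 * h \<alpha> (N k) powr (2 - p) * (\<Sum>j\<in>J. trunc_moment p (h \<alpha> (N k)) j) \<le> (\<Sum>j\<in>J. w j)"
      unfolding sum_distrib_left sum_subtractf[symmetric] w_def y_def
      by (rule sum_mono, rule clip_square_ge[OF _ hp p \<sigma> trunc_L1]) (use J in auto)
    moreover have "(\<Sum>j\<in>J. trunc_moment p (h \<alpha> (N k)) j) \<le> (\<Sum>j\<in>{n0<..N k}. trunc_moment p (h \<alpha> (N k)) j)"
      using J by (intro sum_mono2) (auto intro: trunc_nonneg)
    then have "4 * h \<alpha> (N k) powr (2 - p) * (\<Sum>j\<in>J. trunc_moment p (h \<alpha> (N k)) j)
        \<le> 4 * h \<alpha> (N k) powr (2 - p) * (\<Sum>j\<in>{n0<..N k}. trunc_moment p (h \<alpha> (N k)) j)"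
      by (rule mult_left_mono) simp
    ultimately have "v (N k) * (1 - 1 / c) - 4 * h \<alpha> (N k) powr (2 - p) * (\<Sum>j\<in>{n0<..N k}. trunc_moment p (h \<alpha> (N k)) j) \<le> (\<Sum>j\<in>J. w j)"
      using sq by linarith
    then have "l\<^sup>2 * (v (N k) * (1 - 1 / c) - 4 * h \<alpha> (N k) powr (2 - p) * (\<Sum>j\<in>{n0<..N k}. trunc_moment p (h \<alpha> (N k)) j)) \<le> l\<^sup>2 * (\<Sum>j\<in>J. w j)"
      by (rule mult_left_mono) simp
    moreover have "l\<^sup>2 * v (N k) = T\<^sup>2"
      unfolding l_def s_square[symmetric] S_def[symmetric] using S by (simp add: power_divide)
    moreover have "l\<^sup>2 * (h \<alpha> (N k) powr (2 - p) * (\<Sum>j\<in>{n0<..N k}. trunc_moment p (h \<alpha> (N k)) j)) \<le> \<alpha>\<^sup>2 * \<alpha> powr - p"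
    proof -
      have "h \<alpha> (N k) powr (2 - p) = (h \<alpha> (N k))\<^sup>2 * h \<alpha> (N k) powr - p"
        using hp by (simp add: powr_diff powr_minus_divide powr_numeral)
      then have "l\<^sup>2 * (h \<alpha> (N k) powr (2 - p) * (\<Sum>j\<in>{n0<..N k}. trunc_moment p (h \<alpha> (N k)) j))
        = (l * h \<alpha> (N k))\<^sup>2 * (h \<alpha> (N k) powr - p * (\<Sum>j\<in>{n0<..N k}. trunc_moment p (h \<alpha> (N k)) j))"
        by (simp add: power_mult_distrib)
      also have "\<dots> \<le> (l * h \<alpha> (N k))\<^sup>2 * (\<alpha> powr - p * (L k * T powr (2 * p)))"
        unfolding T_def by (intro mult_left_mono trunc_sum_le[OF k(1)]) simp
      also have "\<dots> \<le> (l * h \<alpha> (N k))\<^sup>2 * (\<alpha> powr - p * 1)"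
        unfolding T_def using good_le(2)[OF k(2)] by (intro mult_left_mono) auto
      finally show ?thesis by (simp add: lh)
    qed
    ultimately have lw: "T\<^sup>2 * (1 - 1 / c) - 4 * (\<alpha>\<^sup>2 * \<alpha> powr - p) \<le> l\<^sup>2 * (\<Sum>j\<in>J. w j)"
      by (simp add: algebra_simps)
    define b where "b = \<theta>\<^sup>2 / 2 * exp (- (4 * \<alpha>))"
    have b: "0 \<le> b" "b \<le> 2"
    proof -
      have "\<theta>\<^sup>2 / 2 * exp (- (4 * \<alpha>)) \<le> 2\<^sup>2 / 2 * 1" using \<theta> \<alpha> by (intro mult_mono divide_right_mono power_mono) auto
      then show "b \<le> 2" by (simp add: b_def)
    qed (simp add: b_def)
    have "b * (T\<^sup>2 * (1 - 1 / c) - 4 * (\<alpha>\<^sup>2 * \<alpha> powr - p)) \<le> b * (l\<^sup>2 * (\<Sum>j\<in>J. w j))"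
      using lw b by (intro mult_left_mono)
    moreover have "b * (l\<^sup>2 * (\<Sum>j\<in>J. w j)) = (\<Sum>j\<in>J. A j)"
      unfolding A_def b_def sum_distrib_left[symmetric] by (simp add: power_mult_distrib)
    moreover have "b * (4 * (\<alpha>\<^sup>2 * \<alpha> powr - p)) \<le> 2 * (4 * (\<alpha>\<^sup>2 * \<alpha> powr - p))"
      using b by (intro mult_right_mono) auto
    ultimately show ?thesis by (simp add: b_def algebra_simps)
  qed
  have SB: "(\<Sum>j\<in>J. B j) \<le> 2 * (e1 * T\<^sup>2 + \<alpha> * \<alpha> powr - p)"
  proof -
    have "(\<Sum>j\<in>J. mb j) \<le> (\<Sum>j=1..N k. mb j)" using J by (intro sum_mono2) (auto intro: mb_nonneg)
    then have "l * (\<Sum>j\<in>J. mb j) \<le> l * (e1 * a (N k))" using e1 l by (intro mult_left_mono) auto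
    also have "\<dots> = e1 * T\<^sup>2" using S by (simp add: l_def a_def T_def[symmetric] S_def[symmetric] power2_eq_square)
    finally have 1: "l * (\<Sum>j\<in>J. mb j) \<le> e1 * T\<^sup>2" .
    have 2: "l * (\<Sum>j\<in>J. exc y j) \<le> \<alpha> * \<alpha> powr - p"
      unfolding l_def T_def S_def y_def by (rule exc_sum_le[OF k J])
    have "0 \<le> l * (\<Sum>j\<in>J. mb j) + l * (\<Sum>j\<in>J. exc y j)"
      using l J by (intro add_nonneg_nonneg mult_nonneg_nonneg sum_nonneg mb_nonneg exc_nonneg) auto
    then have "\<theta> * (l * (\<Sum>j\<in>J. mb j) + l * (\<Sum>j\<in>J. exc y j)) \<le> 2 * (l * (\<Sum>j\<in>J. mb j) + l * (\<Sum>j\<in>J. exc y j))"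
      using \<theta> by (intro mult_right_mono) auto
    also have "\<dots> \<le> 2 * (e1 * T\<^sup>2 + \<alpha> * \<alpha> powr - p)"
      by (rule mult_left_mono[OF add_mono[OF 1 2]]) simp
    also have "\<theta> * (l * (\<Sum>j\<in>J. mb j) + l * (\<Sum>j\<in>J. exc y j)) = (\<Sum>j\<in>J. B j)"
      unfolding B_def by (simp add: sum.distrib sum_distrib_left distrib_left mult.assoc)
    finally show ?thesis .
  qed
  have "(1 - 16 * \<alpha>\<^sup>2) * exp (- (4 * \<alpha>)) * (1 - 1 / c) * (\<theta>\<^sup>2 / 2 * T\<^sup>2) - 6 * e1 * T\<^sup>2 - (8 * \<alpha>\<^sup>2 * \<alpha> powr - p + 6 * (\<alpha> * \<alpha> powr - p))
    \<le> (\<Sum>j\<in>J. A j * (1 - 16 * \<alpha>\<^sup>2) - 3 * B j)"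
  proof -
    have "(1 - 16 * \<alpha>\<^sup>2) * (exp (- (4 * \<alpha>)) * (1 - 1 / c) * (\<theta>\<^sup>2 / 2 * T\<^sup>2) - 8 * \<alpha>\<^sup>2 * \<alpha> powr - p) \<le> (1 - 16 * \<alpha>\<^sup>2) * (\<Sum>j\<in>J. A j)"
      using SA \<alpha>2 by (intro mult_left_mono) auto
    moreover have "(1 - 16 * \<alpha>\<^sup>2) * (8 * \<alpha>\<^sup>2 * \<alpha> powr - p) \<le> 1 * (8 * \<alpha>\<^sup>2 * \<alpha> powr - p)"
      by (intro mult_right_mono) auto
    moreover have "(\<Sum>j\<in>J. A j * (1 - 16 * \<alpha>\<^sup>2) - 3 * B j) = (1 - 16 * \<alpha>\<^sup>2) * (\<Sum>j\<in>J. A j) - 3 * (\<Sum>j\<in>J. B j)"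
      unfolding sum_subtractf sum_distrib_right[symmetric] sum_distrib_left[symmetric] by (simp only: mult.commute)
    moreover have "\<kappa> * P - 6 * e - (Q + 6 * K) \<le> R"
      if "\<kappa> * (P - Q) \<le> \<kappa> * a" "\<kappa> * Q \<le> 1 * Q" "R = \<kappa> * a - 3 * b" "b \<le> 2 * (e + K)"
      for \<kappa> P Q a b e K R :: real
      using that by (simp add: algebra_simps)
    ultimately show ?thesis using SB unfolding mult.assoc by blast
  qed
  then have "exp ((1 - 16 * \<alpha>\<^sup>2) * exp (- (4 * \<alpha>)) * (1 - 1 / c) * (\<theta>\<^sup>2 / 2 * T\<^sup>2) - 6 * e1 * T\<^sup>2 - (8 * \<alpha>\<^sup>2 * \<alpha> powr - p + 6 * (\<alpha> * \<alpha> powr - p)))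
    \<le> (\<Prod>j\<in>J. exp (A j * (1 - 16 * \<alpha>\<^sup>2) - 3 * B j))"
    by (simp add: exp_sum[OF Jf, symmetric])
  also have "\<dots> \<le> (\<Prod>j\<in>J. rE (\<lambda>\<omega>. exp (\<theta> * l * clip y (\<sigma> * X j \<omega>))))"
    by (rule prod_mono) (use each J in auto)
  also have "\<dots> = block_mgf \<sigma> k \<theta>"
    unfolding block_mgf_prod[OF \<sigma>] by (simp add: l_def T_def S_def y_def J_def)
  finally show ?thesis by (simp add: T_def)
qed

text \<open>For the lower bound the errors are budgeted in quarters of \<delta> * t^2: the relative
  error \<delta> / 8 meets \<theta>^2 / 2 \<le> 2, the means enter six times with \<delta> / 24, and
  the constant \<open>K2\<close> is overtaken once t is large. The upper bound needs less.\<close>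

lemma block_mgf_asymp:
  assumes \<delta>: "0 < \<delta>" and \<alpha>8: "\<alpha> \<le> 1/8" and u: "exp (4 * \<alpha>) \<le> 1 + \<delta> / 8"
    and lo: "1 - \<delta> / 8 \<le> (1 - 16 * \<alpha>\<^sup>2) * exp (- (4 * \<alpha>)) * (1 - 1 / c)"
    and \<sigma>: "\<sigma> = 1 \<or> \<sigma> = -1"
  shows "\<exists>k0. \<forall>k\<ge>k0. active k \<and> good k \<longrightarrow> (\<forall>\<theta>. 0 \<le> \<theta> \<and> \<theta> \<le> 2 \<longrightarrow>
    exp ((\<theta>\<^sup>2 / 2 - \<delta>) * (t (N k))\<^sup>2) \<le> block_mgf \<sigma> k \<theta> \<and>
    block_mgf \<sigma> k \<theta> \<le> exp ((\<theta>\<^sup>2 / 2 + \<delta>) * (t (N k))\<^sup>2))"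
proof -
  have \<delta>24: "0 < \<delta> / 24" using \<delta> by simp
  obtain n1 where n1: "\<And>n. n \<ge> n1 \<Longrightarrow> (\<Sum>j=1..n. mb j) \<le> \<delta> / 24 * a n"
    using mb_sum_small[OF \<delta>24] by blast
  define K2 where "K2 = 8 * \<alpha>\<^sup>2 * \<alpha> powr - p + 6 * (\<alpha> * \<alpha> powr - p)"
  obtain k1 where k1: "\<And>k. k \<ge> k1 \<Longrightarrow> n1 \<le> N k"
    using block_end_tends[OF c, of n1] unfolding eventually_sequentially by blast
  obtain k2 where k2: "\<And>k. k \<ge> k2 \<Longrightarrow> n0 \<le> block_start k" using block_start_tends by blast
  obtain k3 where k3: "\<And>k. k \<ge> k3 \<Longrightarrow> hit c k \<Longrightarrow> 4 * K2 / \<delta> \<le> t (N k)" using t_block_tends by blast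
  show ?thesis
  proof (intro exI allI impI, elim conjE)
    fix k and \<theta> :: real assume kk: "max k1 (max k2 k3) \<le> k" and k: "active k" "good k" and \<theta>: "0 \<le> \<theta>" "\<theta> \<le> 2"
    define T where "T = t (N k)"
    have T: "1 \<le> T" using t_ge_1 by (simp add: T_def)
    have "4 * K2 / \<delta> \<le> T" using k3[of k] kk k(1) by (simp add: active_def T_def)
    moreover have "T * 1 \<le> T * T" using T by (intro mult_left_mono) auto
    ultimately have "4 * K2 / \<delta> \<le> T\<^sup>2" by (simp add: power2_eq_square)
    then have K2: "K2 \<le> \<delta> / 4 * T\<^sup>2" using \<delta> by (simp add: field_simps)
    have K10: "0 \<le> \<alpha> * \<alpha> powr - p" "0 \<le> 8 * \<alpha>\<^sup>2 * \<alpha> powr - p" using \<alpha> by auto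
    have e1: "(\<Sum>j=1..N k. mb j) \<le> \<delta> / 24 * a (N k)" using n1[OF k1[of k]] kk by simp
    have big: "n0 \<le> block_start k" using k2[of k] kk by simp
    have \<theta>2: "0 \<le> \<theta>\<^sup>2 / 2" "\<theta>\<^sup>2 / 2 \<le> 2" using power_mono[OF \<theta>(2,1), of 2] by auto
    have \<theta>\<delta>: "\<theta>\<^sup>2 / 2 * (\<delta> / 8) * T\<^sup>2 \<le> \<delta> / 4 * T\<^sup>2"
    proof -
      have "\<theta>\<^sup>2 / 2 * (\<delta> / 8) * T\<^sup>2 \<le> 2 * (\<delta> / 8) * T\<^sup>2" using \<theta>2 \<delta> by (intro mult_right_mono) auto
      then show ?thesis by simp
    qed
    have \<delta>T: "0 \<le> \<delta> * T\<^sup>2" using \<delta> by simp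
    show "exp ((\<theta>\<^sup>2 / 2 - \<delta>) * (t (N k))\<^sup>2) \<le> block_mgf \<sigma> k \<theta> \<and>
      block_mgf \<sigma> k \<theta> \<le> exp ((\<theta>\<^sup>2 / 2 + \<delta>) * (t (N k))\<^sup>2)"
    proof
      have "(\<theta>\<^sup>2 / 2 - \<delta>) * T\<^sup>2 \<le> (1 - 16 * \<alpha>\<^sup>2) * exp (- (4 * \<alpha>)) * (1 - 1 / c) * (\<theta>\<^sup>2 / 2 * T\<^sup>2)
          - 6 * (\<delta> / 24) * T\<^sup>2 - K2"
      proof -
        have "(1 - \<delta> / 8) * (\<theta>\<^sup>2 / 2 * T\<^sup>2) \<le> (1 - 16 * \<alpha>\<^sup>2) * exp (- (4 * \<alpha>)) * (1 - 1 / c) * (\<theta>\<^sup>2 / 2 * T\<^sup>2)"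
          using lo \<theta>2 by (intro mult_right_mono) auto
        moreover have "(1 - \<delta> / 8) * (\<theta>\<^sup>2 / 2 * T\<^sup>2) = \<theta>\<^sup>2 / 2 * T\<^sup>2 - \<theta>\<^sup>2 / 2 * (\<delta> / 8) * T\<^sup>2"
          by (simp add: field_simps)
        moreover have "(\<theta>\<^sup>2 / 2 - \<delta>) * T\<^sup>2 = \<theta>\<^sup>2 / 2 * T\<^sup>2 - \<delta> * T\<^sup>2" by (simp add: algebra_simps)
        moreover have "6 * (\<delta> / 24) * T\<^sup>2 = \<delta> * T\<^sup>2 / 4" "\<delta> / 4 * T\<^sup>2 = \<delta> * T\<^sup>2 / 4" by auto
        moreover have "x \<le> y - e - K" if "z \<le> y" "z = Z - W" "x = Z - D" "e = D / 4" "D' = D / 4" "W \<le> D'" "K \<le> D'" "0 \<le> D"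
          for x y z e K Z W D D' :: real
          using that by linarith
        ultimately show ?thesis using \<theta>\<delta> K2 \<delta>T by blast
      qed
      then have "exp ((\<theta>\<^sup>2 / 2 - \<delta>) * T\<^sup>2) \<le> exp ((1 - 16 * \<alpha>\<^sup>2) * exp (- (4 * \<alpha>)) * (1 - 1 / c) * (\<theta>\<^sup>2 / 2 * T\<^sup>2)
          - 6 * (\<delta> / 24) * T\<^sup>2 - K2)" by simp
      also have "\<dots> \<le> block_mgf \<sigma> k \<theta>"
        unfolding K2_def T_def by (rule block_mgf_lower[OF k big \<theta> \<alpha>8 \<sigma> e1])
      finally show "exp ((\<theta>\<^sup>2 / 2 - \<delta>) * (t (N k))\<^sup>2) \<le> block_mgf \<sigma> k \<theta>" by (simp add: T_def)
      have "\<theta>\<^sup>2 / 2 * exp (4 * \<alpha>) * T\<^sup>2 + 2 * (\<delta> / 24) * T\<^sup>2 + 2 * (\<alpha> * \<alpha> powr - p) \<le> (\<theta>\<^sup>2 / 2 + \<delta>) * T\<^sup>2"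
      proof -
        have "\<theta>\<^sup>2 / 2 * exp (4 * \<alpha>) * T\<^sup>2 \<le> \<theta>\<^sup>2 / 2 * (1 + \<delta> / 8) * T\<^sup>2"
          using u \<theta>2 by (intro mult_right_mono mult_left_mono) auto
        moreover have "\<theta>\<^sup>2 / 2 * (1 + \<delta> / 8) * T\<^sup>2 = \<theta>\<^sup>2 / 2 * T\<^sup>2 + \<theta>\<^sup>2 / 2 * (\<delta> / 8) * T\<^sup>2"
          by (simp add: algebra_simps)
        moreover have "(\<theta>\<^sup>2 / 2 + \<delta>) * T\<^sup>2 = \<theta>\<^sup>2 / 2 * T\<^sup>2 + \<delta> * T\<^sup>2" by (simp add: algebra_simps)
        moreover have "2 * (\<delta> / 24) * T\<^sup>2 = \<delta> * T\<^sup>2 / 12" "\<delta> / 4 * T\<^sup>2 = \<delta> * T\<^sup>2 / 4" by auto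
        moreover have "2 * (\<alpha> * \<alpha> powr - p) \<le> K2" using K10 unfolding K2_def by linarith
        moreover have "x + e + K \<le> y" if "x \<le> z" "z = Z + W" "y = Z + D" "e = D / 12" "D' = D / 4" "K \<le> K'" "W \<le> D'" "K' \<le> D'" "0 \<le> D"
          for x y z e K K' Z W D D' :: real
          using that by linarith
        ultimately show ?thesis using \<theta>\<delta> K2 \<delta>T by blast
      qed
      then have "exp (\<theta>\<^sup>2 / 2 * exp (4 * \<alpha>) * T\<^sup>2 + 2 * (\<delta> / 24) * T\<^sup>2 + 2 * (\<alpha> * \<alpha> powr - p)) \<le> exp ((\<theta>\<^sup>2 / 2 + \<delta>) * T\<^sup>2)"
        by simp
      then show "block_mgf \<sigma> k \<theta> \<le> exp ((\<theta>\<^sup>2 / 2 + \<delta>) * (t (N k))\<^sup>2)"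
        using block_mgf_upper[OF k big \<theta> \<sigma> e1] unfolding T_def by (rule order_trans[rotated])
    qed
  qed
qed

text \<open>A Lipschitz stand-in for the event that the block sum is large: the ramp climbs from (1
  - 4 * \<eta>) * a to (1 - 3 * \<eta>) * a.\<close>

definition soft_event :: "real \<Rightarrow> real \<Rightarrow> nat \<Rightarrow> (nat \<Rightarrow> real) \<Rightarrow> real" where
  "soft_event \<eta> \<sigma> k x = max 0 (min 1 ((block_sum \<sigma> k x / a (N k) - (1 - 4 * \<eta>)) / \<eta>))"

lemma soft_event_01: "0 \<le> soft_event \<eta> \<sigma> k x" "soft_event \<eta> \<sigma> k x \<le> 1"
  by (auto simp: soft_event_def)

lemma cyl_soft_event:
  assumes "0 < \<eta>" "\<sigma> = 1 \<or> \<sigma> = -1"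
  shows "cyl {block_start k<..N k} (soft_event \<eta> \<sigma> k)"
proof -
  have "cyl {block_start k<..N k} (\<lambda>x. 1 / (a (N k) * \<eta>) * block_sum \<sigma> k x + (- (1 - 4 * \<eta>) / \<eta>))"
    by (intro cyl_add cyl_cmult cyl_block_sum assms cyl_const) simp
  then have "cyl {block_start k<..N k} (\<lambda>x. max 0 (min 1 (1 / (a (N k) * \<eta>) * block_sum \<sigma> k x + (- (1 - 4 * \<eta>) / \<eta>))))"
    by (rule cyl_lip[where C=1]) (auto simp: max_def min_def)
  moreover have "max 0 (min 1 (1 / (a (N k) * \<eta>) * block_sum \<sigma> k x + (- (1 - 4 * \<eta>) / \<eta>))) = soft_event \<eta> \<sigma> k x" for x
    unfolding soft_event_def by (simp add: diff_divide_distrib)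
  ultimately show ?thesis by simp
qed

text \<open>Chernoff's comparison: under the exponentially tilted expectation with parameter \<open>\<theta>\<close> the block
  sum concentrates at \<open>\<theta> * a\<close>, as the tilts with \<open>\<theta> + \<eta>\<close> and \<open>\<theta> - \<eta>\<close> show.\<close>

lemma soft_event_ge:
  assumes \<eta>: "0 < \<eta>" "\<eta> \<le> 1/4" and \<alpha>8: "\<alpha> \<le> 1/8" and u: "exp (4 * \<alpha>) \<le> 1 + \<eta>\<^sup>2 / 8 / 8"
    and lo: "1 - \<eta>\<^sup>2 / 8 / 8 \<le> (1 - 16 * \<alpha>\<^sup>2) * exp (- (4 * \<alpha>)) * (1 - 1 / c)"
    and \<sigma>: "\<sigma> = 1 \<or> \<sigma> = -1"
  shows "\<exists>C>0. \<exists>k0. \<forall>k\<ge>k0. active k \<and> good k \<longrightarrow> C * real (Suc k) powr (\<eta> - 1) \<le> Ex (soft_event \<eta> \<sigma> k)"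
proof -
  \<comment> \<open>Shifting the tilt by \<eta> gains \<eta>^2 / 2 in the exponent. With error
    \<delta> on either side this leaves a loss of 3 * \<eta>^2 / 8 in the tails against \<eta>^2 / 8
    in the main term.\<close>
  define \<delta> where "\<delta> = \<eta>\<^sup>2 / 8"
  have \<delta>: "0 < \<delta>" using \<eta> by (simp add: \<delta>_def)
  obtain k1 where k1: "\<And>k \<theta>. k \<ge> k1 \<Longrightarrow> active k \<Longrightarrow> good k \<Longrightarrow> 0 \<le> \<theta> \<Longrightarrow> \<theta> \<le> 2 \<Longrightarrow>
    exp ((\<theta>\<^sup>2 / 2 - \<delta>) * (t (N k))\<^sup>2) \<le> block_mgf \<sigma> k \<theta> \<and> block_mgf \<sigma> k \<theta> \<le> exp ((\<theta>\<^sup>2 / 2 + \<delta>) * (t (N k))\<^sup>2)"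
    using block_mgf_asymp[OF \<delta> \<alpha>8 u[folded \<delta>_def] lo[folded \<delta>_def] \<sigma>] by blast
  obtain k2 where k2: "\<And>k. k \<ge> k2 \<Longrightarrow> hit c k \<Longrightarrow> 8 / \<eta>\<^sup>2 \<le> t (N k)" using t_block_tends by blast
  define C where "C = 1/2 * exp (- 1) * (1 + ln c) powr (\<eta> - 1)"
  have lc: "0 < 1 + ln c" using c by (simp add: add_pos_pos)
  have "C > 0" using lc by (simp add: C_def)
  moreover have "C * real (Suc k) powr (\<eta> - 1) \<le> Ex (soft_event \<eta> \<sigma> k)"
    if kk: "max k1 k2 \<le> k" and k: "active k" "good k" for k
  proof -
    have vp: "0 < v (N k)" by (rule active_pos[OF k(1)])
    define T where "T = t (N k)"
    have T: "1 \<le> T" using t_ge_1 by (simp add: T_def)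
    have ap: "0 < a (N k)" by (rule a_pos[OF vp])
    define R where "R x = block_sum \<sigma> k x / a (N k)" for x
    \<comment> \<open>The left end \<theta> - \<eta> = 1 - 3 * \<eta> of the window around \<theta>
      is where \<open>soft_event\<close> reaches 1.\<close>
    define \<theta> where "\<theta> = 1 - 2 * \<eta>"
    have \<theta>: "0 \<le> \<theta> - \<eta>" "\<theta> + \<eta> \<le> 2" "0 \<le> \<theta>" "\<theta> \<le> 2" "0 \<le> \<theta> + \<eta>" "\<theta> - \<eta> \<le> 2" using \<eta> by (auto simp: \<theta>_def)
    have mgf: "block_mgf \<sigma> k r = Ex (\<lambda>x. exp (r * T\<^sup>2 * R x))" for r
    proof -
      have "t (N k) / s (N k) = T\<^sup>2 / a (N k)"
        using s_pos[OF vp] T by (simp add: a_def T_def power2_eq_square)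
      then have "r * (t (N k) / s (N k)) * block_sum \<sigma> k x = r * T\<^sup>2 * R x" for x
        by (simp add: R_def)
      then show ?thesis unfolding block_mgf_def by simp
    qed
    have cR: "cyl {block_start k<..N k} R"
      unfolding R_def using cyl_cmult[OF cyl_block_sum[OF \<sigma>], of k "1 / a (N k)"] by simp
    have ce: "cyl {block_start k<..N k} (\<lambda>x. exp (r * T\<^sup>2 * R x))" for r
      by (intro cyl_exp cyl_cmult cR)
    have L: "(\<lambda>\<omega>. exp (r * T\<^sup>2 * R (path \<omega>))) \<in> L1" for r
      by (rule cyl_L1[OF ce]) simp
    have Lf: "(\<lambda>\<omega>. soft_event \<eta> \<sigma> k (path \<omega>)) \<in> L1"
      by (rule cyl_L1[OF cyl_soft_event[OF \<eta>(1) \<sigma>]]) simp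
    let ?b1 = "exp (\<theta> * (\<theta> + \<eta>) * T\<^sup>2)" and ?b2 = "exp (- (\<eta> * (\<theta> + \<eta>)) * T\<^sup>2)" and ?b3 = "exp (\<eta> * (\<theta> - \<eta>) * T\<^sup>2)"
    \<comment> \<open>Off the window of half-width \<eta> around \<theta> one of the two shifted
      tilts dominates; inside, \<open>soft_event\<close> is 1.\<close>
    have pw: "exp (\<theta> * T\<^sup>2 * R x) \<le> ?b1 * soft_event \<eta> \<sigma> k x
      + (?b2 * exp ((\<theta> + \<eta>) * T\<^sup>2 * R x) + ?b3 * exp ((\<theta> - \<eta>) * T\<^sup>2 * R x))" for x
    proof -
      have T2: "0 \<le> T\<^sup>2" by simp
      have s0: "0 \<le> ?b1 * soft_event \<eta> \<sigma> k x" using soft_event_01 by simp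
      consider "\<theta> + \<eta> \<le> R x" | "R x \<le> \<theta> - \<eta>" | "\<theta> - \<eta> < R x" "R x < \<theta> + \<eta>" by linarith
      then show ?thesis
      proof cases
        case 1
        have "\<theta> * R x \<le> - (\<eta> * (\<theta> + \<eta>)) + (\<theta> + \<eta>) * R x"
          using mult_left_mono[OF 1, of \<eta>] \<eta> by (simp add: algebra_simps)
        from mult_left_mono[OF this T2] have "exp (\<theta> * T\<^sup>2 * R x) \<le> ?b2 * exp ((\<theta> + \<eta>) * T\<^sup>2 * R x)"
          unfolding exp_add[symmetric] by (simp add: algebra_simps)
        moreover have "0 \<le> ?b3 * exp ((\<theta> - \<eta>) * T\<^sup>2 * R x)" by simp
        ultimately show ?thesis using s0 by linarith
      next
        case 2
        have "\<theta> * R x \<le> \<eta> * (\<theta> - \<eta>) + (\<theta> - \<eta>) * R x"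
          using mult_left_mono[OF 2, of \<eta>] \<eta> by (simp add: algebra_simps)
        from mult_left_mono[OF this T2] have "exp (\<theta> * T\<^sup>2 * R x) \<le> ?b3 * exp ((\<theta> - \<eta>) * T\<^sup>2 * R x)"
          unfolding exp_add[symmetric] by (simp add: algebra_simps)
        moreover have "0 \<le> ?b2 * exp ((\<theta> + \<eta>) * T\<^sup>2 * R x)" by simp
        ultimately show ?thesis using s0 by linarith
      next
        case 3
        have "1 \<le> (R x - (1 - 4 * \<eta>)) / \<eta>" using 3(1) \<eta> by (simp add: \<theta>_def le_divide_eq)
        then have "soft_event \<eta> \<sigma> k x = 1" by (simp add: soft_event_def R_def)
        then have "?b1 * soft_event \<eta> \<sigma> k x = ?b1" by simp
        moreover have "\<theta> * R x \<le> \<theta> * (\<theta> + \<eta>)" using 3(2) \<theta> by (intro mult_left_mono) auto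
        from mult_left_mono[OF this T2] have "exp (\<theta> * T\<^sup>2 * R x) \<le> ?b1"
          by (simp add: algebra_simps)
        moreover have "0 \<le> ?b2 * exp ((\<theta> + \<eta>) * T\<^sup>2 * R x)" "0 \<le> ?b3 * exp ((\<theta> - \<eta>) * T\<^sup>2 * R x)" by simp_all
        ultimately show ?thesis by linarith
      qed
    qed
    have tail_eq1: "- (\<eta> * (\<theta> + \<eta>)) + ((\<theta> + \<eta>)\<^sup>2 / 2 + \<delta>) = \<theta>\<^sup>2 / 2 - 3 * \<eta>\<^sup>2 / 8"
      by (simp add: \<delta>_def power2_eq_square field_simps)
    have tail_eq2: "\<eta> * (\<theta> - \<eta>) + ((\<theta> - \<eta>)\<^sup>2 / 2 + \<delta>) = \<theta>\<^sup>2 / 2 - 3 * \<eta>\<^sup>2 / 8"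
      by (simp add: \<delta>_def power2_eq_square field_simps)
    let ?F = "exp ((\<theta>\<^sup>2 / 2 - \<delta>) * T\<^sup>2)"
    \<comment> \<open>The gap \<eta>^2 / 4 between the exponents yields the factor exp (- 2) \<le>
      1/4 once t^2 \<ge> 8 / \<eta>^2.\<close>
    have tail: "exp ((\<theta>\<^sup>2 / 2 - 3 * \<eta>\<^sup>2 / 8) * T\<^sup>2) \<le> 1/4 * ?F"
    proof -
      have "8 / \<eta>\<^sup>2 \<le> T" using k2[of k] kk k(1) by (simp add: active_def T_def)
      moreover have "T * 1 \<le> T * T" using T by (intro mult_left_mono) auto
      ultimately have "8 / \<eta>\<^sup>2 \<le> T\<^sup>2" by (simp add: power2_eq_square)
      then have "2 \<le> \<eta>\<^sup>2 / 4 * T\<^sup>2" using \<eta> by (simp add: field_simps)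
      moreover have "4 \<le> exp (2::real)"
        using exp_lower_Taylor_quadratic[of 2] by simp
      ultimately have "4 \<le> exp (\<eta>\<^sup>2 / 4 * T\<^sup>2)" by (meson exp_le_cancel_iff order_trans)
      then have "exp (- (\<eta>\<^sup>2 / 4 * T\<^sup>2)) \<le> 1/4" by (simp add: exp_minus field_simps)
      then have "?F * exp (- (\<eta>\<^sup>2 / 4 * T\<^sup>2)) \<le> ?F * (1/4)" by (intro mult_left_mono) auto
      also have "?F * exp (- (\<eta>\<^sup>2 / 4 * T\<^sup>2)) = exp ((\<theta>\<^sup>2 / 2 - 3 * \<eta>\<^sup>2 / 8) * T\<^sup>2)"
        unfolding exp_add[symmetric] \<delta>_def by (simp add: field_simps)
      finally show ?thesis by (simp only: mult.commute)
    qed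
    have "?F \<le> block_mgf \<sigma> k \<theta>" unfolding T_def by (rule conjunct1[OF k1]) (use kk k \<theta> in auto)
    also have "\<dots> = rE (\<lambda>\<omega>. exp (\<theta> * T\<^sup>2 * R (path \<omega>)))" by (simp add: mgf Ex_def)
    also have "\<dots> \<le> rE (\<lambda>\<omega>. ?b1 * soft_event \<eta> \<sigma> k (path \<omega>)
      + (?b2 * exp ((\<theta> + \<eta>) * T\<^sup>2 * R (path \<omega>)) + ?b3 * exp ((\<theta> - \<eta>) * T\<^sup>2 * R (path \<omega>))))"
      by (rule rE_mono[OF L L1_add[OF L1_cmult[OF Lf] L1_add[OF L1_cmult[OF L] L1_cmult[OF L]]] pw])
    also have "\<dots> \<le> rE (\<lambda>\<omega>. ?b1 * soft_event \<eta> \<sigma> k (path \<omega>))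
      + rE (\<lambda>\<omega>. ?b2 * exp ((\<theta> + \<eta>) * T\<^sup>2 * R (path \<omega>)) + ?b3 * exp ((\<theta> - \<eta>) * T\<^sup>2 * R (path \<omega>)))"
      by (rule rE_add[OF L1_cmult[OF Lf] L1_add[OF L1_cmult[OF L] L1_cmult[OF L]]])
    also have "rE (\<lambda>\<omega>. ?b1 * soft_event \<eta> \<sigma> k (path \<omega>)) = ?b1 * Ex (soft_event \<eta> \<sigma> k)"
      unfolding Ex_def by (rule rE_cmult[OF Lf]) simp
    also have "rE (\<lambda>\<omega>. ?b2 * exp ((\<theta> + \<eta>) * T\<^sup>2 * R (path \<omega>)) + ?b3 * exp ((\<theta> - \<eta>) * T\<^sup>2 * R (path \<omega>)))
      \<le> rE (\<lambda>\<omega>. ?b2 * exp ((\<theta> + \<eta>) * T\<^sup>2 * R (path \<omega>))) + rE (\<lambda>\<omega>. ?b3 * exp ((\<theta> - \<eta>) * T\<^sup>2 * R (path \<omega>)))"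
      by (rule rE_add[OF L1_cmult[OF L] L1_cmult[OF L]])
    also have "rE (\<lambda>\<omega>. ?b2 * exp ((\<theta> + \<eta>) * T\<^sup>2 * R (path \<omega>))) = ?b2 * block_mgf \<sigma> k (\<theta> + \<eta>)"
      unfolding mgf Ex_def by (rule rE_cmult[OF L]) simp
    also have "rE (\<lambda>\<omega>. ?b3 * exp ((\<theta> - \<eta>) * T\<^sup>2 * R (path \<omega>))) = ?b3 * block_mgf \<sigma> k (\<theta> - \<eta>)"
      unfolding mgf Ex_def by (rule rE_cmult[OF L]) simp
    also have "?b2 * block_mgf \<sigma> k (\<theta> + \<eta>) \<le> 1/4 * ?F"
    proof -
      have "block_mgf \<sigma> k (\<theta> + \<eta>) \<le> exp (((\<theta> + \<eta>)\<^sup>2 / 2 + \<delta>) * T\<^sup>2)"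
        unfolding T_def by (rule conjunct2[OF k1]) (use kk k \<theta> in auto)
      then have "?b2 * block_mgf \<sigma> k (\<theta> + \<eta>) \<le> ?b2 * exp (((\<theta> + \<eta>)\<^sup>2 / 2 + \<delta>) * T\<^sup>2)" by (intro mult_left_mono) auto
      also have "\<dots> = exp ((\<theta>\<^sup>2 / 2 - 3 * \<eta>\<^sup>2 / 8) * T\<^sup>2)"
        unfolding exp_add[symmetric] distrib_right[symmetric] tail_eq1 ..
      finally show ?thesis using tail by (rule order_trans)
    qed
    also have "?b3 * block_mgf \<sigma> k (\<theta> - \<eta>) \<le> 1/4 * ?F"
    proof -
      have "block_mgf \<sigma> k (\<theta> - \<eta>) \<le> exp (((\<theta> - \<eta>)\<^sup>2 / 2 + \<delta>) * T\<^sup>2)"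
        unfolding T_def by (rule conjunct2[OF k1]) (use kk k \<theta> in auto)
      then have "?b3 * block_mgf \<sigma> k (\<theta> - \<eta>) \<le> ?b3 * exp (((\<theta> - \<eta>)\<^sup>2 / 2 + \<delta>) * T\<^sup>2)" by (intro mult_left_mono) auto
      also have "\<dots> = exp ((\<theta>\<^sup>2 / 2 - 3 * \<eta>\<^sup>2 / 8) * T\<^sup>2)"
        unfolding exp_add[symmetric] distrib_right[symmetric] tail_eq2 ..
      finally show ?thesis using tail by (rule order_trans)
    qed
    \<comment> \<open>Each tail takes at most a quarter of \<open>?F\<close>, so half of it is left
      for the soft event.\<close>
    finally have main: "1/2 * ?F \<le> ?b1 * Ex (soft_event \<eta> \<sigma> k)" by simp
    have low1: "C * real (Suc k) powr (\<eta> - 1) \<le> 1/2 * (exp (- 1) * log_e (v (N k)) powr (\<eta> - 1))"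
    proof -
      have "log_e (v (N k)) \<le> (1 + ln c) * real (Suc k)" by (rule log_e_le_block[OF c v_block_end[OF c]])
      then have "((1 + ln c) * real (Suc k)) powr (\<eta> - 1) \<le> log_e (v (N k)) powr (\<eta> - 1)"
        using log_e_ge_1[of "v (N k)"] \<eta> by (intro powr_mono2') auto
      then show ?thesis unfolding C_def using lc by (simp add: powr_mult mult.assoc)
    qed
    have low2: "exp (- 1) * log_e (v (N k)) powr (\<eta> - 1) \<le> exp (- ((1 - \<eta>) * LL (v (N k))))"
    proof -
      let ?y = "log_e (v (N k))"
      have y: "1 \<le> ?y" by (rule log_e_ge_1)
      have "LL (v (N k)) \<le> 1 + ln ?y"
        unfolding LL_def log_e_def[of ?y] using y by (auto simp: max_def)
      then have "(1 - \<eta>) * LL (v (N k)) \<le> (1 - \<eta>) * (1 + ln ?y)" using \<eta> by (intro mult_left_mono) auto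
      also have "\<dots> \<le> 1 + (1 - \<eta>) * ln ?y" using \<eta> by (simp add: algebra_simps)
      finally have "exp (- (1 + (1 - \<eta>) * ln ?y)) \<le> exp (- ((1 - \<eta>) * LL (v (N k))))" by simp
      moreover have "exp (- (1 + (1 - \<eta>) * ln ?y)) = exp (- 1) * ?y powr (\<eta> - 1)"
      proof -
        have "- (1 + (1 - \<eta>) * ln ?y) = - 1 + (\<eta> - 1) * ln ?y" by (simp add: algebra_simps)
        then show ?thesis using y by (simp only: exp_add) (simp add: powr_def)
      qed
      ultimately show ?thesis by (simp only:)
    qed
    have low3: "1/2 * exp (- ((1 - \<eta>) * LL (v (N k)))) \<le> Ex (soft_event \<eta> \<sigma> k)"
    proof -
      have e0: "(1 - \<eta>) * LL (v (N k)) = (1 - \<eta>) / 2 * T\<^sup>2" unfolding T_def t_square by simp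
      \<comment> \<open>With \<theta> = 1 - 2 * \<eta> the two sides differ by \<eta> / 2 - \<eta>^2
        / 8; since t^2 / 2 = LL v, the exponent - (1 - \<eta>) * t^2 / 2 corresponds to the power
        \<eta> - 1 of the logarithm.\<close>
      have poly: "- ((1 - \<eta>) / 2) \<le> (\<theta>\<^sup>2 / 2 - \<delta>) - \<theta> * (\<theta> + \<eta>)"
      proof -
        have "(\<theta>\<^sup>2 / 2 - \<delta>) - \<theta> * (\<theta> + \<eta>) + (1 - \<eta>) / 2 = \<eta> / 2 - \<eta> * \<eta> / 8"
          unfolding \<theta>_def \<delta>_def by (simp add: power2_eq_square field_simps)
        moreover have "\<eta> * \<eta> \<le> \<eta> * 1" using \<eta> by (intro mult_left_mono) auto
        ultimately show ?thesis using \<eta> by linarith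
      qed
      have "- ((1 - \<eta>) / 2) * T\<^sup>2 \<le> ((\<theta>\<^sup>2 / 2 - \<delta>) - \<theta> * (\<theta> + \<eta>)) * T\<^sup>2"
        using poly by (intro mult_right_mono) auto
      then have "exp (- ((1 - \<eta>) / 2 * T\<^sup>2)) \<le> exp ((\<theta>\<^sup>2 / 2 - \<delta>) * T\<^sup>2 - \<theta> * (\<theta> + \<eta>) * T\<^sup>2)"
        by (simp add: left_diff_distrib)
      also have "\<dots> = ?F / ?b1" by (rule exp_diff)
      finally have "1/2 * exp (- ((1 - \<eta>) / 2 * T\<^sup>2)) \<le> (1/2 * ?F) / ?b1" by simp
      also have "\<dots> \<le> Ex (soft_event \<eta> \<sigma> k)" using main by (simp add: divide_le_eq mult.commute)
      finally show ?thesis unfolding e0 .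
    qed
    show ?thesis using low1 low2 low3 by linarith
  qed
  ultimately show ?thesis by blast
qed

text \<open>On a bad block \<open>L k powr (d + 1)\<close> is at least t to the power - 4 * p * (d +
  1), and that power of t is at least a multiple of (k + 1)^(\<eta> - 1). So the terms of bad blocks
  are summable, and the divergence in \<open>hit_not_summable\<close> rests on the good
  ones.\<close>

lemma good_not_summable:
  assumes \<eta>: "0 < \<eta>" "\<eta> < 1"
  shows "\<not> summable (\<lambda>k. if active k \<and> good k \<and> k1 \<le> k then real (Suc k) powr (\<eta> - 1) else 0)"
proof
  assume S: "summable (\<lambda>k. if active k \<and> good k \<and> k1 \<le> k then real (Suc k) powr (\<eta> - 1) else 0)"
  define Q where "Q = 4 * p * (d + 1)"
  have Q: "0 < Q" using p d by (simp add: Q_def)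
  obtain C where C: "0 < C" "\<And>v. sqrt (2 * LL v) powr Q \<le> C * log_e v powr (1 - \<eta>)"
    using t_powr_le[of "1 - \<eta>" Q] \<eta> Q by auto
  define C' where "C' = C * (1 + ln c) powr (1 - \<eta>)"
  have lc: "0 < 1 + ln c" using c by (simp add: add_pos_pos)
  have bad: "real (Suc k) powr (\<eta> - 1) \<le> C' * L k powr (d + 1)" if k: "active k" "\<not> good k" for k
  proof -
    have T: "1 \<le> t (N k)" by (rule t_ge_1)
    have "t (N k) powr Q \<le> C * log_e (v (N k)) powr (1 - \<eta>)" using C(2) by (simp add: t_def)
    also have "\<dots> \<le> C * ((1 + ln c) * real (Suc k)) powr (1 - \<eta>)"
      using C(1) \<eta> log_e_le_block[OF c v_block_end[OF c]] log_e_ge_1[of "v (N k)"]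
      by (intro mult_left_mono powr_mono2) auto
    also have "\<dots> = C' * real (Suc k) powr (1 - \<eta>)" using lc by (simp add: C'_def powr_mult)
    finally have 1: "t (N k) powr Q \<le> C' * real (Suc k) powr (1 - \<eta>)" .
    have "1 < L k * t (N k) powr (4 * p)" using k(2) by (simp add: good_def)
    then have "1 powr (d + 1) \<le> (L k * t (N k) powr (4 * p)) powr (d + 1)" using d by (intro powr_mono2) auto
    then have "1 \<le> L k powr (d + 1) * t (N k) powr Q"
      using L_pos[of k] by (simp add: powr_mult powr_powr Q_def)
    also have "\<dots> \<le> L k powr (d + 1) * (C' * real (Suc k) powr (1 - \<eta>))"
      using 1 by (intro mult_left_mono) auto
    finally have "1 * real (Suc k) powr (\<eta> - 1) \<le> L k powr (d + 1) * (C' * real (Suc k) powr (1 - \<eta>)) * real (Suc k) powr (\<eta> - 1)"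
      by (rule mult_right_mono) simp
    also have "\<dots> = C' * L k powr (d + 1) * (real (Suc k) powr (1 - \<eta>) * real (Suc k) powr (\<eta> - 1))"
      by (simp only: mult_ac)
    also have "real (Suc k) powr (1 - \<eta>) * real (Suc k) powr (\<eta> - 1) = 1"
      by (simp add: powr_add[symmetric])
    finally show ?thesis by simp
  qed
  have C'0: "0 \<le> C'" using C(1) by (simp add: C'_def)
  have "summable (\<lambda>k. if hit c k then real (Suc k) powr (\<eta> - 1) else 0)"
  proof (rule summable_comparison_test_ev[OF _ summable_add[OF S summable_mult[OF L_sum, of C']]])
    obtain k2 where k2: "\<And>k. k \<ge> k2 \<Longrightarrow> Suc n0 \<le> N k"
      using block_end_tends[OF c, of "Suc n0"] unfolding eventually_sequentially by blast
    show "\<forall>\<^sub>F k in sequentially. norm (if hit c k then real (Suc k) powr (\<eta> - 1) else 0)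
      \<le> (if active k \<and> good k \<and> k1 \<le> k then real (Suc k) powr (\<eta> - 1) else 0)
        + C' * (if hit c k \<and> n0 < N k then L k powr (d + 1) else 0)"
      unfolding eventually_sequentially
    proof (intro exI allI impI)
      fix k assume kk: "max k1 k2 \<le> k"
      have n0N: "n0 < N k" using k2[of k] kk by simp
      show "norm (if hit c k then real (Suc k) powr (\<eta> - 1) else 0)
      \<le> (if active k \<and> good k \<and> k1 \<le> k then real (Suc k) powr (\<eta> - 1) else 0)
        + C' * (if hit c k \<and> n0 < N k then L k powr (d + 1) else 0)"
        using bad[of k] n0N kk C'0 by (cases "hit c k"; cases "good k") (auto simp: active_def)
    qed
  qed
  then show False using hit_not_summable[OF c \<eta>] by simp
qed

text \<open>The divergence half of the Borel-Cantelli lemma under \<open>E\<close>: on disjoint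
  windows, the lower expectation that no soft event occurs is multiplied by 1 - Ex f \<le> exp (- Ex
  f) for each window.\<close>

lemma rich_blocks:
  assumes \<eta>: "0 < \<eta>" "\<eta> < 1" and \<sigma>: "\<sigma> = 1 \<or> \<sigma> = -1" and C: "0 < C"
    and prob: "\<And>k. k \<ge> k0 \<Longrightarrow> active k \<Longrightarrow> good k \<Longrightarrow> C * real (Suc k) powr (\<eta> - 1) \<le> Ex (soft_event \<eta> \<sigma> k)"
  shows "rich (\<lambda>n x. \<exists>k. active k \<and> good k \<and> n \<le> block_start k \<and> (1 - 4 * \<eta>) * a (N k) \<le> block_sum \<sigma> k x)"
  unfolding rich_def
proof (intro allI impI)
  fix n :: nat and e :: real assume e: "0 < e"
  obtain k1 where k1: "\<And>k. k \<ge> k1 \<Longrightarrow> n \<le> block_start k" using block_start_tends by blast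
  define A where "A k \<longleftrightarrow> active k \<and> good k \<and> max k0 k1 \<le> k" for k
  \<comment> \<open>Windows of equal parity are disjoint, and one of the two parity classes inherits
    the divergence.\<close>
  define u where "u \<rho> k = (if A k \<and> k mod 2 = \<rho> then real (Suc k) powr (\<eta> - 1) else 0)" for \<rho> k :: nat
  have "\<exists>\<rho>. \<not> summable (u \<rho>)"
  proof (rule ccontr)
    assume "\<not> ?thesis"
    then have "summable (\<lambda>k. u 0 k + u 1 k)" by (intro summable_add) auto
    moreover have "u 0 k + u 1 k = (if active k \<and> good k \<and> max k0 k1 \<le> k then real (Suc k) powr (\<eta> - 1) else 0)" for k
      by (auto simp: u_def A_def)
    ultimately show False using good_not_summable[OF \<eta>, of "max k0 k1"] by simp
  qed
  then obtain \<rho> where \<rho>: "\<not> summable (u \<rho>)" ..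
  have u0: "0 \<le> u \<rho> k" for k by (simp add: u_def)
  have "\<exists>m. \<not> (\<Sum>k<m. u \<rho> k) \<le> \<bar>ln e\<bar> / C"
    using summableI_nonneg_bounded[of "u \<rho>" "\<bar>ln e\<bar> / C"] u0 \<rho> by blast
  \<comment> \<open>A sum beyond this level makes the final product at most e.\<close>
  then obtain m where m: "\<bar>ln e\<bar> / C < (\<Sum>k<m. u \<rho> k)" by (auto simp: not_le)
  define B where "B k \<longleftrightarrow> A k \<and> k mod 2 = \<rho>" for k
  define f where "f = soft_event \<eta> \<sigma>"
  define PR where "PR i x = (\<Prod>k\<in>{k. k < i \<and> B k}. 1 - f k x)" for i x
  have f01: "0 \<le> f k x" "f k x \<le> 1" for k x unfolding f_def by (rule soft_event_01)+
  have PR01: "0 \<le> PR i x" "PR i x \<le> 1" for i x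
    unfolding PR_def using f01 by (auto intro!: prod_nonneg prod_le_1)
  have cf: "cyl {block_start k<..N k} (f k)" for k unfolding f_def by (rule cyl_soft_event[OF \<eta>(1) \<sigma>])
  have cPR: "cyl I (PR i)" if "finite I" "\<And>k. k < i \<Longrightarrow> B k \<Longrightarrow> {block_start k<..N k} \<subseteq> I" for I i
    unfolding PR_def
  proof (rule cyl_prod[OF that(1)])
    fix k assume "k \<in> {k. k < i \<and> B k}"
    then show "cyl I (\<lambda>x. 1 - f k x)"
      by (intro cyl_diff cyl_const cyl_mono[OF cf]) (use that in auto)
  qed
  have cyl1: "cyl {1..N i} (PR i)" for i
  proof (rule cPR)
    fix k assume "k < i"
    then have "N k \<le> N i" by (intro block_end_mono c) simp
    then show "{block_start k<..N k} \<subseteq> {1..N i}" by auto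
  qed simp
  have LP: "(\<lambda>\<omega>. 1 - PR i (path \<omega>)) \<in> L1" for i
    by (rule cyl_L1[where J="{1..N i}"], intro cyl_diff cyl_const cyl1) auto
  \<comment> \<open>The left side is the lower expectation of \<open>PR i\<close>; it is this
    quantity, not \<open>Ex (PR i)\<close>, that \<open>Ex_block\<close> lets factorise
    here.\<close>
  have main: "1 - Ex (\<lambda>x. 1 - PR i x) \<le> exp (- (C * (\<Sum>k<i. u \<rho> k)))" for i
  proof (induction i)
    case 0
    show ?case by (simp add: PR_def)
  next
    case (Suc i)
    show ?case
    proof (cases "B i")
      case False
      then have "{k. k < Suc i \<and> B k} = {k. k < i \<and> B k}" by (auto simp: less_Suc_eq)
      moreover have "u \<rho> i = 0" using False by (auto simp: u_def B_def)
      ultimately show ?thesis using Suc by (simp add: PR_def)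
    next
      case True
      have "{k. k < Suc i \<and> B k} = insert i {k. k < i \<and> B k}" using True by (auto simp: less_Suc_eq)
      then have PS: "PR (Suc i) x = (1 - f i x) * PR i x" for x by (simp add: PR_def)
      have ci: "cyl {1..block_start i} (PR i)"
      proof (rule cPR)
        fix k assume k: "k < i" "B k"
        then have "k + 2 \<le> i" using True by (auto simp: B_def) presburger
        then have "N k \<le> block_start i" by (rule block_end_le_start)
        then show "{block_start k<..N k} \<subseteq> {1..block_start i}" by auto
      qed simp
      let ?e = "Ex (f i)"
      have Lf: "(\<lambda>\<omega>. f i (path \<omega>)) \<in> L1" by (rule cyl_L1[OF cf]) simp
      have e01: "0 \<le> ?e" "?e \<le> 1"
        unfolding Ex_def using rE_ge[OF Lf, of 0] rE_le[OF Lf, of 1] f01 by auto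
      \<comment> \<open>Either an earlier event occurred or the one of window i does: the form
        \<open>A + B * \<psi>\<close> of \<open>Ex_block\<close>.\<close>
      have "Ex (\<lambda>x. 1 - PR (Suc i) x) = Ex (\<lambda>x. (1 - PR i x) + PR i x * f i x)"
        unfolding PS by (simp add: algebra_simps)
      also have "\<dots> = Ex (\<lambda>x. (1 - PR i x) + PR i x * ?e)"
        by (rule Ex_block[OF cyl_diff[OF cyl_const ci] ci PR01(1) block_start_le cf]) simp
      also have "\<dots> = rE (\<lambda>\<omega>. ?e + (1 - ?e) * (1 - PR i (path \<omega>)))"
        unfolding Ex_def[of "\<lambda>x. (1 - PR i x) + PR i x * ?e"] by (simp add: algebra_simps)
      also have "\<dots> = ?e + rE (\<lambda>\<omega>. (1 - ?e) * (1 - PR i (path \<omega>)))"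
        by (rule rE_add_const[OF L1_cmult[OF LP]])
      also have "rE (\<lambda>\<omega>. (1 - ?e) * (1 - PR i (path \<omega>))) = (1 - ?e) * Ex (\<lambda>x. 1 - PR i x)"
        unfolding Ex_def[of "\<lambda>x. 1 - PR i x"] by (rule rE_cmult[OF LP]) (use e01 in simp)
      finally have "1 - Ex (\<lambda>x. 1 - PR (Suc i) x) = (1 - ?e) * (1 - Ex (\<lambda>x. 1 - PR i x))"
        by (simp add: algebra_simps)
      also have "\<dots> \<le> exp (- ?e) * exp (- (C * (\<Sum>k<i. u \<rho> k)))"
      proof (rule mult_mono[OF _ Suc])
        show "1 - ?e \<le> exp (- ?e)" using exp_ge_add_one_self[of "- ?e"] by simp
        have "Ex (\<lambda>x. 1 - PR i x) \<le> 1" unfolding Ex_def by (rule rE_le[OF LP]) (use PR01 in auto)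
        then show "0 \<le> 1 - Ex (\<lambda>x. 1 - PR i x)" by simp
      qed simp
      also have "\<dots> \<le> exp (- (C * u \<rho> i)) * exp (- (C * (\<Sum>k<i. u \<rho> k)))"
      proof (rule mult_right_mono)
        have "C * u \<rho> i \<le> ?e" using prob[of i] True by (simp add: u_def B_def A_def f_def)
        then show "exp (- ?e) \<le> exp (- (C * u \<rho> i))" by simp
      qed simp
      also have "\<dots> = exp (- (C * (\<Sum>k<Suc i. u \<rho> k)))"
        unfolding exp_add[symmetric] by (simp add: algebra_simps)
      finally show ?thesis .
    qed
  qed
  let ?N' = "max (Suc n) (N m)"
  have g1: "n < ?N'" by simp
  have g2: "cyl {n<..?N'} (\<lambda>x. 1 - PR m x)"
  proof (intro cyl_diff cyl_const cPR)
    fix k assume k: "k < m" "B k"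
    then have "n \<le> block_start k" using k1 by (auto simp: B_def A_def)
    moreover have "N k \<le> N m" using k by (intro block_end_mono c) simp
    ultimately show "{block_start k<..N k} \<subseteq> {n<..?N'}" by auto
  qed simp_all
  have g4: "1 - e \<le> Ex (\<lambda>x. 1 - PR m x)"
  proof -
    have "\<bar>ln e\<bar> < C * (\<Sum>k<m. u \<rho> k)" using m C by (simp add: divide_less_eq mult.commute)
    then have "- (C * (\<Sum>k<m. u \<rho> k)) \<le> ln e" by linarith
    then have "exp (- (C * (\<Sum>k<m. u \<rho> k))) \<le> exp (ln e)" by simp
    then show ?thesis using main[of m] e by simp
  qed
  have g5: "\<exists>k. active k \<and> good k \<and> n \<le> block_start k \<and> (1 - 4 * \<eta>) * a (N k) \<le> block_sum \<sigma> k x"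
    if "0 < 1 - PR m x" for x
  proof -
    have "\<exists>k\<in>{k. k < m \<and> B k}. 1 - f k x \<noteq> 1"
    proof (rule ccontr)
      assume "\<not> ?thesis"
      then have "PR m x = 1" unfolding PR_def by (intro prod.neutral) auto
      then show False using that by simp
    qed
    then obtain k where k: "B k" "f k x \<noteq> 0" by auto
    then have "active k" "good k" "n \<le> block_start k" using k1 by (auto simp: B_def A_def)
    moreover have "(1 - 4 * \<eta>) * a (N k) \<le> block_sum \<sigma> k x"
    proof -
      have ap: "0 < a (N k)" by (rule a_pos[OF active_pos[OF \<open>active k\<close>]])
      have "0 < (block_sum \<sigma> k x / a (N k) - (1 - 4 * \<eta>)) / \<eta>"
      proof (rule ccontr)
        have z: "max 0 (min 1 z) = 0" if "\<not> 0 < z" for z :: real using that by simp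
        assume "\<not> 0 < (block_sum \<sigma> k x / a (N k) - (1 - 4 * \<eta>)) / \<eta>"
        from z[OF this] show False using k(2) unfolding f_def soft_event_def by contradiction
      qed
      then have "1 - 4 * \<eta> < block_sum \<sigma> k x / a (N k)" using \<eta> by (simp add: zero_less_divide_iff)
      then show ?thesis using ap by (simp add: less_divide_eq)
    qed
    ultimately show ?thesis by blast
  qed
  show "\<exists>N' g. n < N' \<and> cyl {n<..N'} g \<and> (\<forall>x. 0 \<le> g x \<and> g x \<le> 1) \<and> 1 - e \<le> Ex g \<and>
    (\<forall>x. 0 < g x \<longrightarrow> (\<exists>k. active k \<and> good k \<and> n \<le> block_start k \<and> (1 - 4 * \<eta>) * a (N k) \<le> block_sum \<sigma> k x))"
    by (intro exI[of _ ?N'] exI[of _ "\<lambda>x. 1 - PR m x"] conjI allI impI g1 g2 g4 g5) (use PR01 in auto)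
qed

text \<open>The sum before the window is bounded by \<open>upper_half\<close> for the opposite sign,
  with the crude constant 2; as c \<ge> 4 / \<eta>^2, it costs at most \<eta> * a (N k). The
  excesses cost another \<eta>, which turns 4 * \<eta> into 6 * \<eta>.\<close>

lemma block_realised:
  assumes \<eta>: "0 < \<eta>" "\<eta> \<le> 1/4" and \<sigma>: "\<sigma> = 1 \<or> \<sigma> = -1" and c\<eta>: "4 / \<eta>\<^sup>2 \<le> c"
  shows "qs (\<lambda>\<omega>. (\<forall>m. \<exists>m'\<ge>m. \<exists>k. active k \<and> good k \<and> m' \<le> block_start k \<and>
      (1 - 4 * \<eta>) * a (N k) \<le> block_sum \<sigma> k (path \<omega>)) \<longrightarrow>
    (\<forall>m. \<exists>n\<ge>m. (1 - 6 * \<eta>) * a n \<le> \<sigma> * (\<Sum>j=1..n. X j \<omega>)))"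
proof -
  have \<sigma>': "- \<sigma> = 1 \<or> - \<sigma> = -1" using \<sigma> by auto
  from qs_conj[OF excess_small[OF \<eta>(1)] upper_half[OF zero_less_one \<sigma>']]
  show ?thesis
  proof (rule qs_mono, elim conjE, intro impI allI)
    fix \<omega> m
    assume 1: "\<forall>\<^sub>F k in sequentially. active k \<and> good k \<longrightarrow>
        (\<Sum>j\<in>{n0<..N k}. max (\<bar>X j \<omega>\<bar> - 2 * h \<alpha> (N k)) 0) < \<eta> * a (N k)"
      and 2: "\<forall>\<^sub>F n in sequentially. - \<sigma> * (\<Sum>j=1..n. X j \<omega>) \<le> (1 + 1) * a n"
      and 3: "\<forall>m. \<exists>m'\<ge>m. \<exists>k. active k \<and> good k \<and> m' \<le> block_start k \<and>
      (1 - 4 * \<eta>) * a (N k) \<le> block_sum \<sigma> k (path \<omega>)"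
    obtain k1 where k1: "\<And>k. k \<ge> k1 \<Longrightarrow> active k \<Longrightarrow> good k \<Longrightarrow>
        (\<Sum>j\<in>{n0<..N k}. max (\<bar>X j \<omega>\<bar> - 2 * h \<alpha> (N k)) 0) < \<eta> * a (N k)"
      using 1 unfolding eventually_sequentially by blast
    obtain m1 where m1: "\<And>n. n \<ge> m1 \<Longrightarrow> - \<sigma> * (\<Sum>j=1..n. X j \<omega>) \<le> (1 + 1) * a n"
      using 2 unfolding eventually_sequentially by blast
    \<comment> \<open>Late enough for all the eventual statements; exceeding \<open>N k1\<close>
      forces k \<ge> k1.\<close>
    obtain m' k where mk: "m' \<ge> Suc (max (max m m1) (max n0 (N k1)))" and k: "active k" "good k" "m' \<le> block_start k"
      and T: "(1 - 4 * \<eta>) * a (N k) \<le> block_sum \<sigma> k (path \<omega>)"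
      using 3 by blast
    have bs: "m \<le> block_start k" "m1 \<le> block_start k" "n0 \<le> block_start k" "N k1 < block_start k"
      using mk k(3) by auto
    have kk: "k1 \<le> k"
    proof (rule ccontr)
      assume "\<not> k1 \<le> k"
      then have "N k \<le> N k1" by (intro block_end_mono c) simp
      then show False using bs(4) block_start_le[of k] by simp
    qed
    have ap: "0 < a (N k)" by (rule a_pos[OF active_pos[OF k(1)]])
    have hp: "0 < h \<alpha> (N k)" by (rule h_pos[OF active_pos[OF k(1)]])
    have "a (block_start k) \<le> \<eta> / 2 * a (N k)"
    proof (rule power2_le_imp_le)
      have vb: "v (block_start k) \<le> v (N k) / c"
      proof -
        have "c ^ k / c \<le> v (N k) / c" using k(1) c by (intro divide_right_mono) (auto simp: active_def hit_def)
        then show ?thesis using v_block_start[of k] by linarith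
      qed
      have "1 / c \<le> \<eta>\<^sup>2 / 4" using c\<eta> \<eta> c by (simp add: field_simps)
      then have "v (N k) * (1 / c) \<le> v (N k) * (\<eta>\<^sup>2 / 4)" using v_nonneg by (intro mult_left_mono)
      moreover have "v (N k) * (1 / c) = v (N k) / c" by simp
      ultimately have "v (block_start k) \<le> v (N k) * (\<eta>\<^sup>2 / 4)" using vb by linarith
      then have "v (block_start k) * LL (v (block_start k)) \<le> v (N k) * (\<eta>\<^sup>2 / 4) * LL (v (N k))"
        using LL_mono[OF v_mono[OF block_start_le[of k]]] LL_ge_1[of "v (block_start k)"] v_nonneg
        by (intro mult_mono) auto
      then show "(a (block_start k))\<^sup>2 \<le> (\<eta> / 2 * a (N k))\<^sup>2"
        unfolding power_mult_distrib a_square by (simp add: power_divide mult_ac)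
    qed (use \<eta> a_nonneg in simp)
    then have "(1 + 1) * a (block_start k) \<le> \<eta> * a (N k)" by simp
    from order_trans[OF m1[OF bs(2)] this]
    have S1: "- \<sigma> * (\<Sum>j=1..block_start k. X j \<omega>) \<le> \<eta> * a (N k)" .
    have S2: "(1 - 4 * \<eta>) * a (N k) - \<eta> * a (N k) \<le> (\<Sum>j\<in>{block_start k<..N k}. \<sigma> * X j \<omega>)"
    proof -
      have "block_sum \<sigma> k (path \<omega>) = (\<Sum>j\<in>{block_start k<..N k}. clip (2 * h \<alpha> (N k)) (\<sigma> * X j \<omega>))"
        by (simp add: block_sum_def path_def)
      also have "\<dots> \<le> (\<Sum>j\<in>{block_start k<..N k}. \<sigma> * X j \<omega> + max (\<bar>X j \<omega>\<bar> - 2 * h \<alpha> (N k)) 0)"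
      proof (rule sum_mono)
        fix j
        show "clip (2 * h \<alpha> (N k)) (\<sigma> * X j \<omega>) \<le> \<sigma> * X j \<omega> + max (\<bar>X j \<omega>\<bar> - 2 * h \<alpha> (N k)) 0"
          using clip_excess[of "2 * h \<alpha> (N k)" "\<sigma> * X j \<omega>"] hp \<sigma> by (auto simp: abs_le_iff abs_if split: if_splits)
      qed
      also have "\<dots> = (\<Sum>j\<in>{block_start k<..N k}. \<sigma> * X j \<omega>) + (\<Sum>j\<in>{block_start k<..N k}. max (\<bar>X j \<omega>\<bar> - 2 * h \<alpha> (N k)) 0)"
        by (rule sum.distrib)
      also have "(\<Sum>j\<in>{block_start k<..N k}. max (\<bar>X j \<omega>\<bar> - 2 * h \<alpha> (N k)) 0) \<le> (\<Sum>j\<in>{n0<..N k}. max (\<bar>X j \<omega>\<bar> - 2 * h \<alpha> (N k)) 0)"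
        using bs by (intro sum_mono2) auto
      also have "\<dots> \<le> \<eta> * a (N k)" using k1[OF kk k(1,2)] by simp
      finally show ?thesis using T by linarith
    qed
    have "{1..N k} = {1..block_start k} \<union> {block_start k<..N k}" using block_start_le[of k] by auto
    then have "(\<Sum>j=1..N k. X j \<omega>) = (\<Sum>j=1..block_start k. X j \<omega>) + (\<Sum>j\<in>{block_start k<..N k}. X j \<omega>)"
      by (simp only:) (rule sum.union_disjoint, auto)
    then have "\<sigma> * (\<Sum>j=1..N k. X j \<omega>) = \<sigma> * (\<Sum>j=1..block_start k. X j \<omega>) + (\<Sum>j\<in>{block_start k<..N k}. \<sigma> * X j \<omega>)"
      by (simp add: distrib_left sum_distrib_left)
    moreover have "(1 - 6 * \<eta>) * a (N k) = (1 - 4 * \<eta>) * a (N k) - \<eta> * a (N k) - \<eta> * a (N k)"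
      by (simp add: algebra_simps)
    ultimately have "(1 - 6 * \<eta>) * a (N k) \<le> \<sigma> * (\<Sum>j=1..N k. X j \<omega>)"
      using S1 S2 by linarith
    moreover have "m \<le> N k" using bs(1) block_start_le[of k] by simp
    ultimately show "\<exists>n\<ge>m. (1 - 6 * \<eta>) * a n \<le> \<sigma> * (\<Sum>j=1..n. X j \<omega>)" by blast
  qed
qed

end

context lil_sequence
begin

lemma lower_half:
  assumes \<eta>: "0 < \<eta>" "\<eta> \<le> 1/4" and \<sigma>: "\<sigma> = 1 \<or> \<sigma> = -1"
  shows "\<exists>F. rich F \<and> qs (\<lambda>\<omega>. (\<forall>m. \<exists>m'\<ge>m. F m' (path \<omega>)) \<longrightarrow>
    (\<forall>m. \<exists>n\<ge>m. (1 - 6 * \<eta>) * a n \<le> \<sigma> * (\<Sum>j=1..n. X j \<omega>)))"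
proof -
  \<comment> \<open>Both 1 / c and 6 * \<alpha> equal \<eta>^2 / 128; together they make up the
    admissible loss \<eta>^2 / 64 in \<open>lo\<close>.\<close>
  define c where "c = 128 / \<eta>\<^sup>2"
  define \<alpha> where "\<alpha> = \<eta>\<^sup>2 / 768"
  have \<eta>2: "0 < \<eta>\<^sup>2" "\<eta>\<^sup>2 \<le> 1/16" using \<eta> power_mono[of \<eta> "1/4" 2] by (auto simp: power2_eq_square)
  have c: "1 < c" using \<eta>2 by (simp add: c_def less_divide_eq)
  have \<alpha>0: "0 < \<alpha>" and \<alpha>8: "\<alpha> \<le> 1/8" using \<eta>2 by (simp_all add: \<alpha>_def)
  have "norm (4 * \<alpha>) \<le> 1/2" using \<alpha>0 \<eta>2 by (simp add: \<alpha>_def)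
  from exp_bound_lemma[OF this] have "exp (4 * \<alpha>) \<le> 1 + 2 * (4 * \<alpha>)" using \<alpha>0 by simp
  moreover have "2 * (4 * \<alpha>) = \<eta>\<^sup>2 / 96" by (simp add: \<alpha>_def)
  ultimately have u: "exp (4 * \<alpha>) \<le> 1 + \<eta>\<^sup>2 / 8 / 8" using \<eta>2 by linarith
  have lo: "1 - \<eta>\<^sup>2 / 8 / 8 \<le> (1 - 16 * \<alpha>\<^sup>2) * exp (- (4 * \<alpha>)) * (1 - 1 / c)"
  proof -
    have "\<alpha> * \<alpha> \<le> 1/8 * \<alpha>" using \<alpha>0 \<alpha>8 by (intro mult_right_mono) auto
    then have x: "16 * \<alpha>\<^sup>2 \<le> 2 * \<alpha>" by (simp add: power2_eq_square)
    have prod3: "1 - r - s - w \<le> (1 - r) * (1 - s) * (1 - w)"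
      if "0 \<le> r" "0 \<le> s" "0 \<le> w" "w \<le> 1" "r + s \<le> 1" for r s w :: real
    proof -
      have "(1 - r - s) * (1 - w) \<le> ((1 - r) * (1 - s)) * (1 - w)"
        using that mult_nonneg_nonneg[of r s] by (intro mult_right_mono) (auto simp: algebra_simps)
      moreover have "0 \<le> (r + s) * w" using that by simp
      ultimately show ?thesis by (simp add: algebra_simps)
    qed
    have "1 / c = \<eta>\<^sup>2 / 128" by (simp add: c_def)
    then have "1 - \<eta>\<^sup>2 / 8 / 8 \<le> 1 - 2 * \<alpha> - 4 * \<alpha> - 1 / c" using \<eta>2 by (simp add: \<alpha>_def)
    also have "\<dots> \<le> (1 - 2 * \<alpha>) * (1 - 4 * \<alpha>) * (1 - 1 / c)"
      by (rule prod3) (use \<alpha>0 \<alpha>8 c in auto)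
    also have "\<dots> \<le> (1 - 16 * \<alpha>\<^sup>2) * exp (- (4 * \<alpha>)) * (1 - 1 / c)"
      using x \<alpha>8 c exp_ge_add_one_self[of "- (4 * \<alpha>)"] by (intro mult_right_mono mult_mono) auto
    finally show ?thesis .
  qed
  obtain p d n0 L where "block_scheme M H E X PP V c \<alpha> p d n0 L"
    using block_scheme_exists[OF \<alpha>0 c] by blast
  then interpret block_scheme M H E X PP V c \<alpha> p d n0 L .
  obtain C k0 where C: "0 < C"
    and prob: "\<And>k. k \<ge> k0 \<Longrightarrow> active k \<Longrightarrow> good k \<Longrightarrow> C * real (Suc k) powr (\<eta> - 1) \<le> Ex (soft_event \<eta> \<sigma> k)"
    using soft_event_ge[OF \<eta> \<alpha>8 u lo \<sigma>] by blast
  have \<eta>1: "\<eta> < 1" using \<eta> by simp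
  have c\<eta>: "4 / \<eta>\<^sup>2 \<le> c" using \<eta>2 by (simp add: c_def divide_right_mono)
  show ?thesis
    using rich_blocks[OF \<eta>(1) \<eta>1 \<sigma> C prob] block_realised[OF \<eta> \<sigma> c\<eta>]
    by (intro exI[of _ "\<lambda>n x. \<exists>k. active k \<and> good k \<and> n \<le> block_start k \<and> (1 - 4 * \<eta>) * a (N k) \<le> block_sum \<sigma> k x"] conjI)
qed

end

section \<open>The law of the iterated logarithm\<close>

lemma limsup_ge_frequently:
  fixes f :: "nat \<Rightarrow> ereal"
  assumes "\<And>m. \<exists>n\<ge>m. C \<le> f n"
  shows "C \<le> limsup f"
  unfolding limsup_INF_SUP
proof (rule INF_greatest)
  fix m :: nat
  obtain n where "n \<ge> m" "C \<le> f n" using assms by blast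
  then show "C \<le> (SUP n\<in>{m..}. f n)" by (intro SUP_upper2[of n]) auto
qed

lemma ereal_le_inverse_Suc:
  fixes x y :: ereal
  assumes "\<And>m. x \<le> y + ereal (K / real (Suc m))"
  shows "x \<le> y"
proof (rule ereal_le_epsilon2)
  fix e :: real assume e: "0 < e"
  obtain m where m: "\<bar>K\<bar> / e < real (Suc m)"
    using reals_Archimedean2 less_trans[OF _ of_nat_less_iff[THEN iffD2, OF lessI]] by blast
  have "K / real (Suc m) \<le> \<bar>K\<bar> / real (Suc m)" by (intro divide_right_mono) auto
  also have "\<dots> \<le> e" using m e by (simp add: field_simps)
  finally have "y + ereal (K / real (Suc m)) \<le> y + ereal e" by (intro add_left_mono) simp
  with assms[of m] show "x \<le> y + ereal e" by (rule order_trans)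
qed

context lil_sequence
begin

lemma qs_limsup_le: "qs (\<lambda>\<omega>. limsup (\<lambda>n. ereal (\<bar>\<Sum>j=1..n. X j \<omega>\<bar> / a n)) \<le> 1)"
proof -
  have "qs (\<lambda>\<omega>. (\<forall>\<^sub>F n in sequentially. 1 * (\<Sum>j=1..n. X j \<omega>) \<le> (1 + 1 / real (Suc m)) * a n) \<and>
    (\<forall>\<^sub>F n in sequentially. -1 * (\<Sum>j=1..n. X j \<omega>) \<le> (1 + 1 / real (Suc m)) * a n))" for m
    by (intro qs_conj upper_half) auto
  then have "qs (\<lambda>\<omega>. \<forall>m. (\<forall>\<^sub>F n in sequentially. 1 * (\<Sum>j=1..n. X j \<omega>) \<le> (1 + 1 / real (Suc m)) * a n) \<and>
    (\<forall>\<^sub>F n in sequentially. -1 * (\<Sum>j=1..n. X j \<omega>) \<le> (1 + 1 / real (Suc m)) * a n))"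
    by (rule qs_all)
  then show ?thesis
  proof (rule qs_mono)
    fix \<omega> assume *: "\<forall>m. (\<forall>\<^sub>F n in sequentially. 1 * (\<Sum>j=1..n. X j \<omega>) \<le> (1 + 1 / real (Suc m)) * a n) \<and>
    (\<forall>\<^sub>F n in sequentially. -1 * (\<Sum>j=1..n. X j \<omega>) \<le> (1 + 1 / real (Suc m)) * a n)"
    obtain n1 where n1: "\<forall>n\<ge>n1. 0 < a n" using a_tends[of 0] by blast
    show "limsup (\<lambda>n. ereal (\<bar>\<Sum>j=1..n. X j \<omega>\<bar> / a n)) \<le> 1"
    proof (rule ereal_le_inverse_Suc)
      fix m
      have "\<forall>\<^sub>F n in sequentially. 1 * (\<Sum>j=1..n. X j \<omega>) \<le> (1 + 1 / real (Suc m)) * a n"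
        "\<forall>\<^sub>F n in sequentially. -1 * (\<Sum>j=1..n. X j \<omega>) \<le> (1 + 1 / real (Suc m)) * a n"
        using * by auto
      with eventually_ge_at_top[of n1]
      have "\<forall>\<^sub>F n in sequentially. ereal (\<bar>\<Sum>j=1..n. X j \<omega>\<bar> / a n) \<le> ereal (1 + 1 / real (Suc m))"
      proof eventually_elim
        case (elim n)
        then have "0 < a n" "\<bar>\<Sum>j=1..n. X j \<omega>\<bar> \<le> (1 + 1 / real (Suc m)) * a n" using n1 by (auto simp: abs_le_iff)
        then show ?case by (simp only: ereal_less_eq divide_le_eq) simp
      qed
      then have "limsup (\<lambda>n. ereal (\<bar>\<Sum>j=1..n. X j \<omega>\<bar> / a n)) \<le> ereal (1 + 1 / real (Suc m))"
        by (rule Limsup_bounded)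
      then show "limsup (\<lambda>n. ereal (\<bar>\<Sum>j=1..n. X j \<omega>\<bar> / a n)) \<le> 1 + ereal (1 / real (Suc m))"
        by (simp add: one_ereal_def)
    qed
  qed
qed

text \<open>The tolerance is the 6 * \<eta> of \<open>lower_half\<close> for \<eta> = 1 / (4 * (i +
  1)), which respects \<eta> \<le> 1/4 and tends to 0.\<close>

lemma limsup_ge_1:
  assumes "\<And>i m. \<exists>n\<ge>m. (1 - 6 * (1 / (4 * real (Suc i)))) * a n \<le> \<sigma> * (\<Sum>j=1..n. X j \<omega>)"
  shows "1 \<le> limsup (\<lambda>n. ereal (\<sigma> * (\<Sum>j=1..n. X j \<omega>) / a n))"
proof (rule ereal_le_inverse_Suc)
  fix i
  obtain n1 where n1: "\<forall>n\<ge>n1. 0 < a n" using a_tends[of 0] by blast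
  have "ereal (1 - 6 / 4 / real (Suc i)) \<le> limsup (\<lambda>n. ereal (\<sigma> * (\<Sum>j=1..n. X j \<omega>) / a n))"
  proof (rule limsup_ge_frequently)
    fix m
    obtain n where n: "n \<ge> max m n1" "(1 - 6 * (1 / (4 * real (Suc i)))) * a n \<le> \<sigma> * (\<Sum>j=1..n. X j \<omega>)"
      using assms by blast
    have "0 < a n" using n1 n by simp
    moreover have "6 * (1 / (4 * real (Suc i))) = 6 / 4 / real (Suc i)" by (simp add: field_simps)
    ultimately have "1 - 6 / 4 / real (Suc i) \<le> \<sigma> * (\<Sum>j=1..n. X j \<omega>) / a n"
      using n(2) by (simp only: le_divide_eq) simp
    then show "\<exists>n\<ge>m. ereal (1 - 6 / 4 / real (Suc i)) \<le> ereal (\<sigma> * (\<Sum>j=1..n. X j \<omega>) / a n)"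
      using n(1) by (intro exI[of _ n]) simp
  qed
  then have "ereal (1 - 6 / 4 / real (Suc i)) + ereal (6 / 4 / real (Suc i))
    \<le> limsup (\<lambda>n. ereal (\<sigma> * (\<Sum>j=1..n. X j \<omega>) / a n)) + ereal (6 / 4 / real (Suc i))"
    by (rule add_right_mono)
  then show "1 \<le> limsup (\<lambda>n. ereal (\<sigma> * (\<Sum>j=1..n. X j \<omega>) / a n)) + ereal (6 / 4 / real (Suc i))"
    by (simp only: plus_ereal.simps) (simp add: one_ereal_def)
qed

definition lil_event :: "'a set" where
  "lil_event = {\<omega> \<in> space M. liminf (\<lambda>n. ereal ((\<Sum>j=1..n. X j \<omega>) / a n)) = -1 \<and>
    limsup (\<lambda>n. ereal ((\<Sum>j=1..n. X j \<omega>) / a n)) = 1}"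

lemma lil_eventI:
  assumes \<omega>: "\<omega> \<in> space M" and up: "limsup (\<lambda>n. ereal (\<bar>\<Sum>j=1..n. X j \<omega>\<bar> / a n)) \<le> 1"
    and lo: "\<And>i m. \<exists>n\<ge>m. (1 - 6 * (1 / (4 * real (Suc i)))) * a n \<le> 1 * (\<Sum>j=1..n. X j \<omega>)"
      "\<And>i m. \<exists>n\<ge>m. (1 - 6 * (1 / (4 * real (Suc i)))) * a n \<le> -1 * (\<Sum>j=1..n. X j \<omega>)"
  shows "\<omega> \<in> lil_event"
proof -
  have u: "limsup (\<lambda>n. ereal (\<sigma> * (\<Sum>j=1..n. X j \<omega>) / a n)) \<le> 1" if "\<sigma> = 1 \<or> \<sigma> = -1" for \<sigma>
  proof (rule order_trans[OF Limsup_mono up], rule always_eventually, rule allI)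
    fix n
    have "\<sigma> * (\<Sum>j=1..n. X j \<omega>) \<le> \<bar>\<Sum>j=1..n. X j \<omega>\<bar>" using that by auto
    then show "ereal (\<sigma> * (\<Sum>j=1..n. X j \<omega>) / a n) \<le> ereal (\<bar>\<Sum>j=1..n. X j \<omega>\<bar> / a n)"
      using a_nonneg[of n] by (simp only: ereal_less_eq divide_right_mono)
  qed
  have 1: "limsup (\<lambda>n. ereal (1 * (\<Sum>j=1..n. X j \<omega>) / a n)) = 1"
    using u[of 1] limsup_ge_1[OF lo(1)] by (intro antisym) auto
  have 2: "limsup (\<lambda>n. ereal (-1 * (\<Sum>j=1..n. X j \<omega>) / a n)) = 1"
    using u[of "-1"] limsup_ge_1[OF lo(2)] by (intro antisym) auto
  have "limsup (\<lambda>n. - ereal ((\<Sum>j=1..n. X j \<omega>) / a n)) = - liminf (\<lambda>n. ereal ((\<Sum>j=1..n. X j \<omega>) / a n))"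
    by (rule ereal_Limsup_uminus)
  then have "- liminf (\<lambda>n. ereal ((\<Sum>j=1..n. X j \<omega>) / a n)) = 1" using 2 by simp
  then have "liminf (\<lambda>n. ereal ((\<Sum>j=1..n. X j \<omega>) / a n)) = -1" by (metis ereal_uminus_uminus)
  then show ?thesis using 1 \<omega> by (simp add: lil_event_def)
qed

text \<open>All combinations of sign and tolerance are listed in one sequence, because
  \<open>rich_realised\<close> yields one measure for countably many families; measures found for
  each family separately would say nothing about the intersection.\<close>

lemma ex_measure_lil_event:
  assumes e: "0 < e"
  shows "\<exists>P\<in>PP. 1 - e \<le> measure P lil_event"
proof -
  \<comment> \<open>Even indices serve the limsup, odd ones the liminf; \<open>i div 2\<close>
    numbers the tolerances.\<close>
  define \<sigma> where "\<sigma> i = (if even i then 1 else -1 :: real)" for i :: nat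
  define \<eta> where "\<eta> i = 1 / (4 * real (Suc (i div 2)))" for i
  have \<eta>: "0 < \<eta> i" "\<eta> i \<le> 1/4" for i by (auto simp: \<eta>_def field_simps)
  have \<sigma>: "\<sigma> i = 1 \<or> \<sigma> i = -1" for i by (simp add: \<sigma>_def)
  have "\<exists>F. \<forall>i. rich (F i) \<and> qs (\<lambda>\<omega>. (\<forall>m. \<exists>m'\<ge>m. F i m' (path \<omega>)) \<longrightarrow>
    (\<forall>m. \<exists>n\<ge>m. (1 - 6 * \<eta> i) * a n \<le> \<sigma> i * (\<Sum>j=1..n. X j \<omega>)))"
    by (intro choice allI lower_half \<eta> \<sigma>)
  then obtain F where F: "\<And>i. rich (F i)" "\<And>i. qs (\<lambda>\<omega>. (\<forall>m. \<exists>m'\<ge>m. F i m' (path \<omega>)) \<longrightarrow>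
    (\<forall>m. \<exists>n\<ge>m. (1 - 6 * \<eta> i) * a n \<le> \<sigma> i * (\<Sum>j=1..n. X j \<omega>)))" by auto
  obtain P G where P: "P \<in> PP" and G: "G \<in> sets P" "1 - e \<le> measure P G"
    "\<And>\<omega> i m. \<omega> \<in> G \<Longrightarrow> \<exists>m'\<ge>m. F i m' (path \<omega>)"
    using rich_realised[of F, OF F(1) e] by blast
  interpret prob_space P by (rule PP_prob[OF P])
  have qsG: "qs (\<lambda>\<omega>. \<omega> \<in> G \<longrightarrow> \<omega> \<in> lil_event)"
  proof (rule qs_mono[OF qs_conj[OF qs_limsup_le qs_all[OF F(2)]]], elim conjE, intro impI)
    fix \<omega> assume \<omega>: "\<omega> \<in> space M" "limsup (\<lambda>n. ereal (\<bar>\<Sum>j=1..n. X j \<omega>\<bar> / a n)) \<le> 1" "\<omega> \<in> G"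
      and *: "\<forall>i. (\<forall>m. \<exists>m'\<ge>m. F i m' (path \<omega>)) \<longrightarrow>
        (\<forall>m. \<exists>n\<ge>m. (1 - 6 * \<eta> i) * a n \<le> \<sigma> i * (\<Sum>j=1..n. X j \<omega>))"
    have all: "\<exists>n\<ge>m. (1 - 6 * \<eta> i) * a n \<le> \<sigma> i * (\<Sum>j=1..n. X j \<omega>)" for i m
      using * G(3)[OF \<omega>(3)] by blast
    show "\<omega> \<in> lil_event"
    proof (rule lil_eventI[OF \<omega>(1,2)])
      fix i m :: nat
      have "\<exists>n\<ge>m. (1 - 6 * \<eta> (2 * i)) * a n \<le> \<sigma> (2 * i) * (\<Sum>j=1..n. X j \<omega>)" by (rule all)
      then show "\<exists>n\<ge>m. (1 - 6 * (1 / (4 * real (Suc i)))) * a n \<le> 1 * (\<Sum>j=1..n. X j \<omega>)"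
        by (simp add: \<eta>_def \<sigma>_def)
      have "\<exists>n\<ge>m. (1 - 6 * \<eta> (Suc (2 * i))) * a n \<le> \<sigma> (Suc (2 * i)) * (\<Sum>j=1..n. X j \<omega>)" by (rule all)
      then show "\<exists>n\<ge>m. (1 - 6 * (1 / (4 * real (Suc i)))) * a n \<le> -1 * (\<Sum>j=1..n. X j \<omega>)"
        by (simp add: \<eta>_def \<sigma>_def)
    qed
  qed
  have GM: "G \<subseteq> space M" using sets.sets_into_space[OF G(1)] space_PP[OF P] by simp
  have lilP: "lil_event \<in> sets P"
  proof -
    have Xm: "X j \<in> borel_measurable P" if "j \<ge> 1" for j by (rule H_measurable_PP[OF P X_H[OF that]])
    have Sm: "(\<lambda>\<omega>. ereal ((\<Sum>j=1..n. X j \<omega>) / a n)) \<in> borel_measurable P" for n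
      by (intro borel_measurable_ereal borel_measurable_divide borel_measurable_sum borel_measurable_const) (auto intro: Xm)
    have "lil_event = {\<omega> \<in> space P. liminf (\<lambda>n. ereal ((\<Sum>j=1..n. X j \<omega>) / a n)) = -1 \<and>
      limsup (\<lambda>n. ereal ((\<Sum>j=1..n. X j \<omega>) / a n)) = 1}"
      by (simp add: lil_event_def space_PP[OF P])
    also have "\<dots> \<in> sets P" using Sm by measurable
    finally show ?thesis .
  qed
  \<comment> \<open>\<open>G\<close> need not lie in the event, but the difference is null under
    \<open>P\<close> because the inclusion holds quasi-surely.\<close>
  have "{\<omega> \<in> space M. \<not> (\<omega> \<in> G \<longrightarrow> \<omega> \<in> lil_event)} = G - lil_event" using GM by auto
  then have "measure P (G - lil_event) = 0" using qs_measure[OF qsG P] by simp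
  moreover have "measure P G \<le> measure P (lil_event \<union> (G - lil_event))"
    using G(1) lilP by (intro finite_measure_mono) auto
  moreover have "measure P (lil_event \<union> (G - lil_event)) \<le> measure P lil_event + measure P (G - lil_event)"
    using G(1) lilP by (intro measure_Un_le) auto
  ultimately show ?thesis using G(2) P by (intro bexI[of _ P]) auto
qed

lemma V_P_lil_event: "1 \<le> V_P PP lil_event"
proof (rule ereal_le_epsilon2)
  fix e :: real assume "0 < e"
  then obtain P where P: "P \<in> PP" "1 - e \<le> measure P lil_event" using ex_measure_lil_event by blast
  have "ereal (measure P lil_event) \<le> V_P PP lil_event" unfolding V_P_def by (rule SUP_upper[OF P(1)])
  then have "ereal (measure P lil_event) + ereal e \<le> V_P PP lil_event + ereal e" by (rule add_right_mono)
  moreover have "1 \<le> ereal (measure P lil_event) + ereal e" using P(2) by (simp add: one_ereal_def)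
  ultimately show "1 \<le> V_P PP lil_event + ereal e" by (rule order_trans[rotated])
qed

text \<open>The capacities are ordered: \<open>V_P\<close> below \<open>C_star\<close> below
  \<open>V_hat_star\<close>. So the null event is settled by the largest and the full event by the
  smallest, with 1 as an upper bound for the largest.\<close>

lemma law_of_iterated_logarithm:
  assumes "W \<in> {V_P PP, C_star M H E, V_hat_star M H E}"
  shows "W {\<omega> \<in> space M. 1 < limsup (\<lambda>n. ereal (\<bar>\<Sum>j=1..n. X j \<omega>\<bar> / a n))} = 0 \<and> W lil_event = 1"
proof -
  have "{\<omega> \<in> space M. 1 < limsup (\<lambda>n. ereal (\<bar>\<Sum>j=1..n. X j \<omega>\<bar> / a n))}
      = {\<omega> \<in> space M. \<not> limsup (\<lambda>n. ereal (\<bar>\<Sum>j=1..n. X j \<omega>\<bar> / a n)) \<le> 1}" (is "?A = _")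
    by (simp add: not_le)
  then have A: "V_hat_star M H E ?A \<le> 0" using V_hat_star_qs[OF qs_limsup_le] by simp
  have B: "V_hat_star M H E lil_event \<le> 1" by (rule V_hat_star_le_1) (auto simp: lil_event_def)
  note cA = order_trans[OF C_star_le_V_hat_star A] and cB = order_trans[OF C_star_le_V_hat_star B]
  note pA = order_trans[OF V_P_nonneg V_P_le_C_star, of ?A] and pB = order_trans[OF V_P_lil_event V_P_le_C_star]
  from assms consider "W = V_P PP" | "W = C_star M H E" | "W = V_hat_star M H E" by blast
  then show ?thesis
  proof cases
    case 1
    show ?thesis unfolding 1
      by (intro conjI antisym order_trans[OF V_P_le_C_star cA] order_trans[OF V_P_le_C_star cB]
          V_P_nonneg V_P_lil_event)
  next
    case 2
    show ?thesis unfolding 2 by (intro conjI antisym cA cB pA pB)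
  next
    case 3
    show ?thesis unfolding 3
      by (intro conjI antisym A B order_trans[OF pA C_star_le_V_hat_star] order_trans[OF pB C_star_le_V_hat_star])
  qed
qed

end

theorem theorem5p6:
  fixes M :: "'a measure" and H :: "('a \<Rightarrow> real) set" and E :: "('a \<Rightarrow> real) \<Rightarrow> ereal"
    and \<P> :: "'a measure set" and V :: "'a set \<Rightarrow> real" and X :: "nat \<Rightarrow> 'a \<Rightarrow> real"
    and S :: "nat \<Rightarrow> 'a \<Rightarrow> real" and a :: "nat \<Rightarrow> real"
  defines "S \<equiv> partial_sum X"
    and "a \<equiv> a_norm E X"
  assumes space: "sublinear_expectation_space M H E"
    and CC: "condition_CC M H E \<P>"
    and V: "subadditive_capacity M V" "property_C M H E V"
    and X: "\<And>n. n \<ge> 1 \<Longrightarrow> X n \<in> H" "independent_seq H E X"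
    and second_moment: "\<And>n. n \<ge> 1 \<Longrightarrow> E (\<lambda>\<omega>. (X n \<omega>)\<^sup>2) < \<infinity>"
    and i: "\<And>\<epsilon>::real. \<epsilon> > 0 \<Longrightarrow>
      (\<Sum>n. ereal (V {\<omega> \<in> space M. \<bar>X (Suc n) \<omega>\<bar> \<ge> \<epsilon> * a (Suc n)})) < \<infinity>"
    and ii: "\<And>\<alpha>::real. \<alpha> > 0 \<Longrightarrow> \<exists>p::real. \<exists>d::real. p \<ge> 2 \<and> d \<ge> 0 \<and>
      (\<Sum>n. Gam E X (Suc n) p \<alpha> * ereal (1 / a (Suc n) powr p)
            * ereal_powr (Lam E X (Suc n) p \<alpha> * ereal (1 / a (Suc n) powr p)) d) < \<infinity>"
    and iii: "\<And>\<delta>::real. \<delta> > 0 \<Longrightarrow>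
      (\<Sum>n. ereal (1 / ss E X (Suc n) * log_e (ss E X (Suc n)) powr (\<delta> - 1))
            * E (\<lambda>\<omega>. (X (Suc n) \<omega>)\<^sup>2)) = \<infinity>"
    and iv: "(\<lambda>n. (\<Sum>j=1..n. \<bar>E (X j)\<bar> + \<bar>conj_expectation E (X j)\<bar>) / ereal (a n)) \<longlonglongrightarrow> 0"
  shows "\<forall>W \<in> {V_P \<P>, C_star M H E, V_hat_star M H E}.
      W {\<omega> \<in> space M. limsup (\<lambda>n. ereal (\<bar>S n \<omega>\<bar> / a n)) > 1} = 0 \<and>
      W {\<omega> \<in> space M. liminf (\<lambda>n. ereal (S n \<omega> / a n)) = -1 \<and>
                      limsup (\<lambda>n. ereal (S n \<omega> / a n)) = 1} = 1"
proof -
  interpret L: lil_sequence M H E X \<P> V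
    by (intro lil_sequence.intro L2_sequence.intro CC_sequence.intro indep_sequence.intro
        lil_sequence_axioms.intro L2_sequence_axioms.intro CC_sequence_axioms.intro
        indep_sequence_axioms.intro space CC V X second_moment i[unfolded a_def] ii[unfolded a_def]
        iii iv[unfolded a_def])
  have eq: "a = L.a" "S n \<omega> = (\<Sum>j=1..n. X j \<omega>)" for n \<omega>
    by (simp_all add: a_def S_def L.a_norm_eq partial_sum_def)
  show ?thesis
    using L.law_of_iterated_logarithm unfolding L.lil_event_def eq by blast
qed

end
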